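(* Assume the Generalized Continuum Hypothesis. For any ultrafilters $U$ (on a set $X$) and $W$ (on a set $Y$), the filter $U\times W$ is an ultrafilter on $X\times Y$ if and only if $U\sqsubset W$ and $W\sqsubset U$, where $\sqsubset$ denotes the internal relation.
   Context: The Cartesian product $U\times W$ is the filter on $X\times Y$ generated by the sets $A\times B$ with $A\in U$, $B\in W$. For an ultrafilter $U$ on $X$, $j_U:V\to M_U$ denotes the ultrapower of the universe by $U$ (possibly ill-founded), whose elements are classes $[f]_U$ of functions $f$ on $X$. For an ultrafilter $W$, $j_U(M_W)$ denotes the class of $M_U$ defined in $M_U$ from $j_U(W)$ as $M_W$ is defined in $V$ from $W$, i.e. $j_U(M_W)=(M_{j_U(W)})^{M_U}$; equivalently, it consists of the classes $[f]_U$ of functions $f:X\to M_W$. The embedding $j_U\restriction M_W:M_W\to j_U(M_W)$ sends $a$ to the class of the constant function with value $a$. Internal relation: $U\sqsubset W$ if $j_U\restriction M_W$ is isomorphic to an internal ultrapower embedding of $M_W$, i.e. there are $\tilde U\in M_W$ which $M_W$ believes to be an ultrafilter and an isomorphism $k:(M_{\tilde U})^{M_W}\to j_U(M_W)$ such that $k\circ (j_{\tilde U})^{M_W}=j_U\restriction M_W$. *)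

theory Defs
  imports Main
begin

(* The universe V of the statement is an arbitrary model of first-order ZFC: a nonempty HOL set
   univ M with a binary relation mem M, not assumed externally wellfounded.  Sets, functions, ultrafilters,
   products, cardinalities are all meant in the sense of M.  The same definitions are then applied
   to the ultrapowers of M, which are again structures of this kind; a definition evaluated in
   "ult M X U" is the relativization of that definition to the ultrapower. *)

record 'a eps_model =
  univ :: "'a set"
  mem :: "'a \<Rightarrow> 'a \<Rightarrow> bool"

definition elts :: "'a eps_model \<Rightarrow> 'a \<Rightarrow> 'a set" where
  "elts M a = {x \<in> univ M. mem M x a}"

(* The element of M whose extension is S; unspecified if there is none. *)
definition the_set :: "'a eps_model \<Rightarrow> 'a set \<Rightarrow> 'a" where
  "the_set M S = (THE a. a \<in> univ M \<and> elts M a = S)"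

(* Formulas of the language of set theory with de Bruijn indices. *)
datatype fm = Mem nat nat | Equal nat nat | Neg fm | Conj fm fm | All fm

primrec sat :: "'a eps_model \<Rightarrow> fm \<Rightarrow> (nat \<Rightarrow> 'a) \<Rightarrow> bool" where
  "sat M (Mem i j) s \<longleftrightarrow> mem M (s i) (s j)"
| "sat M (Equal i j) s \<longleftrightarrow> s i = s j"
| "sat M (Neg p) s \<longleftrightarrow> \<not> sat M p s"
| "sat M (Conj p q) s \<longleftrightarrow> sat M p s \<and> sat M q s"
| "sat M (All p) s \<longleftrightarrow> (\<forall>x\<in>univ M. sat M p (case_nat x s))"

definition is_inductive :: "'a eps_model \<Rightarrow> 'a \<Rightarrow> bool" where
  "is_inductive M I \<longleftrightarrow> I \<in> univ M \<and> (\<exists>e\<in>elts M I. elts M e = {}) \<and>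
     (\<forall>x\<in>elts M I. \<exists>y\<in>elts M I. elts M y = insert x (elts M x))"

(* The first-order schemes; the parameters of an instance are the values of the assignment s, so
   they may include the set a itself. *)
definition separation_scheme :: "'a eps_model \<Rightarrow> bool" where
  "separation_scheme M \<longleftrightarrow> (\<forall>p s. \<forall>a\<in>univ M. (\<forall>n. s n \<in> univ M) \<longrightarrow>
     (\<exists>c\<in>univ M. elts M c = {x \<in> elts M a. sat M p (case_nat x s)}))"

definition replacement_scheme :: "'a eps_model \<Rightarrow> bool" where
  "replacement_scheme M \<longleftrightarrow> (\<forall>p s. \<forall>a\<in>univ M. (\<forall>n. s n \<in> univ M) \<longrightarrow>
     (\<forall>x\<in>elts M a. \<exists>!y. y \<in> univ M \<and> sat M p (case_nat x (case_nat y s))) \<longrightarrow>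
     (\<exists>c\<in>univ M. elts M c =
        {y \<in> univ M. \<exists>x\<in>elts M a. sat M p (case_nat x (case_nat y s))}))"

definition choice_axiom :: "'a eps_model \<Rightarrow> bool" where
  "choice_axiom M \<longleftrightarrow> (\<forall>a\<in>univ M. (\<forall>x\<in>elts M a. elts M x \<noteq> {}) \<longrightarrow>
     (\<forall>x\<in>elts M a. \<forall>y\<in>elts M a. x \<noteq> y \<longrightarrow> elts M x \<inter> elts M y = {}) \<longrightarrow>
     (\<exists>c\<in>univ M. \<forall>x\<in>elts M a. \<exists>!z. z \<in> elts M x \<inter> elts M c))"

definition foundation_axiom :: "'a eps_model \<Rightarrow> bool" where
  "foundation_axiom M \<longleftrightarrow>
     (\<forall>a\<in>univ M. elts M a \<noteq> {} \<longrightarrow> (\<exists>x\<in>elts M a. elts M x \<inter> elts M a = {}))"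

definition ZFC :: "'a eps_model \<Rightarrow> bool" where
  "ZFC M \<longleftrightarrow>
     (\<forall>a\<in>univ M. \<forall>b\<in>univ M. elts M a = elts M b \<longrightarrow> a = b) \<and>
     foundation_axiom M \<and>
     (\<forall>a\<in>univ M. \<forall>b\<in>univ M. \<exists>c\<in>univ M. elts M c = {a, b}) \<and>
     (\<forall>a\<in>univ M. \<exists>c\<in>univ M. elts M c = (\<Union>x\<in>elts M a. elts M x)) \<and>
     (\<forall>a\<in>univ M. \<exists>c\<in>univ M. elts M c = {x \<in> univ M. elts M x \<subseteq> elts M a}) \<and>
     (\<exists>I. is_inductive M I) \<and>
     separation_scheme M \<and> replacement_scheme M \<and> choice_axiom M"

definition opair :: "'a eps_model \<Rightarrow> 'a \<Rightarrow> 'a \<Rightarrow> 'a" where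
  "opair M a b = the_set M {the_set M {a}, the_set M {a, b}}"

definition cprod :: "'a eps_model \<Rightarrow> 'a \<Rightarrow> 'a \<Rightarrow> 'a" where
  "cprod M X Y = the_set M {opair M x y | x y. x \<in> elts M X \<and> y \<in> elts M Y}"

definition powerset :: "'a eps_model \<Rightarrow> 'a \<Rightarrow> 'a" where
  "powerset M X = the_set M {A \<in> univ M. elts M A \<subseteq> elts M X}"

definition omega :: "'a eps_model \<Rightarrow> 'a" where
  "omega M = the_set M {n \<in> univ M. \<forall>I. is_inductive M I \<longrightarrow> n \<in> elts M I}"

definition funs :: "'a eps_model \<Rightarrow> 'a \<Rightarrow> 'a set" where
  "funs M X = {f \<in> univ M.
     (\<forall>p\<in>elts M f. \<exists>x\<in>elts M X. \<exists>y\<in>univ M. p = opair M x y) \<and>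
     (\<forall>x\<in>elts M X. \<exists>!y. y \<in> univ M \<and> opair M x y \<in> elts M f)}"

definition app :: "'a eps_model \<Rightarrow> 'a \<Rightarrow> 'a \<Rightarrow> 'a" where
  "app M f x = (THE y. y \<in> univ M \<and> opair M x y \<in> elts M f)"

definition const_fun :: "'a eps_model \<Rightarrow> 'a \<Rightarrow> 'a \<Rightarrow> 'a" where
  "const_fun M X a = the_set M {opair M x a | x. x \<in> elts M X}"

definition card_le :: "'a eps_model \<Rightarrow> 'a \<Rightarrow> 'a \<Rightarrow> bool" where
  "card_le M A B \<longleftrightarrow>
     (\<exists>f\<in>funs M A. app M f ` elts M A \<subseteq> elts M B \<and> inj_on (app M f) (elts M A))"

(* No cardinality lies strictly between an infinite set and its power set; given Choice, this says
   2^kappa = kappa^+ for every infinite cardinal kappa of M. *)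
definition GCH :: "'a eps_model \<Rightarrow> bool" where
  "GCH M \<longleftrightarrow> (\<forall>A\<in>univ M. \<forall>B\<in>univ M.
     card_le M (omega M) A \<longrightarrow> card_le M A B \<longrightarrow> card_le M B (powerset M A) \<longrightarrow>
     card_le M B A \<or> card_le M (powerset M A) B)"

definition is_filter :: "'a eps_model \<Rightarrow> 'a \<Rightarrow> 'a \<Rightarrow> bool" where
  "is_filter M X F \<longleftrightarrow> X \<in> univ M \<and> F \<in> univ M \<and>
     (\<forall>A\<in>elts M F. elts M A \<subseteq> elts M X) \<and>
     X \<in> elts M F \<and>
     (\<forall>A\<in>elts M F. elts M A \<noteq> {}) \<and>
     (\<forall>A\<in>elts M F. \<forall>B\<in>elts M F. \<forall>C\<in>univ M.
        elts M C = elts M A \<inter> elts M B \<longrightarrow> C \<in> elts M F) \<and>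
     (\<forall>A\<in>elts M F. \<forall>B\<in>univ M. elts M A \<subseteq> elts M B \<longrightarrow> elts M B \<subseteq> elts M X \<longrightarrow> B \<in> elts M F)"

definition is_ultrafilter :: "'a eps_model \<Rightarrow> 'a \<Rightarrow> 'a \<Rightarrow> bool" where
  "is_ultrafilter M X U \<longleftrightarrow> is_filter M X U \<and>
     (\<forall>A\<in>univ M. \<forall>B\<in>univ M. elts M A \<subseteq> elts M X \<longrightarrow> elts M B = elts M X - elts M A \<longrightarrow>
        A \<in> elts M U \<or> B \<in> elts M U)"

(* The least filter on X x Y containing all rectangles A x B with A in U and B in W. *)
definition product_filter :: "'a eps_model \<Rightarrow> 'a \<Rightarrow> 'a \<Rightarrow> 'a \<Rightarrow> 'a \<Rightarrow> 'a" where
  "product_filter M X U Y W = the_set M {C \<in> univ M. \<forall>F.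
     is_filter M (cprod M X Y) F \<and> (\<forall>A\<in>elts M U. \<forall>B\<in>elts M W. cprod M A B \<in> elts M F)
     \<longrightarrow> C \<in> elts M F}"

(* S is the extension of a member of U, i.e. "S is in U" for a HOL set S. *)
definition large :: "'a eps_model \<Rightarrow> 'a \<Rightarrow> 'a set \<Rightarrow> bool" where
  "large M U S \<longleftrightarrow> S \<in> elts M ` elts M U"

definition ult_class :: "'a eps_model \<Rightarrow> 'a \<Rightarrow> 'a \<Rightarrow> 'a \<Rightarrow> 'a set" where
  "ult_class M X U f = {g \<in> funs M X. large M U {x \<in> elts M X. app M f x = app M g x}}"

(* M_U, computed in M.  The class [f]_U is the whole equivalence class, a HOL set (a proper class
   from the point of view of M). *)
definition ult :: "'a eps_model \<Rightarrow> 'a \<Rightarrow> 'a \<Rightarrow> 'a set eps_model" where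
  "ult M X U =
     \<lparr> univ = ult_class M X U ` funs M X,
       mem = (\<lambda>a b. \<exists>f\<in>a. \<exists>g\<in>b. large M U {x \<in> elts M X. mem M (app M f x) (app M g x)}) \<rparr>"

definition ult_emb :: "'a eps_model \<Rightarrow> 'a \<Rightarrow> 'a \<Rightarrow> 'a \<Rightarrow> 'a set" where
  "ult_emb M X U a = ult_class M X U (const_fun M X a)"

(* j_U(M_W) = (M_{j_U(W)})^{M_U} *)
definition ult_of_ult ::
    "'a eps_model \<Rightarrow> 'a \<Rightarrow> 'a \<Rightarrow> 'a \<Rightarrow> 'a \<Rightarrow> 'a set set eps_model" where
  "ult_of_ult M X U Y W = ult (ult M X U) (ult_emb M X U Y) (ult_emb M X U W)"

(* The restriction of j_U to M_W.  An element a = [g]_W of M_W is a class of M, and j_U(a) is the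
   class [j_U(g)]_{j_U(W)} of M_U, which does not depend on the choice of g in a. *)
definition ult_emb_restr ::
    "'a eps_model \<Rightarrow> 'a \<Rightarrow> 'a \<Rightarrow> 'a \<Rightarrow> 'a \<Rightarrow> 'a set \<Rightarrow> 'a set set" where
  "ult_emb_restr M X U Y W a =
     the_elem ((\<lambda>g. ult_class (ult M X U) (ult_emb M X U Y) (ult_emb M X U W) (ult_emb M X U g)) ` a)"

definition model_iso :: "('a \<Rightarrow> 'b) \<Rightarrow> 'a eps_model \<Rightarrow> 'b eps_model \<Rightarrow> bool" where
  "model_iso k M N \<longleftrightarrow> bij_betw k (univ M) (univ N) \<and>
     (\<forall>a\<in>univ M. \<forall>b\<in>univ M. mem N (k a) (k b) \<longleftrightarrow> mem M a b)"

(* U \<sqsubset> W for ultrafilters U on X and W on Y.  The internal ultrafilter D and its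
   underlying set Z are elements of M_W.  The isomorphism k may be any HOL function; as it is
   determined by its value at the class of the identity on Z, it is automatically definable
   with parameters over M. *)
definition internal_rel :: "'a eps_model \<Rightarrow> 'a \<Rightarrow> 'a \<Rightarrow> 'a \<Rightarrow> 'a \<Rightarrow> bool" where
  "internal_rel M X U Y W \<longleftrightarrow>
     (\<exists>Z D k. is_ultrafilter (ult M Y W) Z D \<and>
        model_iso k (ult (ult M Y W) Z D) (ult_of_ult M X U Y W) \<and>
        (\<forall>a\<in>univ (ult M Y W). k (ult_emb (ult M Y W) Z D a) = ult_emb_restr M X U Y W a))"

end

theory Submission
  imports Defs
begin

text \<open>In terms of quantifiers, \<open>U\<close> precedes \<open>W\<close> in the internal relation iff there are ultrafilters \<open>u(y)\<close> on \<open>X\<close> such that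
  for every relation \<open>R\<close>: for \<open>U\<close>-almost all \<open>x\<close> and \<open>W\<close>-almost all \<open>y\<close> we have \<open>R(x,y)\<close> iff for \<open>W\<close>-almost all \<open>y\<close> and
  \<open>u(y)\<close>-almost all \<open>x\<close> we have \<open>R(x,y)\<close>.  If the product filter is an ultrafilter, then the quantifiers of \<open>U\<close> and \<open>W\<close>
  commute, so the constant family \<open>u(y) = U\<close> works, and the isomorphism exchanges the two ways to read
  a function on \<open>X \<times> Y\<close> as a family of functions.

  Conversely, let \<open>u\<close> and \<open>w\<close> witness the two relations and suppose that some \<open>C\<close> is not decided by a rectangle,
  with \<open>X\<close> of least cardinality.  Then \<open>U\<close> is uniform on \<open>X\<close>, and a liar set defined from \<open>u\<close> and \<open>w\<close> shows that no
  function from \<open>Y\<close> to \<open>X\<close> is unbounded modulo \<open>W\<close>.  Under GCH an argument of Kunen and Prikry, with a second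
  liar set, extends this to functions from \<open>Y\<close> to the power set of \<open>X\<close> and to the power set of that.  But the image of \<open>W\<close> under
  the map sending \<open>y\<close> to \<open>u(y)\<close> and the section of \<open>C\<close> at \<open>y\<close> is again part of a counterexample, so by minimality it
  is uniform on a set of one of these three cardinalities, which yields such an unbounded function.\<close>

section \<open>Definability with parameters\<close>

text \<open>The model may be ill-founded from outside, so no set can be formed externally: each
  separation, choice, recursion or minimization must come from a formula with parameters. This
  forces the calculus of \<open>dfn\<close> and \<open>dft\<close>, and well-orders of the sets at
  hand replace ordinals. A liar set works because \<open>w\<close> moves the quantifier over
  \<open>x\<close> inside the one over \<open>y\<close>, and \<open>u\<close> moves it out again;
  the question whether almost all \<open>x\<close> belong to the set returns negated. To make such a
  definition well-founded, a function \<open>h\<close> from \<open>Y\<close> to \<open>X\<close> is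
  needed with \<open>h(y) < x\<close> for almost all \<open>x\<close> and \<open>x < h(y)\<close>
  for almost all \<open>y\<close>. The range of three cardinalities arises as follows. The smallest
  image \<open>L\<close> of \<open>W\<close> is at least as large as \<open>X\<close> by minimality,
  and at most the double power set, because \<open>u(y)\<close> matters only as a set of subsets of
  \<open>X\<close> and a section of the undecided set is a subset of \<open>X\<close>. Under GCH
  each power set is the successor of its base. The descent from successor to base is direct when the
  base is regular; only a singular \<open>X\<close> obstructs it. Then \<open>X\<close> is a strong
  limit, the coverings have too few traces to separate its points, and this is what the second liar
  set exploits.\<close>

primrec ren :: "(nat \<Rightarrow> nat) \<Rightarrow> fm \<Rightarrow> fm" where
  "ren r (Mem i j) = Mem (r i) (r j)"
| "ren r (Equal i j) = Equal (r i) (r j)"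
| "ren r (Neg p) = Neg (ren r p)"
| "ren r (Conj p q) = Conj (ren r p) (ren r q)"
| "ren r (All p) = All (ren (case_nat 0 (\<lambda>n. Suc (r n))) p)"

lemma sat_ren: "sat M (ren r p) s \<longleftrightarrow> sat M p (\<lambda>n. s (r n))"
proof (induction p arbitrary: r s)
  case (All p)
  have "(\<lambda>n. case_nat x s (case_nat 0 (\<lambda>n. Suc (r n)) n)) = case_nat x (\<lambda>n. s (r n))" for x
    by (auto split: nat.split)
  then show ?case by (simp add: All)
qed auto

definition envs :: "'a eps_model \<Rightarrow> (nat \<Rightarrow> 'a) set" where
  "envs M = {e. \<forall>n. e n \<in> univ M}"

definition mix :: "(nat \<Rightarrow> 'a) \<Rightarrow> (nat \<Rightarrow> 'a) \<Rightarrow> nat \<Rightarrow> 'a" where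
  "mix e s n = (if even n then e (n div 2) else s (n div 2))"

lemma mix_simps [simp]: "mix e s (2 * n) = e n" "mix e s (Suc (2 * n)) = s n"
  by (auto simp: mix_def)

lemma mix_envs [intro]: "e \<in> envs M \<Longrightarrow> s \<in> envs M \<Longrightarrow> mix e s \<in> envs M"
  by (auto simp: envs_def mix_def)

text \<open>Definability with parameters: the variables of the formula are split into those read from
  the environment (even indices) and those holding parameters (odd indices).\<close>

definition dfn :: "'a eps_model \<Rightarrow> ((nat \<Rightarrow> 'a) \<Rightarrow> bool) \<Rightarrow> bool" where
  "dfn M P \<longleftrightarrow> (\<exists>p. \<exists>s\<in>envs M. \<forall>e\<in>envs M. sat M p (mix e s) = P e)"

text \<open>A term is given by its graph: variable 0 holds the value and the arguments move up by
  one place. With this layout \<open>dfn_subst\<close> eliminates a term by quantifying over its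
  value.\<close>

definition dft :: "'a eps_model \<Rightarrow> ((nat \<Rightarrow> 'a) \<Rightarrow> 'a) \<Rightarrow> bool" where
  "dft M t \<longleftrightarrow> (\<forall>e\<in>envs M. t e \<in> univ M) \<and> dfn M (\<lambda>e. e 0 = t (\<lambda>n. e (Suc n)))"

lemma envs_case [simp]: "case_nat x e \<in> envs M \<longleftrightarrow> x \<in> univ M \<and> e \<in> envs M"
  by (auto simp: envs_def split: nat.splits)

lemma envs_Suc [intro]: "e \<in> envs M \<Longrightarrow> (\<lambda>n. e (Suc n)) \<in> envs M"
  by (auto simp: envs_def)

lemma envsD: "e \<in> envs M \<Longrightarrow> e n \<in> univ M"
  by (auto simp: envs_def)

lemma dfn_cong: "dfn M P \<Longrightarrow> (\<And>e. e \<in> envs M \<Longrightarrow> P e = Q e) \<Longrightarrow> dfn M Q"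
  unfolding dfn_def by auto

lemma dfn_not:
  assumes "dfn M P" shows "dfn M (\<lambda>e. \<not> P e)"
proof -
  obtain p s where "s \<in> envs M" "\<forall>e\<in>envs M. sat M p (mix e s) = P e"
    using assms unfolding dfn_def by blast
  then show ?thesis unfolding dfn_def by (intro exI[of _ "Neg p"] bexI[of _ s]) auto
qed

lemma dfn_conj:
  assumes "dfn M P" "dfn M Q"
  shows "dfn M (\<lambda>e. P e \<and> Q e)"
proof -
  obtain p s q t where s: "s \<in> envs M" "t \<in> envs M"
    and p: "\<And>e. e \<in> envs M \<Longrightarrow> sat M p (mix e s) = P e"
    and q: "\<And>e. e \<in> envs M \<Longrightarrow> sat M q (mix e t) = Q e"
    using assms unfolding dfn_def by blast
  \<comment> \<open>The parameters of both formulas are merged into \<open>mix s t\<close>: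
    parameter \<open>m\<close> of \<open>s\<close> then stands at index \<open>4 * m + 1\<close>,
    parameter \<open>m\<close> of \<open>t\<close> at \<open>4 * m + 3\<close>.\<close>
  let ?f = "\<lambda>n. if even n then n else 4 * (n div 2) + 1"
  let ?g = "\<lambda>n. if even n then n else 4 * (n div 2) + 3"
  have f: "(\<lambda>n. mix e (mix s t) (?f n)) = mix e s" for e
    by (auto simp: mix_def fun_eq_iff elim!: oddE)
  have g: "(\<lambda>n. mix e (mix s t) (?g n)) = mix e t" for e
  proof
    fix n
    have "(4 * (n div 2) + 3) div 2 = Suc (2 * (n div 2))" by presburger
    then show "mix e (mix s t) (?g n) = mix e t n" by (auto simp: mix_def)
  qed
  have "sat M (Conj (ren ?f p) (ren ?g q)) (mix e (mix s t)) = (P e \<and> Q e)" if "e \<in> envs M" for e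
    using p[OF that] q[OF that] f[of e] g[of e] by (simp only: sat.simps sat_ren)
  then show ?thesis using s unfolding dfn_def by blast
qed

lemma dfn_all:
  assumes "dfn M (\<lambda>e. P (e 0) (\<lambda>n. e (Suc n)))"
  shows "dfn M (\<lambda>e. \<forall>x\<in>univ M. P x e)"
proof -
  obtain p s where s: "s \<in> envs M"
    and p: "\<And>e. e \<in> envs M \<Longrightarrow> sat M p (mix e s) = P (e 0) (\<lambda>n. e (Suc n))"
    using assms unfolding dfn_def by blast
  \<comment> \<open>With the quantified value pushed in front, variable \<open>m\<close> of
    \<open>e\<close> stands at \<open>2 * m + 1\<close> where \<open>p\<close> expects it at
    \<open>2 * m + 2\<close>, and parameter \<open>m\<close> stands at \<open>2 * m + 2\<close>
    where \<open>p\<close> expects it at \<open>2 * m + 1\<close>.\<close>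
  let ?f = "\<lambda>n. if n = 0 then 0 else if even n then n - 1 else Suc n"
  have f: "(\<lambda>n. case_nat x (mix e s) (?f n)) = mix (case_nat x e) s" for e x
  proof
    fix n show "case_nat x (mix e s) (?f n) = mix (case_nat x e) s n"
    proof (cases "n = 0")
      case False
      show ?thesis
      proof (cases "even n")
        case True
        then obtain m where "n = 2 * Suc m" using False by (cases "n div 2") auto
        then show ?thesis by (simp add: mix_def)
      qed (auto simp: mix_def elim!: oddE)
    qed (auto simp: mix_def)
  qed
  have "sat M (All (ren ?f p)) (mix e s) = (\<forall>x\<in>univ M. P x e)" if "e \<in> envs M" for e
    using p f[of _ e] that by (simp add: sat_ren)
  then show ?thesis using s unfolding dfn_def by blast
qed

lemma dfnI: "s \<in> envs M \<Longrightarrow> (\<And>e. e \<in> envs M \<Longrightarrow> sat M p (mix e s) = P e) \<Longrightarrow> dfn M P"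
  unfolding dfn_def by blast

lemma dfn_ren:
  assumes "dfn M P" shows "dfn M (\<lambda>e. P (\<lambda>n. e (r n)))"
proof -
  obtain p s where s: "s \<in> envs M"
    and p: "\<And>e. e \<in> envs M \<Longrightarrow> sat M p (mix e s) = P e"
    using assms unfolding dfn_def by blast
  let ?f = "\<lambda>n. if even n then 2 * r (n div 2) else n"
  have f: "(\<lambda>n. mix e s (?f n)) = mix (\<lambda>n. e (r n)) s" for e
    by (auto simp: fun_eq_iff mix_def)
  have "sat M (ren ?f p) (mix e s) = P (\<lambda>n. e (r n))" if "e \<in> envs M" for e
  proof -
    have "(\<lambda>n. e (r n)) \<in> envs M" using that by (auto simp: envs_def)
    then show ?thesis using p by (simp add: sat_ren f)
  qed
  then show ?thesis using s by (intro dfnI[of s]) auto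
qed

lemmas dfn_shift = dfn_ren[where r=Suc]

text \<open>The fixed environment \<open>e0\<close> is stored among the parameters. This turns
  definability relative to an environment into definability in one variable, the form that
  separation accepts.\<close>

lemma dfn_inst:
  assumes "dfn M (\<lambda>e. P (e 0) (\<lambda>n. e (Suc n)))" and e0: "e0 \<in> envs M"
  shows "dfn M (\<lambda>e. P (e 0) e0)"
proof -
  obtain p s where s: "s \<in> envs M"
    and p: "\<And>e. e \<in> envs M \<Longrightarrow> sat M p (mix e s) = P (e 0) (\<lambda>n. e (Suc n))"
    using assms unfolding dfn_def by blast
  let ?f = "\<lambda>n. if n = 0 then 0 else if even n then 4 * (n div 2 - 1) + 3 else 4 * (n div 2) + 1"
  have f: "(\<lambda>n. mix e (mix s e0) (?f n)) = mix (case_nat (e 0) e0) s" for e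
  proof
    fix n show "mix e (mix s e0) (?f n) = mix (case_nat (e 0) e0) s n"
    proof (cases "n = 0")
      case False
      show ?thesis
      proof (cases "even n")
        case True
        then obtain m where n: "n = 2 * Suc m" using False by (cases "n div 2") auto
        have "(4 * m + 3) div 2 = Suc (2 * m)" by presburger
        then show ?thesis using n by (simp add: mix_def)
      qed (auto simp: mix_def elim!: oddE)
    qed (auto simp: mix_def)
  qed
  have "sat M (ren ?f p) (mix e (mix s e0)) = P (e 0) e0" if e: "e \<in> envs M" for e
  proof -
    have "case_nat (e 0) e0 \<in> envs M" using e e0 by (simp add: envsD)
    from p[OF this] show ?thesis unfolding sat_ren f by simp
  qed
  then show ?thesis using s e0 unfolding dfn_def by blast
qed

lemma dfn_inst2:
  assumes "dfn M (\<lambda>e. P (e 0) (e 1) (\<lambda>n. e (Suc (Suc n))))" and e0: "e0 \<in> envs M"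
  shows "dfn M (\<lambda>e. P (e 0) (e 1) e0)"
proof -
  obtain p s where s: "s \<in> envs M"
    and p: "\<And>e. e \<in> envs M \<Longrightarrow> sat M p (mix e s) = P (e 0) (e 1) (\<lambda>n. e (Suc (Suc n)))"
    using assms unfolding dfn_def by blast
  let ?f = "\<lambda>n. if n = 0 then 0 else if n = 2 then 2 else
     if even n then 4 * (n div 2 - 2) + 3 else 4 * (n div 2) + 1"
  have f: "(\<lambda>n. mix e (mix s e0) (?f n)) = mix (case_nat (e 0) (case_nat (e 1) e0)) s" for e
  proof
    fix n show "mix e (mix s e0) (?f n) = mix (case_nat (e 0) (case_nat (e 1) e0)) s n"
    proof (cases "n = 0 \<or> n = 2")
      case True then show ?thesis by (auto simp: mix_def)
    next
      case False
      show ?thesis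
      proof (cases "even n")
        case True
        then obtain m where m: "n = 2 * m" by blast
        then obtain m' where "m = Suc (Suc m')" using False by (cases m; cases "m - 1") auto
        then have n: "n = 2 * Suc (Suc m')" using m by simp
        have "(4 * m' + 3) div 2 = Suc (2 * m')" by presburger
        then show ?thesis using n by (simp add: mix_def)
      qed (use False in \<open>auto simp: mix_def elim!: oddE\<close>)
    qed
  qed
  have "sat M (ren ?f p) (mix e (mix s e0)) = P (e 0) (e 1) e0" if e: "e \<in> envs M" for e
  proof -
    have "case_nat (e 0) (case_nat (e 1) e0) \<in> envs M" using e e0 by (simp add: envsD)
    from p[OF this] show ?thesis unfolding sat_ren f by simp
  qed
  then show ?thesis using s e0 unfolding dfn_def by blast
qed

lemma dfn_ex: "dfn M (\<lambda>e. \<exists>x\<in>univ M. P x e)" if "dfn M (\<lambda>e. P (e 0) (\<lambda>n. e (Suc n)))"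
proof -
  have "dfn M (\<lambda>e. \<not> (\<forall>x\<in>univ M. \<not> P x e))"
    by (intro dfn_not dfn_all that)
  then show ?thesis by simp
qed

lemma dfn_disj: "dfn M P \<Longrightarrow> dfn M Q \<Longrightarrow> dfn M (\<lambda>e. P e \<or> Q e)"
  using dfn_not[OF dfn_conj[OF dfn_not dfn_not], of M P Q] by simp

lemma dfn_imp: "dfn M P \<Longrightarrow> dfn M Q \<Longrightarrow> dfn M (\<lambda>e. P e \<longrightarrow> Q e)"
  using dfn_not[OF dfn_conj[OF _ dfn_not], of M P Q] by simp

lemma dfn_iff: 
  assumes "dfn M P" "dfn M Q" shows "dfn M (\<lambda>e. P e \<longleftrightarrow> Q e)"
  by (rule dfn_cong[OF dfn_conj[OF dfn_imp[OF assms] dfn_imp[OF assms(2,1)]]]) blast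

lemma dfn_if:
  assumes "dfn M P" "dfn M Q" "dfn M R" shows "dfn M (\<lambda>e. if P e then Q e else R e)"
  by (rule dfn_cong[OF dfn_conj[OF dfn_imp[OF assms(1,2)] dfn_imp[OF dfn_not[OF assms(1)] assms(3)]]]) simp

lemma dfn_mem_var: "dfn M (\<lambda>e. e i \<in> elts M (e j))" if "envs M \<noteq> {}"
proof -
  from that obtain s where "s \<in> envs M" by blast
  then show ?thesis
    by (rule dfnI[where p="Mem (2*i) (2*j)" and P="\<lambda>e. e i \<in> elts M (e j)"]) (auto simp: elts_def dest: envsD)
qed

lemma dfn_eq_var: "dfn M (\<lambda>e. e i = e j)" if "envs M \<noteq> {}"
proof -
  from that obtain s where "s \<in> envs M" by blast
  then show ?thesis by (rule dfnI[where p="Equal (2*i) (2*j)" and P="\<lambda>e. e i = e j"]) simp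
qed

lemma dfn_eq_const: "dfn M (\<lambda>e. e i = a)" if "a \<in> univ M"
proof (rule dfnI[where p="Equal (2*i) 1" and s="\<lambda>_. a" and P="\<lambda>e. e i = a"])
  show "sat M (Equal (2 * i) 1) (mix e (\<lambda>_. a)) = (e i = a)" for e
    by (simp add: mix_def)
qed (use that in \<open>simp add: envs_def\<close>)

lemma dfn_const: "dfn M (\<lambda>e. b)" if "envs M \<noteq> {}"
proof -
  have *: "dfn M (\<lambda>e. True)" using dfn_eq_var[OF that, of 0 0] by simp
  show ?thesis using * dfn_not[OF *] by (cases b) auto
qed

lemma dft_var: "dft M (\<lambda>e. e i)" if "envs M \<noteq> {}"
  unfolding dft_def using dfn_eq_var[OF that] by (auto simp: envsD)

lemma dft_const: "dft M (\<lambda>e. a)" if "a \<in> univ M"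
  unfolding dft_def using that by (auto intro: dfn_eq_const)

lemma dft_in: "dft M t \<Longrightarrow> e \<in> envs M \<Longrightarrow> t e \<in> univ M"
  by (auto simp: dft_def)

lemma dfn_subst:
  assumes t: "dft M t" and Q: "dfn M (\<lambda>e. Q (e 0) (\<lambda>n. e (Suc n)))"
  shows "dfn M (\<lambda>e. Q (t e) e)"
proof -
  have "dfn M (\<lambda>e. \<exists>x\<in>univ M. x = t e \<and> Q x e)"
    using t Q unfolding dft_def by (intro dfn_ex dfn_conj) auto
  then show ?thesis by (rule dfn_cong) (use t in \<open>auto simp: dft_def\<close>)
qed

lemma dft_ren:
  assumes "dft M t" shows "dft M (\<lambda>e. t (\<lambda>n. e (r n)))"
proof -
  have "dfn M (\<lambda>e. e 0 = t (\<lambda>n. e (Suc n)))" using assms by (simp add: dft_def)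
  from dfn_ren[OF this, of "case_nat 0 (\<lambda>n. Suc (r n))"]
  have "dfn M (\<lambda>e. e 0 = t (\<lambda>n. e (Suc (r n))))" by simp
  then show ?thesis using assms unfolding dft_def by (auto simp: envs_def)
qed

lemmas dft_shift = dft_ren[where r=Suc]

lemma dfn_mem:
  assumes "envs M \<noteq> {}" "dft M t" "dft M s" shows "dfn M (\<lambda>e. t e \<in> elts M (s e))"
  by (rule dfn_subst[OF assms(2), where Q="\<lambda>x e. x \<in> elts M (s e)"],
      rule dfn_subst[OF dft_shift[OF assms(3)], where Q="\<lambda>x e. e 0 \<in> elts M x"],
      rule dfn_mem_var[OF assms(1)])

lemma dfn_eq:
  assumes "envs M \<noteq> {}" "dft M t" "dft M s" shows "dfn M (\<lambda>e. t e = s e)"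
  by (rule dfn_subst[OF assms(2), where Q="\<lambda>x e. x = s e"],
      rule dfn_subst[OF dft_shift[OF assms(3)], where Q="\<lambda>x e. e 0 = x"],
      rule dfn_eq_var[OF assms(1)])

lemma elts_univ: "x \<in> elts M a \<Longrightarrow> x \<in> univ M"
  by (simp add: elts_def)

lemma dfn_ball:
  assumes "envs M \<noteq> {}" "dft M t" "dfn M (\<lambda>e. P (e 0) (\<lambda>n. e (Suc n)))"
  shows "dfn M (\<lambda>e. \<forall>x\<in>elts M (t e). P x e)"
proof -
  have "dfn M (\<lambda>e. \<forall>x\<in>univ M. x \<in> elts M (t e) \<longrightarrow> P x e)"
    by (intro dfn_all dfn_imp dfn_mem dft_var dft_shift assms)
  then show ?thesis by (elim dfn_cong) (auto simp: elts_univ)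
qed

lemma dfn_bex:
  assumes "envs M \<noteq> {}" "dft M t" "dfn M (\<lambda>e. P (e 0) (\<lambda>n. e (Suc n)))"
  shows "dfn M (\<lambda>e. \<exists>x\<in>elts M (t e). P x e)"
proof -
  have "dfn M (\<lambda>e. \<exists>x\<in>univ M. x \<in> elts M (t e) \<and> P x e)"
    by (intro dfn_ex dfn_conj dfn_mem dft_var dft_shift assms)
  then show ?thesis by (elim dfn_cong) (auto simp: elts_univ)
qed

lemma dft_if:
  assumes "dfn M P" "dft M t" "dft M s" "envs M \<noteq> {}"
  shows "dft M (\<lambda>e. if P e then t e else s e)"
proof -
  have "dfn M (\<lambda>e. if P (\<lambda>n. e (Suc n)) then e 0 = t (\<lambda>n. e (Suc n)) else e 0 = s (\<lambda>n. e (Suc n)))"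
    by (intro dfn_if dfn_eq dft_var dft_shift dfn_shift assms)
  then show ?thesis using assms unfolding dft_def by (auto simp: if_distrib elim: dfn_cong)
qed

section \<open>Sets and functions inside a model\<close>

definition Sep :: "'a eps_model \<Rightarrow> 'a \<Rightarrow> ('a \<Rightarrow> bool) \<Rightarrow> 'a" where
  "Sep M a P = the_set M {x \<in> elts M a. P x}"

definition Lam :: "'a eps_model \<Rightarrow> 'a \<Rightarrow> ('a \<Rightarrow> 'a) \<Rightarrow> 'a" where
  "Lam M a t = the_set M {opair M x (t x) | x. x \<in> elts M a}"

text \<open>Unlike \<^const>\<open>app\<close>, this application operator is total on the universe.\<close>

definition ap :: "'a eps_model \<Rightarrow> 'a \<Rightarrow> 'a \<Rightarrow> 'a" where
  "ap M f x = (if \<exists>!y. y \<in> univ M \<and> opair M x y \<in> elts M f then app M f x else x)"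

definition almost :: "'a eps_model \<Rightarrow> 'a \<Rightarrow> 'a \<Rightarrow> ('a \<Rightarrow> bool) \<Rightarrow> bool" where
  "almost M U X P \<longleftrightarrow> large M U {x \<in> elts M X. P x}"

definition isset :: "'a eps_model \<Rightarrow> 'a set \<Rightarrow> bool" where
  "isset M S \<longleftrightarrow> (\<exists>c\<in>univ M. elts M c = S)"

text \<open>Objects that are not pairs are sent to themselves, which makes the projections total on
  the universe and hence definable terms.\<close>

definition fs :: "'a eps_model \<Rightarrow> 'a \<Rightarrow> 'a" where
  "fs M p = (if \<exists>x\<in>univ M. \<exists>y\<in>univ M. p = opair M x y
     then THE x. x \<in> univ M \<and> (\<exists>y\<in>univ M. p = opair M x y) else p)"

definition sn :: "'a eps_model \<Rightarrow> 'a \<Rightarrow> 'a" where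
  "sn M p = (if \<exists>x\<in>univ M. \<exists>y\<in>univ M. p = opair M x y
     then THE y. y \<in> univ M \<and> (\<exists>x\<in>univ M. p = opair M x y) else p)"

text \<open>Closure rules for definability: \<open>intro dfns\<close> reads the definability of a
  predicate or term off its syntactic shape.\<close>

named_theorems dfns

lemmas [dfns] = dfn_not dfn_conj dfn_disj dfn_imp dfn_iff dfn_all dfn_ex

locale zfc =
  fixes M :: "'a eps_model"
  assumes ZFC: "ZFC M"
begin

abbreviation "V \<equiv> univ M"
abbreviation "E \<equiv> elts M"
abbreviation "op \<equiv> opair M"
abbreviation "Pw \<equiv> powerset M"

lemma ext: "a \<in> V \<Longrightarrow> b \<in> V \<Longrightarrow> E a = E b \<Longrightarrow> a = b"
  using ZFC unfolding ZFC_def by blast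

lemma E_V: "x \<in> E a \<Longrightarrow> x \<in> V"
  by (simp add: elts_def)

lemma isset_E [simp, intro]: "a \<in> V \<Longrightarrow> isset M (E a)"
  by (auto simp: isset_def)

lemma the_set_eq: "c \<in> V \<Longrightarrow> E c = S \<Longrightarrow> the_set M S = c"
  unfolding the_set_def by (rule the_equality) (auto intro: ext)

lemma the_set_V: "isset M S \<Longrightarrow> the_set M S \<in> V"
  and E_the_set: "isset M S \<Longrightarrow> E (the_set M S) = S"
  unfolding isset_def using the_set_eq by auto

lemma nonempty: "V \<noteq> {}"
  using ZFC unfolding ZFC_def is_inductive_def by blast

lemma envs_ne: "envs M \<noteq> {}"
proof -
  obtain v where "v \<in> V" using nonempty by blast
  then have "(\<lambda>_. v) \<in> envs M" by (simp add: envs_def)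
  then show ?thesis by blast
qed

lemmas dfn_base [dfns] =
  dfn_mem[OF envs_ne] dfn_eq[OF envs_ne] dfn_ball[OF envs_ne] dfn_bex[OF envs_ne]
  dft_var[OF envs_ne] dft_const
lemmas [dfns] = dfn_if dft_if[OF _ _ _ envs_ne]
lemmas dfn_bool [dfns] = dfn_const[OF envs_ne]

lemma isset_sep:
  assumes "a \<in> V" "dfn M (\<lambda>e. P (e 0))" shows "isset M {x \<in> E a. P x}"
proof -
  obtain p s where s: "s \<in> envs M" and p: "\<And>e. e \<in> envs M \<Longrightarrow> sat M p (mix e s) = P (e 0)"
    using assms(2) unfolding dfn_def by blast
  \<comment> \<open>A predicate of one variable may be evaluated in a constant environment, so all
    even indices are read from the bound variable 0.\<close>
  let ?f = "\<lambda>n. if even n then 0 else Suc (n div 2)"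
  have f: "(\<lambda>n. case_nat x s (?f n)) = mix (\<lambda>_. x) s" for x
    by (auto simp: fun_eq_iff mix_def)
  have "\<exists>c\<in>V. E c = {x \<in> E a. sat M (ren ?f p) (case_nat x s)}"
    using ZFC assms(1) s unfolding ZFC_def separation_scheme_def envs_def by blast
  moreover have "sat M (ren ?f p) (case_nat x s) = P x" if "x \<in> E a" for x
    using p[of "\<lambda>_. x"] that unfolding sat_ren f by (simp add: envs_def E_V)
  ultimately show ?thesis unfolding isset_def by (metis (no_types, lifting) Collect_cong)
qed

lemma isset_replace:
  assumes a: "a \<in> V" and d: "dfn M (\<lambda>e. R (e 0) (e 1))"
    and u: "\<And>x. x \<in> E a \<Longrightarrow> \<exists>!y. y \<in> V \<and> R x y"
  shows "isset M {y \<in> V. \<exists>x\<in>E a. R x y}"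
proof -
  obtain p s where s: "s \<in> envs M" and p: "\<And>e. e \<in> envs M \<Longrightarrow> sat M p (mix e s) = R (e 0) (e 1)"
    using d unfolding dfn_def by blast
  let ?f = "\<lambda>n. if even n then (if n = 0 then 0 else 1) else Suc (Suc (n div 2))"
  have f: "(\<lambda>n. case_nat x (case_nat y s) (?f n)) = mix (\<lambda>n. if n = 0 then x else y) s" for x y
    by (auto simp: fun_eq_iff mix_def)
  have eq: "sat M (ren ?f p) (case_nat x (case_nat y s)) = R x y" if "x \<in> V" "y \<in> V" for x y
    using p[of "\<lambda>n. if n = 0 then x else y"] that unfolding sat_ren f by (simp add: envs_def)
  have "\<forall>x\<in>E a. \<exists>!y. y \<in> V \<and> sat M (ren ?f p) (case_nat x (case_nat y s))"
  proof
    fix x assume x: "x \<in> E a"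
    show "\<exists>!y. y \<in> V \<and> sat M (ren ?f p) (case_nat x (case_nat y s))"
      using u[OF x] eq[OF E_V[OF x]] by (metis (no_types, lifting))
  qed
  then have "\<exists>c\<in>V. E c = {y \<in> V. \<exists>x\<in>E a. sat M (ren ?f p) (case_nat x (case_nat y s))}"
    using ZFC a s unfolding ZFC_def replacement_scheme_def envs_def by blast
  moreover have "{y \<in> V. \<exists>x\<in>E a. sat M (ren ?f p) (case_nat x (case_nat y s))} = {y \<in> V. \<exists>x\<in>E a. R x y}"
    using eq E_V by blast
  ultimately show ?thesis unfolding isset_def by simp
qed

lemma isset_image:
  assumes a: "a \<in> V" and t: "dft M (\<lambda>e. t (e 0))"
  shows "isset M (t ` E a)"
proof -
  have tV: "t x \<in> V" if "x \<in> V" for x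
    using dft_in[OF t, of "\<lambda>_. x"] that by (simp add: envs_def)
  have "isset M {y \<in> V. \<exists>x\<in>E a. y = t x}"
  proof (rule isset_replace[OF a])
    show "dfn M (\<lambda>e. e 1 = t (e 0))" by (intro dfns t)
  qed (use tV E_V in auto)
  moreover have "{y \<in> V. \<exists>x\<in>E a. y = t x} = t ` E a" using tV E_V by auto
  ultimately show ?thesis by simp
qed

lemma isset_pair: "a \<in> V \<Longrightarrow> b \<in> V \<Longrightarrow> isset M {a, b}"
  and isset_Union: "a \<in> V \<Longrightarrow> isset M (\<Union>x\<in>E a. E x)"
  and isset_Pow: "a \<in> V \<Longrightarrow> isset M {x \<in> V. E x \<subseteq> E a}"
  using ZFC unfolding ZFC_def isset_def by blast+

lemma isset_sing: "a \<in> V \<Longrightarrow> isset M {a}"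
  using isset_pair[of a a] by simp

lemma isset_Un:
  assumes "isset M A" "isset M B" shows "isset M (A \<union> B)"
proof -
  obtain a b where a: "a \<in> V" "E a = A" "b \<in> V" "E b = B" using assms unfolding isset_def by blast
  obtain c where c: "c \<in> V" "E c = {a, b}" using isset_pair a unfolding isset_def by blast
  from isset_Union[OF c(1)] show ?thesis using a c by simp
qed

lemma E_Pw: "a \<in> V \<Longrightarrow> E (Pw a) = {x \<in> V. E x \<subseteq> E a}" and Pw_V [simp]: "a \<in> V \<Longrightarrow> Pw a \<in> V"
  unfolding powerset_def using isset_Pow E_the_set the_set_V by auto

lemma op_V [simp]: "a \<in> V \<Longrightarrow> b \<in> V \<Longrightarrow> op a b \<in> V"
  unfolding opair_def by (intro the_set_V isset_pair isset_sing)

lemma op_inj [simp]: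
  assumes "a \<in> V" "b \<in> V" "c \<in> V" "d \<in> V"
  shows "op a b = op c d \<longleftrightarrow> a = c \<and> b = d"
proof
  have *: "E (the_set M {x}) = {x}" "E (the_set M {x, y}) = {x, y}" if "x \<in> V" "y \<in> V" for x y
    using that by (auto simp: E_the_set isset_pair isset_sing)
  have e: "E (op x y) = {the_set M {x}, the_set M {x, y}}" if "x \<in> V" "y \<in> V" for x y
    unfolding opair_def using that by (intro E_the_set isset_pair the_set_V isset_sing)
  assume "op a b = op c d"
  then have "{the_set M {a}, the_set M {a, b}} = {the_set M {c}, the_set M {c, d}}"
    using e assms by metis
  then have "E ` {the_set M {a}, the_set M {a, b}} = E ` {the_set M {c}, the_set M {c, d}}" by simp
  then have "{{a}, {a, b}} = {{c}, {c, d}}" using * assms by simp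
  then show "a = c \<and> b = d" by (metis doubleton_eq_iff singleton_insert_inj_eq' insert_absorb2)
qed simp

text \<open>By extensionality a set is pinned down by its membership relation, so the term is
  definable once that relation is. All set-forming operations below become definable through this
  rule.\<close>

lemma dft_set:
  assumes "\<And>e. e \<in> envs M \<Longrightarrow> isset M (S e)" "dfn M (\<lambda>e. e 0 \<in> S (\<lambda>n. e (Suc n)))"
  shows "dft M (\<lambda>e. the_set M (S e))"
proof -
  have 1: "dfn M (\<lambda>e. e 0 \<in> S (\<lambda>n. e (Suc (Suc n))))"
    using dfn_ren[OF assms(2), of "case_nat 0 (\<lambda>n. Suc (Suc n))"] by simp
  have "dfn M (\<lambda>e. \<forall>w\<in>V. w \<in> E (e 0) \<longleftrightarrow> w \<in> S (\<lambda>n. e (Suc n)))"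
    by (intro dfns 1)
  then have "dfn M (\<lambda>e. e 0 = the_set M (S (\<lambda>n. e (Suc n))))"
  proof (rule dfn_cong)
    fix e assume e: "e \<in> envs M"
    note i = assms(1)[OF envs_Suc[OF e]]
    show "(\<forall>w\<in>V. w \<in> E (e 0) \<longleftrightarrow> w \<in> S (\<lambda>n. e (Suc n))) = (e 0 = the_set M (S (\<lambda>n. e (Suc n))))"
    proof
      assume "\<forall>w\<in>V. w \<in> E (e 0) \<longleftrightarrow> w \<in> S (\<lambda>n. e (Suc n))"
      then have "E (e 0) = E (the_set M (S (\<lambda>n. e (Suc n))))"
        using E_the_set[OF i] E_V by blast
      then show "e 0 = the_set M (S (\<lambda>n. e (Suc n)))"
        using ext the_set_V[OF i] envsD[OF e] by blast
    qed (use E_the_set[OF i] in auto)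
  qed
  then show ?thesis unfolding dft_def using assms(1) the_set_V by blast
qed

lemma dft_pairset [dfns]:
  assumes "dft M t" "dft M s" shows "dft M (\<lambda>e. the_set M {t e, s e})"
proof (rule dft_set)
  have "dfn M (\<lambda>e. e 0 = t (\<lambda>n. e (Suc n)) \<or> e 0 = s (\<lambda>n. e (Suc n)))"
    by (intro dfns dft_shift assms)
  then show "dfn M (\<lambda>e. e 0 \<in> {t (\<lambda>n. e (Suc n)), s (\<lambda>n. e (Suc n))})" by simp
qed (use assms in \<open>auto intro: isset_pair dft_in\<close>)

lemma dft_singset [dfns]:
  assumes "dft M t" shows "dft M (\<lambda>e. the_set M {t e})"
  using dft_pairset[OF assms assms] by simp

lemma dft_op [dfns]: "dft M t \<Longrightarrow> dft M s \<Longrightarrow> dft M (\<lambda>e. op (t e) (s e))"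
  unfolding opair_def by (intro dfns)

lemma dfn_subset [dfns]:
  assumes "dft M t" "dft M s" shows "dfn M (\<lambda>e. E (t e) \<subseteq> E (s e))"
  unfolding subset_iff
  by (rule dfn_cong[where P="\<lambda>e. \<forall>x\<in>E (t e). x \<in> E (s e)"]) (intro dfns dft_shift assms, auto)

lemma dft_Pw [dfns]: assumes "dft M t" shows "dft M (\<lambda>e. Pw (t e))"
  unfolding powerset_def
proof (rule dft_set)
  have "dfn M (\<lambda>e. e 0 \<in> V \<and> E (e 0) \<subseteq> E (t (\<lambda>n. e (Suc n))))"
    by (rule dfn_cong[where P="\<lambda>e. E (e 0) \<subseteq> E (t (\<lambda>n. e (Suc n)))"])
      (intro dfns dft_shift assms, auto simp: envsD)
  then show "dfn M (\<lambda>e. e 0 \<in> {A \<in> V. E A \<subseteq> E (t (\<lambda>n. e (Suc n)))})" by simp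
qed (use assms in \<open>auto intro: isset_Pow dft_in\<close>)

lemma isset_Sep: "a \<in> V \<Longrightarrow> dfn M (\<lambda>e. P (e 0)) \<Longrightarrow> Sep M a P \<in> V \<and> E (Sep M a P) = {x \<in> E a. P x}"
  unfolding Sep_def using isset_sep E_the_set the_set_V by blast

lemma Sep_V [simp]: "a \<in> V \<Longrightarrow> dfn M (\<lambda>e. P (e 0)) \<Longrightarrow> Sep M a P \<in> V"
  and E_Sep [simp]: "a \<in> V \<Longrightarrow> dfn M (\<lambda>e. P (e 0)) \<Longrightarrow> E (Sep M a P) = {x \<in> E a. P x}"
  using isset_Sep by auto

lemma dft_Sep [dfns]:
  assumes "dft M a" "dfn M (\<lambda>e. P (e 0) (\<lambda>n. e (Suc n)))"
  shows "dft M (\<lambda>e. Sep M (a e) (\<lambda>x. P x e))"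
  unfolding Sep_def
proof (rule dft_set)
  fix e assume "e \<in> envs M"
  then show "isset M {x \<in> E (a e). P x e}"
    by (intro isset_sep dft_in[OF assms(1)] dfn_inst[OF assms(2)])
next
  have "dfn M (\<lambda>e. e 0 \<in> E (a (\<lambda>n. e (Suc n))) \<and> P (e 0) (\<lambda>n. e (Suc n)))"
    by (intro dfns dft_shift assms)
  then show "dfn M (\<lambda>e. e 0 \<in> {x \<in> E (a (\<lambda>n. e (Suc n))). P x (\<lambda>n. e (Suc n))})" by simp
qed

lemma dft_inst:
  assumes "dft M (\<lambda>e. t (e 0) (\<lambda>n. e (Suc n)))" "e0 \<in> envs M"
  shows "dft M (\<lambda>e. t (e 0) e0)"
proof -
  have "dfn M (\<lambda>e. e 0 = t (e 1) (\<lambda>n. e (Suc (Suc n))))" using assms(1) by (simp add: dft_def)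
  from dfn_inst2[where P="\<lambda>x y e. x = t y e", OF this assms(2)] have "dfn M (\<lambda>e. e 0 = t (e 1) e0)" .
  moreover have "t (e 0) e0 \<in> V" if "e \<in> envs M" for e
    using dft_in[OF assms(1), of "case_nat (e 0) e0"] that assms(2) by (simp add: envsD)
  ultimately show ?thesis unfolding dft_def by simp
qed

lemma dft_Lam [dfns]:
  assumes "dft M a" "dft M (\<lambda>e. t (e 0) (\<lambda>n. e (Suc n)))"
  shows "dft M (\<lambda>e. Lam M (a e) (\<lambda>x. t x e))"
  unfolding Lam_def
proof (rule dft_set)
  fix e assume e: "e \<in> envs M"
  have "isset M ((\<lambda>x. op x (t x e)) ` E (a e))"
    by (intro isset_image dfns dft_in[OF assms(1)] dft_inst[OF assms(2)] e)
  then show "isset M {op x (t x e) |x. x \<in> E (a e)}" by (simp add: image_def setcompr_eq_image)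
next
  have 1: "dft M (\<lambda>e. t (e 0) (\<lambda>n. e (Suc (Suc n))))"
    using dft_ren[OF assms(2), of "case_nat 0 (\<lambda>n. Suc (Suc n))"] by simp
  have "dfn M (\<lambda>e. \<exists>x\<in>E (a (\<lambda>n. e (Suc n))). e 0 = op x (t x (\<lambda>n. e (Suc n))))"
    by (intro dfns dft_shift assms 1)
  then show "dfn M (\<lambda>e. e 0 \<in> {op x (t x (\<lambda>n. e (Suc n))) |x. x \<in> E (a (\<lambda>n. e (Suc n)))})"
    by (rule dfn_cong) auto
qed

lemma Lam_E:
  assumes "a \<in> V" "dft M (\<lambda>e. t (e 0))"
  shows "Lam M a t \<in> V \<and> E (Lam M a t) = {op x (t x) | x. x \<in> E a}"
proof -
  have "isset M ((\<lambda>x. op x (t x)) ` E a)" by (intro isset_image dfns assms)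
  then have "isset M {op x (t x) | x. x \<in> E a}" by (simp add: setcompr_eq_image)
  then show ?thesis unfolding Lam_def using E_the_set the_set_V by blast
qed

lemma dft1_V: "dft M (\<lambda>e. t (e 0)) \<Longrightarrow> x \<in> V \<Longrightarrow> t x \<in> V"
  using dft_in[of M "\<lambda>e. t (e 0)" "\<lambda>_. x"] by (simp add: envs_def)

lemma Lam_V: "a \<in> V \<Longrightarrow> dft M (\<lambda>e. t (e 0)) \<Longrightarrow> Lam M a t \<in> V"
  using Lam_E by blast

lemma Lam_funs:
  assumes "a \<in> V" "dft M (\<lambda>e. t (e 0))" shows "Lam M a t \<in> funs M a"
proof -
  have t: "t x \<in> V" if "x \<in> E a" for x using dft1_V[OF assms(2) E_V[OF that]] .
  have "\<exists>!y. y \<in> V \<and> op x y \<in> E (Lam M a t)" if "x \<in> E a" for x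
  proof (rule ex1I[of _ "t x"])
    show "t x \<in> V \<and> op x (t x) \<in> E (Lam M a t)" using Lam_E[OF assms] t that by blast
    fix y assume y: "y \<in> V \<and> op x y \<in> E (Lam M a t)"
    from y obtain x' where x': "x' \<in> E a" "op x y = op x' (t x')" using Lam_E[OF assms] by blast
    moreover from x' have "x \<in> V" "x' \<in> V" using that x'(1) by (blast dest: E_V)+
    ultimately show "y = t x" using op_inj[of x y x' "t x'"] y t[OF x'(1)] by blast
  qed
  moreover have "\<forall>p\<in>E (Lam M a t). \<exists>x\<in>E a. \<exists>y\<in>V. p = op x y"
    using conjunct2[OF Lam_E[OF assms]] t by auto
  ultimately show ?thesis unfolding funs_def using conjunct1[OF Lam_E[OF assms]] by simp
qed

lemma app_in:
  assumes "f \<in> funs M a" "x \<in> E a"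
  shows "app M f x \<in> V" "op x (app M f x) \<in> E f" "\<And>y. y \<in> V \<Longrightarrow> op x y \<in> E f \<Longrightarrow> y = app M f x"
proof -
  have u: "\<exists>!y. y \<in> V \<and> op x y \<in> E f" using assms unfolding funs_def by blast
  show "app M f x \<in> V" "op x (app M f x) \<in> E f" using theI'[OF u] unfolding app_def by auto
  then show "y = app M f x" if "y \<in> V" "op x y \<in> E f" for y using u that by blast
qed

lemma app_Lam:
  assumes "a \<in> V" "dft M (\<lambda>e. t (e 0))" "x \<in> E a" shows "app M (Lam M a t) x = t x"
proof -
  have "op x (t x) \<in> E (Lam M a t)" using Lam_E[OF assms(1,2)] assms(3) by blast
  then show ?thesis
    using app_in(3)[OF Lam_funs[OF assms(1,2)] assms(3), of "t x"] dft1_V[OF assms(2)] E_V[OF assms(3)] by simp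
qed

lemma ap_app: "f \<in> funs M a \<Longrightarrow> x \<in> E a \<Longrightarrow> ap M f x = app M f x"
  unfolding ap_def funs_def by auto

lemma ap_Lam [simp]: "a \<in> V \<Longrightarrow> dft M (\<lambda>e. t (e 0)) \<Longrightarrow> x \<in> E a \<Longrightarrow> ap M (Lam M a t) x = t x"
  using ap_app[OF Lam_funs] app_Lam by simp

lemma funs_V: "f \<in> funs M a \<Longrightarrow> f \<in> V" by (simp add: funs_def)

lemma ap_V: assumes "x \<in> V" shows "ap M f x \<in> V"
proof (cases "\<exists>!y. y \<in> V \<and> op x y \<in> E f")
  case True
  from theI'[OF True] show ?thesis using True unfolding ap_def app_def by simp
qed (use assms in \<open>simp add: ap_def\<close>)

lemma dfn_ex1: 
  assumes "dfn M (\<lambda>e. P (e 0) (\<lambda>n. e (Suc n)))"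
  shows "dfn M (\<lambda>e. \<exists>!y. y \<in> V \<and> P y e)"
proof -
  have 1: "dfn M (\<lambda>e. P (e 0) (\<lambda>n. e (Suc (Suc n))))"
    using dfn_ren[OF assms, of "case_nat 0 (\<lambda>n. Suc (Suc n))"] by simp
  have "dfn M (\<lambda>e. \<exists>y\<in>V. P y e \<and> (\<forall>z\<in>V. P z e \<longrightarrow> z = y))"
    by (intro dfns assms 1)
  then show ?thesis by (rule dfn_cong) blast
qed

lemma dft_ap [dfns]:
  assumes "dft M f" "dft M t" shows "dft M (\<lambda>e. ap M (f e) (t e))"
  unfolding dft_def
proof
  show "\<forall>e\<in>envs M. ap M (f e) (t e) \<in> V" using ap_V dft_in[OF assms(2)] by blast
  have "dfn M (\<lambda>e. if \<exists>!y. y \<in> V \<and> op (t (\<lambda>n. e (Suc n))) y \<in> E (f (\<lambda>n. e (Suc n)))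
      then op (t (\<lambda>n. e (Suc n))) (e 0) \<in> E (f (\<lambda>n. e (Suc n)))
      else e 0 = t (\<lambda>n. e (Suc n)))"
    by (intro dfns dfn_ex1 assms dft_shift dft_ren[OF assms(1)] dft_ren[OF assms(2)])
  then show "dfn M (\<lambda>e. e 0 = ap M (f (\<lambda>n. e (Suc n))) (t (\<lambda>n. e (Suc n))))"
  proof (rule dfn_cong)
    fix e assume e: "e \<in> envs M"
    let ?f = "f (\<lambda>n. e (Suc n))" and ?t = "t (\<lambda>n. e (Suc n))"
    show "(if \<exists>!y. y \<in> V \<and> op ?t y \<in> E ?f then op ?t (e 0) \<in> E ?f else e 0 = ?t) = (e 0 = ap M ?f ?t)"
    proof (cases "\<exists>!y. y \<in> V \<and> op ?t y \<in> E ?f")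
      case True
      from theI'[OF True] have "app M ?f ?t \<in> V" "op ?t (app M ?f ?t) \<in> E ?f" unfolding app_def by auto
      then show ?thesis using True envsD[OF e] unfolding ap_def by auto
    qed (simp add: ap_def)
  qed
qed

lemma dfn_funs [dfns]:
  assumes "dft M f" "dft M a" shows "dfn M (\<lambda>e. f e \<in> funs M (a e))"
proof -
  have "dfn M (\<lambda>e. (\<forall>p\<in>E (f e). \<exists>x\<in>E (a e). \<exists>y\<in>V. p = op x y) \<and>
     (\<forall>x\<in>E (a e). \<exists>!y. y \<in> V \<and> op x y \<in> E (f e)))"
    by (intro dfns dfn_ex1 dft_ren[OF assms(1)] dft_ren[OF assms(2)] assms dft_shift)
  then show ?thesis by (rule dfn_cong) (use dft_in[OF assms(1)] in \<open>auto simp: funs_def\<close>)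
qed

lemma large_iff: "large M U S \<longleftrightarrow> (\<exists>A\<in>E U. E A = S)"
  unfolding large_def by auto

lemma dfn_almost [dfns]:
  assumes "dft M U" "dft M X" "dfn M (\<lambda>e. P (e 0) (\<lambda>n. e (Suc n)))"
  shows "dfn M (\<lambda>e. almost M (U e) (X e) (\<lambda>x. P x e))"
proof -
  have 1: "dfn M (\<lambda>e. P (e 0) (\<lambda>n. e (Suc (Suc n))))"
    using dfn_ren[OF assms(3), of "case_nat 0 (\<lambda>n. Suc (Suc n))"] by simp
  have "dfn M (\<lambda>e. \<exists>A\<in>E (U e). \<forall>x\<in>V. x \<in> E A \<longleftrightarrow> x \<in> E (X e) \<and> P x e)"
    by (intro dfns 1 assms dft_shift dft_ren[OF assms(2)])
  then show ?thesis
    by (rule dfn_cong) (unfold almost_def large_iff, use E_V in blast)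
qed

text \<open>A Kuratowski pair of elements of the union \<open>u\<close> lies in the double power set
  of \<open>u\<close>, so the product can be separated from a set.\<close>

lemma E_cprod:
  assumes "a \<in> V" "b \<in> V"
  shows "cprod M a b \<in> V" "E (cprod M a b) = {op x y | x y. x \<in> E a \<and> y \<in> E b}"
proof -
  have V: "x \<in> V" "y \<in> V" if "x \<in> E a" "y \<in> E b" for x y using that E_V by auto
  obtain u where u: "u \<in> V" "E u = E a \<union> E b"
    using isset_Un[of "E a" "E b"] assms unfolding isset_def by blast
  have "{op x y | x y. x \<in> E a \<and> y \<in> E b} = {p \<in> E (Pw (Pw u)). \<exists>x\<in>E a. \<exists>y\<in>E b. p = op x y}"
  proof -
    have "op x y \<in> E (Pw (Pw u))" if "x \<in> E a" "y \<in> E b" for x y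
    proof -
      have s: "the_set M {x} \<in> V" "E (the_set M {x}) = {x}" "the_set M {x,y} \<in> V" "E (the_set M {x,y}) = {x,y}"
        using V[OF that] by (auto intro: the_set_V isset_sing isset_pair simp: E_the_set isset_sing isset_pair)
      then have "E (op x y) = {the_set M {x}, the_set M {x, y}}"
        unfolding opair_def by (intro E_the_set isset_pair)
      then show ?thesis using s u that V[OF that] by (auto simp: E_Pw)
    qed
    then show ?thesis by blast
  qed
  moreover have "isset M {p \<in> E (Pw (Pw u)). \<exists>x\<in>E a. \<exists>y\<in>E b. p = op x y}"
    by (intro isset_sep dfns) (use u assms in auto)
  ultimately have i: "isset M {op x y | x y. x \<in> E a \<and> y \<in> E b}" by simp
  show "cprod M a b \<in> V" "E (cprod M a b) = {op x y | x y. x \<in> E a \<and> y \<in> E b}"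
    unfolding cprod_def using the_set_V[OF i] E_the_set[OF i] by auto
qed

lemma op_cprod [simp]:
  assumes "a \<in> V" "b \<in> V" "x \<in> V" "y \<in> V"
  shows "op x y \<in> E (cprod M a b) \<longleftrightarrow> x \<in> E a \<and> y \<in> E b"
proof
  assume "op x y \<in> E (cprod M a b)"
  then obtain x' y' where "op x y = op x' y'" "x' \<in> E a" "y' \<in> E b" using E_cprod assms by auto
  moreover from this have "x' \<in> V" "y' \<in> V" using E_V by auto
  ultimately show "x \<in> E a \<and> y \<in> E b" using assms by simp
qed (use E_cprod assms in blast)

lemma cprodE:
  assumes "p \<in> E (cprod M a b)" "a \<in> V" "b \<in> V"
  obtains x y where "p = op x y" "x \<in> E a" "y \<in> E b" "x \<in> V" "y \<in> V"
proof -
  from assms obtain x y where "p = op x y" "x \<in> E a" "y \<in> E b" using E_cprod(2)[OF assms(2,3)] by blast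
  then show thesis using that E_V by blast
qed

lemma fs_op [simp]: "x \<in> V \<Longrightarrow> y \<in> V \<Longrightarrow> fs M (op x y) = x"
  and sn_op [simp]: "x \<in> V \<Longrightarrow> y \<in> V \<Longrightarrow> sn M (op x y) = y"
  unfolding fs_def sn_def by (auto intro!: the_equality)

lemma dft_fs [dfns]: assumes t: "dft M t" shows "dft M (\<lambda>e. fs M (t e))"
proof -
  let ?t = "\<lambda>e. t (\<lambda>n. e (Suc n))"
  have "dfn M (\<lambda>e. if \<exists>x\<in>V. \<exists>y\<in>V. ?t e = op x y then \<exists>y\<in>V. ?t e = op (e 0) y else e 0 = ?t e)"
    by (intro dfns dft_ren[OF t])
  then have "dfn M (\<lambda>e. e 0 = fs M (?t e))"
  proof (rule dfn_cong)
    fix e assume e: "e \<in> envs M"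
    show "(if \<exists>x\<in>V. \<exists>y\<in>V. ?t e = op x y then \<exists>y\<in>V. ?t e = op (e 0) y else e 0 = ?t e) = (e 0 = fs M (?t e))"
    proof (cases "\<exists>x\<in>V. \<exists>y\<in>V. ?t e = op x y")
      case True
      then obtain x y where "x \<in> V" "y \<in> V" "?t e = op x y" by blast
      then show ?thesis using envsD[OF e] by auto
    qed (simp add: fs_def)
  qed
  moreover have "fs M p \<in> V" if "p \<in> V" for p
    using that fs_op by (cases "\<exists>x\<in>V. \<exists>y\<in>V. p = op x y") (auto simp: fs_def)
  ultimately show ?thesis using dft_in[OF t] unfolding dft_def by blast
qed

lemma dft_sn [dfns]: assumes t: "dft M t" shows "dft M (\<lambda>e. sn M (t e))"
proof -
  let ?t = "\<lambda>e. t (\<lambda>n. e (Suc n))"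
  have "dfn M (\<lambda>e. if \<exists>x\<in>V. \<exists>y\<in>V. ?t e = op x y then \<exists>x\<in>V. ?t e = op x (e 0) else e 0 = ?t e)"
    by (intro dfns dft_ren[OF t])
  then have "dfn M (\<lambda>e. e 0 = sn M (?t e))"
  proof (rule dfn_cong)
    fix e assume e: "e \<in> envs M"
    show "(if \<exists>x\<in>V. \<exists>y\<in>V. ?t e = op x y then \<exists>x\<in>V. ?t e = op x (e 0) else e 0 = ?t e) = (e 0 = sn M (?t e))"
    proof (cases "\<exists>x\<in>V. \<exists>y\<in>V. ?t e = op x y")
      case True
      then obtain x y where "x \<in> V" "y \<in> V" "?t e = op x y" by blast
      then show ?thesis using envsD[OF e] by auto
    qed (simp add: sn_def)
  qed
  moreover have "sn M p \<in> V" if "p \<in> V" for p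
    using that sn_op by (cases "\<exists>x\<in>V. \<exists>y\<in>V. p = op x y") (auto simp: sn_def)
  ultimately show ?thesis using dft_in[OF t] unfolding dft_def by blast
qed

lemma dft_cprod [dfns]:
  assumes "dft M a" "dft M b" shows "dft M (\<lambda>e. cprod M (a e) (b e))"
  unfolding cprod_def
proof (rule dft_set)
  fix e assume e: "e \<in> envs M"
  show "isset M {op x y |x y. x \<in> E (a e) \<and> y \<in> E (b e)}"
    using E_cprod[OF dft_in[OF assms(1) e] dft_in[OF assms(2) e]] unfolding isset_def by blast
next
  have "dfn M (\<lambda>e. \<exists>x\<in>E (a (\<lambda>n. e (Suc n))). \<exists>y\<in>E (b (\<lambda>n. e (Suc n))). e 0 = op x y)"
    by (intro dfns assms dft_ren[OF assms(1)] dft_ren[OF assms(2)])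
  then show "dfn M (\<lambda>e. e 0 \<in> {op x y |x y. x \<in> E (a (\<lambda>n. e (Suc n))) \<and> y \<in> E (b (\<lambda>n. e (Suc n)))})"
    by (rule dfn_cong) auto
qed

lemma card_le_iff:
  "card_le M A B \<longleftrightarrow> (\<exists>f\<in>funs M A. (\<forall>x\<in>E A. ap M f x \<in> E B) \<and>
     (\<forall>x\<in>E A. \<forall>y\<in>E A. ap M f x = ap M f y \<longrightarrow> x = y))"
  unfolding card_le_def inj_on_def image_subset_iff
  by (rule bex_cong[OF refl]) (simp add: ap_app)

lemma dfn_card_le [dfns]:
  assumes "dft M a" "dft M b" shows "dfn M (\<lambda>e. card_le M (a e) (b e))"
proof -
  have "dfn M (\<lambda>e. \<exists>f\<in>V. f \<in> funs M (a e) \<and> (\<forall>x\<in>E (a e). ap M f x \<in> E (b e)) \<and>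
     (\<forall>x\<in>E (a e). \<forall>y\<in>E (a e). ap M f x = ap M f y \<longrightarrow> x = y))"
    by (intro dfns assms dft_shift dft_ren[OF assms(1)] dft_ren[OF assms(2)])
  then show ?thesis by (rule dfn_cong) (use funs_V in \<open>auto simp: card_le_iff\<close>)
qed

lemma card_leI:
  assumes "A \<in> V" "dft M (\<lambda>e. t (e 0))" "\<And>x. x \<in> E A \<Longrightarrow> t x \<in> E B"
    "\<And>x y. x \<in> E A \<Longrightarrow> y \<in> E A \<Longrightarrow> t x = t y \<Longrightarrow> x = y"
  shows "card_le M A B"
  unfolding card_le_iff using assms Lam_funs[OF assms(1,2)]
  by (intro bexI[of _ "Lam M A t"]) auto

lemma card_leE:
  assumes "card_le M A B"
  obtains f where "f \<in> V" "f \<in> funs M A" "\<forall>x\<in>E A. ap M f x \<in> E B"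
    "\<forall>x\<in>E A. \<forall>y\<in>E A. ap M f x = ap M f y \<longrightarrow> x = y"
  using assms funs_V unfolding card_le_iff by blast

lemma card_le_subset: "A \<in> V \<Longrightarrow> E A \<subseteq> E B \<Longrightarrow> card_le M A B"
  by (rule card_leI[where t="\<lambda>x. x"]) (auto intro: dfns)

lemma card_le_trans:
  assumes "card_le M A B" "card_le M B C" "A \<in> V" shows "card_le M A C"
proof -
  obtain f where f: "f \<in> V" "f \<in> funs M A" "\<forall>x\<in>E A. ap M f x \<in> E B"
    "\<forall>x\<in>E A. \<forall>y\<in>E A. ap M f x = ap M f y \<longrightarrow> x = y"
    by (rule card_leE[OF assms(1)])
  obtain g where g: "g \<in> V" "g \<in> funs M B" "\<forall>x\<in>E B. ap M g x \<in> E C"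
    "\<forall>x\<in>E B. \<forall>y\<in>E B. ap M g x = ap M g y \<longrightarrow> x = y"
    by (rule card_leE[OF assms(2)])
  show ?thesis
    by (rule card_leI[where t="\<lambda>x. ap M g (ap M f x)"]) (use assms f g in \<open>auto intro!: dfns\<close>)
qed

lemma card_le_Pw:
  assumes "card_le M A B" "A \<in> V" "B \<in> V" shows "card_le M (Pw A) (Pw B)"
proof -
  obtain f where f: "f \<in> V" "f \<in> funs M A" "\<forall>x\<in>E A. ap M f x \<in> E B"
    "\<forall>x\<in>E A. \<forall>y\<in>E A. ap M f x = ap M f y \<longrightarrow> x = y"
    by (rule card_leE[OF assms(1)])
  define t where "t = (\<lambda>S. Sep M B (\<lambda>b. \<exists>x\<in>E S. b = ap M f x))"
  have tE: "E (t S) = {b \<in> E B. \<exists>x\<in>E S. b = ap M f x}" and tV: "t S \<in> V" if "S \<in> V" for S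
    unfolding t_def using assms f that by (auto intro!: E_Sep Sep_V dfns)
  show ?thesis
  proof (rule card_leI[where t=t])
    show "dft M (\<lambda>e. t (e 0))" unfolding t_def by (intro dfns) (use assms f in auto)
    show "t S \<in> E (Pw B)" if "S \<in> E (Pw A)" for S
      using that tE tV assms by (auto simp: E_Pw)
    fix S T assume ST: "S \<in> E (Pw A)" "T \<in> E (Pw A)" "t S = t T"
    have V: "S \<in> V" "T \<in> V" and sub: "E S \<subseteq> E A" "E T \<subseteq> E A" using ST assms by (auto simp: E_Pw)
    have "{b \<in> E B. \<exists>x\<in>E S. b = ap M f x} = {b \<in> E B. \<exists>x\<in>E T. b = ap M f x}"
      using tE[OF V(1)] tE[OF V(2)] ST(3) by simp
    then have *: "\<And>b. b \<in> E B \<Longrightarrow> (\<exists>x\<in>E S. b = ap M f x) \<longleftrightarrow> (\<exists>x\<in>E T. b = ap M f x)" by blast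
    have "E S = E T"
    proof (intro set_eqI iffI)
      fix x assume "x \<in> E S" then show "x \<in> E T" using *[of "ap M f x"] f(3,4) sub by blast
    next
      fix x assume "x \<in> E T" then show "x \<in> E S" using *[of "ap M f x"] f(3,4) sub by blast
    qed
    then show "S = T" using ext V by blast
  qed (use assms in auto)
qed

lemma card_le_cprod:
  assumes "card_le M A B" "card_le M C D" "A \<in> V" "B \<in> V" "C \<in> V" "D \<in> V"
  shows "card_le M (cprod M A C) (cprod M B D)"
proof -
  obtain f where f: "f \<in> V" "f \<in> funs M A" "\<forall>x\<in>E A. ap M f x \<in> E B"
    "\<forall>x\<in>E A. \<forall>y\<in>E A. ap M f x = ap M f y \<longrightarrow> x = y"
    by (rule card_leE[OF assms(1)])
  obtain g where g: "g \<in> V" "g \<in> funs M C" "\<forall>x\<in>E C. ap M g x \<in> E D"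
    "\<forall>x\<in>E C. \<forall>y\<in>E C. ap M g x = ap M g y \<longrightarrow> x = y"
    by (rule card_leE[OF assms(2)])
  show ?thesis
  proof (rule card_leI[where t="\<lambda>p. op (ap M f (fs M p)) (ap M g (sn M p))"])
    show "dft M (\<lambda>e. op (ap M f (fs M (e 0))) (ap M g (sn M (e 0))))" by (intro dfns f g)
    show "cprod M A C \<in> V" using assms E_cprod by blast
    fix p assume p: "p \<in> E (cprod M A C)"
    then show "op (ap M f (fs M p)) (ap M g (sn M p)) \<in> E (cprod M B D)"
      by (rule cprodE) (use assms f g ap_V in auto)
    fix q assume q: "q \<in> E (cprod M A C)"
      and eq: "op (ap M f (fs M p)) (ap M g (sn M p)) = op (ap M f (fs M q)) (ap M g (sn M q))"
    from p obtain x y where "p = op x y" "x \<in> E A" "y \<in> E C" "x \<in> V" "y \<in> V" by (rule cprodE) (use assms in auto)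
    moreover from q obtain x' y' where "q = op x' y'" "x' \<in> E A" "y' \<in> E C" "x' \<in> V" "y' \<in> V" by (rule cprodE) (use assms in auto)
    ultimately show "p = q" using eq f(4) g(4) ap_V by auto
  qed
qed

end

section \<open>Choice, well-founded orders and recursion\<close>

context zfc
begin

lemma dfn2_subst:
  assumes "dfn M (\<lambda>e. Q (e 0) (e 1))" "dft M s" "dft M t" shows "dfn M (\<lambda>e. Q (s e) (t e))"
proof -
  have "dfn M (\<lambda>e. \<exists>x\<in>V. \<exists>y\<in>V. x = s e \<and> y = t e \<and> Q x y)"
    using dfn_ren[OF assms(1), of "\<lambda>n. if n = 0 then 1 else 0"]
    by (intro dfns dft_ren[OF assms(2)] dft_ren[OF assms(3)]) simp
  then show ?thesis by (rule dfn_cong) (use dft_in assms in blast)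
qed

lemma dfn3_subst:
  assumes "dfn M (\<lambda>e. Q (e 0) (e 1) (e 2))" "dft M s" "dft M t" "dft M u"
  shows "dfn M (\<lambda>e. Q (s e) (t e) (u e))"
proof -
  have "dfn M (\<lambda>e. \<exists>x\<in>V. \<exists>y\<in>V. \<exists>z\<in>V. x = s e \<and> y = t e \<and> z = u e \<and> Q x y z)"
    using dfn_ren[OF assms(1), of "\<lambda>n. if n = 0 then 2 else if n = 1 then 1 else 0"]
    by (intro dfns dft_ren[OF assms(2)] dft_ren[OF assms(3)] dft_ren[OF assms(4)]) (simp add: numeral_2_eq_2)
  then show ?thesis by (rule dfn_cong) (use dft_in assms in blast)
qed

lemma Un_E: "a \<in> V \<Longrightarrow> \<exists>u\<in>V. E u = (\<Union>x\<in>E a. E x)"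
  using isset_Union unfolding isset_def by blast

text \<open>The fibre \<open>t x\<close> consists of pairs with first component \<open>x\<close>, so
  fibres over different points are disjoint, as the choice axiom of the model demands. The selector,
  restricted to these fibres, is itself the graph of the function. The bound \<open>B\<close> makes
  the fibres sets.\<close>

lemma choice:
  assumes a: "a \<in> V" and B: "B \<in> V" and Q: "dfn M (\<lambda>e. Q (e 0) (e 1))"
    and ex: "\<And>x. x \<in> E a \<Longrightarrow> \<exists>y\<in>E B. Q x y"
  shows "\<exists>f\<in>funs M a. \<forall>x\<in>E a. ap M f x \<in> E B \<and> Q x (ap M f x)"
proof -
  define t where "t = (\<lambda>x. Sep M (cprod M a B) (\<lambda>p. fs M p = x \<and> Q (fs M p) (sn M p)))"
  have dQ: "dfn M (\<lambda>e. Q (fs M (e 0)) (sn M (e 0)))"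
    by (rule dfn2_subst[OF Q]) (intro dfns)+
  have cV: "cprod M a B \<in> V" using E_cprod a B by blast
  have tV: "t x \<in> V" and tE: "E (t x) = {p \<in> E (cprod M a B). fs M p = x \<and> Q (fs M p) (sn M p)}" if "x \<in> V" for x
    unfolding t_def by (rule Sep_V E_Sep, rule cV, intro dfns dQ that)+
  have dt: "dft M (\<lambda>e. t (e 0))" unfolding t_def by (intro dfns cV dQ)
  have "isset M (t ` E a)" using isset_image[OF a dt] .
  then obtain F where F: "F \<in> V" "E F = t ` E a" unfolding isset_def by blast
  have ne: "E x \<noteq> {}" if xF: "x \<in> E F" for x
  proof -
    obtain z where z: "z \<in> E a" "x = t z" using xF F by blast
    then obtain y where y: "y \<in> E B" "Q z y" using ex by blast
    have "z \<in> V" "y \<in> V" using z y E_V by auto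
    then have "op z y \<in> E x" using z y tE a B by simp
    then show ?thesis by blast
  qed
  have dj: "E x \<inter> E y = {}" if xF: "x \<in> E F" "y \<in> E F" "x \<noteq> y" for x y
  proof -
    obtain z w where "x = t z" "z \<in> E a" "y = t w" "w \<in> E a" using xF(1,2) F(2) by blast
    then show ?thesis using tE[OF E_V[of z a]] tE[OF E_V[of w a]] xF(3) by auto
  qed
  obtain c where c: "c \<in> V" "\<forall>x\<in>E F. \<exists>!z. z \<in> E x \<inter> E c"
  proof -
    have "choice_axiom M" using ZFC unfolding ZFC_def by blast
    then have "\<exists>c\<in>V. \<forall>x\<in>E F. \<exists>!z. z \<in> E x \<inter> E c"
      unfolding choice_axiom_def using F(1) ne dj by simp
    then show thesis using that by blast
  qed
  define f where "f = Sep M (cprod M a B) (\<lambda>p. p \<in> E c \<and> p \<in> E (t (fs M p)))"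
  have dtf: "dft M (\<lambda>e. t (fs M (e 0)))" unfolding t_def by (intro dfns cV dQ)
  have f: "f \<in> V" "E f = {p \<in> E (cprod M a B). p \<in> E c \<and> p \<in> E (t (fs M p))}"
    unfolding f_def by (rule Sep_V E_Sep, rule cV, intro dfns dtf c(1))+
  have key: "\<exists>y\<in>E B. Q x y \<and> op x y \<in> E f \<and> (\<forall>z\<in>V. op x z \<in> E f \<longrightarrow> z = y)" if x: "x \<in> E a" for x
  proof -
    have xV: "x \<in> V" using x E_V by blast
    have u: "\<exists>!z. z \<in> E (t x) \<inter> E c" using c(2) F(2) x by blast
    then obtain p where p: "p \<in> E (t x)" "p \<in> E c" by blast
    have "p \<in> E (cprod M a B)" "fs M p = x" using p tE xV by auto
    then obtain y where y: "p = op x y" "y \<in> E B" "y \<in> V" using a B xV by (metis cprodE fs_op)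
    have "Q x y" using p(1) y tE xV by auto
    moreover have "op x y \<in> E f" using f p y xV x a B by auto
    moreover have "z = y" if "z \<in> V" "op x z \<in> E f" for z
    proof -
      have "op x z \<in> E (t x) \<inter> E c" using that f xV by auto
      then have "op x z = p" using u p by blast
      then show ?thesis using y that xV by simp
    qed
    ultimately show ?thesis using y by blast
  qed
  have ff: "f \<in> funs M a" unfolding funs_def
  proof (intro CollectI conjI ballI f)
    fix p assume "p \<in> E f"
    then have "p \<in> E (cprod M a B)" using f by simp
    then show "\<exists>x\<in>E a. \<exists>y\<in>V. p = op x y" by (rule cprodE) (use a B in auto)
  next
    fix x assume "x \<in> E a"
    from key[OF this] show "\<exists>!y. y \<in> V \<and> op x y \<in> E f" using E_V by blast
  qed
  show ?thesis
  proof (intro bexI[OF _ ff] ballI)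
    fix x assume x: "x \<in> E a"
    obtain y where y: "y \<in> E B" "Q x y" "op x y \<in> E f" using key[OF x] by blast
    have "ap M f x = y" using app_in(3)[OF ff x E_V[OF y(1)] y(3)] ap_app[OF ff x] by simp
    then show "ap M f x \<in> E B \<and> Q x (ap M f x)" using y by simp
  qed
qed

section \<open>Well-founded relations and recursion inside the model\<close>

definition lt :: "'a \<Rightarrow> 'a \<Rightarrow> 'a \<Rightarrow> bool" where
  "lt r x y \<longleftrightarrow> op x y \<in> E r"

lemma dfn_lt [dfns]: "dft M r \<Longrightarrow> dft M s \<Longrightarrow> dft M t \<Longrightarrow> dfn M (\<lambda>e. lt (r e) (s e) (t e))"
  unfolding lt_def by (intro dfns)

text \<open>Minimal elements are demanded only for subsets that are elements of the model.
  Accordingly induction, in the form \<open>wf_least\<close>, is restricted to definable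
  predicates.\<close>

definition wf_on :: "'a \<Rightarrow> 'a \<Rightarrow> bool" where
  "wf_on P r \<longleftrightarrow> P \<in> V \<and> r \<in> V \<and>
     (\<forall>x\<in>E P. \<forall>y\<in>E P. \<forall>z\<in>E P. lt r x y \<longrightarrow> lt r y z \<longrightarrow> lt r x z) \<and>
     (\<forall>S\<in>V. E S \<subseteq> E P \<longrightarrow> E S \<noteq> {} \<longrightarrow> (\<exists>x\<in>E S. \<forall>y\<in>E S. \<not> lt r y x))"

definition wo :: "'a \<Rightarrow> 'a \<Rightarrow> bool" where
  "wo P r \<longleftrightarrow> wf_on P r \<and> (\<forall>x\<in>E P. \<forall>y\<in>E P. lt r x y \<or> x = y \<or> lt r y x)"

lemma dfn_wf_on [dfns]: assumes "dft M P" "dft M r" shows "dfn M (\<lambda>e. wf_on (P e) (r e))"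
proof -
  have "dfn M (\<lambda>e. (\<forall>x\<in>E (P e). \<forall>y\<in>E (P e). \<forall>z\<in>E (P e). lt (r e) x y \<longrightarrow> lt (r e) y z \<longrightarrow> lt (r e) x z) \<and>
     (\<forall>S\<in>V. E S \<subseteq> E (P e) \<longrightarrow> \<not> (\<forall>x\<in>E S. False) \<longrightarrow> (\<exists>x\<in>E S. \<forall>y\<in>E S. \<not> lt (r e) y x)))"
    by (intro dfns dft_ren[OF assms(1)] dft_ren[OF assms(2)] assms)
  then show ?thesis by (rule dfn_cong) (use dft_in assms in \<open>auto simp: wf_on_def\<close>)
qed

lemma dfn_wo [dfns]: "dft M P \<Longrightarrow> dft M r \<Longrightarrow> dfn M (\<lambda>e. wo (P e) (r e))"
  by (rule dfn2_subst) (unfold wo_def, intro dfns)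

lemma wf_V: "wf_on P r \<Longrightarrow> P \<in> V" "wf_on P r \<Longrightarrow> r \<in> V" by (auto simp: wf_on_def)

lemma wf_least:
  assumes "wf_on P r" "dfn M (\<lambda>e. Q (e 0))" "x \<in> E P" "Q x"
  shows "\<exists>x\<in>E P. Q x \<and> (\<forall>y\<in>E P. Q y \<longrightarrow> \<not> lt r y x)"
proof -
  have P: "P \<in> V" using assms wf_V by blast
  have "Sep M P Q \<in> V" "E (Sep M P Q) = {x \<in> E P. Q x}" using P assms(2) by auto
  moreover from this have "\<exists>x\<in>E (Sep M P Q). \<forall>y\<in>E (Sep M P Q). \<not> lt r y x"
    using assms unfolding wf_on_def by blast
  ultimately show ?thesis by auto
qed

lemma wf_irrefl: "wf_on P r \<Longrightarrow> x \<in> E P \<Longrightarrow> \<not> lt r x x"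
  using wf_least[of P r "\<lambda>y. y = x" x] dfn_eq_const[OF E_V, of x] by auto

lemma wf_trans: "wf_on P r \<Longrightarrow> lt r x y \<Longrightarrow> lt r y z \<Longrightarrow> x \<in> E P \<Longrightarrow> y \<in> E P \<Longrightarrow> z \<in> E P \<Longrightarrow> lt r x z"
  unfolding wf_on_def by blast

lemma wo_wf: "wo P r \<Longrightarrow> wf_on P r" by (simp add: wo_def)

lemma wo_total: "wo P r \<Longrightarrow> x \<in> E P \<Longrightarrow> y \<in> E P \<Longrightarrow> lt r x y \<or> x = y \<or> lt r y x"
  unfolding wo_def by blast

lemma wo_least:
  assumes "wo P r" "dfn M (\<lambda>e. Q (e 0))" "x \<in> E P" "Q x"
  obtains m where "m \<in> E P" "Q m" "\<And>y. y \<in> E P \<Longrightarrow> lt r y m \<Longrightarrow> \<not> Q y"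
  using wf_least[OF wo_wf[OF assms(1)] assms(2-4)] by blast

definition Ini :: "'a \<Rightarrow> 'a \<Rightarrow> 'a \<Rightarrow> 'a" where
  "Ini P r x = Sep M P (\<lambda>y. lt r y x)"

lemma dft_Ini [dfns]: assumes "dft M P" "dft M r" "dft M x" shows "dft M (\<lambda>e. Ini (P e) (r e) (x e))"
  unfolding Ini_def by (intro dfns dft_ren[OF assms(2)] dft_ren[OF assms(3)] assms)

lemma Ini_V [simp]: "P \<in> V \<Longrightarrow> r \<in> V \<Longrightarrow> x \<in> V \<Longrightarrow> Ini P r x \<in> V"
  and E_Ini [simp]: "P \<in> V \<Longrightarrow> r \<in> V \<Longrightarrow> x \<in> V \<Longrightarrow> E (Ini P r x) = {y \<in> E P. lt r y x}"
  unfolding Ini_def by (auto intro!: Sep_V E_Sep dfns)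

text \<open>Approximations up to \<open>x\<close> agree where both are defined, because a least
  point of disagreement would see the same set below it. They exist for every \<open>x\<close>,
  because at a least failure the earlier ones could be glued together and extended by one decision.
  The solution collects what the approximations say about their own last point.\<close>

lemma set_recursion:
  assumes wf: "wf_on P r" and D: "dfn M (\<lambda>e. F (e 0) (e 1))"
  shows "\<exists>A\<in>V. E A \<subseteq> E P \<and> (\<forall>x\<in>E P. x \<in> E A \<longleftrightarrow> F x (Sep M A (\<lambda>y. lt r y x)))"
proof -
  note PV = wf_V[OF wf]
  \<comment> \<open>\<open>A\<close> obeys the recursion at \<open>x\<close> and at every point
    below \<open>x\<close>; elsewhere it is unconstrained.\<close>
  define good where "good = (\<lambda>x A. E A \<subseteq> E P \<and> (\<forall>y\<in>E P. y = x \<or> lt r y x \<longrightarrow>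
      (y \<in> E A \<longleftrightarrow> F y (Sep M A (\<lambda>z. lt r z y)))))"
  have dF: "dft M s \<Longrightarrow> dft M t \<Longrightarrow> dfn M (\<lambda>e. F (s e) (t e))" for s t by (rule dfn2_subst[OF D])
  have dgood: "dft M s \<Longrightarrow> dft M t \<Longrightarrow> dfn M (\<lambda>e. good (s e) (t e))" for s t
    by (rule dfn2_subst) (unfold good_def, intro dfns dF PV)
  have sub: "Sep M A (\<lambda>z. lt r z y) \<in> V" "E (Sep M A (\<lambda>z. lt r z y)) = {z \<in> E A. lt r z y}"
    if "A \<in> V" "y \<in> V" for A y
    using that PV by (auto intro!: Sep_V E_Sep dfns)
  have uniq: "\<forall>y\<in>E P. (y = x \<or> lt r y x) \<and> (y = x' \<or> lt r y x') \<longrightarrow> (y \<in> E A \<longleftrightarrow> y \<in> E A')"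
    if g: "good x A" "good x' A'" and V: "A \<in> V" "A' \<in> V" and x: "x \<in> E P" "x' \<in> E P" for x x' A A'
  proof (rule ccontr)
    assume "\<not> ?thesis"
    then obtain y0 where y0: "y0 \<in> E P" "(y0 = x \<or> lt r y0 x) \<and> (y0 = x' \<or> lt r y0 x') \<and> (y0 \<in> E A) \<noteq> (y0 \<in> E A')"
      by blast
    define Q where "Q = (\<lambda>y. (y = x \<or> lt r y x) \<and> (y = x' \<or> lt r y x') \<and> \<not> (y \<in> E A \<longleftrightarrow> y \<in> E A'))"
    have dQ: "dfn M (\<lambda>e. Q (e 0))" unfolding Q_def by (intro dfns PV V E_V[OF x(1)] E_V[OF x(2)])
    obtain y where y: "y \<in> E P" "Q y" "\<forall>z\<in>E P. Q z \<longrightarrow> \<not> lt r z y"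
      using wf_least[OF wf dQ y0(1)] y0 Q_def by blast
    have "{z \<in> E A. lt r z y} = {z \<in> E A'. lt r z y}"
    proof -
      have "z \<in> E A \<longleftrightarrow> z \<in> E A'" if z: "lt r z y" "z \<in> E P" for z
      proof -
        have "(z = x \<or> lt r z x) \<and> (z = x' \<or> lt r z x')"
          using y(1,2) z x wf_trans[OF wf] unfolding Q_def by blast
        then show ?thesis using y(3) z unfolding Q_def by blast
      qed
      then show ?thesis using g unfolding good_def by blast
    qed
    then have "Sep M A (\<lambda>z. lt r z y) = Sep M A' (\<lambda>z. lt r z y)"
      using sub V E_V[OF y(1)] ext by simp
    then show False using g y(1,2) unfolding good_def Q_def by auto
  qed
  have ex: "\<exists>A\<in>V. good x A" if xP: "x \<in> E P" for x
  proof (rule ccontr)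
    assume nex: "\<not> (\<exists>A\<in>V. good x A)"
    define Q where "Q = (\<lambda>x. \<not> (\<exists>A\<in>V. good x A))"
    have dQ: "dfn M (\<lambda>e. Q (e 0))" unfolding Q_def by (intro dfns dgood)
    obtain x where x: "x \<in> E P" "Q x" "\<forall>z\<in>E P. Q z \<longrightarrow> \<not> lt r z x"
      using wf_least[OF wf dQ xP] nex Q_def by blast
    have xV: "x \<in> V" using x E_V by blast
    \<comment> \<open>All approximations below the least failure \<open>x\<close>, glued together;
      \<open>A1\<close> then decides \<open>x\<close> itself by evaluating \<open>F\<close> at
      \<open>A0\<close>.\<close>
    define A0 where "A0 = Sep M P (\<lambda>y. lt r y x \<and> (\<exists>A\<in>V. good y A \<and> y \<in> E A))"
    have A0: "A0 \<in> V" "E A0 = {y \<in> E P. lt r y x \<and> (\<exists>A\<in>V. good y A \<and> y \<in> E A)}"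
      unfolding A0_def by (auto intro!: Sep_V E_Sep dfns dgood PV xV)
    define A1 where "A1 = Sep M P (\<lambda>y. y \<in> E A0 \<or> (y = x \<and> F x A0))"
    have A1: "A1 \<in> V" "E A1 = {y \<in> E P. y \<in> E A0 \<or> (y = x \<and> F x A0)}"
      unfolding A1_def by (auto intro!: Sep_V E_Sep dfns PV xV A0(1))
    have low: "Sep M A1 (\<lambda>z. lt r z x) = A0"
    proof (rule ext)
      show "E (Sep M A1 (\<lambda>z. lt r z x)) = E A0"
        using sub[OF A1(1) xV] A0 A1 wf_irrefl[OF wf x(1)] by auto
    qed (use sub A1 xV A0 in auto)
    have "good x A1" unfolding good_def
    proof (intro conjI ballI impI)
      show "E A1 \<subseteq> E P" using A1 by auto
      fix y assume y: "y \<in> E P" "y = x \<or> lt r y x"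
      show "y \<in> E A1 \<longleftrightarrow> F y (Sep M A1 (\<lambda>z. lt r z y))"
      proof (cases "y = x")
        case True then show ?thesis using low A1 A0 x(1) wf_irrefl[OF wf x(1)] by auto
      next
        case False
        then have yx: "lt r y x" using y by blast
        obtain A where A: "A \<in> V" "good y A" using x(3) y(1) yx unfolding Q_def by blast
        have agree: "z \<in> E A1 \<longleftrightarrow> z \<in> E A" if z: "z \<in> E P" "z = y \<or> lt r z y" for z
        proof -
          have zx: "lt r z x" using z yx y(1) x(1) wf_trans[OF wf] by blast
          have "z \<noteq> x" using zx wf_irrefl[OF wf x(1)] by blast
          moreover have "(\<exists>A'\<in>V. good z A' \<and> z \<in> E A') \<longleftrightarrow> z \<in> E A"
          proof
            assume "\<exists>A'\<in>V. good z A' \<and> z \<in> E A'"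
            then show "z \<in> E A" using uniq[OF _ A(2) _ A(1) z(1) y(1)] z by blast
          next
            assume "z \<in> E A"
            moreover obtain A' where A': "A' \<in> V" "good z A'" using x(3) z(1) zx unfolding Q_def by blast
            ultimately show "\<exists>A'\<in>V. good z A' \<and> z \<in> E A'" using uniq[OF A'(2) A(2) A'(1) A(1) z(1) y(1)] z by blast
          qed
          ultimately show ?thesis using A1 A0 z zx by auto
        qed
        have "Sep M A1 (\<lambda>z. lt r z y) = Sep M A (\<lambda>z. lt r z y)"
        proof (rule ext)
          show "E (Sep M A1 (\<lambda>z. lt r z y)) = E (Sep M A (\<lambda>z. lt r z y))"
            using sub[OF A1(1) E_V[OF y(1)]] sub[OF A(1) E_V[OF y(1)]] agree A1 A(2) unfolding good_def by blast
        qed (use sub A1 A E_V[OF y(1)] in auto)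
        then show ?thesis using agree[OF y(1)] A(2) y(1) unfolding good_def by auto
      qed
    qed
    then show False using x(2) A1(1) unfolding Q_def by blast
  qed
  define A where "A = Sep M P (\<lambda>y. \<exists>A\<in>V. good y A \<and> y \<in> E A)"
  have A: "A \<in> V" "E A = {y \<in> E P. \<exists>A\<in>V. good y A \<and> y \<in> E A}"
    unfolding A_def by (auto intro!: Sep_V E_Sep dfns dgood PV)
  show ?thesis
  proof (intro bexI[OF _ A(1)] conjI ballI)
    show "E A \<subseteq> E P" using A by auto
    fix x assume x: "x \<in> E P"
    obtain B where B: "B \<in> V" "good x B" using ex[OF x] by blast
    have agree: "z \<in> E A \<longleftrightarrow> z \<in> E B" if z: "z \<in> E P" "z = x \<or> lt r z x" for z
    proof
      assume "z \<in> E A"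
      then obtain A' where "A' \<in> V" "good z A'" "z \<in> E A'" using A by blast
      then show "z \<in> E B" using uniq[OF _ B(2) _ B(1) z(1) x] z by blast
    next
      assume "z \<in> E B"
      moreover obtain A' where A': "A' \<in> V" "good z A'" using ex[OF z(1)] by blast
      ultimately show "z \<in> E A" using uniq[OF A'(2) B(2) A'(1) B(1) z(1) x] z A by blast
    qed
    have "Sep M A (\<lambda>z. lt r z x) = Sep M B (\<lambda>z. lt r z x)"
    proof (rule ext)
      show "E (Sep M A (\<lambda>z. lt r z x)) = E (Sep M B (\<lambda>z. lt r z x))"
        using sub[OF A(1) E_V[OF x]] sub[OF B(1) E_V[OF x]] agree A B(2) unfolding good_def by blast
    qed (use sub A B E_V[OF x] in auto)
    then show "x \<in> E A \<longleftrightarrow> F x (Sep M A (\<lambda>y. lt r y x))"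
      using agree[OF x] B(2) x unfolding good_def by auto
  qed
qed

end

section \<open>Well-orders and cardinals\<close>

context zfc
begin

lemma dft1_subst:
  assumes f: "dft M (\<lambda>e. f (e 0))" and t: "dft M t" shows "dft M (\<lambda>e. f (t e))"
proof -
  have 1: "dfn M (\<lambda>e. e 0 = f (e 1))" using f unfolding dft_def by simp
  have "dfn M (\<lambda>e. e 0 = f (t (\<lambda>n. e (Suc n))))"
    by (rule dfn2_subst[where Q="\<lambda>x y. x = f y", OF 1]) (intro dfns dft_shift t)+
  moreover have "f (t e) \<in> V" if "e \<in> envs M" for e using dft1_V[OF f dft_in[OF t that]] .
  ultimately show ?thesis unfolding dft_def by blast
qed

text \<open>Zermelo's second proof: with a choice function \<open>c\<close>, let \<open>T\<close> be
  the least family that contains \<open>S\<close>, is closed under intersections and under removal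
  of the chosen element. \<open>T\<close> is a chain, and \<open>x\<close> precedes \<open>y\<close>
  when some member of \<open>T\<close> has already lost \<open>x\<close> but still contains
  \<open>y\<close>.\<close>

theorem zermelo:
  assumes S: "S \<in> V" shows "\<exists>r. wo S r"
proof -
  define a where "a = Sep M (Pw S) (\<lambda>A. \<exists>x\<in>E A. True)"
  have aV: "a \<in> V" and aE: "E a = {A \<in> E (Pw S). \<exists>x\<in>E A. True}"
    unfolding a_def by (rule Sep_V E_Sep, simp add: S, intro dfns)+
  have dQ: "dfn M (\<lambda>e. e 1 \<in> E (e 0))" by (intro dfns)
  have "\<exists>c\<in>funs M a. \<forall>A\<in>E a. ap M c A \<in> E S \<and> ap M c A \<in> E A"
  proof (rule choice[OF aV S dQ])
    fix A assume "A \<in> E a" then show "\<exists>y\<in>E S. y \<in> E A" using aE E_Pw[OF S] by blast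
  qed
  then obtain c where cV: "c \<in> V" and c0: "\<forall>A\<in>E a. ap M c A \<in> E A" using funs_V by blast
  have c: "ap M c A \<in> E A" if "A \<in> V" "E A \<subseteq> E S" "x \<in> E A" for A x
    using c0 aE E_Pw[OF S] that by blast
  define cut where "cut = (\<lambda>A. Sep M A (\<lambda>x. x \<noteq> ap M c A))"
  have dcut: "dft M t \<Longrightarrow> dft M (\<lambda>e. cut (t e))" for t
    by (rule dft1_subst) (unfold cut_def, intro dfns cV)
  have cut: "cut A \<in> V" "E (cut A) = {x \<in> E A. x \<noteq> ap M c A}" if "A \<in> V" for A
    unfolding cut_def by (rule Sep_V E_Sep, rule that, intro dfns cV that)+
  \<comment> \<open>Intersections are taken inside \<open>S\<close>, so the empty family yields
    \<open>S\<close> itself.\<close>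
  define Cap where "Cap = (\<lambda>G. Sep M S (\<lambda>x. \<forall>A\<in>E G. x \<in> E A))"
  have dCap: "dft M t \<Longrightarrow> dft M (\<lambda>e. Cap (t e))" for t
    by (rule dft1_subst) (unfold Cap_def, intro dfns S)
  have Cap: "Cap G \<in> V" "E (Cap G) = {x \<in> E S. \<forall>A\<in>E G. x \<in> E A}" if "G \<in> V" for G
    unfolding Cap_def by (rule Sep_V E_Sep, rule S, intro dfns that)+
  define Th where "Th = (\<lambda>F. E F \<subseteq> E (Pw S) \<and> S \<in> E F \<and> (\<forall>A\<in>E F. cut A \<in> E F) \<and>
     (\<forall>G\<in>V. E G \<subseteq> E F \<longrightarrow> Cap G \<in> E F))"
  have dTh: "dfn M (\<lambda>e. Th (e i))" for i
    unfolding Th_def by (intro dfns S dcut dCap)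
  define T where "T = Sep M (Pw S) (\<lambda>A. \<forall>F\<in>V. Th F \<longrightarrow> A \<in> E F)"
  have TV: "T \<in> V" and TE: "E T = {A \<in> E (Pw S). \<forall>F\<in>V. Th F \<longrightarrow> A \<in> E F}"
    unfolding T_def by (rule Sep_V E_Sep, simp add: S, intro dfns dTh)+
  have TS: "A \<in> V" "E A \<subseteq> E S" if "A \<in> E T" for A
    using that unfolding TE using E_Pw[OF S] by auto
  have T1: "S \<in> E T" unfolding TE Th_def using E_Pw[OF S] S by blast
  have T2: "cut A \<in> E T" if "A \<in> E T" for A
  proof -
    have "cut A \<in> E (Pw S)" using cut[OF TS(1)[OF that]] TS[OF that] E_Pw[OF S] by auto
    then show ?thesis using that unfolding TE Th_def by blast
  qed
  have T3: "Cap G \<in> E T" if "G \<in> V" "E G \<subseteq> E T" for G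
  proof -
    have "Cap G \<in> E (Pw S)" using Cap[OF that(1)] E_Pw[OF S] by auto
    moreover have "E G \<subseteq> E F" if "F \<in> V" "Th F" for F using that \<open>E G \<subseteq> E T\<close> unfolding TE by blast
    ultimately show ?thesis using that(1) unfolding TE Th_def by blast
  qed
  have induct: "\<forall>A\<in>E T. P A" if P: "dfn M (\<lambda>e. P (e 0))" "P S" "\<And>A. A \<in> E T \<Longrightarrow> P A \<Longrightarrow> P (cut A)"
     "\<And>G. G \<in> V \<Longrightarrow> E G \<subseteq> E T \<Longrightarrow> \<forall>A\<in>E G. P A \<Longrightarrow> P (Cap G)" for P
  proof -
    have F: "Sep M T P \<in> V" "E (Sep M T P) = {A \<in> E T. P A}" by (rule Sep_V E_Sep, rule TV, rule P(1))+
    have "Th (Sep M T P)"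
      unfolding Th_def F(2)
    proof (intro conjI ballI impI)
      show "{A \<in> E T. P A} \<subseteq> E (Pw S)" using TE by blast
      show "S \<in> {A \<in> E T. P A}" using T1 P(2) by blast
      show "cut A \<in> {A \<in> E T. P A}" if "A \<in> {A \<in> E T. P A}" for A using T2 P(3) that by blast
      show "Cap G \<in> {A \<in> E T. P A}" if "G \<in> V" "E G \<subseteq> {A \<in> E T. P A}" for G
        using T3[of G] P(4)[of G] that by blast
    qed
    then show ?thesis using F TE by blast
  qed
  define comp where "comp = (\<lambda>A. \<forall>B\<in>E T. E A \<subseteq> E B \<or> E B \<subseteq> E A)"
  have dcomp: "dfn M (\<lambda>e. comp (e 0))" unfolding comp_def by (intro dfns TV)
  \<comment> \<open>No member of \<open>T\<close> lies strictly between \<open>cut A\<close> and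
    \<open>A\<close> once \<open>A\<close> is comparable with all members; this is what makes
    comparability pass from \<open>A\<close> to \<open>cut A\<close>.\<close>
  have step: "\<forall>B\<in>E T. E A \<subseteq> E B \<or> E B \<subseteq> E (cut A)" if A: "A \<in> E T" "comp A" for A
  proof (rule induct)
    show "dfn M (\<lambda>e. E A \<subseteq> E (e 0) \<or> E (e 0) \<subseteq> E (cut A))"
      by (intro dfns TS(1)[OF A(1)] cut(1))
    show "E A \<subseteq> E S \<or> E S \<subseteq> E (cut A)" using TS A by blast
  next
    fix B assume B: "B \<in> E T" "E A \<subseteq> E B \<or> E B \<subseteq> E (cut A)"
    have BV: "B \<in> V" and AV: "A \<in> V" using TS A B by auto
    show "E A \<subseteq> E (cut B) \<or> E (cut B) \<subseteq> E (cut A)"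
    proof (cases "E B \<subseteq> E (cut A)")
      case True then show ?thesis using cut(2)[OF BV] by blast
    next
      case False
      then have AB: "E A \<subseteq> E B" using B by blast
      show ?thesis
      proof (cases "ap M c B \<in> E A")
        case True
        have "E A \<subseteq> E (cut B) \<or> E (cut B) \<subseteq> E A" using A(2) T2[OF B(1)] unfolding comp_def by blast
        then have "E B \<subseteq> E A" using True cut(2)[OF BV] by blast
        then have "A = B" using AB ext AV BV by blast
        then show ?thesis by simp
      next
        case False then show ?thesis using AB cut(2)[OF BV] by blast
      qed
    qed
  next
    fix G assume G: "G \<in> V" "E G \<subseteq> E T" "\<forall>B\<in>E G. E A \<subseteq> E B \<or> E B \<subseteq> E (cut A)"
    show "E A \<subseteq> E (Cap G) \<or> E (Cap G) \<subseteq> E (cut A)"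
    proof (cases "\<exists>B\<in>E G. E B \<subseteq> E (cut A)")
      case True then show ?thesis using Cap(2)[OF G(1)] by auto
    next
      case False then have "\<forall>B\<in>E G. E A \<subseteq> E B" using G(3) by blast
      then show ?thesis using Cap(2)[OF G(1)] TS(2)[OF A(1)] by auto
    qed
  qed
  have "\<forall>A\<in>E T. comp A"
  proof (rule induct[OF dcomp])
    show "comp S" unfolding comp_def using TS by blast
  next
    fix A assume A: "A \<in> E T" "comp A"
    show "comp (cut A)" using step[OF A] cut(2)[OF TS(1)[OF A(1)]] unfolding comp_def by blast
  next
    fix G assume G: "G \<in> V" "E G \<subseteq> E T" "\<forall>A\<in>E G. comp A"
    show "comp (Cap G)" unfolding comp_def
    proof
      fix B assume B: "B \<in> E T"
      show "E (Cap G) \<subseteq> E B \<or> E B \<subseteq> E (Cap G)"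
      proof (cases "\<exists>A\<in>E G. E A \<subseteq> E B")
        case True then show ?thesis using Cap(2)[OF G(1)] by auto
      next
        case False then have "\<forall>A\<in>E G. E B \<subseteq> E A" using G(3) B unfolding comp_def by blast
        then show ?thesis using Cap(2)[OF G(1)] TS(2)[OF B] by auto
      qed
    qed
  qed
  then have chain: "E A \<subseteq> E B \<or> E B \<subseteq> E A" and step': "E A \<subseteq> E B \<or> E B \<subseteq> E (cut A)"
    if "A \<in> E T" "B \<in> E T" for A B
    using that step unfolding comp_def by blast+
  define r where "r = Sep M (cprod M S S) (\<lambda>p. \<exists>B\<in>E T. sn M p \<in> E B \<and> fs M p \<notin> E B)"
  have cS: "cprod M S S \<in> V" using E_cprod S by blast
  have rV: "r \<in> V" and rE: "E r = {p \<in> E (cprod M S S). \<exists>B\<in>E T. sn M p \<in> E B \<and> fs M p \<notin> E B}"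
    unfolding r_def by (rule Sep_V E_Sep, rule cS, intro dfns TV)+
  have lt: "lt r x y \<longleftrightarrow> (\<exists>B\<in>E T. y \<in> E B \<and> x \<notin> E B)" if "x \<in> E S" "y \<in> E S" for x y
    using that E_V S unfolding lt_def rE by auto
  have least: "\<exists>m\<in>E Q. (\<forall>y\<in>E Q. \<not> lt r y m) \<and> (\<forall>y\<in>E Q. y \<noteq> m \<longrightarrow> lt r m y)"
    if Q: "Q \<in> V" "E Q \<subseteq> E S" "E Q \<noteq> {}" for Q
  proof -
    define G where "G = Sep M T (\<lambda>B. E Q \<subseteq> E B)"
    have G: "G \<in> V" "E G = {B \<in> E T. E Q \<subseteq> E B}"
      unfolding G_def by (rule Sep_V E_Sep, rule TV, intro dfns Q(1))+
    \<comment> \<open>The smallest member of \<open>T\<close> that includes \<open>Q\<close>. Its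
      chosen element must lie in \<open>Q\<close>, since otherwise \<open>cut R\<close> would be a
      smaller one; it is the least element of \<open>Q\<close>.\<close>
    define R where "R = Cap G"
    have R: "R \<in> E T" unfolding R_def using T3 G by auto
    have RE: "E R = {x \<in> E S. \<forall>A\<in>E G. x \<in> E A}" unfolding R_def using Cap G by blast
    have QR: "E Q \<subseteq> E R" using Q G RE by auto
    note RV = TS[OF R]
    have cR: "ap M c R \<in> E R" using c[OF RV] QR Q(3) by blast
    have mQ: "ap M c R \<in> E Q"
    proof (rule ccontr)
      assume "ap M c R \<notin> E Q"
      then have "E Q \<subseteq> E (cut R)" using QR cut(2)[OF RV(1)] by auto
      then have "cut R \<in> E G" using G T2[OF R] by blast
      then show False using cR RE cut(2)[OF RV(1)] by auto
    qed
    show ?thesis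
    proof (intro bexI[OF _ mQ] conjI ballI impI)
      fix y assume y: "y \<in> E Q"
      have yS: "y \<in> E S" "ap M c R \<in> E S" using y mQ Q by auto
      show "\<not> lt r y (ap M c R)"
      proof
        assume "lt r y (ap M c R)"
        then obtain B where B: "B \<in> E T" "ap M c R \<in> E B" "y \<notin> E B" using lt[OF yS] by blast
        have "E R \<subseteq> E B \<or> E B \<subseteq> E (cut R)" using step'[OF R B(1)] .
        then show False using B y QR cut(2)[OF RV(1)] by auto
      qed
      show "lt r (ap M c R) y" if "y \<noteq> ap M c R"
        unfolding lt[OF yS(2,1)] using T2[OF R] cut(2)[OF RV(1)] y QR that by (intro bexI[of _ "cut R"]) auto
    qed
  qed
  have "wo S r" unfolding wo_def wf_on_def
  proof (intro conjI ballI impI S rV)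
    fix x y z assume xyz: "x \<in> E S" "y \<in> E S" "z \<in> E S" "lt r x y" "lt r y z"
    obtain B where B: "B \<in> E T" "y \<in> E B" "x \<notin> E B" using xyz(4) unfolding lt[OF xyz(1,2)] by blast
    obtain B' where B': "B' \<in> E T" "z \<in> E B'" "y \<notin> E B'" using xyz(5) unfolding lt[OF xyz(2,3)] by blast
    have "E B' \<subseteq> E B" using chain[OF B(1) B'(1)] B B' by blast
    then show "lt r x z" unfolding lt[OF xyz(1,3)] using B B' by blast
  next
    fix Q assume "Q \<in> V" "E Q \<subseteq> E S" "E Q \<noteq> {}"
    from least[OF this] show "\<exists>x\<in>E Q. \<forall>y\<in>E Q. \<not> lt r y x" by blast
  next
    fix x y assume xy: "x \<in> E S" "y \<in> E S"
    have "isset M {x, y}" by (rule isset_pair) (use xy E_V in auto)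
    then obtain Q where Q: "Q \<in> V" "E Q = {x, y}" unfolding isset_def by blast
    have "E Q \<subseteq> E S" "E Q \<noteq> {}" using Q xy by auto
    from least[OF Q(1) this] show "lt r x y \<or> x = y \<or> lt r y x" unfolding Q(2) by auto
  qed
  then show ?thesis by blast
qed

lemma wo_V: "wo P r \<Longrightarrow> P \<in> V" "wo P r \<Longrightarrow> r \<in> V"
  by (auto simp: wo_def wf_on_def)

lemma wo_sub: "wo P r \<Longrightarrow> Q \<in> V \<Longrightarrow> E Q \<subseteq> E P \<Longrightarrow> wo Q r"
  unfolding wo_def wf_on_def
proof (elim conjE, intro conjI ballI impI; (assumption)?)
  assume a: "E Q \<subseteq> E P" and t: "\<forall>x\<in>E P. \<forall>y\<in>E P. \<forall>z\<in>E P. lt r x y \<longrightarrow> lt r y z \<longrightarrow> lt r x z"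
    and l: "\<forall>S\<in>V. E S \<subseteq> E P \<longrightarrow> E S \<noteq> {} \<longrightarrow> (\<exists>x\<in>E S. \<forall>y\<in>E S. \<not> lt r y x)"
    and tot: "\<forall>x\<in>E P. \<forall>y\<in>E P. lt r x y \<or> x = y \<or> lt r y x"
  show "lt r x z" if "x \<in> E Q" "y \<in> E Q" "z \<in> E Q" "lt r x y" "lt r y z" for x y z
    using that a t by blast
  show "\<exists>x\<in>E S. \<forall>y\<in>E S. \<not> lt r y x" if "S \<in> V" "E S \<subseteq> E Q" "E S \<noteq> {}" for S
    using that a l by (meson order_trans)
  show "lt r x y \<or> x = y \<or> lt r y x" if "x \<in> E Q" "y \<in> E Q" for x y
    using that a tot by blast
qed

lemma wo_asym: "wo P r \<Longrightarrow> x \<in> E P \<Longrightarrow> y \<in> E P \<Longrightarrow> lt r x y \<Longrightarrow> \<not> lt r y x"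
  using wf_trans[OF wo_wf] wf_irrefl[OF wo_wf] by blast

lemma card_le_rel:
  assumes A: "A \<in> V" "B \<in> V" and Q: "dfn M (\<lambda>e. Q (e 0) (e 1))"
    and ex: "\<And>a. a \<in> E A \<Longrightarrow> \<exists>b\<in>E B. Q a b"
    and inj: "\<And>a a' b. a \<in> E A \<Longrightarrow> a' \<in> E A \<Longrightarrow> b \<in> E B \<Longrightarrow> Q a b \<Longrightarrow> Q a' b \<Longrightarrow> a = a'"
  shows "card_le M A B"
proof -
  obtain f where f: "f \<in> funs M A" "\<forall>x\<in>E A. ap M f x \<in> E B \<and> Q x (ap M f x)"
    using choice[OF A Q ex] by blast
  show ?thesis unfolding card_le_iff
    by (intro bexI[OF _ f(1)]) (use f(2) inj in metis)
qed

text \<open>Pairs with equal first coordinate stay incomparable, so a recursion along this order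
  sees at \<open>(q, k)\<close> everything decided for smaller \<open>q\<close> and nothing decided
  for \<open>q\<close> itself.\<close>

lemma wf_fst:
  assumes wf: "wf_on Q s" and K: "K \<in> V"
  shows "\<exists>r. wf_on (cprod M Q K) r \<and> (\<forall>p\<in>E (cprod M Q K). \<forall>p'\<in>E (cprod M Q K). lt r p p' \<longleftrightarrow> lt s (fs M p) (fs M p'))"
proof -
  note QV = wf_V[OF wf]
  let ?P = "cprod M Q K"
  have PV: "?P \<in> V" "cprod M ?P ?P \<in> V" using E_cprod QV K by auto
  define r where "r = Sep M (cprod M ?P ?P) (\<lambda>z. lt s (fs M (fs M z)) (fs M (sn M z)))"
  have rV: "r \<in> V" and rE: "E r = {z \<in> E (cprod M ?P ?P). lt s (fs M (fs M z)) (fs M (sn M z))}"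
    unfolding r_def by (rule Sep_V E_Sep, rule PV, intro dfns QV)+
  have lt: "lt r p p' \<longleftrightarrow> lt s (fs M p) (fs M p')" if "p \<in> E ?P" "p' \<in> E ?P" for p p'
    using that E_V PV unfolding lt_def[of r] rE by auto
  have fsQ: "fs M p \<in> E Q" if "p \<in> E ?P" for p using that by (rule cprodE) (use QV K in auto)
  have "wf_on ?P r" unfolding wf_on_def
  proof (intro conjI ballI impI PV rV)
    fix x y z assume "x \<in> E ?P" "y \<in> E ?P" "z \<in> E ?P" "lt r x y" "lt r y z"
    then show "lt r x z" using lt wf_trans[OF wf, of "fs M x" "fs M y" "fs M z"] fsQ by blast
  next
    fix S assume S: "S \<in> V" "E S \<subseteq> E ?P" "E S \<noteq> {}"
    then obtain p where p: "p \<in> E S" by blast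
    have "dfn M (\<lambda>e. \<exists>p\<in>E S. e 0 = fs M p)" by (intro dfns S(1))
    from wf_least[OF wf this, of "fs M p"]
    obtain q where q: "q \<in> E Q" "\<exists>p\<in>E S. q = fs M p" "\<forall>y\<in>E Q. (\<exists>p\<in>E S. y = fs M p) \<longrightarrow> \<not> lt s y q"
      using p fsQ S by blast
    then show "\<exists>x\<in>E S. \<forall>y\<in>E S. \<not> lt r y x" using lt S fsQ by (metis subsetD)
  qed
  then show ?thesis using lt by blast
qed

text \<open>Relations on \<open>Q\<close> and \<open>K\<close> are built by
  \<open>set_recursion\<close> along the order of first coordinates. The part of \<open>h\<close>
  decided before \<open>q\<close> is handed to \<open>F\<close> as an element \<open>B\<close> of
  the model.\<close>

lemma rel_recursion:
  assumes wf: "wf_on Q s" and K: "K \<in> V" and D: "dfn M (\<lambda>e. F (e 0) (e 1) (e 2))"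
  shows "\<exists>h\<in>V. \<forall>q\<in>E Q. \<forall>k\<in>E K. op q k \<in> E h \<longleftrightarrow>
     (\<exists>B\<in>V. E B = {p \<in> E h. p \<in> E (cprod M Q K) \<and> lt s (fs M p) q} \<and> F q k B)"
proof -
  note QV = wf_V[OF wf]
  let ?P = "cprod M Q K"
  have PV: "?P \<in> V" using E_cprod QV K by auto
  obtain r where r: "wf_on ?P r" and lt: "\<And>p p'. p \<in> E ?P \<Longrightarrow> p' \<in> E ?P \<Longrightarrow> lt r p p' \<longleftrightarrow> lt s (fs M p) (fs M p')"
    using wf_fst[OF wf K] by blast
  have "dfn M (\<lambda>e. F (fs M (e 0)) (sn M (e 0)) (e 1))" by (rule dfn3_subst[OF D]) (intro dfns)+
  from set_recursion[OF r this]
  obtain A where A: "A \<in> V" "E A \<subseteq> E ?P"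
    "\<And>x. x \<in> E ?P \<Longrightarrow> x \<in> E A \<longleftrightarrow> F (fs M x) (sn M x) (Sep M A (\<lambda>y. lt r y x))" by blast
  show ?thesis
  proof (intro bexI[OF _ A(1)] ballI)
    fix q k assume q: "q \<in> E Q" and k: "k \<in> E K"
    have qk: "q \<in> V" "k \<in> V" using q k E_V by auto
    have p: "op q k \<in> E ?P" using q k qk QV K by simp
    let ?B = "Sep M A (\<lambda>y. lt r y (op q k))"
    have B: "?B \<in> V" "E ?B = {y \<in> E A. lt r y (op q k)}"
      by (rule Sep_V E_Sep, rule A, intro dfns wf_V[OF r] op_V qk)+
    have BE: "E ?B = {p \<in> E A. p \<in> E ?P \<and> lt s (fs M p) q}"
      unfolding B(2) using lt[OF _ p] A(2) qk by auto
    have "op q k \<in> E A \<longleftrightarrow> F q k ?B" using A(3)[OF p] qk by simp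
    moreover have "B' = ?B" if "B' \<in> V" "E B' = {p \<in> E A. p \<in> E ?P \<and> lt s (fs M p) q}" for B'
      using ext[OF that(1) B(1)] that(2) BE by simp
    ultimately show "op q k \<in> E A \<longleftrightarrow> (\<exists>B\<in>V. E B = {p \<in> E A. p \<in> E ?P \<and> lt s (fs M p) q} \<and> F q k B)"
      using B(1) BE by blast
  qed
qed

lemma compar:
  assumes K: "wo K r" and Q: "Q \<in> V"
  shows "card_le M K Q \<or> (\<exists>k\<in>E K. card_le M Q (Ini K r k))"
proof -
  obtain s where s: "wo Q s" using zermelo[OF Q] by blast
  note KV = wo_V[OF K] note sV = wo_V[OF s]
  define F where "F = (\<lambda>(q::'a) k B. (\<forall>j\<in>E K. lt r j k \<longrightarrow> (\<exists>q'\<in>E Q. op q' j \<in> E B)) \<and> \<not> (\<exists>q'\<in>E Q. op q' k \<in> E B))"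
  have dF: "dfn M (\<lambda>e. F (e 0) (e 1) (e 2))" unfolding F_def by (intro dfns KV Q)
  from rel_recursion[OF wo_wf[OF s] KV(1) dF]
  obtain h where h: "h \<in> V" "\<And>q k. q \<in> E Q \<Longrightarrow> k \<in> E K \<Longrightarrow> op q k \<in> E h \<longleftrightarrow>
     (\<exists>B\<in>V. E B = {p \<in> E h. p \<in> E (cprod M Q K) \<and> lt s (fs M p) q} \<and> F q k B)" by blast
  have hB: "\<exists>B\<in>V. E B = {p \<in> E h. p \<in> E (cprod M Q K) \<and> lt s (fs M p) q}" if "q \<in> E Q" for q
  proof -
    have "isset M {p \<in> E h. p \<in> E (cprod M Q K) \<and> lt s (fs M p) q}"
      by (rule isset_sep, rule h, intro dfns KV Q sV E_V[OF that])
    then show ?thesis unfolding isset_def .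
  qed
  have H: "op q k \<in> E h \<longleftrightarrow> (\<forall>j\<in>E K. lt r j k \<longrightarrow> (\<exists>q'\<in>E Q. lt s q' q \<and> op q' j \<in> E h)) \<and>
     \<not> (\<exists>q'\<in>E Q. lt s q' q \<and> op q' k \<in> E h)" if q: "q \<in> E Q" and k: "k \<in> E K" for q k
  proof -
    obtain B where B: "B \<in> V" "E B = {p \<in> E h. p \<in> E (cprod M Q K) \<and> lt s (fs M p) q}" using hB[OF q] by blast
    have "op q' j \<in> E B \<longleftrightarrow> lt s q' q \<and> op q' j \<in> E h" if "q' \<in> E Q" "j \<in> E K" for q' j
      using that E_V[OF that(1)] E_V[OF that(2)] Q KV unfolding B(2) by auto
    then have "F q k B \<longleftrightarrow> (\<forall>j\<in>E K. lt r j k \<longrightarrow> (\<exists>q'\<in>E Q. lt s q' q \<and> op q' j \<in> E h)) \<and>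
     \<not> (\<exists>q'\<in>E Q. lt s q' q \<and> op q' k \<in> E h)" unfolding F_def using k by auto
    moreover have "(\<exists>B\<in>V. E B = {p \<in> E h. p \<in> E (cprod M Q K) \<and> lt s (fs M p) q} \<and> F q k B) \<longleftrightarrow> F q k B"
      using B ext by metis
    ultimately show ?thesis using h(2)[OF q k] by simp
  qed
  have hfun: "k = k'" if "q \<in> E Q" "k \<in> E K" "k' \<in> E K" "op q k \<in> E h" "op q k' \<in> E h" for q k k'
    using that H wo_total[OF K that(2,3)] by blast
  have inj: "q = q'" if "q \<in> E Q" "q' \<in> E Q" "k \<in> E K" "op q k \<in> E h" "op q' k \<in> E h" for q q' k
    using that H wo_total[OF s that(1,2)] by blast
  show ?thesis
  proof (cases "\<forall>k\<in>E K. \<exists>q\<in>E Q. op q k \<in> E h")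
    case True
    have "card_le M K Q"
    proof (rule card_le_rel[where Q="\<lambda>k q. op q k \<in> E h"])
      show "dfn M (\<lambda>e. op (e 1) (e 0) \<in> E h)" by (intro dfns h)
    qed (use KV Q True hfun in auto)
    then show ?thesis ..
  next
    case False
    then obtain k where k: "k \<in> E K" "\<not> (\<exists>q\<in>E Q. op q k \<in> E h)" by blast
    have kV: "k \<in> V" using k E_V by blast
    have "card_le M Q (Ini K r k)"
    proof (rule card_le_rel[where Q="\<lambda>q k. op q k \<in> E h"])
      show "dfn M (\<lambda>e. op (e 0) (e 1) \<in> E h)" by (intro dfns h)
      fix q assume q: "q \<in> E Q"
      let ?N = "\<lambda>k. \<not> (\<exists>q'\<in>E Q. lt s q' q \<and> op q' k \<in> E h)"
      have d: "dfn M (\<lambda>e. ?N (e 0))" by (intro dfns Q sV h E_V[OF q])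
      have "?N k" using k(2) by blast
      from wf_least[OF wo_wf[OF K] d k(1) this]
      obtain m where m: "m \<in> E K" "?N m" "\<forall>y\<in>E K. ?N y \<longrightarrow> \<not> lt r y m" by blast
      then have mh: "op q m \<in> E h" using H[OF q m(1)] by blast
      have "lt r m k"
      proof -
        have "\<not> lt r k m" using mh H[OF q m(1)] k by blast
        moreover have "m \<noteq> k" using mh k q by blast
        ultimately show ?thesis using wo_total[OF K m(1) k(1)] by blast
      qed
      then show "\<exists>b\<in>E (Ini K r k). op q b \<in> E h" using mh m(1) KV kV by auto
    next
      fix q q' b assume b: "q \<in> E Q" "q' \<in> E Q" "b \<in> E (Ini K r k)" "op q b \<in> E h" "op q' b \<in> E h"
      have "b \<in> E K" using b(3) KV kV by simp
      then show "q = q'" using inj[OF b(1,2) _ b(4,5)] by blast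
    qed (use KV kV Q in auto)
    then show ?thesis using k by blast
  qed
qed

lemma wo_pull:
  assumes K: "wo K r" and S: "S \<in> V" and f: "f \<in> V" "\<forall>x\<in>E S. ap M f x \<in> E K"
    "\<forall>x\<in>E S. \<forall>y\<in>E S. ap M f x = ap M f y \<longrightarrow> x = y"
  shows "\<exists>s. wo S s \<and> (\<forall>x\<in>E S. \<forall>y\<in>E S. lt s x y \<longleftrightarrow> lt r (ap M f x) (ap M f y))"
proof -
  note KV = wo_V[OF K]
  have SS: "cprod M S S \<in> V" using E_cprod S by auto
  define s where "s = Sep M (cprod M S S) (\<lambda>z. lt r (ap M f (fs M z)) (ap M f (sn M z)))"
  have sV: "s \<in> V" and sE: "E s = {z \<in> E (cprod M S S). lt r (ap M f (fs M z)) (ap M f (sn M z))}"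
    unfolding s_def by (rule Sep_V E_Sep, rule SS, intro dfns KV f)+
  have lt: "lt s x y \<longleftrightarrow> lt r (ap M f x) (ap M f y)" if "x \<in> E S" "y \<in> E S" for x y
    using that E_V[OF that(1)] E_V[OF that(2)] S unfolding lt_def[of s] sE by auto
  have "wo S s" unfolding wo_def wf_on_def
  proof (intro conjI ballI impI S sV)
    fix x y z assume a: "x \<in> E S" "y \<in> E S" "z \<in> E S" "lt s x y" "lt s y z"
    have "lt r (ap M f x) (ap M f z)"
      by (rule wf_trans[OF wo_wf[OF K], of _ "ap M f y"]) (use a lt f(2) in auto)
    then show "lt s x z" using lt a by blast
  next
    fix x y assume a: "x \<in> E S" "y \<in> E S"
    then have "lt r (ap M f x) (ap M f y) \<or> ap M f x = ap M f y \<or> lt r (ap M f y) (ap M f x)"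
      using wo_total[OF K] f(2) by blast
    then show "lt s x y \<or> x = y \<or> lt s y x" using lt a f(3) by blast
  next
    fix T assume T: "T \<in> V" "E T \<subseteq> E S" "E T \<noteq> {}"
    then obtain p where p: "p \<in> E T" by blast
    have "dfn M (\<lambda>e. \<exists>p\<in>E T. e 0 = ap M f p)" by (intro dfns T(1) f)
    from wf_least[OF wo_wf[OF K] this, of "ap M f p"]
    obtain q where q: "\<exists>p\<in>E T. q = ap M f p" "\<forall>y\<in>E K. (\<exists>p\<in>E T. y = ap M f p) \<longrightarrow> \<not> lt r y q"
      using p f(2) T by blast
    then show "\<exists>x\<in>E T. \<forall>y\<in>E T. \<not> lt s y x" using lt T f(2) by (metis subsetD)
  qed
  then show ?thesis using lt by blast
qed

text \<open>Cardinals are well-orders that do not inject into a proper initial segment, and a set is infinite if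
  some well-order without maximum injects into it.\<close>

definition init :: "'a \<Rightarrow> 'a \<Rightarrow> bool" where
  "init K r \<longleftrightarrow> wo K r \<and> (\<forall>k\<in>E K. \<not> card_le M K (Ini K r k))"

definition nomax :: "'a \<Rightarrow> 'a \<Rightarrow> bool" where
  "nomax K r \<longleftrightarrow> (\<exists>x\<in>E K. True) \<and> (\<forall>x\<in>E K. \<exists>y\<in>E K. lt r x y)"

definition infi :: "'a \<Rightarrow> bool" where
  "infi S \<longleftrightarrow> (\<exists>K\<in>V. \<exists>r\<in>V. wo K r \<and> nomax K r \<and> card_le M K S)"

lemma dfn_nomax [dfns]: "dft M K \<Longrightarrow> dft M r \<Longrightarrow> dfn M (\<lambda>e. nomax (K e) (r e))"
  by (rule dfn2_subst) (unfold nomax_def, intro dfns)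

lemma dfn_infi [dfns]: "dft M S \<Longrightarrow> dfn M (\<lambda>e. infi (S e))"
  by (rule dfn_subst[where Q="\<lambda>x e. infi x"], assumption) (unfold infi_def, intro dfns)

text \<open>Take the least \<open>k\<close> such that \<open>S\<close> injects into the segment
  below \<open>k\<close> and pull the order back along this injection \<open>f\<close>. A proper
  segment of the new order goes into the segment below some \<open>f x\<close>, which is too small
  because \<open>f x\<close> precedes \<open>k\<close>.\<close>

lemma ex_init:
  assumes S: "S \<in> V" shows "\<exists>r. init S r"
proof -
  obtain r where r: "wo S r" using zermelo[OF S] by blast
  note rV = wo_V(2)[OF r]
  show ?thesis
  proof (cases "\<forall>k\<in>E S. \<not> card_le M S (Ini S r k)")
    case True then show ?thesis using r unfolding init_def by blast
  next
    case False
    then obtain k0 where k0: "k0 \<in> E S" "card_le M S (Ini S r k0)" by blast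
    have "dfn M (\<lambda>e. card_le M S (Ini S r (e 0)))" by (intro dfns S rV)
    from wo_least[OF r this k0] obtain k where k: "k \<in> E S" "card_le M S (Ini S r k)"
      "\<And>y. y \<in> E S \<Longrightarrow> lt r y k \<Longrightarrow> \<not> card_le M S (Ini S r y)" by blast
    have kV: "k \<in> V" using k E_V by blast
    obtain f where f: "f \<in> V" "f \<in> funs M S" "\<forall>x\<in>E S. ap M f x \<in> E (Ini S r k)"
      "\<forall>x\<in>E S. \<forall>y\<in>E S. ap M f x = ap M f y \<longrightarrow> x = y" using k(2) by (rule card_leE)
    have f': "\<forall>x\<in>E S. ap M f x \<in> E S \<and> lt r (ap M f x) k" using f(3) S rV kV by simp
    obtain s where s: "wo S s" "\<forall>x\<in>E S. \<forall>y\<in>E S. lt s x y \<longleftrightarrow> lt r (ap M f x) (ap M f y)"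
      using wo_pull[OF r S f(1) _ f(4)] f' by blast
    have "\<not> card_le M S (Ini S s x)" if x: "x \<in> E S" for x
    proof
      assume "card_le M S (Ini S s x)"
      moreover have xV: "x \<in> V" using x E_V by blast
      moreover have "card_le M (Ini S s x) (Ini S r (ap M f x))"
      proof (rule card_leI[where t="\<lambda>y. ap M f y"])
        show "dft M (\<lambda>e. ap M f (e 0))" by (intro dfns f)
      qed (use S wo_V(2)[OF s(1)] xV ap_V rV f' f(4) s(2) x in auto)
      ultimately have "card_le M S (Ini S r (ap M f x))" using card_le_trans S by blast
      then show False using k(3) f' x by blast
    qed
    then show ?thesis using s(1) unfolding init_def by blast
  qed
qed

text \<open>Well-foundedness of cardinality for definable properties. Witnesses are measured by the
  initial segments of a well-order of \<open>S0\<close> into which they inject; a witness for the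
  least possible segment is minimal by \<open>compar\<close>.\<close>

lemma min_card:
  assumes D: "dfn M (\<lambda>e. P (e 0))" and S0: "S0 \<in> V" "P S0"
  shows "\<exists>S\<in>V. P S \<and> (\<forall>S'\<in>V. P S' \<longrightarrow> card_le M S S')"
proof -
  obtain r where r: "wo S0 r" using zermelo[OF S0(1)] by blast
  note rV = wo_V(2)[OF r]
  have D': "dfn M (\<lambda>e. P (e i))" for i using dfn_ren[OF D, of "\<lambda>_. i"] .
  show ?thesis
  proof (cases "\<exists>k\<in>E S0. \<exists>S\<in>V. P S \<and> card_le M S (Ini S0 r k)")
    case False
    then show ?thesis using compar[OF r] S0 by blast
  next
    case True
    then obtain k0 where k0: "k0 \<in> E S0" "\<exists>S\<in>V. P S \<and> card_le M S (Ini S0 r k0)" by blast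
    have "dfn M (\<lambda>e. \<exists>S\<in>V. P S \<and> card_le M S (Ini S0 r (e 0)))" by (intro dfns S0 rV D')
    from wo_least[OF r this k0] obtain k where k: "k \<in> E S0" "\<exists>S\<in>V. P S \<and> card_le M S (Ini S0 r k)"
      "\<And>y. y \<in> E S0 \<Longrightarrow> lt r y k \<Longrightarrow> \<not> (\<exists>S\<in>V. P S \<and> card_le M S (Ini S0 r y))" by blast
    have kV: "k \<in> V" using k E_V by blast
    obtain S where S: "S \<in> V" "P S" "card_le M S (Ini S0 r k)" using k by blast
    have I: "Ini S0 r k \<in> V" "E (Ini S0 r k) = {y \<in> E S0. lt r y k}" using S0 rV kV by auto
    have w: "wo (Ini S0 r k) r" by (rule wo_sub[OF r]) (use I in auto)
    have "card_le M S S'" if S': "S' \<in> V" "P S'" for S'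
      using compar[OF w S'(1)]
    proof
      assume "card_le M (Ini S0 r k) S'" then show ?thesis using S card_le_trans by blast
    next
      assume "\<exists>j\<in>E (Ini S0 r k). card_le M S' (Ini (Ini S0 r k) r j)"
      then obtain j where j: "j \<in> E S0" "lt r j k" "card_le M S' (Ini (Ini S0 r k) r j)" using I by auto
      have jV: "j \<in> V" using j E_V by blast
      have "card_le M (Ini (Ini S0 r k) r j) (Ini S0 r j)"
        by (rule card_le_subset) (use I jV rV S0 in auto)
      then have "card_le M S' (Ini S0 r j)" using j card_le_trans S' by blast
      then show ?thesis using k(3)[OF j(1,2)] S' by blast
    qed
    then show ?thesis using S by blast
  qed
qed

end

section \<open>Cardinal arithmetic\<close>

context zfc
begin

lemma cantor:
  assumes K: "K \<in> V" shows "\<not> card_le M (Pw K) K"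
proof
  assume "card_le M (Pw K) K"
  then obtain f where f: "f \<in> V" "f \<in> funs M (Pw K)" "\<forall>A\<in>E (Pw K). ap M f A \<in> E K"
    "\<forall>A\<in>E (Pw K). \<forall>B\<in>E (Pw K). ap M f A = ap M f B \<longrightarrow> A = B" by (rule card_leE)
  \<comment> \<open>The diagonal is taken over codes: \<open>k\<close> enters when it codes a set
    that omits \<open>k\<close>.\<close>
  define N where "N = Sep M K (\<lambda>k. \<exists>A\<in>E (Pw K). ap M f A = k \<and> k \<notin> E A)"
  have N: "N \<in> V" "E N = {k \<in> E K. \<exists>A\<in>E (Pw K). ap M f A = k \<and> k \<notin> E A}"
    unfolding N_def by (rule Sep_V E_Sep, rule K, intro dfns K Pw_V f)+
  have NP: "N \<in> E (Pw K)" using N E_Pw[OF K] by auto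
  show False
  proof (cases "ap M f N \<in> E N")
    case True
    then obtain A where "A \<in> E (Pw K)" "ap M f A = ap M f N" "ap M f N \<notin> E A" unfolding N(2) by blast
    moreover from this have "A = N" using f(4) NP by blast
    ultimately show False using True by blast
  next
    case False
    moreover have "ap M f N \<in> E N" using N(2) f(3) NP False by auto
    ultimately show False by blast
  qed
qed

text \<open>Choice of one injection for each of the fibres at once, the step of a union bound that
  uses the axiom of choice.\<close>

lemma inj_family:
  assumes V: "J \<in> V" "T \<in> V" "I \<in> V"
    and R: "dfn M (\<lambda>e. R (e 0) (e 1))"
    and small: "\<And>s. s \<in> E I \<Longrightarrow> card_le M (Sep M T (R s)) J"
  shows "\<exists>j\<in>V. \<forall>s\<in>E I. (\<forall>x\<in>E T. R s x \<longrightarrow> ap M (ap M j s) x \<in> E J) \<and>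
    (\<forall>x\<in>E T. \<forall>y\<in>E T. R s x \<longrightarrow> R s y \<longrightarrow> ap M (ap M j s) x = ap M (ap M j s) y \<longrightarrow> x = y)"
proof -
  have R': "dfn M (\<lambda>e. R (e i) (e j))" for i j by (rule dfn2_subst[OF R]) (intro dfns)+
  have Rs: "dfn M (\<lambda>e. R s (e 0))" if "s \<in> V" for s
    by (rule dfn2_subst[OF R]) (intro dfns that)+
  have RT: "Sep M T (R s) \<in> V" "E (Sep M T (R s)) = {x \<in> E T. R s x}" if "s \<in> V" for s
    by (rule Sep_V E_Sep, rule V, rule Rs[OF that])+
  define Q where "Q = (\<lambda>s i. (\<forall>x\<in>E T. R s x \<longrightarrow> ap M i x \<in> E J) \<and>
    (\<forall>x\<in>E T. \<forall>y\<in>E T. R s x \<longrightarrow> R s y \<longrightarrow> ap M i x = ap M i y \<longrightarrow> x = y))"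
  have dQ: "dfn M (\<lambda>e. Q (e 0) (e 1))" unfolding Q_def by (intro dfns V R')
  \<comment> \<open>Injections of the fibres are graphs inside \<open>T\<close> times
    \<open>J\<close>, so \<open>choice\<close> may select them from a single set.\<close>
  let ?B = "Pw (cprod M T J)"
  have B: "cprod M T J \<in> V" "?B \<in> V" using V E_cprod by auto
  have "\<exists>i\<in>E ?B. Q s i" if s: "s \<in> E I" for s
  proof -
    have sV: "s \<in> V" using s E_V by blast
    obtain i where i: "i \<in> V" "i \<in> funs M (Sep M T (R s))" "\<forall>x\<in>E (Sep M T (R s)). ap M i x \<in> E J"
      "\<forall>x\<in>E (Sep M T (R s)). \<forall>y\<in>E (Sep M T (R s)). ap M i x = ap M i y \<longrightarrow> x = y"
      using small[OF s] by (rule card_leE)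
    have "E i \<subseteq> E (cprod M T J)"
    proof
      fix p assume p: "p \<in> E i"
      then obtain x y where xy: "x \<in> E (Sep M T (R s))" "y \<in> V" "p = op x y" using i(2) unfolding funs_def by blast
      then have "y = ap M i x" using app_in(3)[OF i(2)] ap_app[OF i(2)] p by metis
      then show "p \<in> E (cprod M T J)" using xy i(3) RT[OF sV] V E_V[OF xy(1)] by auto
    qed
    then have "i \<in> E ?B" using i(1) E_Pw[OF B(1)] by blast
    moreover have "Q s i" unfolding Q_def using i(3,4) RT[OF sV] by auto
    ultimately show ?thesis by blast
  qed
  from choice[OF V(3) B(2) dQ this]
  obtain j where j: "j \<in> funs M I" "\<forall>s\<in>E I. ap M j s \<in> E ?B \<and> Q s (ap M j s)" by blast
  then show ?thesis using funs_V unfolding Q_def by blast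
qed

text \<open>Each \<open>x\<close> is coded by the index of a chosen fibre containing it and by its
  code inside that fibre; the pair is then absorbed by the assumption on the square of
  \<open>J\<close>.\<close>

lemma union_card:
  assumes V: "J \<in> V" "T \<in> V" "I \<in> V" and JJ: "card_le M (cprod M J J) J" and IJ: "card_le M I J"
    and R: "dfn M (\<lambda>e. R (e 0) (e 1))"
    and cov: "\<And>x. x \<in> E T \<Longrightarrow> \<exists>s\<in>E I. R s x"
    and small: "\<And>s. s \<in> E I \<Longrightarrow> card_le M (Sep M T (R s)) J"
  shows "card_le M T J"
proof -
  have "dfn M (\<lambda>e. R (e 1) (e 0))" by (rule dfn2_subst[OF R]) (intro dfns)+
  from choice[OF V(2,3) this cov]
  obtain c where c: "c \<in> funs M T" "\<forall>x\<in>E T. ap M c x \<in> E I \<and> R (ap M c x) x" by blast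
  obtain j where jV: "j \<in> V" and j: "\<forall>s\<in>E I. (\<forall>x\<in>E T. R s x \<longrightarrow> ap M (ap M j s) x \<in> E J) \<and>
    (\<forall>x\<in>E T. \<forall>y\<in>E T. R s x \<longrightarrow> R s y \<longrightarrow> ap M (ap M j s) x = ap M (ap M j s) y \<longrightarrow> x = y)"
    using inj_family[OF V R small] by blast
  have "card_le M T (cprod M I J)"
  proof (rule card_leI[where t="\<lambda>x. op (ap M c x) (ap M (ap M j (ap M c x)) x)"])
    show "dft M (\<lambda>e. op (ap M c (e 0)) (ap M (ap M j (ap M c (e 0))) (e 0)))"
      by (intro dfns funs_V[OF c(1)] jV)
    fix x assume x: "x \<in> E T"
    have xV: "x \<in> V" using x E_V by blast
    have cx: "ap M c x \<in> E I" "R (ap M c x) x" using c x by auto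
    then show "op (ap M c x) (ap M (ap M j (ap M c x)) x) \<in> E (cprod M I J)"
      using j V ap_V[OF xV] x by auto
    fix y assume y: "y \<in> E T" and eq: "op (ap M c x) (ap M (ap M j (ap M c x)) x) = op (ap M c y) (ap M (ap M j (ap M c y)) y)"
    have yV: "y \<in> V" using y E_V by blast
    have cc: "ap M c x = ap M c y" "ap M (ap M j (ap M c x)) x = ap M (ap M j (ap M c y)) y"
      using eq ap_V[OF xV] ap_V[OF yV] by auto
    have "R (ap M c x) y" using c y cc by simp
    then show "x = y" using j cx cc x y by auto
  qed (rule V)
  moreover have "card_le M J J" by (rule card_le_subset) (use V in auto)
  ultimately show ?thesis
    using card_le_trans[OF _ card_le_trans[OF card_le_cprod[OF IJ] JJ]] V E_cprod by blast
qed

text \<open>The additional element \<open>m\<close> goes to \<open>(b, a)\<close>, the others go to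
  pairs with first coordinate \<open>a\<close>. Combined with a bound for the square of
  \<open>I\<close>, this absorbs one more element.\<close>

lemma add_one:
  assumes V: "I \<in> V" "I' \<in> V" "L \<in> V" and le: "card_le M I' I" and ab: "a \<in> E I" "b \<in> E I" "a \<noteq> b"
    and sub: "E L \<subseteq> insert m (E I')" and m: "m \<in> V"
  shows "card_le M L (cprod M I I)"
proof -
  obtain f where f: "f \<in> V" "f \<in> funs M I'" "\<forall>x\<in>E I'. ap M f x \<in> E I"
    "\<forall>x\<in>E I'. \<forall>y\<in>E I'. ap M f x = ap M f y \<longrightarrow> x = y" using le by (rule card_leE)
  have abV: "a \<in> V" "b \<in> V" using ab E_V by auto
  show ?thesis
  proof (rule card_leI[where t="\<lambda>x. if x = m then op b a else op a (ap M f x)"])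
    show "dft M (\<lambda>e. if e 0 = m then op b a else op a (ap M f (e 0)))" by (intro dfns m f op_V abV)
    fix x assume x: "x \<in> E L"
    have xV: "x \<in> V" using x E_V by blast
    show "(if x = m then op b a else op a (ap M f x)) \<in> E (cprod M I I)"
      using x sub f(3) V ab abV ap_V[OF xV] by auto
    fix y assume y: "y \<in> E L" and eq: "(if x = m then op b a else op a (ap M f x)) = (if y = m then op b a else op a (ap M f y))"
    have yV: "y \<in> V" using y E_V by blast
    show "x = y"
    proof (cases "x = m \<or> y = m")
      case True then show ?thesis using eq ab(3) abV ap_V[OF xV] ap_V[OF yV] by (auto split: if_splits)
    next
      case False
      then have "x \<in> E I'" "y \<in> E I'" "ap M f x = ap M f y"
        using eq x y sub abV ap_V[OF xV] ap_V[OF yV] by auto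
      then show ?thesis using f(4) by blast
    qed
  qed (rule V)
qed

section \<open>Infinite sets and the set of natural numbers of the model\<close>

lemma infi_mono: "infi S \<Longrightarrow> card_le M S T \<Longrightarrow> infi T"
  unfolding infi_def using card_le_trans by blast

lemma infi_two:
  assumes "infi S" obtains a b where "a \<in> E S" "b \<in> E S" "a \<noteq> b"
proof -
  obtain K r where K: "K \<in> V" "r \<in> V" "wo K r" "nomax K r" "card_le M K S" using assms unfolding infi_def by blast
  obtain f where f: "f \<in> V" "f \<in> funs M K" "\<forall>x\<in>E K. ap M f x \<in> E S"
    "\<forall>x\<in>E K. \<forall>y\<in>E K. ap M f x = ap M f y \<longrightarrow> x = y" using K(5) by (rule card_leE)
  obtain x y where "x \<in> E K" "y \<in> E K" "lt r x y" using K(4) unfolding nomax_def by blast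
  moreover from this have "x \<noteq> y" using wf_irrefl[OF wo_wf[OF K(3)]] by blast
  ultimately show thesis using that[of "ap M f x" "ap M f y"] f(3,4) by blast
qed

lemma is_inductive_iff: "is_inductive M I \<longleftrightarrow> I \<in> V \<and> (\<exists>x\<in>E I. \<forall>z\<in>E x. False) \<and>
     (\<forall>x\<in>E I. \<exists>y\<in>E I. \<forall>z\<in>V. z \<in> E y \<longleftrightarrow> z = x \<or> z \<in> E x)"
proof -
  have "E y = insert x (E x) \<longleftrightarrow> (\<forall>z\<in>V. z \<in> E y \<longleftrightarrow> z = x \<or> z \<in> E x)" if "x \<in> E I" for x y
    using that E_V by blast
  then show ?thesis unfolding is_inductive_def by auto
qed

lemma dfn_is_inductive: "dfn M (\<lambda>e. is_inductive M (e i))"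
proof -
  have "dfn M (\<lambda>e. (\<exists>x\<in>E (e i). \<forall>z\<in>E x. False) \<and>
     (\<forall>x\<in>E (e i). \<exists>y\<in>E (e i). \<forall>z\<in>V. z \<in> E y \<longleftrightarrow> z = x \<or> z \<in> E x))" by (intro dfns)
  then show ?thesis by (rule dfn_cong) (use envsD in \<open>auto simp: is_inductive_iff\<close>)
qed

lemma omega_props:
  shows "omega M \<in> V" "is_inductive M (omega M)" "is_inductive M I \<Longrightarrow> E (omega M) \<subseteq> E I"
proof -
  obtain I0 where I0: "is_inductive M I0" using ZFC unfolding ZFC_def by blast
  then have V0: "I0 \<in> V" by (simp add: is_inductive_def)
  \<comment> \<open>Relative to one inductive set \<open>I0\<close> the intersection of all
    inductive sets becomes a separation.\<close>
  have eq: "{n \<in> V. \<forall>I. is_inductive M I \<longrightarrow> n \<in> E I} = {n \<in> E I0. \<forall>I\<in>V. is_inductive M I \<longrightarrow> n \<in> E I}"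
    using I0 E_V unfolding is_inductive_iff by blast
  have "isset M {n \<in> E I0. \<forall>I\<in>V. is_inductive M I \<longrightarrow> n \<in> E I}"
    by (rule isset_sep[OF V0]) (intro dfns dfn_is_inductive)
  then have om: "omega M \<in> V" "E (omega M) = {n \<in> V. \<forall>I. is_inductive M I \<longrightarrow> n \<in> E I}"
    unfolding omega_def eq[symmetric] by (rule the_set_V E_the_set)+
  show "omega M \<in> V" by (rule om)
  show sub: "E (omega M) \<subseteq> E I" if "is_inductive M I" for I using that om by blast
  have "\<exists>x\<in>E (omega M). E x = {}"
  proof -
    obtain x where x: "x \<in> E I0" "E x = {}" using I0 unfolding is_inductive_def by blast
    have "x \<in> E I" if iI: "is_inductive M I" for I
    proof -
      obtain x' where "x' \<in> E I" "E x' = {}" using iI unfolding is_inductive_def by blast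
      moreover from this have "x' = x" using x ext E_V by metis
      ultimately show ?thesis by simp
    qed
    then show ?thesis using x om E_V by blast
  qed
  moreover have "\<exists>y\<in>E (omega M). E y = insert x (E x)" if xo: "x \<in> E (omega M)" for x
  proof -
    obtain y where y: "y \<in> E I0" "E y = insert x (E x)" using I0 sub[OF I0] xo unfolding is_inductive_def by blast
    have "y \<in> E I" if iI: "is_inductive M I" for I
    proof -
      obtain y' where "y' \<in> E I" "E y' = insert x (E x)" using iI sub[OF iI] xo unfolding is_inductive_def by blast
      moreover from this have "y' = y" using y ext E_V by metis
      ultimately show ?thesis by simp
    qed
    then show ?thesis using y om E_V by blast
  qed
  ultimately show "is_inductive M (omega M)" using om unfolding is_inductive_def by blast
qed

lemma omega_le:
  assumes K: "wo K r" "nomax K r" shows "card_le M (omega M) K"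
proof -
  \<comment> \<open>the Mostowski collapse of \<open>K\<close>, as a relation \<open>h\<close>, takes every element of \<open>omega\<close> as a value\<close>
  let ?w = "omega M"
  note KV = wo_V[OF K(1)] note oV = omega_props(1)
  define F where "F = (\<lambda>(k::'a) n B. \<forall>z\<in>V. z \<in> E n \<longleftrightarrow> (\<exists>j\<in>E K. op j z \<in> E B))"
  have dF: "dfn M (\<lambda>e. F (e 0) (e 1) (e 2))" unfolding F_def by (intro dfns KV)
  from rel_recursion[OF wo_wf[OF K(1)] oV dF]
  obtain h where h: "h \<in> V" "\<And>k n. k \<in> E K \<Longrightarrow> n \<in> E ?w \<Longrightarrow> op k n \<in> E h \<longleftrightarrow>
     (\<exists>B\<in>V. E B = {p \<in> E h. p \<in> E (cprod M K ?w) \<and> lt r (fs M p) k} \<and> F k n B)" by blast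
  have H: "op k n \<in> E h \<longleftrightarrow> (\<forall>z\<in>V. z \<in> E n \<longleftrightarrow> (\<exists>j\<in>E K. lt r j k \<and> z \<in> E ?w \<and> op j z \<in> E h))"
    if k: "k \<in> E K" and n: "n \<in> E ?w" for k n
  proof -
    have "isset M {p \<in> E h. p \<in> E (cprod M K ?w) \<and> lt r (fs M p) k}"
      by (rule isset_sep, rule h, intro dfns KV oV E_V[OF k])
    then obtain B where B: "B \<in> V" "E B = {p \<in> E h. p \<in> E (cprod M K ?w) \<and> lt r (fs M p) k}" unfolding isset_def by blast
    have "op j z \<in> E B \<longleftrightarrow> lt r j k \<and> z \<in> E ?w \<and> op j z \<in> E h" if "j \<in> E K" "z \<in> V" for j z
      using that E_V[OF that(1)] KV oV unfolding B(2) by auto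
    then have "F k n B \<longleftrightarrow> (\<forall>z\<in>V. z \<in> E n \<longleftrightarrow> (\<exists>j\<in>E K. lt r j k \<and> z \<in> E ?w \<and> op j z \<in> E h))"
      unfolding F_def by auto
    moreover have "(\<exists>B\<in>V. E B = {p \<in> E h. p \<in> E (cprod M K ?w) \<and> lt r (fs M p) k} \<and> F k n B) \<longleftrightarrow> F k n B"
      using B ext by metis
    ultimately show ?thesis using h(2)[OF k n] by simp
  qed
  have hfun: "n = n'" if a: "k \<in> E K" "n \<in> E ?w" "n' \<in> E ?w" "op k n \<in> E h" "op k n' \<in> E h" for k n n'
  proof (rule ext)
    show "E n = E n'" using H[OF a(1,2)] H[OF a(1,3)] a(4,5) E_V by blast
  qed (use a E_V in auto)
  define I where "I = Sep M ?w (\<lambda>n. \<exists>k\<in>E K. op k n \<in> E h)"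
  have I: "I \<in> V" "E I = {n \<in> E ?w. \<exists>k\<in>E K. op k n \<in> E h}"
    unfolding I_def by (rule Sep_V E_Sep, rule oV, intro dfns KV h)+
  have "is_inductive M I" unfolding is_inductive_def
  proof (intro conjI ballI I(1))
    obtain z where z: "z \<in> E ?w" "E z = {}" using omega_props(2) unfolding is_inductive_def by blast
    obtain k0 where "k0 \<in> E K" using K(2) unfolding nomax_def by blast
    from wf_least[OF wo_wf[OF K(1)] dfn_bool this, of True]
    obtain k where k: "k \<in> E K" "\<forall>j\<in>E K. \<not> lt r j k" by blast
    have "op k z \<in> E h" unfolding H[OF k(1) z(1)] using z k by blast
    then show "\<exists>e\<in>E I. E e = {}" using I k z by blast
  next
    fix n assume n: "n \<in> E I"
    then obtain k where k: "k \<in> E K" "op k n \<in> E h" "n \<in> E ?w" using I by blast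
    have nV: "n \<in> V" and kV: "k \<in> V" using k E_V by auto
    obtain y where y: "y \<in> E ?w" "E y = insert n (E n)" using omega_props(2) k(3) unfolding is_inductive_def by blast
    obtain k1 where k1: "k1 \<in> E K" "lt r k k1" using K(2) k(1) unfolding nomax_def by blast
    have "dfn M (\<lambda>e. lt r k (e 0))" by (intro dfns KV kV)
    from wf_least[OF wo_wf[OF K(1)] this k1]
    \<comment> \<open>\<open>k'\<close> is the immediate successor of \<open>k\<close>, so its
      collapse adds exactly the value \<open>n\<close> to the elements of \<open>n\<close>.\<close>
    obtain k' where k': "k' \<in> E K" "lt r k k'" "\<forall>j\<in>E K. lt r k j \<longrightarrow> \<not> lt r j k'" by blast
    have low: "lt r j k' \<longleftrightarrow> lt r j k \<or> j = k" if "j \<in> E K" for j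
      using k' wo_total[OF K(1) that k(1)] wf_trans[OF wo_wf[OF K(1)], of j k k'] that k(1) by blast
    have "op k' y \<in> E h" unfolding H[OF k'(1) y(1)]
    proof
      fix z assume zV: "z \<in> V"
      have n1: "z \<in> E n \<longleftrightarrow> (\<exists>j\<in>E K. lt r j k \<and> z \<in> E ?w \<and> op j z \<in> E h)"
        using H[OF k(1,3)] k(2) zV by blast
      have n2: "z = n \<longleftrightarrow> z \<in> E ?w \<and> op k z \<in> E h" using k hfun[OF k(1) _ k(3) _ k(2)] by blast
      show "z \<in> E y \<longleftrightarrow> (\<exists>j\<in>E K. lt r j k' \<and> z \<in> E ?w \<and> op j z \<in> E h)"
        unfolding y(2) insert_iff n1 using n2 low k(1) by blast
    qed
    then show "\<exists>y\<in>E I. E y = insert n (E n)" using I y k'(1) by blast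
  qed
  then have all: "E ?w \<subseteq> E I" by (rule omega_props(3))
  show ?thesis
  proof (rule card_le_rel[where Q="\<lambda>n k. op k n \<in> E h"])
    show "dfn M (\<lambda>e. op (e 1) (e 0) \<in> E h)" by (intro dfns h)
    show "\<exists>b\<in>E K. op b a \<in> E h" if "a \<in> E ?w" for a using that all I by blast
  qed (use oV KV hfun in auto)
qed

lemma infi_omega: "infi S \<Longrightarrow> card_le M (omega M) S"
  unfolding infi_def using omega_le card_le_trans omega_props(1) by blast

text \<open>Here smallness means injecting into a proper initial segment. For \<open>init\<close>
  orders this is, by \<open>compar\<close>, the same as not being injected into by
  \<open>K\<close>.\<close>

definition reg :: "'a \<Rightarrow> 'a \<Rightarrow> bool" where
  "reg K r \<longleftrightarrow> (\<forall>k\<in>E K. \<forall>S\<in>V. E S \<subseteq> E K \<longrightarrow> card_le M S (Ini K r k) \<longrightarrow> (\<exists>b\<in>E K. \<forall>s\<in>E S. lt r s b))"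

lemma upper2:
  assumes K: "wo K r" "nomax K r" and x: "x \<in> E K" "y \<in> E K"
  obtains z where "z \<in> E K" "lt r x z" "lt r y z"
proof -
  obtain x' y' where z: "x' \<in> E K" "lt r x x'" "y' \<in> E K" "lt r y y'" using K(2) x unfolding nomax_def by meson
  consider "lt r x' y'" | "x' = y'" | "lt r y' x'" using wo_total[OF K(1) z(1,3)] by blast
  then show thesis
  proof cases
    case 1 then show ?thesis using that[of y'] z wf_trans[OF wo_wf[OF K(1)] z(2) 1] x by blast
  next
    case 2 then show ?thesis using that[of y'] z by blast
  next
    case 3 then show ?thesis using that[of x'] z wf_trans[OF wo_wf[OF K(1)] z(4) 3] x by blast
  qed
qed

text \<open>At a least failure \<open>k\<close>, the segment below \<open>k\<close> is nonempty and
  not infinite, so it has a maximum \<open>m\<close>. Dropping the one point of \<open>S\<close>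
  sent to \<open>m\<close> leaves a set injecting below \<open>m\<close>, which is bounded by
  minimality of \<open>k\<close>; the dropped point is then dominated as well.\<close>

lemma reg_omega:
  assumes K: "wo K r" "nomax K r" and fin: "\<And>k. k \<in> E K \<Longrightarrow> \<not> infi (Ini K r k)"
  shows "reg K r"
proof (rule ccontr)
  note KV = wo_V[OF K(1)]
  define P where "P = (\<lambda>k. \<exists>S\<in>V. E S \<subseteq> E K \<and> card_le M S (Ini K r k) \<and> \<not> (\<exists>b\<in>E K. \<forall>s\<in>E S. lt r s b))"
  have dP: "dfn M (\<lambda>e. P (e 0))" unfolding P_def by (intro dfns KV)
  assume "\<not> reg K r"
  then obtain k0 where "k0 \<in> E K" "P k0" unfolding reg_def P_def by blast
  from wf_least[OF wo_wf[OF K(1)] dP this] obtain k where k: "k \<in> E K" "P k" "\<forall>j\<in>E K. P j \<longrightarrow> \<not> lt r j k" by blast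
  have kV: "k \<in> V" using k E_V by blast
  obtain S where S: "S \<in> V" "E S \<subseteq> E K" "card_le M S (Ini K r k)" "\<not> (\<exists>b\<in>E K. \<forall>s\<in>E S. lt r s b)"
    using k(2) unfolding P_def by blast
  let ?I = "Ini K r k"
  have I: "?I \<in> V" "E ?I = {j \<in> E K. lt r j k}" using KV kV by auto
  obtain i where i: "i \<in> V" "i \<in> funs M S" "\<forall>x\<in>E S. ap M i x \<in> E ?I"
    "\<forall>x\<in>E S. \<forall>y\<in>E S. ap M i x = ap M i y \<longrightarrow> x = y" using S(3) by (rule card_leE)
  have "E ?I \<noteq> {}"
  proof
    assume "E ?I = {}"
    then have "E S = {}" using i(3) by auto
    then show False using S(4) k(1) by blast
  qed
  moreover have "\<not> nomax ?I r"
  proof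
    assume "nomax ?I r"
    moreover have "wo ?I r" by (rule wo_sub[OF K(1)]) (use I in auto)
    moreover have "card_le M ?I ?I" by (rule card_le_subset) (use I in auto)
    ultimately show False using fin[OF k(1)] I(1) KV unfolding infi_def by blast
  qed
  ultimately obtain m where m: "m \<in> E ?I" "\<forall>j\<in>E ?I. \<not> lt r m j" unfolding nomax_def by blast
  have mK: "m \<in> E K" "lt r m k" "m \<in> V" using m(1) I E_V by auto
  define S' where "S' = Sep M S (\<lambda>x. ap M i x \<noteq> m)"
  have S': "S' \<in> V" "E S' = {x \<in> E S. ap M i x \<noteq> m}"
    unfolding S'_def by (rule Sep_V E_Sep, rule S(1), intro dfns i mK)+
  have "card_le M S' (Ini K r m)"
  proof (rule card_leI[where t="\<lambda>x. ap M i x"])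
    show "dft M (\<lambda>e. ap M i (e 0))" by (intro dfns i)
    fix x assume x: "x \<in> E S'"
    then have "ap M i x \<in> E ?I" "ap M i x \<noteq> m" using S' i by auto
    then have "lt r (ap M i x) m" using m(2) wo_total[OF K(1), of "ap M i x" m] mK(1) I by auto
    then show "ap M i x \<in> E (Ini K r m)" using \<open>ap M i x \<in> E ?I\<close> I KV mK by simp
  qed (use S' i in auto)
  moreover have "\<not> P m" using k(3) mK by blast
  ultimately obtain b where b: "b \<in> E K" "\<forall>s\<in>E S'. lt r s b"
    using S' S(2) unfolding P_def by blast
  show False
  proof (cases "\<exists>t\<in>E S. ap M i t = m")
    case False
    then have "\<forall>s\<in>E S. lt r s b" using b S' by auto
    then show False using S(4) b(1) by blast
  next
    case True
    then obtain t where t: "t \<in> E S" "ap M i t = m" by blast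
    obtain c where c: "c \<in> E K" "lt r b c" "lt r t c" using upper2[OF K b(1)] t(1) S(2) by blast
    have "lt r s c" if s: "s \<in> E S" for s
    proof (cases "s = t")
      case False
      then have "s \<in> E S'" using s t i(4) S' by auto
      then show ?thesis using b wf_trans[OF wo_wf[OF K(1)], of s b c] c s S(2) by blast
    qed (use c in simp)
    then show False using S(4) c(1) by blast
  qed
qed

text \<open>An unbounded subset of size at most \<open>J\<close> would cover \<open>K\<close> by
  that many initial segments, each of size at most \<open>J\<close>, and \<open>union_card\<close>
  would make \<open>K\<close> too small.\<close>

lemma reg_succ:
  assumes K: "wo K r" "nomax K r" and J: "J \<in> V" "card_le M (cprod M J J) J"
    and small: "\<And>k. k \<in> E K \<Longrightarrow> card_le M (Ini K r k) J" and big: "\<not> card_le M K J"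
  shows "reg K r"
  unfolding reg_def
proof (intro ballI impI; rule ccontr)
  note KV = wo_V[OF K(1)]
  fix k S assume k: "k \<in> E K" and S: "S \<in> V" "E S \<subseteq> E K" "card_le M S (Ini K r k)"
    and nb: "\<not> (\<exists>b\<in>E K. \<forall>s\<in>E S. lt r s b)"
  have "card_le M K J"
  proof (rule union_card[where I=S and R="\<lambda>s x. lt r x s"])
    show "card_le M S J" using card_le_trans S small[OF k] by blast
    show "dfn M (\<lambda>e. lt r (e 1) (e 0))" by (intro dfns KV)
    fix x assume x: "x \<in> E K"
    obtain b where b: "b \<in> E K" "lt r x b" using K(2) x unfolding nomax_def by blast
    then obtain s where s: "s \<in> E S" "\<not> lt r s b" using nb by blast
    then have "s = b \<or> lt r b s" using wo_total[OF K(1), of s b] b S(2) by blast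
    then show "\<exists>s\<in>E S. lt r x s" using s b wf_trans[OF wo_wf[OF K(1)] b(2), of s] x S(2) by blast
  next
    fix s assume s: "s \<in> E S"
    have "Sep M K (\<lambda>x. lt r x s) = Ini K r s" by (simp add: Ini_def)
    then show "card_le M (Sep M K (\<lambda>x. lt r x s)) J" using small s S(2) by auto
  qed (use J KV S in auto)
  then show False using big by blast
qed

text \<open>The points sent into one row of the square inject into the segment, so regularity bounds
  each row. There are equally few rows, so their bounds have a common bound \<open>b\<close>; but
  \<open>b\<close> itself is sent into some row. In \<open>hessenberg\<close> this settles the case
  in which all initial segments are finite.\<close>

lemma reg_pigeon:
  assumes K: "wo K r" "nomax K r" "reg K r" and k: "k \<in> E K"
  shows "\<not> card_le M K (cprod M (Ini K r k) (Ini K r k))"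
proof
  note KV = wo_V[OF K(1)]
  have kV: "k \<in> V" using k E_V by blast
  let ?I = "Ini K r k"
  have I: "?I \<in> V" using KV kV by simp
  assume "card_le M K (cprod M ?I ?I)"
  then obtain i where i: "i \<in> V" "i \<in> funs M K" "\<forall>x\<in>E K. ap M i x \<in> E (cprod M ?I ?I)"
    "\<forall>x\<in>E K. \<forall>y\<in>E K. ap M i x = ap M i y \<longrightarrow> x = y" by (rule card_leE)
  have i1: "fs M (ap M i x) \<in> E ?I \<and> sn M (ap M i x) \<in> E ?I \<and> op (fs M (ap M i x)) (sn M (ap M i x)) = ap M i x"
    if x: "x \<in> E K" for x
  proof -
    have "ap M i x \<in> E (cprod M ?I ?I)" using i x by blast
    then show ?thesis by (rule cprodE) (use I in auto)
  qed
  define B where "B = (\<lambda>a t. (\<forall>s\<in>E K. fs M (ap M i s) = a \<longrightarrow> lt r s t))"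
  have dB: "dft M u \<Longrightarrow> dft M v \<Longrightarrow> dfn M (\<lambda>e. B (u e) (v e))" for u v
    by (rule dfn2_subst) (unfold B_def, intro dfns KV i)
  \<comment> \<open>\<open>L a t\<close>: \<open>t\<close> is the least strict upper bound of the
    points sent to row \<open>a\<close>.\<close>
  define L where "L = (\<lambda>a t. B a t \<and> (\<forall>t'\<in>E K. lt r t' t \<longrightarrow> \<not> B a t'))"
  have dL: "dfn M (\<lambda>e. L (e 0) (e 1))"
    unfolding L_def by (intro dfns KV dB)
  have dL': "dfn M (\<lambda>e. L (e 1) (e 0))" "dfn M (\<lambda>e. L (e 0) (e (Suc 0)))"
    by (rule dfn2_subst[OF dL], (intro dfns)+)+
  have exB: "\<exists>t\<in>E K. L a t" if a: "a \<in> E ?I" for a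
  proof -
    have aV: "a \<in> V" using a E_V by blast
    define S where "S = Sep M K (\<lambda>s. fs M (ap M i s) = a)"
    have S: "S \<in> V" "E S = {s \<in> E K. fs M (ap M i s) = a}"
      unfolding S_def by (rule Sep_V E_Sep, rule KV, intro dfns i aV)+
    have "card_le M S ?I"
    proof (rule card_leI[where t="\<lambda>s. sn M (ap M i s)"])
      show "dft M (\<lambda>e. sn M (ap M i (e 0)))" by (intro dfns i)
      show "sn M (ap M i x) \<in> E ?I" if "x \<in> E S" for x using i1 that S by blast
      fix x y assume xy: "x \<in> E S" "y \<in> E S" "sn M (ap M i x) = sn M (ap M i y)"
      have "ap M i x = op a (sn M (ap M i x))" using xy(1) i1[of x] S by auto
      moreover have "ap M i y = op a (sn M (ap M i y))" using xy(2) i1[of y] S by auto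
      ultimately have "ap M i x = ap M i y" using xy(3) by simp
      then show "x = y" using i(4) xy S by auto
    qed (rule S)
    then obtain b where b: "b \<in> E K" "\<forall>s\<in>E S. lt r s b" using K(3) k S unfolding reg_def by blast
    then have "B a b" unfolding B_def using S by auto
    have "dfn M (\<lambda>e. B a (e 0))" by (intro dB dfns aV)
    from wf_least[OF wo_wf[OF K(1)] this b(1)] \<open>B a b\<close> show ?thesis unfolding L_def by blast
  qed
  have uniq: "t = t'" if "t \<in> E K" "t' \<in> E K" "L a t" "L a t'" for a t t'
    using wo_total[OF K(1) that(1,2)] that unfolding L_def by blast
  define T where "T = Sep M K (\<lambda>t. \<exists>a\<in>E ?I. L a t)"
  have T: "T \<in> V" "E T = {t \<in> E K. \<exists>a\<in>E ?I. L a t}"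
    unfolding T_def by (rule Sep_V E_Sep, rule KV, intro dfns I dL')+
  have "card_le M T ?I"
    by (rule card_le_rel[where Q="\<lambda>t a. L a t"]) (use T I dL' uniq in auto)
  then obtain b where b: "b \<in> E K" "\<forall>t\<in>E T. lt r t b" using K(3) k T unfolding reg_def by blast
  obtain t where t: "t \<in> E K" "L (fs M (ap M i b)) t" using exB i1[OF b(1)] by blast
  then have "lt r b t" using b(1) unfolding L_def B_def by blast
  moreover have "lt r t b" using b(2) T t i1[OF b(1)] by blast
  ultimately show False using wo_asym[OF K(1) b(1) t(1)] by blast
qed

text \<open>Goedel's order of pairs: compare maxima, then first, then second coordinates. Its use
  lies in the last clause: all predecessors of a pair live in the square bounded by the larger
  coordinate of that pair.\<close>

lemma goedel_order:
  assumes S: "wo S r"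
  shows "\<exists>g. wo (cprod M S S) g \<and> (\<forall>p\<in>E (cprod M S S). \<forall>q\<in>E (cprod M S S). lt g p q \<longrightarrow>
     (\<exists>m\<in>E S. (m = fs M q \<or> m = sn M q) \<and> \<not> lt r m (fs M p) \<and> \<not> lt r m (sn M p)))"
proof -
  note SV = wo_V[OF S]
  let ?P = "cprod M S S"
  have PV: "?P \<in> V" "cprod M ?P ?P \<in> V" using E_cprod SV by auto
  define mx where "mx = (\<lambda>p. if lt r (fs M p) (sn M p) then sn M p else fs M p)"
  have dmx: "dft M t \<Longrightarrow> dft M (\<lambda>e. mx (t e))" for t
    by (rule dft1_subst) (unfold mx_def, intro dfns SV)
  have comp: "fs M p \<in> E S" "sn M p \<in> E S" "op (fs M p) (sn M p) = p" "mx p \<in> E S"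
    "\<not> lt r (mx p) (fs M p)" "\<not> lt r (mx p) (sn M p)" "mx p = fs M p \<or> mx p = sn M p" if "p \<in> E ?P" for p
  proof -
    obtain x y where p: "p = op x y" "x \<in> E S" "y \<in> E S" "x \<in> V" "y \<in> V" using \<open>p \<in> E ?P\<close> by (rule cprodE) (rule SV)+
    show "fs M p \<in> E S" "sn M p \<in> E S" "op (fs M p) (sn M p) = p" "mx p \<in> E S" "mx p = fs M p \<or> mx p = sn M p"
      unfolding mx_def using p by auto
    show "\<not> lt r (mx p) (fs M p)" "\<not> lt r (mx p) (sn M p)"
      unfolding mx_def using p wo_asym[OF S] wf_irrefl[OF wo_wf[OF S]] by auto
  qed
  define L where "L = (\<lambda>p q. lt r (mx p) (mx q) \<or> (mx p = mx q \<and> (lt r (fs M p) (fs M q) \<or>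
     (fs M p = fs M q \<and> lt r (sn M p) (sn M q)))))"
  have dL: "dft M s \<Longrightarrow> dft M t \<Longrightarrow> dfn M (\<lambda>e. L (s e) (t e))" for s t
    by (rule dfn2_subst) (unfold L_def, intro dfns dmx SV)
  define g where "g = Sep M (cprod M ?P ?P) (\<lambda>z. L (fs M z) (sn M z))"
  have g: "g \<in> V" "E g = {z \<in> E (cprod M ?P ?P). L (fs M z) (sn M z)}"
    unfolding g_def by (rule Sep_V E_Sep, rule PV, intro dfns dL)+
  have lt: "lt g p q \<longleftrightarrow> L p q" if "p \<in> E ?P" "q \<in> E ?P" for p q
    using that E_V[OF that(1)] E_V[OF that(2)] PV unfolding lt_def[of g] g(2) by auto
  note tr = wf_trans[OF wo_wf[OF S]]
  have "wo ?P g" unfolding wo_def wf_on_def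
  proof (intro conjI ballI impI PV g(1))
    fix x y z assume a: "x \<in> E ?P" "y \<in> E ?P" "z \<in> E ?P" "lt g x y" "lt g y z"
    have L: "L x y" "L y z" using a lt by auto
    have "L x z"
      using L tr[of "mx x" "mx y" "mx z"] tr[of "fs M x" "fs M y" "fs M z"] tr[of "sn M x" "sn M y" "sn M z"]
        comp[OF a(1)] comp[OF a(2)] comp[OF a(3)] unfolding L_def by metis
    then show "lt g x z" using lt a by blast
  next
    fix p q assume a: "p \<in> E ?P" "q \<in> E ?P"
    have "L p q \<or> p = q \<or> L q p"
      using wo_total[OF S comp(4)[OF a(1)] comp(4)[OF a(2)]] wo_total[OF S comp(1)[OF a(1)] comp(1)[OF a(2)]]
        wo_total[OF S comp(2)[OF a(1)] comp(2)[OF a(2)]] comp(3)[OF a(1)] comp(3)[OF a(2)] unfolding L_def by metis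
    then show "lt g p q \<or> p = q \<or> lt g q p" using lt a by blast
  next
    fix T assume T: "T \<in> V" "E T \<subseteq> E ?P" "E T \<noteq> {}"
    have least: "\<exists>p\<in>E T. Q p \<and> (\<forall>q\<in>E T. Q q \<longrightarrow> \<not> lt r (k q) (k p))"
      if d: "dfn M (\<lambda>e. Q (e 0))" "dft M (\<lambda>e. k (e 0))" and p: "p \<in> E T" "Q p"
        and kS: "\<And>p. p \<in> E ?P \<Longrightarrow> k p \<in> E S" for Q k p
    proof -
      have dQ: "dfn M (\<lambda>e. Q (e i))" for i using dfn_ren[OF d(1), of "\<lambda>_. i"] .
      have dk: "dft M (\<lambda>e. k (e i))" for i using dft_ren[OF d(2), of "\<lambda>_. i"] .
      have "dfn M (\<lambda>e. \<exists>p\<in>E T. Q p \<and> e 0 = k p)" by (intro dfns T dQ dk)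
      from wf_least[OF wo_wf[OF S] this, of "k p"] show ?thesis using p kS T(2) by blast
    qed
    obtain p0 where "p0 \<in> E T" using T(3) by blast
    from least[of "\<lambda>_. True" mx, OF dfn_bool dmx[OF dft_var[OF envs_ne]] this] comp(4)
    obtain p where p: "p \<in> E T" "\<forall>q\<in>E T. \<not> lt r (mx q) (mx p)" by auto
    have pV: "p \<in> V" using p E_V by blast
    have "dfn M (\<lambda>e. mx (e 0) = mx p)" by (intro dfns dmx pV)
    from least[of "\<lambda>q. mx q = mx p" "fs M", OF this dft_fs[OF dft_var[OF envs_ne]] p(1)] comp(1)
    obtain p' where p': "p' \<in> E T" "mx p' = mx p" "\<forall>q\<in>E T. mx q = mx p \<longrightarrow> \<not> lt r (fs M q) (fs M p')" by auto
    have pV': "p' \<in> V" using p' E_V by blast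
    have "dfn M (\<lambda>e. mx (e 0) = mx p \<and> fs M (e 0) = fs M p')" by (intro dfns dmx pV pV')
    from least[of "\<lambda>q. mx q = mx p \<and> fs M q = fs M p'" "sn M", OF this dft_sn[OF dft_var[OF envs_ne]] p'(1)] comp(2) p'(2)
    obtain p'' where p'': "p'' \<in> E T" "mx p'' = mx p" "fs M p'' = fs M p'"
       "\<forall>q\<in>E T. mx q = mx p \<and> fs M q = fs M p' \<longrightarrow> \<not> lt r (sn M q) (sn M p'')" by auto
    have "\<not> L q p''" if q: "q \<in> E T" for q
      using p(2) p'(3) p''(2-4) q unfolding L_def by metis
    then show "\<exists>x\<in>E T. \<forall>y\<in>E T. \<not> lt g y x" using p''(1) lt T(2) by blast
  qed
  moreover have "\<exists>m\<in>E S. (m = fs M q \<or> m = sn M q) \<and> \<not> lt r m (fs M p) \<and> \<not> lt r m (sn M p)"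
    if a: "p \<in> E ?P" "q \<in> E ?P" "lt g p q" for p q
  proof (intro bexI[of _ "mx q"] conjI)
    have "lt r (mx p) (mx q) \<or> mx p = mx q" using a lt unfolding L_def by blast
    then show "\<not> lt r (mx q) (fs M p)" "\<not> lt r (mx q) (sn M p)"
      using comp[OF a(1)] comp[OF a(2)] tr[of "mx p" "mx q" "fs M p"] tr[of "mx p" "mx q" "sn M p"] by metis+
  qed (use comp[OF a(2)] in auto)
  ultimately show ?thesis by blast
qed

text \<open>In a counterexample \<open>S\<close> of least cardinality, \<open>S\<close> injects into
  an initial segment of Goedel's order and so into the square of a proper initial segment of
  \<open>S\<close>. If that segment can be enlarged to an infinite one, minimality shrinks the
  square to the segment and contradicts initiality; if all segments are finite,
  \<open>reg_omega\<close> and \<open>reg_pigeon\<close> apply.\<close>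

theorem hessenberg:
  assumes "S0 \<in> V" "infi S0" shows "card_le M (cprod M S0 S0) S0"
proof (rule ccontr)
  assume n0: "\<not> card_le M (cprod M S0 S0) S0"
  have "dfn M (\<lambda>e. infi (e 0) \<and> \<not> card_le M (cprod M (e 0) (e 0)) (e 0))" by (intro dfns)
  from min_card[OF this assms(1)] assms(2) n0
  obtain S where S: "S \<in> V" "infi S" "\<not> card_le M (cprod M S S) S"
    and min: "\<And>T. T \<in> V \<Longrightarrow> infi T \<Longrightarrow> \<not> card_le M S T \<Longrightarrow> card_le M (cprod M T T) T" by blast
  obtain r where r: "init S r" using ex_init[OF S(1)] by blast
  then have w: "wo S r" and ini: "\<And>k. k \<in> E S \<Longrightarrow> \<not> card_le M S (Ini S r k)" unfolding init_def by auto
  note rV = wo_V(2)[OF w]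
  have I: "Ini S r k \<in> V" "E (Ini S r k) = {j \<in> E S. lt r j k}" if "k \<in> E S" for k
    using that E_V S(1) rV by auto
  have nm: "nomax S r"
  proof (rule ccontr)
    assume "\<not> nomax S r"
    moreover obtain a0 b0 where "a0 \<in> E S" using infi_two[OF S(2)] by blast
    ultimately obtain m where m: "m \<in> E S" "\<forall>y\<in>E S. \<not> lt r m y" unfolding nomax_def by blast
    have mV: "m \<in> V" using m E_V by blast
    obtain K s where K: "K \<in> V" "s \<in> V" "wo K s" "nomax K s" "card_le M K S" using S(2) unfolding infi_def by blast
    obtain f where f: "f \<in> V" "f \<in> funs M K" "\<forall>x\<in>E K. ap M f x \<in> E S"
      "\<forall>x\<in>E K. \<forall>y\<in>E K. ap M f x = ap M f y \<longrightarrow> x = y" using K(5) by (rule card_leE)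
    \<comment> \<open>At most one element of \<open>K\<close> is sent to the supposed maximum
      \<open>m\<close>. Without it \<open>K\<close> still has no maximum, so the segment below
      \<open>m\<close> is infinite, and it can absorb \<open>m\<close> by
      \<open>add_one\<close>.\<close>
    define K' where "K' = Sep M K (\<lambda>q. ap M f q \<noteq> m)"
    have K': "K' \<in> V" "E K' = {q \<in> E K. ap M f q \<noteq> m}"
      unfolding K'_def by (rule Sep_V E_Sep, rule K, intro dfns f mV)+
    have up: "\<exists>z\<in>E K'. lt s x z" if x: "x \<in> E K" for x
    proof -
      obtain y where y: "y \<in> E K" "lt s x y" using K(4) x unfolding nomax_def by blast
      show ?thesis
      proof (cases "ap M f y = m")
        case False then show ?thesis using y K' by auto
      next
        case True
        obtain z where z: "z \<in> E K" "lt s y z" using K(4) y unfolding nomax_def by blast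
        then have "z \<noteq> y" using wf_irrefl[OF wo_wf[OF K(3)]] by blast
        then have "ap M f z \<noteq> m" using True f(4) z y by metis
        then show ?thesis using z K' wf_trans[OF wo_wf[OF K(3)] y(2) z(2)] x y by auto
      qed
    qed
    have "infi (Ini S r m)" unfolding infi_def
    proof (intro bexI conjI)
      show "wo K' s" by (rule wo_sub[OF K(3)]) (use K' in auto)
      show "nomax K' s" unfolding nomax_def using up K' K(4) unfolding nomax_def by blast
      show "card_le M K' (Ini S r m)"
      proof (rule card_leI[where t="\<lambda>x. ap M f x"])
        show "dft M (\<lambda>e. ap M f (e 0))" by (intro dfns f)
        show "ap M f x \<in> E (Ini S r m)" if "x \<in> E K'" for x
          using that K' f(3) I(2)[OF m(1)] wo_total[OF w, of "ap M f x" m] m by auto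
      qed (use K' f(4) in auto)
    qed (use K K' in auto)
    then have mm: "card_le M (cprod M (Ini S r m) (Ini S r m)) (Ini S r m)"
      using min[OF I(1)[OF m(1)]] ini[OF m(1)] by blast
    obtain a b where ab: "a \<in> E (Ini S r m)" "b \<in> E (Ini S r m)" "a \<noteq> b"
      using infi_two[OF \<open>infi (Ini S r m)\<close>] by blast
    have "card_le M S (cprod M (Ini S r m) (Ini S r m))"
    proof (rule add_one[OF I(1)[OF m(1)] I(1)[OF m(1)] S(1) _ ab _ mV])
      show "card_le M (Ini S r m) (Ini S r m)" by (rule card_le_subset) (use I[OF m(1)] in auto)
      show "E S \<subseteq> insert m (E (Ini S r m))" using I(2)[OF m(1)] wo_total[OF w _ m(1)] m(2) by blast
    qed
    then show False using card_le_trans[OF _ mm S(1)] ini[OF m(1)] by blast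
  qed
  obtain g where g: "wo (cprod M S S) g" and gl: "\<forall>p\<in>E (cprod M S S). \<forall>q\<in>E (cprod M S S). lt g p q \<longrightarrow>
     (\<exists>m\<in>E S. (m = fs M q \<or> m = sn M q) \<and> \<not> lt r m (fs M p) \<and> \<not> lt r m (sn M p))"
    using goedel_order[OF w] by blast
  obtain p where p: "p \<in> E (cprod M S S)" "card_le M S (Ini (cprod M S S) g p)"
    using compar[OF g S(1)] S(3) by blast
  have pc: "fs M q \<in> E S \<and> sn M q \<in> E S \<and> q = op (fs M q) (sn M q)" if q: "q \<in> E (cprod M S S)" for q
    using q by (rule cprodE) (use S in auto)
  obtain m where m: "m \<in> E S" "lt r (fs M p) m" "lt r (sn M p) m" using upper2[OF w nm] pc[OF p(1)] by blast
  have SS: "cprod M S S \<in> V" using E_cprod S by auto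
  have gV: "g \<in> V" using wo_V[OF g] by blast
  have pV: "p \<in> V" using p E_V by blast
  \<comment> \<open>Stated for every \<open>m'\<close> from \<open>m\<close> upwards, because the
    second case below needs to move to an infinite segment.\<close>
  have main: "card_le M S (cprod M (Ini S r m') (Ini S r m'))" if m': "m' \<in> E S" "m' = m \<or> lt r m m'" for m'
  proof -
    have J: "Ini (cprod M S S) g p \<in> V" "E (Ini (cprod M S S) g p) = {q \<in> E (cprod M S S). lt g q p}"
      using SS gV pV by auto
    have "E (Ini (cprod M S S) g p) \<subseteq> E (cprod M (Ini S r m') (Ini S r m'))"
    proof
      fix q assume "q \<in> E (Ini (cprod M S S) g p)"
      then have q: "q \<in> E (cprod M S S)" "lt g q p" using J by auto
      then obtain n where n: "n \<in> E S" "n = fs M p \<or> n = sn M p" "\<not> lt r n (fs M q)" "\<not> lt r n (sn M q)"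
        using gl p(1) by blast
      have nm': "lt r n m'" using n m m' wf_trans[OF wo_wf[OF w], of n m m'] by blast
      have "lt r z m'" if "z \<in> E S" "\<not> lt r n z" for z
        using wo_total[OF w n(1) that(1)] that(2) nm' wf_trans[OF wo_wf[OF w], of z n m'] n(1) m'(1) that(1) by blast
      then have "fs M q \<in> E (Ini S r m')" "sn M q \<in> E (Ini S r m')"
        using pc[OF q(1)] n(3,4) I(2)[OF m'(1)] by auto
      moreover from this have "fs M q \<in> V" "sn M q \<in> V" using E_V by auto
      ultimately show "q \<in> E (cprod M (Ini S r m') (Ini S r m'))"
        using pc[OF q(1)] op_cprod[OF I(1)[OF m'(1)] I(1)[OF m'(1)], of "fs M q" "sn M q"] by auto
    qed
    then have "card_le M (Ini (cprod M S S) g p) (cprod M (Ini S r m') (Ini S r m'))"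
      using card_le_subset J(1) by blast
    then show ?thesis using card_le_trans[OF p(2)] S(1) by blast
  qed
  show False
  proof (cases "\<exists>m0\<in>E S. infi (Ini S r m0)")
    case False
    then have "reg S r" using reg_omega[OF w nm] by blast
    then show False using reg_pigeon[OF w nm _ m(1)] main[OF m(1)] by blast
  next
    case True
    then obtain m0 where m0: "m0 \<in> E S" "infi (Ini S r m0)" by blast
    obtain m' where m': "m' \<in> E S" "lt r m0 m'" "lt r m m'" using upper2[OF w nm m0(1) m(1)] by blast
    have "card_le M (Ini S r m0) (Ini S r m')"
    proof (rule card_le_subset)
      show "E (Ini S r m0) \<subseteq> E (Ini S r m')"
        using I(2)[OF m0(1)] I(2)[OF m'(1)] wf_trans[OF wo_wf[OF w] _ m'(2) _ m0(1) m'(1)] by auto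
    qed (rule I[OF m0(1)])
    then have "infi (Ini S r m')" using infi_mono m0 by blast
    then have "card_le M (cprod M (Ini S r m') (Ini S r m')) (Ini S r m')"
      using min[OF I(1)[OF m'(1)]] ini[OF m'(1)] by blast
    then show False using card_le_trans[OF main[OF m'(1)]] m'(3) ini[OF m'(1)] S(1) by blast
  qed
qed

end

section \<open>Ultrafilter quantifiers and liar sets\<close>

context zfc
begin

abbreviation "uf \<equiv> is_ultrafilter M"

section \<open>Laws of the ultrafilter quantifier\<close>

lemma al_iff:
  assumes "X \<in> V" "dfn M (\<lambda>e. P (e 0))"
  shows "almost M U X P \<longleftrightarrow> Sep M X P \<in> E U"
  unfolding almost_def large_iff
  using Sep_V[OF assms] E_Sep[OF assms] ext E_V by metis

lemma al_cong: "(\<And>x. x \<in> E X \<Longrightarrow> P x = Q x) \<Longrightarrow> almost M U X P = almost M U X Q"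
  unfolding almost_def by (metis (mono_tags, lifting) Collect_cong)

lemma uf_V: "uf X U \<Longrightarrow> X \<in> V" "uf X U \<Longrightarrow> U \<in> V"
  by (auto simp: is_ultrafilter_def is_filter_def)

lemma al_mono:
  assumes u: "uf X U" and al: "almost M U X P" and Q: "dfn M (\<lambda>e. Q (e 0))"
    and PQ: "\<And>x. x \<in> E X \<Longrightarrow> P x \<Longrightarrow> Q x"
  shows "almost M U X Q"
proof -
  note X = uf_V(1)[OF u]
  obtain A where A: "A \<in> E U" "E A = {x \<in> E X. P x}" using al unfolding almost_def large_iff by blast
  have "E A \<subseteq> E (Sep M X Q)" "E (Sep M X Q) \<subseteq> E X" using A PQ E_Sep[OF X Q] by auto
  then have "Sep M X Q \<in> E U" using u A Sep_V[OF X Q] unfolding is_ultrafilter_def is_filter_def by blast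
  then show ?thesis using al_iff[OF X Q] by blast
qed

lemma al_conj:
  assumes u: "uf X U" and d: "dfn M (\<lambda>e. P (e 0))" "dfn M (\<lambda>e. Q (e 0))"
  shows "almost M U X (\<lambda>x. P x \<and> Q x) \<longleftrightarrow> almost M U X P \<and> almost M U X Q"
proof
  assume "almost M U X (\<lambda>x. P x \<and> Q x)"
  then show "almost M U X P \<and> almost M U X Q" using al_mono[OF u _ d(1)] al_mono[OF u _ d(2)] by blast
next
  note X = uf_V(1)[OF u]
  have d': "dfn M (\<lambda>e. P (e 0) \<and> Q (e 0))" by (intro dfns d)
  assume "almost M U X P \<and> almost M U X Q"
  then have "Sep M X P \<in> E U" "Sep M X Q \<in> E U" using al_iff X d by blast+
  moreover have "E (Sep M X (\<lambda>x. P x \<and> Q x)) = E (Sep M X P) \<inter> E (Sep M X Q)" 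
    using E_Sep[OF X d(1)] E_Sep[OF X d(2)] E_Sep[OF X d'] by auto
  moreover have "Sep M X (\<lambda>x. P x \<and> Q x) \<in> V" by (rule Sep_V[OF X d'])
  ultimately have "Sep M X (\<lambda>x. P x \<and> Q x) \<in> E U"
    using u unfolding is_ultrafilter_def is_filter_def by blast
  then show "almost M U X (\<lambda>x. P x \<and> Q x)" using al_iff[OF X d'] by blast
qed

lemma al_ex:
  assumes u: "uf X U" and "almost M U X P" obtains x where "x \<in> E X" "P x"
proof -
  obtain A where "A \<in> E U" "E A = {x \<in> E X. P x}" using assms(2) unfolding almost_def large_iff by blast
  moreover from this have "E A \<noteq> {}" using u unfolding is_ultrafilter_def is_filter_def by blast
  ultimately show thesis using that by blast
qed

lemma al_not:
  assumes u: "uf X U" and d: "dfn M (\<lambda>e. P (e 0))"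
  shows "almost M U X (\<lambda>x. \<not> P x) \<longleftrightarrow> \<not> almost M U X P"
proof -
  note X = uf_V(1)[OF u]
  have d': "dfn M (\<lambda>e. \<not> P (e 0))" by (intro dfns d)
  have "\<not> (almost M U X P \<and> almost M U X (\<lambda>x. \<not> P x))"
    unfolding al_conj[OF u d d', symmetric] using al_ex[OF u] by blast
  moreover have "almost M U X P \<or> almost M U X (\<lambda>x. \<not> P x)"
  proof -
    have "E (Sep M X (\<lambda>x. \<not> P x)) = E X - E (Sep M X P)" "E (Sep M X P) \<subseteq> E X"
      using E_Sep[OF X d] E_Sep[OF X d'] by auto
    then have "Sep M X P \<in> E U \<or> Sep M X (\<lambda>x. \<not> P x) \<in> E U"
      using u Sep_V[OF X d] Sep_V[OF X d'] unfolding is_ultrafilter_def by blast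
    then show ?thesis using al_iff[OF X d] al_iff[OF X d'] by blast
  qed
  ultimately show ?thesis by blast
qed

lemma al_all: assumes u: "uf X U" and "\<And>x. x \<in> E X \<Longrightarrow> P x" shows "almost M U X P"
proof -
  have "X \<in> E U" using u unfolding is_ultrafilter_def is_filter_def by blast
  moreover have "{x \<in> E X. P x} = E X" using assms(2) by auto
  ultimately show ?thesis unfolding almost_def large_iff by auto
qed

lemma al_const: assumes u: "uf X U" shows "almost M U X (\<lambda>_. b) \<longleftrightarrow> b"
proof (cases b)
  case True then show ?thesis using al_all[OF u, of "\<lambda>_. b"] by simp
next
  case False
  then have "\<not> almost M U X (\<lambda>_. b)" using al_ex[OF u, of "\<lambda>_. b" False] by blast
  then show ?thesis using False by simp
qed

lemma al_cong_al:
  assumes u: "uf X U" and al: "almost M U X R" and d: "dfn M (\<lambda>e. R (e 0))" "dfn M (\<lambda>e. P (e 0))" "dfn M (\<lambda>e. Q (e 0))"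
    and eq: "\<And>x. x \<in> E X \<Longrightarrow> R x \<Longrightarrow> P x = Q x"
  shows "almost M U X P \<longleftrightarrow> almost M U X Q"
proof
  assume "almost M U X P"
  then have "almost M U X (\<lambda>x. R x \<and> P x)" using al al_conj[OF u d(1,2)] by blast
  then show "almost M U X Q" by (rule al_mono[OF u _ d(3)]) (use eq in blast)
next
  assume "almost M U X Q"
  then have "almost M U X (\<lambda>x. R x \<and> Q x)" using al al_conj[OF u d(1,3)] by blast
  then show "almost M U X P" by (rule al_mono[OF u _ d(2)]) (use eq in blast)
qed

lemma al_mem:
  assumes u: "uf X U" and A: "A \<in> V" "E A \<subseteq> E X"
  shows "almost M U X (\<lambda>x. x \<in> E A) \<longleftrightarrow> A \<in> E U"
proof -
  have d: "dfn M (\<lambda>e. e 0 \<in> E A)" by (intro dfns A)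
  have "E (Sep M X (\<lambda>x. x \<in> E A)) = E A" using E_Sep[OF uf_V(1)[OF u] d] A(2) by auto
  then have "Sep M X (\<lambda>x. x \<in> E A) = A" using ext[OF Sep_V[OF uf_V(1)[OF u] d] A(1)] by blast
  then show ?thesis using al_iff[OF uf_V(1)[OF u] d] by simp
qed

lemma uf_sub: "uf X U \<Longrightarrow> A \<in> E U \<Longrightarrow> E A \<subseteq> E X"
  unfolding is_ultrafilter_def is_filter_def by blast

text \<open>\<open>capw X U Y W u\<close>: the ultrafilters \<open>u(y)\<close>, for \<open>y\<close> in \<open>Y\<close>, represent in \<open>M_W\<close> an ultrafilter
  whose ultrapower is \<open>j_U\<close> restricted to \<open>M_W\<close>.  This is the combinatorial content of the internal
  relation: the sum of the \<open>u(y)\<close> along \<open>W\<close> is the tensor product of \<open>U\<close> and \<open>W\<close>.\<close>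

definition capw :: "'a \<Rightarrow> 'a \<Rightarrow> 'a \<Rightarrow> 'a \<Rightarrow> 'a \<Rightarrow> bool" where
  "capw X U Y W u \<longleftrightarrow> (\<forall>R\<in>V. almost M U X (\<lambda>x. almost M W Y (\<lambda>y. op x y \<in> E R)) \<longleftrightarrow>
     almost M W Y (\<lambda>y. almost M (ap M u y) X (\<lambda>x. op x y \<in> E R)))"

lemma dfn_capw:
  assumes d: "dft M X" "dft M U" "dft M Y" "dft M W" "dft M u"
  shows "dfn M (\<lambda>e. capw (X e) (U e) (Y e) (W e) (u e))"
  unfolding capw_def
  by (intro dfns d[THEN dft_ren])

text \<open>\<open>capw\<close> speaks only of relations that are elements of the model, which keeps
  it first-order; a definable relation is cut down to such an element on the product of
  \<open>X\<close> and \<open>Y\<close>.\<close>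

lemma capwD:
  assumes c: "capw X U Y W u" and V: "X \<in> V" "Y \<in> V" and Q: "dfn M (\<lambda>e. Q (e 0) (e 1))"
  shows "almost M U X (\<lambda>x. almost M W Y (Q x)) \<longleftrightarrow> almost M W Y (\<lambda>y. almost M (ap M u y) X (\<lambda>x. Q x y))"
proof -
  have XY: "cprod M X Y \<in> V" using E_cprod V by blast
  define R where "R = Sep M (cprod M X Y) (\<lambda>p. Q (fs M p) (sn M p))"
  have dR: "dfn M (\<lambda>e. Q (fs M (e 0)) (sn M (e 0)))" by (rule dfn2_subst[OF Q]) (intro dfns)+
  have R: "R \<in> V" "E R = {p \<in> E (cprod M X Y). Q (fs M p) (sn M p)}"
    unfolding R_def by (rule Sep_V E_Sep, rule XY, rule dR)+
  have mem: "op x y \<in> E R \<longleftrightarrow> Q x y" if "x \<in> E X" "y \<in> E Y" for x y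
    using that E_V[OF that(1)] E_V[OF that(2)] V unfolding R(2) by auto
  have "almost M U X (\<lambda>x. almost M W Y (Q x)) \<longleftrightarrow> almost M U X (\<lambda>x. almost M W Y (\<lambda>y. op x y \<in> E R))"
    by (intro al_cong) (simp add: mem)
  also have "\<dots> \<longleftrightarrow> almost M W Y (\<lambda>y. almost M (ap M u y) X (\<lambda>x. op x y \<in> E R))"
    using c R(1) unfolding capw_def by blast
  also have "\<dots> \<longleftrightarrow> almost M W Y (\<lambda>y. almost M (ap M u y) X (\<lambda>x. Q x y))"
    by (intro al_cong) (simp add: mem)
  finally show ?thesis .
qed

text \<open>The liar set contains \<open>x\<close> iff, for \<open>w(x)\<close>-almost all \<open>y\<close>, its part below \<open>h(y) < x\<close> is not in \<open>u(y)\<close>.\<close>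

lemma liar:
  assumes u: "uf X U" "uf Y W" and V: "u \<in> V" "w \<in> V" "h \<in> V"
    and cu: "capw X U Y W u" and cw: "capw Y W X U w"
    and r: "wo X r" and h: "\<And>y. y \<in> E Y \<Longrightarrow> ap M h y \<in> E X"
    and unbU: "\<And>k. k \<in> E X \<Longrightarrow> almost M U X (\<lambda>x. lt r k x)"
    and unbW: "\<And>k. k \<in> E X \<Longrightarrow> almost M W Y (\<lambda>y. lt r k (ap M h y))"
  shows False
proof -
  note UV = uf_V[OF u(1)] and WV = uf_V[OF u(2)] and rV = wo_V(2)[OF r]
  \<comment> \<open>The condition that \<open>h(y)\<close> is below \<open>x\<close> makes the
    recursion legitimate: only the part of \<open>A\<close> below \<open>h(y)\<close>, hence below
    \<open>x\<close>, is consulted.\<close>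
  define F where "F = (\<lambda>x A. almost M (ap M w x) Y (\<lambda>y. lt r (ap M h y) x \<and>
     \<not> almost M (ap M u y) X (\<lambda>x'. x' \<in> E A \<and> lt r x' (ap M h y))))"
  have dF: "dfn M (\<lambda>e. F (e 0) (e 1))" unfolding F_def by (intro dfns V UV WV rV)
  from set_recursion[OF wo_wf[OF r] dF]
  obtain A where A: "A \<in> V" "E A \<subseteq> E X" "\<forall>x\<in>E X. x \<in> E A \<longleftrightarrow> F x (Sep M A (\<lambda>y. lt r y x))" by blast
  define S where "S = (\<lambda>y. \<not> almost M (ap M u y) X (\<lambda>x'. x' \<in> E A \<and> lt r x' (ap M h y)))"
  have dS: "dfn M (\<lambda>e. S (e i))" for i unfolding S_def by (intro dfns V UV WV rV A(1))
  have Ax: "x \<in> E A \<longleftrightarrow> almost M (ap M w x) Y (\<lambda>y. lt r (ap M h y) x \<and> S y)" if x: "x \<in> E X" for x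
  proof -
    have xV: "x \<in> V" using x E_V by blast
    have B: "E (Sep M A (\<lambda>y. lt r y x)) = {y \<in> E A. lt r y x}"
      by (rule E_Sep, rule A, intro dfns rV xV)
    have "F x (Sep M A (\<lambda>y. lt r y x)) \<longleftrightarrow> almost M (ap M w x) Y (\<lambda>y. lt r (ap M h y) x \<and> S y)"
      unfolding F_def S_def
    proof (rule al_cong)
      fix y assume y: "y \<in> E Y"
      have "almost M (ap M u y) X (\<lambda>x'. x' \<in> E (Sep M A (\<lambda>y. lt r y x)) \<and> lt r x' (ap M h y)) \<longleftrightarrow>
        almost M (ap M u y) X (\<lambda>x'. x' \<in> E A \<and> lt r x' (ap M h y))" if "lt r (ap M h y) x"
        using B wf_trans[OF wo_wf[OF r] _ that] h[OF y] x A(2) by (intro al_cong) blast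
      then show "(lt r (ap M h y) x \<and> \<not> almost M (ap M u y) X (\<lambda>x'. x' \<in> E (Sep M A (\<lambda>y. lt r y x)) \<and> lt r x' (ap M h y))) \<longleftrightarrow>
        (lt r (ap M h y) x \<and> \<not> almost M (ap M u y) X (\<lambda>x'. x' \<in> E A \<and> lt r x' (ap M h y)))" by blast
    qed
    then show ?thesis using A(3) x by blast
  qed
  have "almost M U X (\<lambda>x. x \<in> E A) \<longleftrightarrow> almost M U X (\<lambda>x. almost M (ap M w x) Y (\<lambda>y. lt r (ap M h y) x \<and> S y))"
    using Ax by (rule al_cong)
  \<comment> \<open>\<open>cw\<close> read from right to left replaces the
    \<open>w(x)\<close>-quantifier by the \<open>W\<close>-quantifier and brings it outside.\<close>
  also have "\<dots> \<longleftrightarrow> almost M W Y (\<lambda>y. almost M U X (\<lambda>x. lt r (ap M h y) x \<and> S y))"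
  proof -
    have "dfn M (\<lambda>e. lt r (ap M h (e 0)) (e 1) \<and> S (e 0))" by (intro dfns V rV dS)
    from capwD[OF cw WV(1) UV(1) this] show ?thesis by blast
  qed
  \<comment> \<open>For fixed \<open>y\<close> almost all \<open>x\<close> exceed
    \<open>h(y)\<close>, and the rest of the condition does not mention \<open>x\<close>.\<close>
  also have "\<dots> \<longleftrightarrow> almost M W Y S"
  proof (rule al_cong)
    fix y assume y: "y \<in> E Y"
    have yV: "y \<in> V" using y E_V by blast
    have "almost M U X (\<lambda>x. lt r (ap M h y) x \<and> S y) \<longleftrightarrow> almost M U X (\<lambda>x. lt r (ap M h y) x) \<and> almost M U X (\<lambda>x. S y)"
      by (rule al_conj[OF u(1)]) (intro dfns V rV yV)+
    then show "almost M U X (\<lambda>x. lt r (ap M h y) x \<and> S y) \<longleftrightarrow> S y" using unbU[OF h[OF y]] al_const[OF u(1)] by blast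
  qed
  also have "\<dots> \<longleftrightarrow> \<not> almost M W Y (\<lambda>y. almost M (ap M u y) X (\<lambda>x'. x' \<in> E A \<and> lt r x' (ap M h y)))"
    unfolding S_def by (rule al_not[OF u(2)]) (intro dfns V UV WV rV A(1))
  \<comment> \<open>\<open>cu\<close> read from right to left returns the quantifier over
    \<open>x\<close> to the outside.\<close>
  also have "\<dots> \<longleftrightarrow> \<not> almost M U X (\<lambda>x. almost M W Y (\<lambda>y. x \<in> E A \<and> lt r x (ap M h y)))"
  proof -
    have "dfn M (\<lambda>e. e 0 \<in> E A \<and> lt r (e 0) (ap M h (e 1)))" by (intro dfns V rV A(1))
    from capwD[OF cu UV(1) WV(1) this] show ?thesis by blast
  qed
  \<comment> \<open>For fixed \<open>x\<close> almost all \<open>y\<close> have \<open>h(y)\<close>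
    above \<open>x\<close>, so only membership of \<open>x\<close> remains, now negated.\<close>
  also have "\<dots> \<longleftrightarrow> \<not> almost M U X (\<lambda>x. x \<in> E A)"
  proof -
    have "almost M W Y (\<lambda>y. x \<in> E A \<and> lt r x (ap M h y)) \<longleftrightarrow> x \<in> E A" if x: "x \<in> E X" for x
    proof -
      have "almost M W Y (\<lambda>y. x \<in> E A \<and> lt r x (ap M h y)) \<longleftrightarrow> almost M W Y (\<lambda>y. x \<in> E A) \<and> almost M W Y (\<lambda>y. lt r x (ap M h y))"
        by (rule al_conj[OF u(2)]) (intro dfns V rV E_V[OF x])+
      then show ?thesis using unbW[OF x] al_const[OF u(2)] by blast
    qed
    then have "almost M U X (\<lambda>x. almost M W Y (\<lambda>y. x \<in> E A \<and> lt r x (ap M h y))) = almost M U X (\<lambda>x. x \<in> E A)"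
      by (rule al_cong)
    then show ?thesis by simp
  qed
  finally show False by blast
qed

text \<open>Here the liar set contains \<open>x\<close> iff, for \<open>w(x)\<close>-almost all \<open>y\<close>, the least element with the same
  trace on \<open>Z(y)\<close> as \<open>x\<close> is below \<open>x\<close> and not in the set.\<close>

lemma liar_types:
  assumes u: "uf X U" "uf Y W" and V: "w \<in> V" "Z \<in> V"
    and cw: "capw Y W X U w" and r: "wo X r"
    and fine: "\<And>N. N \<in> E (Pw X) \<Longrightarrow> almost M W Y (\<lambda>y. N \<in> E (ap M Z y))"
    and few: "almost M W Y (\<lambda>y. almost M U X (\<lambda>x. \<exists>x'\<in>E X. lt r x' x \<and>
       (\<forall>N\<in>E (ap M Z y). x \<in> E N \<longleftrightarrow> x' \<in> E N)))"
  shows False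
proof -
  note UV = uf_V[OF u(1)] and WV = uf_V[OF u(2)] and rV = wo_V(2)[OF r]
  define tp where "tp = (\<lambda>y x x'. \<forall>N\<in>E (ap M Z y). x \<in> E N \<longleftrightarrow> x' \<in> E N)"
  have dtp: "dfn M (\<lambda>e. tp (e i) (e j) (e k))" for i j k
    unfolding tp_def by (intro dfns V)
  \<comment> \<open>\<open>x'\<close> is the least element of \<open>X\<close> with the same trace
    on \<open>Z(y)\<close> as \<open>x\<close>; being least makes it unique.\<close>
  define mt where "mt = (\<lambda>y x x'. tp y x x' \<and> (\<forall>z\<in>E X. lt r z x' \<longrightarrow> \<not> tp y x z))"
  have dmt: "dfn M (\<lambda>e. mt (e i) (e j) (e k))" for i j k
    unfolding mt_def by (intro dfns dtp UV rV)
  define F where "F = (\<lambda>x A. almost M (ap M w x) Y (\<lambda>y. \<exists>x'\<in>E X. lt r x' x \<and> mt y x x' \<and> x' \<notin> E A))"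
  have dF: "dfn M (\<lambda>e. F (e 0) (e 1))" unfolding F_def by (intro dfns V UV WV rV dmt)
  from set_recursion[OF wo_wf[OF r] dF]
  obtain A where A: "A \<in> V" "E A \<subseteq> E X" "\<forall>x\<in>E X. x \<in> E A \<longleftrightarrow> F x (Sep M A (\<lambda>y. lt r y x))" by blast
  define S where "S = (\<lambda>y x. \<exists>x'\<in>E X. lt r x' x \<and> mt y x x' \<and> x' \<notin> E A)"
  have dS: "dfn M (\<lambda>e. S (e i) (e j))" for i j unfolding S_def by (intro dfns V UV WV rV A(1) dmt)
  have Ax: "x \<in> E A \<longleftrightarrow> almost M (ap M w x) Y (\<lambda>y. S y x)" if x: "x \<in> E X" for x
  proof -
    have B: "E (Sep M A (\<lambda>y. lt r y x)) = {y \<in> E A. lt r y x}"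
      by (rule E_Sep, rule A, intro dfns rV E_V[OF x])
    have "F x (Sep M A (\<lambda>y. lt r y x)) \<longleftrightarrow> almost M (ap M w x) Y (\<lambda>y. S y x)"
      unfolding F_def S_def B by (rule al_cong) blast
    then show ?thesis using A(3) x by blast
  qed
  have "almost M U X (\<lambda>x. x \<in> E A) \<longleftrightarrow> almost M U X (\<lambda>x. almost M (ap M w x) Y (\<lambda>y. S y x))"
    using Ax by (rule al_cong)
  also have "\<dots> \<longleftrightarrow> almost M W Y (\<lambda>y. almost M U X (S y))"
    using capwD[OF cw WV(1) UV(1) dS[of 0 1]] by blast
  \<comment> \<open>By \<open>fine\<close> the liar set \<open>A\<close> belongs to
    \<open>Z(y)\<close> for almost all \<open>y\<close>, so \<open>x\<close> and its least companion
    agree about \<open>A\<close>. By \<open>few\<close> the companion is properly below almost every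
    \<open>x\<close>. Hence the clause \<open>S y x\<close> just says that \<open>x\<close> is not
    in \<open>A\<close>.\<close>
  also have "\<dots> \<longleftrightarrow> almost M W Y (\<lambda>y. almost M U X (\<lambda>x. x \<notin> E A))"
  proof (rule al_cong_al[OF u(2)])
    let ?H = "\<lambda>y. almost M U X (\<lambda>x. \<exists>x'\<in>E X. lt r x' x \<and> tp y x x')"
    have dH: "dfn M (\<lambda>e. ?H (e 0))" by (intro dfns UV rV dtp)
    have dZ: "dfn M (\<lambda>e. A \<in> E (ap M Z (e 0)))" by (intro dfns V A)
    have "A \<in> E (Pw X)" using A E_Pw UV by blast
    then have "almost M W Y (\<lambda>y. A \<in> E (ap M Z y))" by (rule fine)
    then show "almost M W Y (\<lambda>y. A \<in> E (ap M Z y) \<and> ?H y)"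
      using few al_conj[OF u(2) dZ dH] unfolding tp_def by blast
    show "dfn M (\<lambda>e. A \<in> E (ap M Z (e 0)) \<and> ?H (e 0))" by (intro dfn_conj dH dZ)
    show "dfn M (\<lambda>e. almost M U X (S (e 0)))" by (intro dfns UV dS)
    show "dfn M (\<lambda>e. almost M U X (\<lambda>x. x \<notin> E A))" by (intro dfns UV A(1))
    fix y assume y: "y \<in> E Y" and yy: "A \<in> E (ap M Z y) \<and> ?H y"
    have yV: "y \<in> V" using y E_V by blast
    have dtp': "dfn M (\<lambda>e. tp y (e i) (e j))" for i j unfolding tp_def by (intro dfns V yV)
    show "almost M U X (S y) \<longleftrightarrow> almost M U X (\<lambda>x. x \<notin> E A)"
    proof (rule al_cong_al[OF u(1) conjunct2[OF yy]])
      show "dfn M (\<lambda>e. \<exists>x'\<in>E X. lt r x' (e 0) \<and> tp y (e 0) x')" by (intro dfns UV rV dtp')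
      show "dfn M (\<lambda>e. S y (e 0))" unfolding S_def mt_def by (intro dfns UV rV A(1) dtp')
      show "dfn M (\<lambda>e. e 0 \<notin> E A)" by (intro dfns A(1))
      fix x assume x: "x \<in> E X" and ex: "\<exists>x'\<in>E X. lt r x' x \<and> tp y x x'"
      have xV: "x \<in> V" using x E_V by blast
      have d: "dfn M (\<lambda>e. lt r (e 0) x \<and> tp y x (e 0))" unfolding tp_def by (intro dfns rV V xV yV)
      from ex obtain x0 where "x0 \<in> E X" "lt r x0 x \<and> tp y x x0" by blast
      from wf_least[OF wo_wf[OF r] d this]
      obtain x' where x': "x' \<in> E X" "lt r x' x" "tp y x x'" "\<forall>z\<in>E X. lt r z x \<and> tp y x z \<longrightarrow> \<not> lt r z x'" by blast
      have m: "mt y x x'" unfolding mt_def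
        using x' wf_trans[OF wo_wf[OF r] _ x'(2) _ x'(1) x] by blast
      have uniq: "z = x'" if "z \<in> E X" "mt y x z" for z
        using wo_total[OF r that(1) x'(1)] that m x'(1) unfolding mt_def by blast
      have "x \<in> E A \<longleftrightarrow> x' \<in> E A" using x'(3) yy unfolding tp_def by blast
      moreover have "S y x \<longleftrightarrow> x' \<notin> E A" unfolding S_def using uniq x' m by blast
      ultimately show "S y x \<longleftrightarrow> x \<notin> E A" by blast
    qed
  qed
  also have "\<dots> \<longleftrightarrow> \<not> almost M U X (\<lambda>x. x \<in> E A)"
  proof -
    have "dfn M (\<lambda>e. e 0 \<in> E A)" by (intro dfns A(1))
    then show ?thesis unfolding al_const[OF u(2)] by (rule al_not[OF u(1)])
  qed
  finally show False by blast
qed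

text \<open>Points without a smaller companion have pairwise different traces on
  \<open>Z(y)\<close>. If they formed a set in \<open>U\<close>, uniformity would inject
  \<open>X\<close> into the power set of \<open>Z(y)\<close> and hence into that of
  \<open>J\<close>.\<close>

lemma few_types:
  assumes u: "uf X U" "uf Y W" and V: "Z \<in> V" "J \<in> V" and r: "wo X r"
    and unif: "\<And>A. A \<in> E U \<Longrightarrow> card_le M X A"
    and Z: "\<And>y. y \<in> E Y \<Longrightarrow> card_le M (ap M Z y) J" and big: "\<not> card_le M X (Pw J)"
  shows "almost M W Y (\<lambda>y. almost M U X (\<lambda>x. \<exists>x'\<in>E X. lt r x' x \<and>
       (\<forall>N\<in>E (ap M Z y). x \<in> E N \<longleftrightarrow> x' \<in> E N)))"
proof (rule al_all[OF u(2)], rule ccontr)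
  note UV = uf_V[OF u(1)] and WV = uf_V[OF u(2)] and rV = wo_V(2)[OF r]
  fix y assume y: "y \<in> E Y"
  have yV: "y \<in> V" using y E_V by blast
  have ZV: "ap M Z y \<in> V" by (rule ap_V[OF yV])
  let ?Q = "\<lambda>x. \<exists>x'\<in>E X. lt r x' x \<and> (\<forall>N\<in>E (ap M Z y). x \<in> E N \<longleftrightarrow> x' \<in> E N)"
  have d: "dfn M (\<lambda>e. ?Q (e 0))" by (intro dfns UV rV V yV)
  have d': "dfn M (\<lambda>e. \<not> ?Q (e 0))" by (intro dfn_not d)
  assume "\<not> almost M U X ?Q"
  then have "almost M U X (\<lambda>x. \<not> ?Q x)" using al_not[OF u(1) d] by blast
  then have B: "Sep M X (\<lambda>x. \<not> ?Q x) \<in> E U" using al_iff[OF UV(1) d'] by blast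
  let ?B = "Sep M X (\<lambda>x. \<not> ?Q x)"
  have BE: "?B \<in> V" "E ?B = {x \<in> E X. \<not> ?Q x}" using Sep_V[OF UV(1) d'] E_Sep[OF UV(1) d'] by auto
  define t where "t = (\<lambda>x. Sep M (ap M Z y) (\<lambda>N. x \<in> E N))"
  have t: "t x \<in> V" "E (t x) = {N \<in> E (ap M Z y). x \<in> E N}" if "x \<in> V" for x
    unfolding t_def by (rule Sep_V E_Sep, rule ZV, intro dfns that)+
  have "card_le M ?B (Pw (ap M Z y))"
  proof (rule card_leI[where t=t])
    show "dft M (\<lambda>e. t (e 0))" unfolding t_def by (intro dfns ZV)
    show "t x \<in> E (Pw (ap M Z y))" if "x \<in> E ?B" for x using t[of x] E_Pw[OF ZV] E_V[OF that] by auto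
    fix x x' assume x: "x \<in> E ?B" "x' \<in> E ?B" and eq: "t x = t x'"
    have xV: "x \<in> V" "x' \<in> V" using x E_V by auto
    have same: "\<forall>N\<in>E (ap M Z y). x \<in> E N \<longleftrightarrow> x' \<in> E N" using eq t(2)[OF xV(1)] t(2)[OF xV(2)] by auto
    have xX: "x \<in> E X" "x' \<in> E X" "\<not> ?Q x" "\<not> ?Q x'" using x BE by auto
    then show "x = x'" using wo_total[OF r xX(1,2)] same by blast
  qed (rule BE)
  then have "card_le M X (Pw (ap M Z y))" using card_le_trans[OF unif[OF B]] UV by blast
  then show False using card_le_trans[OF _ card_le_Pw[OF Z[OF y] ZV V(2)] UV(1)] big by blast
qed

end

section \<open>Unbounded functions under GCH\<close>

locale zfc_gch = zfc +
  assumes GCH: "GCH M"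
begin

section \<open>Power sets as successor cardinals\<close>

lemma gch:
  assumes "infi K" "K \<in> V" "B \<in> V" "card_le M K B" "card_le M B (Pw K)"
  shows "card_le M B K \<or> card_le M (Pw K) B"
  using GCH infi_omega[OF assms(1)] assms unfolding GCH_def by blast

text \<open>A segment of \<open>L\<close> at least as large as \<open>I\<close> lies between
  \<open>I\<close> and its power set. By GCH it has size at most \<open>I\<close> or is as large as
  the power set; the latter would inject \<open>L\<close> into its own segment.\<close>

lemma init_small:
  assumes I: "I \<in> V" "infi I" and L: "init L r" "card_le M L (Pw I)" and l: "l \<in> E L"
  shows "card_le M (Ini L r l) I"
proof -
  have w: "wo L r" and n: "\<not> card_le M L (Ini L r l)" using L l unfolding init_def by auto
  note LV = wo_V[OF w]
  have lV: "l \<in> V" using l E_V by blast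
  have J: "Ini L r l \<in> V" "E (Ini L r l) \<subseteq> E L" using LV lV by auto
  obtain s where s: "wo I s" using zermelo I by blast
  show ?thesis
  proof (cases "card_le M I (Ini L r l)")
    case True
    have "card_le M (Ini L r l) (Pw I)" using card_le_trans[OF card_le_subset[OF J] L(2)] J by blast
    from gch[OF I(2,1) J(1) True this] show ?thesis
      using card_le_trans[OF L(2) _ LV(1)] n by blast
  next
    case False
    then obtain k where k: "k \<in> E I" "card_le M (Ini L r l) (Ini I s k)" using compar[OF s J(1)] by blast
    have "card_le M (Ini I s k) I" by (rule card_le_subset) (use I wo_V(2)[OF s] E_V[OF k(1)] in auto)
    then show ?thesis using card_le_trans[OF k(2)] J by blast
  qed
qed

text \<open>With a maximum, \<open>L\<close> would be a segment of size at most \<open>I\<close>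
  plus one point, which \<open>add_one\<close> and \<open>hessenberg\<close> absorb into
  \<open>I\<close>.\<close>

lemma init_nomax:
  assumes I: "I \<in> V" "infi I" and L: "init L r" "card_le M L (Pw I)" and big: "\<not> card_le M L I"
  shows "nomax L r"
proof (rule ccontr)
  have w: "wo L r" using L unfolding init_def by auto
  note LV = wo_V[OF w]
  obtain a b where ab: "a \<in> E I" "b \<in> E I" "a \<noteq> b" using infi_two[OF I(2)] by blast
  have "E L \<noteq> {}"
  proof
    assume "E L = {}"
    then have "card_le M L I" using card_le_subset LV by blast
    then show False using big by blast
  qed
  moreover assume "\<not> nomax L r"
  ultimately obtain m where m: "m \<in> E L" "\<forall>y\<in>E L. \<not> lt r m y" unfolding nomax_def by blast
  have mV: "m \<in> V" using m E_V by blast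
  have J: "Ini L r m \<in> V" "E (Ini L r m) = {y \<in> E L. lt r y m}" using LV mV by auto
  have "card_le M L (cprod M I I)"
  proof (rule add_one[OF I(1) J(1) LV(1) init_small[OF I L m(1)] ab _ mV])
    show "E L \<subseteq> insert m (E (Ini L r m))" using J(2) wo_total[OF w _ m(1)] m(2) by blast
  qed
  then show False using card_le_trans[OF _ hessenberg[OF I]] LV big by blast
qed

lemma init_reg:
  assumes I: "I \<in> V" "infi I" and L: "init L r" "card_le M L (Pw I)" and big: "\<not> card_le M L I"
  shows "reg L r"
proof -
  have w: "wo L r" using L unfolding init_def by auto
  show ?thesis
    by (rule reg_succ[OF w init_nomax[OF I L big] I(1) hessenberg[OF I] init_small[OF I L] big])
qed

text \<open>If the power set of some segment reaches \<open>L\<close>, then either all segments of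
  \<open>L\<close> are finite, or under GCH \<open>L\<close> behaves as the successor of an infinite
  segment; both cases are regular. This isolates the singular case as a strong limit.\<close>

lemma reg_or_strong_limit:
  assumes L: "init L r" and nm: "nomax L r"
  shows "reg L r \<or> (\<forall>k\<in>E L. \<not> card_le M L (Pw (Ini L r k)))"
proof (rule disjCI)
  have w: "wo L r" and ini: "\<And>k. k \<in> E L \<Longrightarrow> \<not> card_le M L (Ini L r k)" using L unfolding init_def by auto
  note LV = wo_V[OF w]
  have I: "Ini L r k \<in> V" "E (Ini L r k) = {j \<in> E L. lt r j k}" if "k \<in> E L" for k
    using that E_V LV by auto
  have mono: "card_le M (Ini L r j) (Ini L r k)" if "j \<in> E L" "k \<in> E L" "lt r j k" for j k
  proof (rule card_le_subset)
    show "E (Ini L r j) \<subseteq> E (Ini L r k)"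
      using I(2)[OF that(1)] I(2)[OF that(2)] wf_trans[OF wo_wf[OF w] _ that(3) _ that(1,2)] by auto
  qed (rule I[OF that(1)])
  assume "\<not> (\<forall>k\<in>E L. \<not> card_le M L (Pw (Ini L r k)))"
  then obtain k where k: "k \<in> E L" "card_le M L (Pw (Ini L r k))" by blast
  show "reg L r"
  proof (cases "\<exists>m\<in>E L. infi (Ini L r m)")
    case False then show ?thesis using reg_omega[OF w nm] by blast
  next
    case True
    then obtain m where m: "m \<in> E L" "infi (Ini L r m)" by blast
    obtain n where n: "n \<in> E L" "lt r k n" "lt r m n" using upper2[OF w nm k(1) m(1)] by blast
    have "infi (Ini L r n)" using infi_mono[OF m(2) mono[OF m(1) n(1,3)]] .
    moreover have "card_le M L (Pw (Ini L r n))"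
      using card_le_trans[OF k(2) card_le_Pw[OF mono[OF k(1) n(1,2)]]] I k(1) n(1) LV by blast
    ultimately show ?thesis using init_reg[OF I(1)[OF n(1)] _ L] ini[OF n(1)] by blast
  qed
qed

text \<open>In terms of the ultrapower, \<open>h\<close> represents an element of
  \<open>j_W(K)\<close> above all \<open>j_W(k)\<close>, so the embedding is discontinuous at
  \<open>K\<close>.\<close>

definition unb :: "'a \<Rightarrow> 'a \<Rightarrow> 'a \<Rightarrow> 'a \<Rightarrow> 'a \<Rightarrow> bool" where
  "unb Y W K r h \<longleftrightarrow> h \<in> V \<and> (\<forall>y\<in>E Y. ap M h y \<in> E K) \<and> (\<forall>k\<in>E K. almost M W Y (\<lambda>y. lt r k (ap M h y)))"

lemma nomax_infi: assumes "wo K r" "nomax K r" shows "infi K"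
  unfolding infi_def using assms wo_V[OF assms(1)] card_le_subset[of K K] by auto

text \<open>A function into the successor \<open>Pw K\<close> of \<open>K\<close> that is unbounded modulo \<open>W\<close> yields either one into \<open>K\<close>,
  or coverings \<open>Z(y)\<close> of size below \<open>K\<close> capturing every subset of \<open>K\<close> modulo \<open>W\<close>, as in the
  argument of Kunen and Prikry on descending incompleteness.\<close>

lemma kunen_prikry:
  assumes K: "init K r" "nomax K r" and P: "init (Pw K) r1" and g: "unb Y W (Pw K) r1 g"
    and u: "uf Y W"
  shows "(\<exists>h. unb Y W K r h) \<or>
    (\<exists>k\<in>E K. \<exists>Z\<in>V. (\<forall>y\<in>E Y. card_le M (ap M Z y) (Ini K r k)) \<and>
       (\<forall>N\<in>E (Pw K). almost M W Y (\<lambda>y. N \<in> E (ap M Z y))))"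
proof (rule disjCI)
  let ?P = "Pw K"
  have wK: "wo K r" and iK: "\<And>k. k \<in> E K \<Longrightarrow> \<not> card_le M K (Ini K r k)" using K unfolding init_def by auto
  have wP: "wo ?P r1" using P unfolding init_def by auto
  note KV = wo_V[OF wK] and PV = wo_V[OF wP] and WV = uf_V[OF u]
  have gV: "g \<in> V" and gP: "\<And>y. y \<in> E Y \<Longrightarrow> ap M g y \<in> E ?P"
    and gu: "\<And>l. l \<in> E ?P \<Longrightarrow> almost M W Y (\<lambda>y. lt r1 l (ap M g y))" using g unfolding unb_def by auto
  have infK: "infi K" using nomax_infi wK K(2) by blast
  have PP: "card_le M ?P ?P" by (rule card_le_subset) (use PV in auto)
  have "card_le M (Sep M ?P (\<lambda>x. lt r1 x l)) K" if "l \<in> E ?P" for l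
    using init_small[OF KV(1) infK P PP that] by (simp add: Ini_def)
  moreover have "dfn M (\<lambda>e. lt r1 (e 1) (e 0))" by (intro dfns PV)
  \<comment> \<open>Every proper segment of the successor has size at most \<open>K\<close>;
    \<open>e\<close> fixes an injection into \<open>K\<close> for each of them
    simultaneously.\<close>
  ultimately obtain e where eV: "e \<in> V" and e: "\<forall>l\<in>E ?P. (\<forall>x\<in>E ?P. lt r1 x l \<longrightarrow> ap M (ap M e l) x \<in> E K) \<and>
    (\<forall>x\<in>E ?P. \<forall>y\<in>E ?P. lt r1 x l \<longrightarrow> lt r1 y l \<longrightarrow> ap M (ap M e l) x = ap M (ap M e l) y \<longrightarrow> x = y)"
    using inj_family[OF KV(1) PV(1) PV(1), of "\<lambda>l x. lt r1 x l"] by blast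
  \<comment> \<open>The code in \<open>K\<close> of \<open>N\<close>, computed in the segment below
    \<open>g(y)\<close>; it is meaningful whenever \<open>N\<close> is below \<open>g(y)\<close>,
    which holds for almost all \<open>y\<close>.\<close>
  define xi where "xi = (\<lambda>N y. ap M (ap M e (ap M g y)) N)"
  have dxi: "dft M s \<Longrightarrow> dft M t \<Longrightarrow> dft M (\<lambda>e. xi (s e) (t e))" for s t
    unfolding xi_def by (intro dfns eV gV)
  assume noh: "\<not> (\<exists>k\<in>E K. \<exists>Z\<in>V. (\<forall>y\<in>E Y. card_le M (ap M Z y) (Ini K r k)) \<and>
       (\<forall>N\<in>E ?P. almost M W Y (\<lambda>y. N \<in> E (ap M Z y))))"
  show "\<exists>h. unb Y W K r h"
  proof (rule ccontr)
    assume nh: "\<not> (\<exists>h. unb Y W K r h)"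
    obtain k0 where k0: "k0 \<in> E K" using K(2) unfolding nomax_def by blast
    define B where "B = (\<lambda>k N. almost M W Y (\<lambda>y. lt r1 N (ap M g y) \<and> lt r (xi N y) k))"
    have dB: "dft M s \<Longrightarrow> dft M t \<Longrightarrow> dfn M (\<lambda>e. B (s e) (t e))" for s t
      by (rule dfn2_subst) (unfold B_def, intro dfns WV PV KV gV dxi)
    have dB2: "dfn M (\<lambda>e. B (e 0) (e 1))" by (intro dB dfns)
    have cov: "\<exists>k\<in>E K. B k N" if N: "N \<in> E ?P" for N
    proof -
      have NV: "N \<in> V" using N E_V by blast
      have xiK: "xi N y \<in> E K" if "y \<in> E Y" "lt r1 N (ap M g y)" for y
        using e gP[OF that(1)] N that(2) unfolding xi_def by blast
      \<comment> \<open>The codes of a fixed \<open>N\<close> give a function into \<open>K\<close>,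
        with \<open>k0\<close> filled in where there is no code. By assumption it is not unbounded,
        so some \<open>k\<close> bounds the codes for almost all \<open>y\<close>.\<close>
      define h where "h = Lam M Y (\<lambda>y. if xi N y \<in> E K then xi N y else k0)"
      have dh: "dft M (\<lambda>e. if xi N (e 0) \<in> E K then xi N (e 0) else k0)" by (intro dfns dxi NV KV E_V[OF k0])
      have hV: "h \<in> V" unfolding h_def by (rule Lam_V[OF WV(1) dh])
      have hap: "ap M h y = (if xi N y \<in> E K then xi N y else k0)" if "y \<in> E Y" for y
        unfolding h_def by (rule ap_Lam[OF WV(1) dh that])
      have "\<forall>y\<in>E Y. ap M h y \<in> E K" using hap k0 by auto
      then obtain k where k: "k \<in> E K" "\<not> almost M W Y (\<lambda>y. lt r k (ap M h y))"
        using nh hV unfolding unb_def by blast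
      have kV: "k \<in> V" using k E_V by blast
      have d1: "dfn M (\<lambda>e. lt r k (ap M h (e 0)))" "dfn M (\<lambda>e. \<not> lt r k (ap M h (e 0)))"
        "dfn M (\<lambda>e. lt r1 N (ap M g (e 0)))" by (intro dfns KV PV kV hV NV gV)+
      have "almost M W Y (\<lambda>y. lt r1 N (ap M g y) \<and> \<not> lt r k (ap M h y))"
        unfolding al_conj[OF u d1(3,2)] al_not[OF u d1(1)] using gu[OF N] k(2) by blast
      moreover obtain k' where k': "k' \<in> E K" "lt r k k'" using K(2) k(1) unfolding nomax_def by blast
      ultimately have "B k' N" unfolding B_def
      proof (rule_tac al_mono[OF u])
        show "dfn M (\<lambda>e. lt r1 N (ap M g (e 0)) \<and> lt r (xi N (e 0)) k')"
          by (intro dfns KV PV NV gV dxi E_V[OF k'(1)])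
        fix y assume y: "y \<in> E Y" and a: "lt r1 N (ap M g y) \<and> \<not> lt r k (ap M h y)"
        have xK: "xi N y \<in> E K" using xiK y a by blast
        then have "\<not> lt r k (xi N y)" using a hap[OF y] by simp
        then have "lt r (xi N y) k'"
          using wo_total[OF wK xK k(1)] wf_trans[OF wo_wf[OF wK] _ k'(2) xK k(1) k'(1)] k'(2) by blast
        then show "lt r1 N (ap M g y) \<and> lt r (xi N y) k'" using a by blast
      qed
      then show ?thesis using k'(1) by blast
    qed
    \<comment> \<open>Pigeonhole: the successor of \<open>K\<close> is not a union of
      \<open>K\<close> many sets of size at most \<open>K\<close>, so one bound \<open>k\<close>
      serves more than \<open>K\<close> many \<open>N\<close>, and by GCH as many as there are
      subsets of \<open>K\<close>.\<close>
    have "\<exists>k\<in>E K. \<not> card_le M (Sep M ?P (B k)) K"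
    proof (rule ccontr)
      assume "\<not> ?thesis"
      then have "card_le M ?P K"
        using union_card[OF KV(1) PV(1) KV(1) hessenberg[OF KV(1) infK] _ dB2 cov] card_le_subset[OF KV(1), of K] by blast
      then show False using cantor[OF KV(1)] by blast
    qed
    then obtain k where k: "k \<in> E K" "\<not> card_le M (Sep M ?P (B k)) K" by blast
    have kV: "k \<in> V" using k E_V by blast
    have dBk: "dfn M (\<lambda>e. B k (e 0))" by (intro dB dfns kV)
    let ?S = "Sep M ?P (B k)"
    have S: "?S \<in> V" "E ?S = {N \<in> E ?P. B k N}" using Sep_V[OF PV(1) dBk] E_Sep[OF PV(1) dBk] by auto
    have "card_le M K ?S"
    proof (rule ccontr)
      assume "\<not> ?thesis"
      then obtain j where j: "j \<in> E K" "card_le M ?S (Ini K r j)" using compar[OF wK S(1)] by blast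
      have "card_le M (Ini K r j) K" by (rule card_le_subset) (use KV E_V[OF j(1)] in auto)
      then show False using card_le_trans[OF j(2)] S(1) k(2) by blast
    qed
    moreover have "card_le M ?S ?P" by (rule card_le_subset) (use S in auto)
    ultimately have "card_le M ?P ?S" using gch[OF infK KV(1) S(1)] k(2) by blast
    then obtain d where d: "d \<in> V" "d \<in> funs M ?P" "\<forall>N\<in>E ?P. ap M d N \<in> E ?S"
      "\<forall>N\<in>E ?P. \<forall>N'\<in>E ?P. ap M d N = ap M d N' \<longrightarrow> N = N'" by (rule card_leE)
    \<comment> \<open>The injection \<open>d\<close> renames the subsets of \<open>K\<close> by
      elements that share the bound \<open>k\<close>. Then \<open>z(y)\<close> collects those whose
      code at \<open>y\<close> is below \<open>k\<close>, so the coding injects it into the segment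
      below \<open>k\<close>.\<close>
    define z where "z = (\<lambda>y. Sep M ?P (\<lambda>N. lt r1 (ap M d N) (ap M g y) \<and> lt r (xi (ap M d N) y) k))"
    have z: "z y \<in> V" "E (z y) = {N \<in> E ?P. lt r1 (ap M d N) (ap M g y) \<and> lt r (xi (ap M d N) y) k}" if "y \<in> V" for y
      unfolding z_def by (rule Sep_V E_Sep, rule PV, intro dfns PV KV kV d gV dxi that)+
    have dz: "dft M (\<lambda>e. z (e 0))" unfolding z_def by (intro dfns PV KV kV d gV dxi)
    have ZV: "Lam M Y z \<in> V" by (rule Lam_V[OF WV(1) dz])
    have Zap: "ap M (Lam M Y z) y = z y" if "y \<in> E Y" for y by (rule ap_Lam[OF WV(1) dz that])
    have zle: "card_le M (z y) (Ini K r k)" if y: "y \<in> E Y" for y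
    proof (rule card_leI[where t="\<lambda>N. xi (ap M d N) y"])
      have yV: "y \<in> V" using y E_V by blast
      show "z y \<in> V" by (rule z[OF yV])
      show "dft M (\<lambda>e. xi (ap M d (e 0)) y)" by (intro dxi dfns d yV)
      have dP: "ap M d N \<in> E ?P" if "N \<in> E ?P" for N using d(3) S(2) that by auto
      have ee: "\<forall>x\<in>E ?P. lt r1 x (ap M g y) \<longrightarrow> xi x y \<in> E K"
         "\<forall>x\<in>E ?P. \<forall>x'\<in>E ?P. lt r1 x (ap M g y) \<longrightarrow> lt r1 x' (ap M g y) \<longrightarrow> xi x y = xi x' y \<longrightarrow> x = x'"
        using e gP[OF y] unfolding xi_def by blast+
      fix N assume N: "N \<in> E (z y)"
      then have N': "N \<in> E ?P" "lt r1 (ap M d N) (ap M g y)" "lt r (xi (ap M d N) y) k" using z[OF yV] by auto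
      then show "xi (ap M d N) y \<in> E (Ini K r k)" using ee(1) dP KV kV by simp
      fix N2 assume N2: "N2 \<in> E (z y)" and eq: "xi (ap M d N) y = xi (ap M d N2) y"
      have N2': "N2 \<in> E ?P" "lt r1 (ap M d N2) (ap M g y)" using N2 z[OF yV] by auto
      have "ap M d N = ap M d N2" using ee(2) dP[OF N'(1)] dP[OF N2'(1)] N'(2) N2'(2) eq by blast
      then show "N = N2" using d(4) N' N2' by blast
    qed
    have zfine: "almost M W Y (\<lambda>y. N \<in> E (ap M (Lam M Y z) y))" if N: "N \<in> E ?P" for N
    proof -
      have "B k (ap M d N)" using d(3) S(2) N by blast
      moreover have "N \<in> E (ap M (Lam M Y z) y) \<longleftrightarrow> lt r1 (ap M d N) (ap M g y) \<and> lt r (xi (ap M d N) y) k" if "y \<in> E Y" for y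
        using Zap[OF that] z(2)[OF E_V[OF that]] N by simp
      then have "almost M W Y (\<lambda>y. N \<in> E (ap M (Lam M Y z) y)) = B k (ap M d N)" unfolding B_def by (rule al_cong)
      ultimately show ?thesis by simp
    qed
    have "\<forall>y\<in>E Y. card_le M (ap M (Lam M Y z) y) (Ini K r k)" using zle Zap by simp
    then show False using noh k(1) ZV zfine by blast
  qed
qed

text \<open>A covering set \<open>Z(y)\<close> smaller than \<open>K\<close> contains few
  singletons, so by regularity a strict bound \<open>h(y)\<close> for their elements exists. Since
  every singleton is captured for almost all \<open>y\<close>, this \<open>h\<close> is unbounded
  modulo \<open>W\<close>.\<close>

lemma kunen_prikry_reg:
  assumes K: "init K r" "nomax K r" "reg K r" and P: "init (Pw K) r1" and g: "unb Y W (Pw K) r1 g"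
    and u: "uf Y W"
  shows "\<exists>h. unb Y W K r h"
  using kunen_prikry[OF K(1,2) P g u]
proof
  have wK: "wo K r" using K unfolding init_def by auto
  note KV = wo_V[OF wK] and WV = uf_V[OF u]
  assume "\<exists>k\<in>E K. \<exists>Z\<in>V. (\<forall>y\<in>E Y. card_le M (ap M Z y) (Ini K r k)) \<and>
       (\<forall>N\<in>E (Pw K). almost M W Y (\<lambda>y. N \<in> E (ap M Z y)))"
  then obtain k Z where k: "k \<in> E K" and Z: "Z \<in> V" "\<forall>y\<in>E Y. card_le M (ap M Z y) (Ini K r k)"
    "\<forall>N\<in>E (Pw K). almost M W Y (\<lambda>y. N \<in> E (ap M Z y))" by blast
  have sg: "the_set M {x} \<in> V" "E (the_set M {x}) = {x}" if "x \<in> V" for x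
    using that by (auto intro: the_set_V isset_sing simp: E_the_set isset_sing)
  have D: "dfn M (\<lambda>e. \<forall>x\<in>E K. the_set M {x} \<in> E (ap M Z (e 0)) \<longrightarrow> lt r x (e 1))" by (intro dfns KV Z)
  have "\<exists>b\<in>E K. \<forall>x\<in>E K. the_set M {x} \<in> E (ap M Z y) \<longrightarrow> lt r x b" if y: "y \<in> E Y" for y
  proof -
    have yV: "y \<in> V" using y E_V by blast
    define S where "S = Sep M K (\<lambda>x. the_set M {x} \<in> E (ap M Z y))"
    have S: "S \<in> V" "E S = {x \<in> E K. the_set M {x} \<in> E (ap M Z y)}"
      unfolding S_def by (rule Sep_V E_Sep, rule KV, intro dfns Z yV)+
    have "card_le M S (ap M Z y)"
    proof (rule card_leI[where t="\<lambda>x. the_set M {x}"])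
      show "dft M (\<lambda>e. the_set M {e 0})" by (intro dfns)
      fix x x' assume x: "x \<in> E S" "x' \<in> E S" "the_set M {x} = the_set M {x'}"
      have "{x} = E (the_set M {x})" "{x'} = E (the_set M {x'})"
        using sg(2)[OF E_V[OF x(1)]] sg(2)[OF E_V[OF x(2)]] by blast+
      then show "x = x'" using x(3) by (metis singleton_inject)
    qed (use S in auto)
    then have "card_le M S (Ini K r k)" using card_le_trans Z(2) y S(1) by blast
    moreover have "E S \<subseteq> E K" using S by auto
    ultimately obtain b where "b \<in> E K" "\<forall>s\<in>E S. lt r s b" using K(3) k S(1) unfolding reg_def by blast
    then show ?thesis using S(2) by auto
  qed
  from choice[OF WV(1) KV(1) D this]
  obtain h where h: "h \<in> funs M Y" "\<forall>y\<in>E Y. ap M h y \<in> E K \<and>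
    (\<forall>x\<in>E K. the_set M {x} \<in> E (ap M Z y) \<longrightarrow> lt r x (ap M h y))" by blast
  have "unb Y W K r h" unfolding unb_def
  proof (intro conjI ballI)
    fix x assume x: "x \<in> E K"
    have xV: "x \<in> V" using x E_V by blast
    have "the_set M {x} \<in> E (Pw K)" using sg[OF xV] x E_Pw[OF KV(1)] by auto
    then have "almost M W Y (\<lambda>y. the_set M {x} \<in> E (ap M Z y))" using Z(3) by blast
    then show "almost M W Y (\<lambda>y. lt r x (ap M h y))"
    proof (rule al_mono[OF u])
      show "dfn M (\<lambda>e. lt r x (ap M h (e 0)))" by (intro dfns KV xV funs_V[OF h(1)])
    qed (use h x in blast)
  qed (use h funs_V in auto)
  then show ?thesis by blast
qed

end

section \<open>Sets not decided by rectangles\<close>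

context zfc
begin

text \<open>Equations between extensions are expanded into quantified memberships, to which the
  rules \<open>dfns\<close> apply.\<close>

lemma uf_iff:
  "uf X U \<longleftrightarrow> X \<in> V \<and> U \<in> V \<and> (\<forall>A\<in>E U. E A \<subseteq> E X) \<and> X \<in> E U \<and> (\<forall>A\<in>E U. \<exists>x\<in>E A. True) \<and>
     (\<forall>A\<in>E U. \<forall>B\<in>E U. \<forall>C\<in>V. (\<forall>z\<in>V. z \<in> E C \<longleftrightarrow> z \<in> E A \<and> z \<in> E B) \<longrightarrow> C \<in> E U) \<and>
     (\<forall>A\<in>E U. \<forall>B\<in>V. E A \<subseteq> E B \<longrightarrow> E B \<subseteq> E X \<longrightarrow> B \<in> E U) \<and>
     (\<forall>A\<in>V. \<forall>B\<in>V. E A \<subseteq> E X \<longrightarrow> (\<forall>z\<in>V. z \<in> E B \<longleftrightarrow> z \<in> E X \<and> z \<notin> E A) \<longrightarrow> A \<in> E U \<or> B \<in> E U)"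
proof -
  have 1: "E C = E A \<inter> E B \<longleftrightarrow> (\<forall>z\<in>V. z \<in> E C \<longleftrightarrow> z \<in> E A \<and> z \<in> E B)" for A B C using E_V by blast
  have 2: "E B = E X - E A \<longleftrightarrow> (\<forall>z\<in>V. z \<in> E B \<longleftrightarrow> z \<in> E X \<and> z \<notin> E A)" for A B using E_V by blast
  have 3: "E A \<noteq> {} \<longleftrightarrow> (\<exists>x\<in>E A. True)" for A by blast
  show ?thesis unfolding is_ultrafilter_def is_filter_def 1 2 3 by (simp only: conj_assoc)
qed

lemma dfn_uf [dfns]:
  assumes d: "dft M X" "dft M U" shows "dfn M (\<lambda>e. uf (X e) (U e))"
proof -
  have "dfn M (\<lambda>e. uf (e 0) (e 1))"
    by (rule dfn_cong[where P="\<lambda>e. (\<forall>A\<in>E (e 1). E A \<subseteq> E (e 0)) \<and> e 0 \<in> E (e 1) \<and> (\<forall>A\<in>E (e 1). \<exists>x\<in>E A. True) \<and>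
     (\<forall>A\<in>E (e 1). \<forall>B\<in>E (e 1). \<forall>C\<in>V. (\<forall>z\<in>V. z \<in> E C \<longleftrightarrow> z \<in> E A \<and> z \<in> E B) \<longrightarrow> C \<in> E (e 1)) \<and>
     (\<forall>A\<in>E (e 1). \<forall>B\<in>V. E A \<subseteq> E B \<longrightarrow> E B \<subseteq> E (e 0) \<longrightarrow> B \<in> E (e 1)) \<and>
     (\<forall>A\<in>V. \<forall>B\<in>V. E A \<subseteq> E (e 0) \<longrightarrow> (\<forall>z\<in>V. z \<in> E B \<longleftrightarrow> z \<in> E (e 0) \<and> z \<notin> E A) \<longrightarrow> A \<in> E (e 1) \<or> B \<in> E (e 1))"])
     (intro dfns, simp add: uf_iff envsD)
  from dfn2_subst[OF this d] show ?thesis .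
qed

lemmas [dfns] = dfn_capw

definition undec :: "'a \<Rightarrow> 'a \<Rightarrow> 'a \<Rightarrow> bool" where
  "undec U W C \<longleftrightarrow> (\<forall>A\<in>E U. \<forall>B\<in>E W. (\<exists>x\<in>E A. \<exists>y\<in>E B. op x y \<in> E C) \<and> (\<exists>x\<in>E A. \<exists>y\<in>E B. op x y \<notin> E C))"

definition bad :: "'a \<Rightarrow> 'a \<Rightarrow> 'a \<Rightarrow> 'a \<Rightarrow> bool" where
  "bad X U Y W \<longleftrightarrow> uf X U \<and> uf Y W \<and> (\<exists>u\<in>V. capw X U Y W u) \<and> (\<exists>w\<in>V. capw Y W X U w) \<and> (\<exists>C\<in>V. undec U W C)"

lemma dfn_bad: "dfn M (\<lambda>e. bad (e i) (e j) (e k) (e l))"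
  unfolding bad_def undec_def by (intro dfns)

text \<open>A bad configuration is inherited by the image of \<open>U\<close> under \<open>q\<close> as soon as the witnesses \<open>w(x)\<close> and the
  sections of \<open>C\<close> factor through \<open>q\<close> modulo \<open>U\<close>.\<close>

lemma push:
  assumes u: "uf X U" "uf Y W" and V: "u \<in> V" "w \<in> V" "C \<in> V" "q \<in> V" "L \<in> V"
    and cu: "capw X U Y W u" and cw: "capw Y W X U w" and C: "undec U W C" and A: "A \<in> E U"
    and q: "\<And>x x'. x \<in> E A \<Longrightarrow> x' \<in> E A \<Longrightarrow> ap M q x = ap M q x' \<Longrightarrow>
       ap M w x = ap M w x' \<and> (\<forall>y\<in>E Y. op x y \<in> E C \<longleftrightarrow> op x' y \<in> E C)"
    and L: "E L = ap M q ` E A"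
  shows "\<exists>U'\<in>V. bad L U' Y W"
proof -
  note UV = uf_V[OF u(1)] and WV = uf_V[OF u(2)]
  have AV: "A \<in> V" and AX: "E A \<subseteq> E X" using A E_V uf_sub[OF u(1) A] by auto
  have alA: "almost M U X (\<lambda>x. x \<in> E A)" using al_mem[OF u(1) AV AX] A by blast
  have qL: "ap M q x \<in> E L" if "x \<in> E A" for x using L that by blast
  \<comment> \<open>The image under \<open>q\<close> of \<open>U0\<close> cut down to
    \<open>A\<close>. The operation is applied to \<open>U\<close> and also to the sets
    \<open>u(y)\<close>, about which nothing is known individually; only the change of variables
    \<open>pf_al\<close> is used for those.\<close>
  define pf where "pf = (\<lambda>U0. Sep M (Pw L) (\<lambda>S. almost M U0 X (\<lambda>x. x \<in> E A \<and> ap M q x \<in> E S)))"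
  have dpf: "dft M t \<Longrightarrow> dft M (\<lambda>e. pf (t e))" for t
    by (rule dft1_subst) (unfold pf_def, intro dfns AV UV V Pw_V)
  have pfV: "pf U0 \<in> V" and pfE: "E (pf U0) = {S \<in> E (Pw L). almost M U0 X (\<lambda>x. x \<in> E A \<and> ap M q x \<in> E S)}"
    if "U0 \<in> V" for U0
    unfolding pf_def by (rule Sep_V E_Sep, simp add: V, intro dfns AV UV V that)+
  have pf_al: "almost M (pf U0) L P \<longleftrightarrow> almost M U0 X (\<lambda>x. x \<in> E A \<and> P (ap M q x))"
    if U0: "U0 \<in> V" and P: "dfn M (\<lambda>e. P (e 0))" for U0 P
  proof -
    have S: "Sep M L P \<in> V" "E (Sep M L P) = {l \<in> E L. P l}" using Sep_V[OF V(5) P] E_Sep[OF V(5) P] by auto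
    then have "Sep M L P \<in> E (Pw L)" using E_Pw[OF V(5)] by auto
    moreover have "almost M U0 X (\<lambda>x. x \<in> E A \<and> ap M q x \<in> E (Sep M L P)) \<longleftrightarrow> almost M U0 X (\<lambda>x. x \<in> E A \<and> P (ap M q x))"
      unfolding S(2) by (rule al_cong) (use qL in blast)
    ultimately show ?thesis unfolding al_iff[OF V(5) P] pfE[OF U0] by simp
  qed
  let ?U = "pf U"
  let ?T = "\<lambda>S x. x \<in> E A \<and> ap M q x \<in> E S"
  have dT: "dfn M (\<lambda>e. ?T S (e 0))" if "S \<in> V" for S by (intro dfns AV V that)
  note UU = pfV[OF UV(2)] pfE[OF UV(2)]
  have ufL: "uf L ?U" unfolding is_ultrafilter_def is_filter_def
  proof (intro conjI ballI impI V UU)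
    show "E S \<subseteq> E L" if "S \<in> E ?U" for S using that UU(2) E_Pw[OF V(5)] by auto
    have "almost M U X (?T L)" by (rule al_mono[OF u(1) alA dT[OF V(5)]]) (use qL in blast)
    then show "L \<in> E ?U" using UU(2) E_Pw[OF V(5)] V(5) by auto
    show "E S \<noteq> {}" if "S \<in> E ?U" for S
    proof -
      have "almost M U X (?T S)" using that UU by auto
      from al_ex[OF u(1) this] show ?thesis by blast
    qed
  next
    fix S S' T assume S: "S \<in> E ?U" "S' \<in> E ?U" "T \<in> V" "E T = E S \<inter> E S'"
    have SV: "S \<in> V" "S' \<in> V" using S E_V by auto
    have "almost M U X (\<lambda>x. ?T S x \<and> ?T S' x)" unfolding al_conj[OF u(1) dT[OF SV(1)] dT[OF SV(2)]] using S UU by auto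
    then have "almost M U X (?T T)" by (rule al_mono[OF u(1) _ dT[OF S(3)]]) (use S(4) in auto)
    moreover have "E T \<subseteq> E L" using S(1,4) UU(2) E_Pw[OF V(5)] by auto
    ultimately show "T \<in> E ?U" using UU(2) E_Pw[OF V(5)] S(3) by auto
  next
    fix S T assume S: "S \<in> E ?U" "T \<in> V" "E S \<subseteq> E T" "E T \<subseteq> E L"
    have "almost M U X (?T S)" using S UU by auto
    then have "almost M U X (?T T)" by (rule al_mono[OF u(1) _ dT[OF S(2)]]) (use S(3) in auto)
    then show "T \<in> E ?U" using UU(2) E_Pw[OF V(5)] S by auto
  next
    fix S T assume S: "S \<in> V" "T \<in> V" "E S \<subseteq> E L" "E T = E L - E S"
    have "almost M U X (?T S) \<or> almost M U X (?T T)"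
    proof (rule disjCI)
      assume "\<not> almost M U X (?T T)"
      then have "almost M U X (\<lambda>x. \<not> ?T T x)" using al_not[OF u(1) dT[OF S(2)]] by blast
      moreover have d: "dfn M (\<lambda>e. \<not> ?T T (e 0))" "dfn M (\<lambda>e. e 0 \<in> E A)" by (intro dfns AV V S)+
      ultimately have "almost M U X (\<lambda>x. x \<in> E A \<and> \<not> ?T T x)" unfolding al_conj[OF u(1) d(2,1)] using alA by blast
      then show "almost M U X (?T S)" by (rule al_mono[OF u(1) _ dT[OF S(1)]]) (use S(4) qL in auto)
    qed
    then show "S \<in> E ?U \<or> T \<in> E ?U" using UU(2) E_Pw[OF V(5)] S by auto
  qed
  have dsel: "dfn M (\<lambda>e. ap M q (e 1) = e 0)" by (intro dfns V)
  have "\<exists>x\<in>E A. ap M q x = l" if "l \<in> E L" for l using L that by auto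
  from choice[OF V(5) AV dsel this]
  \<comment> \<open>A section of \<open>q\<close>. Since \<open>w\<close> and the sections of
    \<open>C\<close> factor through \<open>q\<close> on \<open>A\<close>, evaluating them at
    \<open>s(q(x))\<close> instead of \<open>x\<close> changes nothing.\<close>
  obtain s where s: "s \<in> funs M L" "\<forall>l\<in>E L. ap M s l \<in> E A \<and> ap M q (ap M s l) = l" by blast
  have sV: "s \<in> V" using s funs_V by blast
  have sq: "ap M w (ap M s (ap M q x)) = ap M w x" "\<And>y. y \<in> E Y \<Longrightarrow> op (ap M s (ap M q x)) y \<in> E C \<longleftrightarrow> op x y \<in> E C"
    if x: "x \<in> E A" for x
    using q[of "ap M s (ap M q x)" x] s(2) qL[OF x] x by blast+
  define u' where "u' = Lam M Y (\<lambda>y. pf (ap M u y))"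
  have du': "dft M (\<lambda>e. pf (ap M u (e 0)))" by (intro dpf dfns V)
  have u'V: "u' \<in> V" unfolding u'_def by (rule Lam_V[OF WV(1) du'])
  have u'ap: "ap M u' y = pf (ap M u y)" if "y \<in> E Y" for y unfolding u'_def by (rule ap_Lam[OF WV(1) du' that])
  define w' where "w' = Lam M L (\<lambda>l. ap M w (ap M s l))"
  have dw': "dft M (\<lambda>e. ap M w (ap M s (e 0)))" by (intro dfns V sV)
  have w'V: "w' \<in> V" unfolding w'_def by (rule Lam_V[OF V(5) dw'])
  have w'ap: "ap M w' l = ap M w (ap M s l)" if "l \<in> E L" for l unfolding w'_def by (rule ap_Lam[OF V(5) dw' that])
  have "capw L ?U Y W u'" unfolding capw_def
  proof
    fix R assume R: "R \<in> V"
    have "almost M ?U L (\<lambda>x. almost M W Y (\<lambda>y. op x y \<in> E R)) \<longleftrightarrow>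
       almost M U X (\<lambda>x. x \<in> E A \<and> almost M W Y (\<lambda>y. op (ap M q x) y \<in> E R))"
      by (rule pf_al[OF UV(2)]) (intro dfns WV R)
    also have "\<dots> \<longleftrightarrow> almost M U X (\<lambda>x. almost M W Y (\<lambda>y. x \<in> E A \<and> op (ap M q x) y \<in> E R))"
    proof (rule al_cong)
      fix x assume x: "x \<in> E X"
      have "almost M W Y (\<lambda>y. x \<in> E A \<and> op (ap M q x) y \<in> E R) \<longleftrightarrow> almost M W Y (\<lambda>y. x \<in> E A) \<and> almost M W Y (\<lambda>y. op (ap M q x) y \<in> E R)"
        by (rule al_conj[OF u(2)]) (intro dfns R ap_V E_V[OF x])+
      then show "(x \<in> E A \<and> almost M W Y (\<lambda>y. op (ap M q x) y \<in> E R)) = almost M W Y (\<lambda>y. x \<in> E A \<and> op (ap M q x) y \<in> E R)"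
        using al_const[OF u(2)] by blast
    qed
    also have "\<dots> \<longleftrightarrow> almost M W Y (\<lambda>y. almost M (ap M u y) X (\<lambda>x. x \<in> E A \<and> op (ap M q x) y \<in> E R))"
    proof -
      have "dfn M (\<lambda>e. e 0 \<in> E A \<and> op (ap M q (e 0)) (e 1) \<in> E R)" by (intro dfns AV R V)
      from capwD[OF cu UV(1) WV(1) this] show ?thesis by blast
    qed
    also have "\<dots> \<longleftrightarrow> almost M W Y (\<lambda>y. almost M (ap M u' y) L (\<lambda>x. op x y \<in> E R))"
    proof (rule al_cong)
      fix y assume y: "y \<in> E Y"
      have yV: "y \<in> V" using y E_V by blast
      have "dfn M (\<lambda>e. op (e 0) y \<in> E R)" by (intro dfns R yV)
      from pf_al[OF ap_V[OF yV] this, of u] show "almost M (ap M u y) X (\<lambda>x. x \<in> E A \<and> op (ap M q x) y \<in> E R) = almost M (ap M u' y) L (\<lambda>x. op x y \<in> E R)"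
        unfolding u'ap[OF y] by blast
    qed
    finally show "almost M ?U L (\<lambda>x. almost M W Y (\<lambda>y. op x y \<in> E R)) \<longleftrightarrow> almost M W Y (\<lambda>y. almost M (ap M u' y) L (\<lambda>x. op x y \<in> E R))" .
  qed
  moreover have "capw Y W L ?U w'" unfolding capw_def
  proof
    fix R assume R: "R \<in> V"
    have "almost M W Y (\<lambda>y. almost M ?U L (\<lambda>x. op y x \<in> E R)) \<longleftrightarrow> almost M W Y (\<lambda>y. almost M U X (\<lambda>x. x \<in> E A \<and> op y (ap M q x) \<in> E R))"
    proof (rule al_cong)
      fix y assume y: "y \<in> E Y"
      show "almost M ?U L (\<lambda>x. op y x \<in> E R) = almost M U X (\<lambda>x. x \<in> E A \<and> op y (ap M q x) \<in> E R)"
        by (rule pf_al[OF UV(2)]) (intro dfns R E_V[OF y])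
    qed
    also have "\<dots> \<longleftrightarrow> almost M U X (\<lambda>x. almost M (ap M w x) Y (\<lambda>y. x \<in> E A \<and> op y (ap M q x) \<in> E R))"
    proof -
      have "dfn M (\<lambda>e. e 1 \<in> E A \<and> op (e 0) (ap M q (e 1)) \<in> E R)" by (intro dfns AV R V)
      from capwD[OF cw WV(1) UV(1) this] show ?thesis by blast
    qed
    also have "\<dots> \<longleftrightarrow> almost M U X (\<lambda>x. x \<in> E A \<and> almost M (ap M w (ap M s (ap M q x))) Y (\<lambda>y. op y (ap M q x) \<in> E R))"
    proof (rule al_cong_al[OF u(1) alA])
      fix x assume x: "x \<in> E X" "x \<in> E A"
      show "almost M (ap M w x) Y (\<lambda>y. x \<in> E A \<and> op y (ap M q x) \<in> E R) = (x \<in> E A \<and> almost M (ap M w (ap M s (ap M q x))) Y (\<lambda>y. op y (ap M q x) \<in> E R))"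
        unfolding sq(1)[OF x(2)] using x(2) by simp
    qed (intro dfns AV V WV R sV)+
    also have "\<dots> \<longleftrightarrow> almost M ?U L (\<lambda>l. almost M (ap M w (ap M s l)) Y (\<lambda>y. op y l \<in> E R))"
    proof -
      have "dfn M (\<lambda>e. almost M (ap M w (ap M s (e 0))) Y (\<lambda>y. op y (e 0) \<in> E R))" by (intro dfns V WV R sV)
      from pf_al[OF UV(2) this] show ?thesis by blast
    qed
    also have "\<dots> \<longleftrightarrow> almost M ?U L (\<lambda>l. almost M (ap M w' l) Y (\<lambda>y. op y l \<in> E R))"
      by (rule al_cong) (simp add: w'ap)
    finally show "almost M W Y (\<lambda>y. almost M ?U L (\<lambda>x. op y x \<in> E R)) \<longleftrightarrow> almost M ?U L (\<lambda>y. almost M (ap M w' y) Y (\<lambda>x. op x y \<in> E R))" .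
  qed
  moreover have "\<exists>D\<in>V. undec ?U W D"
  proof -
    have LY: "cprod M L Y \<in> V" using E_cprod V WV by blast
    \<comment> \<open>\<open>C\<close> is transferred to \<open>L\<close> along the section
      \<open>s\<close>; by the factorization, \<open>(q(x), y)\<close> lies in \<open>D\<close> iff
      \<open>(x, y)\<close> lies in \<open>C\<close>.\<close>
    define D where "D = Sep M (cprod M L Y) (\<lambda>p. op (ap M s (fs M p)) (sn M p) \<in> E C)"
    have D: "D \<in> V" "E D = {p \<in> E (cprod M L Y). op (ap M s (fs M p)) (sn M p) \<in> E C}"
      unfolding D_def by (rule Sep_V E_Sep, rule LY, intro dfns V sV)+
    have mem: "op (ap M q x) y \<in> E D \<longleftrightarrow> op x y \<in> E C" if "x \<in> E A" "y \<in> E Y" for x y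
      using that qL[OF that(1)] E_V[OF qL[OF that(1)]] E_V[OF that(2)] V WV sq(2)[OF that] unfolding D(2) by auto
    have "undec ?U W D" unfolding undec_def
    proof (intro ballI)
      fix S B assume S: "S \<in> E ?U" and B: "B \<in> E W"
      have SV: "S \<in> V" using S E_V by blast
      define A' where "A' = Sep M X (?T S)"
      have A': "A' \<in> V" "E A' = {x \<in> E X. ?T S x}" unfolding A'_def by (rule Sep_V E_Sep, rule UV, rule dT[OF SV])+
      have "A' \<in> E U" unfolding A'_def using al_iff[OF UV(1) dT[OF SV]] S UU by auto
      then have un: "(\<exists>x\<in>E A'. \<exists>y\<in>E B. op x y \<in> E C) \<and> (\<exists>x\<in>E A'. \<exists>y\<in>E B. op x y \<notin> E C)"
        using C B unfolding undec_def by blast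
      have BY: "E B \<subseteq> E Y" using uf_sub u B by blast
      obtain x y where 1: "x \<in> E A'" "y \<in> E B" "op x y \<in> E C" using un by blast
      obtain x' y' where 2: "x' \<in> E A'" "y' \<in> E B" "op x' y' \<notin> E C" using un by blast
      have "op (ap M q x) y \<in> E D" "op (ap M q x') y' \<notin> E D" using mem 1 2 A' BY by auto
      then show "(\<exists>x\<in>E S. \<exists>y\<in>E B. op x y \<in> E D) \<and> (\<exists>x\<in>E S. \<exists>y\<in>E B. op x y \<notin> E D)" using 1 2 A' by blast
    qed
    then show ?thesis using D by blast
  qed
  ultimately show ?thesis using ufL u(2) u'V w'V UU(1) unfolding bad_def by blast
qed

end

section \<open>The minimal counterexample\<close>

context zfc_gch
begin

text \<open>Compose \<open>q\<close> with an injection of \<open>L\<close> into \<open>K\<close>.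
  Were the result bounded by some \<open>k\<close> on a set in \<open>W\<close>, the image of that
  set would inject below a larger \<open>k'\<close>; but by \<open>unif\<close> this image is as
  large as \<open>L\<close> and hence as \<open>K\<close>, contradicting initiality.\<close>

lemma unb_of_uniform:
  assumes u: "uf Y W" and B: "B \<in> E W" and q: "q \<in> V" and L: "L \<in> V" "E L = ap M q ` E B"
    and unif: "\<And>B' L'. B' \<in> E W \<Longrightarrow> L' \<in> V \<Longrightarrow> E L' = ap M q ` E B' \<Longrightarrow> card_le M L L'"
    and K: "init K r" "nomax K r" and LK: "card_le M L K" "card_le M K L"
  shows "\<exists>h. unb Y W K r h"
proof -
  have wK: "wo K r" and iK: "\<And>k. k \<in> E K \<Longrightarrow> \<not> card_le M K (Ini K r k)" using K unfolding init_def by auto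
  note KV = wo_V[OF wK] and WV = uf_V[OF u]
  have BV: "B \<in> V" and BY: "E B \<subseteq> E Y" using B E_V uf_sub[OF u B] by auto
  obtain i where i: "i \<in> V" "i \<in> funs M L" "\<forall>l\<in>E L. ap M i l \<in> E K"
    "\<forall>l\<in>E L. \<forall>l'\<in>E L. ap M i l = ap M i l' \<longrightarrow> l = l'" using LK(1) by (rule card_leE)
  obtain k0 where k0: "k0 \<in> E K" using K(2) unfolding nomax_def by blast
  \<comment> \<open>The value \<open>k0\<close> off \<open>B\<close> serves to make \<open>h\<close>
    total into \<open>K\<close>.\<close>
  define h where "h = Lam M Y (\<lambda>y. if y \<in> E B then ap M i (ap M q y) else k0)"
  have dh: "dft M (\<lambda>e. if e 0 \<in> E B then ap M i (ap M q (e 0)) else k0)" by (intro dfns BV i q E_V[OF k0])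
  have hV: "h \<in> V" unfolding h_def by (rule Lam_V[OF WV(1) dh])
  have hap: "ap M h y = (if y \<in> E B then ap M i (ap M q y) else k0)" if "y \<in> E Y" for y
    unfolding h_def by (rule ap_Lam[OF WV(1) dh that])
  have "unb Y W K r h" unfolding unb_def
  proof (intro conjI ballI hV)
    show "ap M h y \<in> E K" if "y \<in> E Y" for y using hap[OF that] i(3) L(2) k0 by auto
    fix k assume k: "k \<in> E K"
    have kV: "k \<in> V" using k E_V by blast
    have d: "dfn M (\<lambda>e. lt r k (ap M h (e 0)))" "dfn M (\<lambda>e. \<not> lt r k (ap M h (e 0)))" "dfn M (\<lambda>e. e 0 \<in> E B)"
      "dfn M (\<lambda>e. e 0 \<in> E B \<and> \<not> lt r k (ap M h (e 0)))"
      by (intro dfns KV kV hV BV)+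
    show "almost M W Y (\<lambda>y. lt r k (ap M h y))"
    proof (rule ccontr)
      assume "\<not> ?thesis"
      then have "almost M W Y (\<lambda>y. y \<in> E B \<and> \<not> lt r k (ap M h y))"
        unfolding al_conj[OF u d(3,2)] al_not[OF u d(1)] using al_mem[OF u BV BY] B by blast
      then have B': "Sep M Y (\<lambda>y. y \<in> E B \<and> \<not> lt r k (ap M h y)) \<in> E W" using al_iff[OF WV(1) d(4)] by blast
      define B2 where "B2 = Sep M Y (\<lambda>y. y \<in> E B \<and> \<not> lt r k (ap M h y))"
      have B2: "B2 \<in> V" "E B2 = {y \<in> E Y. y \<in> E B \<and> \<not> lt r k (ap M h y)}"
        unfolding B2_def by (rule Sep_V[OF WV(1) d(4)], rule E_Sep[OF WV(1) d(4)])
      have "isset M ((ap M q) ` E B2)" by (rule isset_image[OF B2(1)]) (intro dfns q)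
      then obtain L' where L': "L' \<in> V" "E L' = ap M q ` E B2" unfolding isset_def by blast
      have LL: "card_le M L L'" using unif[OF B'[folded B2_def] L'] .
      obtain k' where k': "k' \<in> E K" "lt r k k'" using K(2) k unfolding nomax_def by blast
      have "card_le M L' (Ini K r k')"
      proof (rule card_leI[where t="ap M i"])
        show "dft M (\<lambda>e. ap M i (e 0))" by (intro dfns i)
        have LB: "E L' \<subseteq> E L" using L' L B2 by auto
        fix l assume l: "l \<in> E L'"
        then obtain y where y: "y \<in> E B2" "l = ap M q y" using L' by blast
        have iK': "ap M i l \<in> E K" using l LB i(3) by blast
        have "\<not> lt r k (ap M i l)" using y B2 hap by auto
        then have "lt r (ap M i l) k'"
          using wo_total[OF wK iK' k] k'(2) wf_trans[OF wo_wf[OF wK] _ k'(2) iK' k k'(1)] by blast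
        then show "ap M i l \<in> E (Ini K r k')" using iK' KV E_V[OF k'(1)] by simp
        fix l2 assume "l2 \<in> E L'" "ap M i l = ap M i l2"
        then show "l = l2" using l LB i(4) by blast
      qed (rule L')
      then have "card_le M K (Ini K r k')"
        using card_le_trans[OF LK(2) card_le_trans[OF LL]] L(1) KV by blast
      then show False using iK[OF k'(1)] by blast
    qed
  qed
  then show ?thesis by blast
qed

theorem no_bad: "\<not> bad X0 U0 Y0 W0"
proof
  assume b0: "bad X0 U0 Y0 W0"
  \<comment> \<open>Minimality is demanded over all configurations with first base set
    \<open>X\<close>, including those with the roles of the two ultrafilters exchanged.\<close>
  have dP: "dfn M (\<lambda>e. \<exists>U\<in>V. \<exists>Y\<in>V. \<exists>W\<in>V. bad (e 0) U Y W)"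
    by (intro dfns dfn_bad)
  have "X0 \<in> V" "\<exists>U\<in>V. \<exists>Y\<in>V. \<exists>W\<in>V. bad X0 U Y W" using b0 uf_V unfolding bad_def by blast+
  from min_card[OF dP this]
  obtain X U Y W where XV: "X \<in> V" and b: "bad X U Y W"
    and min0: "\<forall>S'\<in>V. (\<exists>U\<in>V. \<exists>Y\<in>V. \<exists>W\<in>V. bad S' U Y W) \<longrightarrow> card_le M X S'" by blast
  have min: "card_le M X X'" if "bad X' U' Y' W'" for X' U' Y' W'
  proof -
    have "X' \<in> V" "U' \<in> V" "Y' \<in> V" "W' \<in> V" using that uf_V unfolding bad_def by blast+
    then show ?thesis using min0 that by blast
  qed
  obtain u w C where u: "uf X U" "uf Y W" and uV: "u \<in> V" and cu: "capw X U Y W u" and wV: "w \<in> V" and cw: "capw Y W X U w"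
    and CV: "C \<in> V" and C: "undec U W C" using b unfolding bad_def by blast
  note UV = uf_V[OF u(1)] and WV = uf_V[OF u(2)]
  \<comment> \<open>Restricting \<open>U\<close> to \<open>A\<close> is an instance of
    \<open>push\<close> along the identity, so uniformity of \<open>U\<close> is minimality of
    \<open>X\<close>.\<close>
  have unifU: "card_le M X A" if A: "A \<in> E U" for A
  proof -
    have AV: "A \<in> V" using A E_V by blast
    define q where "q = Lam M X (\<lambda>x. x)"
    have d: "dft M (\<lambda>e. e 0)" by (intro dfns)
    have qV: "q \<in> V" unfolding q_def by (rule Lam_V[OF XV d])
    have qap: "ap M q x = x" if "x \<in> E X" for x unfolding q_def by (rule ap_Lam[OF XV d that])
    have AX: "E A \<subseteq> E X" by (rule uf_sub[OF u(1) A])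
    have "\<exists>U'\<in>V. bad A U' Y W"
    proof (rule push[OF u uV wV CV qV AV cu cw C A])
      show "E A = ap M q ` E A" using qap AX by force
      fix x x' assume x: "x \<in> E A" "x' \<in> E A" "ap M q x = ap M q x'"
      then have "x = x'" using qap[OF subsetD[OF AX x(1)]] qap[OF subsetD[OF AX x(2)]] by simp
      then show "ap M w x = ap M w x' \<and> (\<forall>y\<in>E Y. op x y \<in> E C \<longleftrightarrow> op x' y \<in> E C)" by simp
    qed
    then show ?thesis using min by blast
  qed
  obtain r where r: "init X r" using ex_init[OF XV] by blast
  then have wX: "wo X r" and iX: "\<And>k. k \<in> E X \<Longrightarrow> \<not> card_le M X (Ini X r k)" unfolding init_def by auto
  note rV = wo_V(2)[OF wX]
  have Ini: "Ini X r k \<in> V" "E (Ini X r k) = {j \<in> E X. lt r j k}" if "k \<in> E X" for k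
    using that E_V XV rV by auto
  have nIni: "Ini X r k \<notin> E U" if "k \<in> E X" for k using unifU iX[OF that] by blast
  have nmX: "nomax X r"
  proof (rule ccontr)
    obtain x0 where x0: "x0 \<in> E X" using al_ex[OF u(1) al_all[OF u(1), of "\<lambda>_. True"]] by blast
    assume "\<not> nomax X r"
    then obtain m where m: "m \<in> E X" "\<forall>y\<in>E X. \<not> lt r m y" using x0 unfolding nomax_def by blast
    have mV: "m \<in> V" using m E_V by blast
    have dm: "dfn M (\<lambda>e. e 0 \<in> E (Ini X r m))" "dfn M (\<lambda>e. e 0 = m)" "dfn M (\<lambda>e. op m (e 0) \<in> E C)"
      "dfn M (\<lambda>e. \<not> op m (e 0) \<in> E C)"
      by (intro dfns Ini m mV CV)+
    have "\<not> almost M U X (\<lambda>x. x \<in> E (Ini X r m))"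
      using al_mem[OF u(1) Ini(1)[OF m(1)]] Ini(2)[OF m(1)] nIni[OF m(1)] by auto
    then have "almost M U X (\<lambda>x. \<not> x \<in> E (Ini X r m))" using al_not[OF u(1) dm(1)] by blast
    then have "almost M U X (\<lambda>x. x = m)"
    proof (rule al_mono[OF u(1) _ dm(2)])
      fix x assume "x \<in> E X" "\<not> x \<in> E (Ini X r m)"
      then show "x = m" using Ini(2)[OF m(1)] wo_total[OF wX _ m(1), of x] m(2) by blast
    qed
    then have A: "Sep M X (\<lambda>x. x = m) \<in> E U" using al_iff[OF XV dm(2)] by blast
    \<comment> \<open>A maximum would make \<open>U\<close> principal at \<open>m\<close>, and then
      the singleton of \<open>m\<close> times a suitable section in \<open>W\<close> decides
      \<open>C\<close>.\<close>
    have AE: "E (Sep M X (\<lambda>x. x = m)) = {m}" using E_Sep[OF XV dm(2)] m by auto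
    show False
    proof (cases "almost M W Y (\<lambda>y. op m y \<in> E C)")
      case True
      then have "Sep M Y (\<lambda>y. op m y \<in> E C) \<in> E W" using al_iff[OF WV(1) dm(3)] by blast
      then show False using C A AE E_Sep[OF WV(1) dm(3)] unfolding undec_def by force
    next
      case False
      then have "almost M W Y (\<lambda>y. \<not> op m y \<in> E C)" using al_not[OF u(2) dm(3)] by blast
      then have "Sep M Y (\<lambda>y. \<not> op m y \<in> E C) \<in> E W" using al_iff[OF WV(1) dm(4)] by blast
      then show False using C A AE E_Sep[OF WV(1) dm(4)] unfolding undec_def by force
    qed
  qed
  have infX: "infi X" using nomax_infi wX nmX by blast
  have unbU: "almost M U X (\<lambda>x. lt r k x)" if k: "k \<in> E X" for k
  proof (rule ccontr)
    assume na: "\<not> ?thesis"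
    have kV: "k \<in> V" using k E_V by blast
    have d: "dfn M (\<lambda>e. lt r k (e 0))" by (intro dfns rV kV)
    obtain k' where k': "k' \<in> E X" "lt r k k'" using nmX k unfolding nomax_def by blast
    have d': "dfn M (\<lambda>e. e 0 \<in> E (Ini X r k'))" by (intro dfns Ini k')
    have "almost M U X (\<lambda>x. \<not> lt r k x)" using na al_not[OF u(1) d] by blast
    then have "almost M U X (\<lambda>x. x \<in> E (Ini X r k'))"
    proof (rule al_mono[OF u(1) _ d'])
      fix x assume x: "x \<in> E X" "\<not> lt r k x"
      then show "x \<in> E (Ini X r k')"
        using Ini(2)[OF k'(1)] wo_total[OF wX x(1) k] k' wf_trans[OF wo_wf[OF wX] _ k'(2) x(1) k k'(1)] by blast
    qed
    then show False using al_mem[OF u(1) Ini(1)[OF k'(1)]] Ini(2)[OF k'(1)] nIni[OF k'(1)] by auto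
  qed
  have S0: "\<not> unb Y W X r h" for h
  proof
    assume "unb Y W X r h"
    then show False unfolding unb_def using liar[OF u uV wV _ cu cw wX _ unbU] by blast
  qed
  let ?P1 = "Pw X" let ?P2 = "Pw ?P1"
  have PV: "?P1 \<in> V" "?P2 \<in> V" using XV by auto
  obtain r1 where r1: "init ?P1 r1" using ex_init[OF PV(1)] by blast
  obtain r2 where r2: "init ?P2 r2" using ex_init[OF PV(2)] by blast
  have refl: "card_le M S S" if "S \<in> V" for S by (rule card_le_subset[OF that]) simp
  have nm1: "nomax ?P1 r1" and reg1: "reg ?P1 r1"
    using init_nomax[OF XV infX r1 refl[OF PV(1)] cantor[OF XV]] init_reg[OF XV infX r1 refl[OF PV(1)] cantor[OF XV]] by auto
  have inf1: "infi ?P1" using nomax_infi r1 nm1 unfolding init_def by blast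
  have nm2: "nomax ?P2 r2" using init_nomax[OF PV(1) inf1 r2 refl[OF PV(2)] cantor[OF PV(1)]] .
  have inf2: "infi ?P2" using nomax_infi r2 nm2 unfolding init_def by blast
  \<comment> \<open>For regular \<open>X\<close> the descent leads to \<open>S0\<close>. Otherwise
    \<open>X\<close> is a strong limit, and the coverings of size below \<open>X\<close> that remain
    are refuted by the second liar set.\<close>
  have S1: "\<not> unb Y W ?P1 r1 g" for g
  proof
    assume g: "unb Y W ?P1 r1 g"
    show False
    proof (cases "reg X r")
      case True then show False using kunen_prikry_reg[OF r nmX True r1 g u(2)] S0 by blast
    next
      case False
      then have big: "\<And>k. k \<in> E X \<Longrightarrow> \<not> card_le M X (Pw (Ini X r k))" using reg_or_strong_limit[OF r nmX] by blast
      obtain k Z where k: "k \<in> E X" and Z: "Z \<in> V" "\<forall>y\<in>E Y. card_le M (ap M Z y) (Ini X r k)"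
        "\<forall>N\<in>E (Pw X). almost M W Y (\<lambda>y. N \<in> E (ap M Z y))"
        using kunen_prikry[OF r nmX r1 g u(2)] S0 by blast
      have "almost M W Y (\<lambda>y. almost M U X (\<lambda>x. \<exists>x'\<in>E X. lt r x' x \<and> (\<forall>N\<in>E (ap M Z y). x \<in> E N \<longleftrightarrow> x' \<in> E N)))"
        by (rule few_types[OF u Z(1) Ini(1)[OF k] wX unifU bspec[OF Z(2)] big[OF k]])
      then show False using liar_types[OF u wV Z(1) cw wX] Z(3) by blast
    qed
  qed
  have S2: "\<not> unb Y W ?P2 r2 g" for g
    using kunen_prikry_reg[OF r1 nm1 reg1 r2 _ u(2)] S1 by blast
  \<comment> \<open>the map \<open>q\<close> records the witness \<open>u(y)\<close>, cut down to a set of subsets of \<open>X\<close>, and the section of \<open>C\<close>\<close>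
  define un where "un = (\<lambda>y. Sep M ?P1 (\<lambda>S. S \<in> E (ap M u y)))"
  have dun: "dft M (\<lambda>e. un (e 0))" unfolding un_def by (intro dfns PV uV)
  have un: "un y \<in> V" "E (un y) = {S \<in> E ?P1. S \<in> E (ap M u y)}" if "y \<in> V" for y
    unfolding un_def by (rule Sep_V E_Sep, rule PV, intro dfns uV that)+
  define u1 where "u1 = Lam M Y un"
  have u1V: "u1 \<in> V" unfolding u1_def by (rule Lam_V[OF WV(1) dun])
  have u1ap: "ap M u1 y = un y" if "y \<in> E Y" for y unfolding u1_def by (rule ap_Lam[OF WV(1) dun that])
  have cu1: "capw X U Y W u1" unfolding capw_def
  proof
    fix R assume R: "R \<in> V"
    have "almost M W Y (\<lambda>y. almost M (ap M u y) X (\<lambda>x. op x y \<in> E R)) = almost M W Y (\<lambda>y. almost M (ap M u1 y) X (\<lambda>x. op x y \<in> E R))"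
    proof (rule al_cong)
      fix y assume y: "y \<in> E Y"
      have yV: "y \<in> V" using y E_V by blast
      have d: "dfn M (\<lambda>e. op (e 0) y \<in> E R)" by (intro dfns R yV)
      have "Sep M X (\<lambda>x. op x y \<in> E R) \<in> E ?P1" using Sep_V[OF XV d] E_Sep[OF XV d] E_Pw[OF XV] by auto
      then show "almost M (ap M u y) X (\<lambda>x. op x y \<in> E R) = almost M (ap M u1 y) X (\<lambda>x. op x y \<in> E R)"
        unfolding al_iff[OF XV d] u1ap[OF y] un(2)[OF yV] by simp
    qed
    then show "almost M U X (\<lambda>x. almost M W Y (\<lambda>y. op x y \<in> E R)) \<longleftrightarrow> almost M W Y (\<lambda>y. almost M (ap M u1 y) X (\<lambda>x. op x y \<in> E R))"
      using cu R unfolding capw_def by blast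
  qed
  define cs where "cs = (\<lambda>y. Sep M X (\<lambda>x. op x y \<in> E C))"
  have dcs: "dft M (\<lambda>e. cs (e 0))" unfolding cs_def by (intro dfns XV CV)
  have cs: "cs y \<in> V" "E (cs y) = {x \<in> E X. op x y \<in> E C}" if "y \<in> V" for y
    unfolding cs_def by (rule Sep_V E_Sep, rule XV, intro dfns CV that)+
  have dq: "dft M (\<lambda>e. op (un (e 0)) (cs (e 0)))" by (intro dfns dun dcs)
  define q where "q = Lam M Y (\<lambda>y. op (un y) (cs y))"
  have qV: "q \<in> V" unfolding q_def by (rule Lam_V[OF WV(1) dq])
  have qap: "ap M q y = op (un y) (cs y)" if "y \<in> E Y" for y unfolding q_def by (rule ap_Lam[OF WV(1) dq that])
  have CC: "cprod M ?P2 ?P1 \<in> V" "cprod M ?P2 ?P2 \<in> V" using E_cprod PV by auto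
  have qC: "ap M q y \<in> E (cprod M ?P2 ?P1)" if y: "y \<in> E Y" for y
  proof -
    have yV: "y \<in> V" using y E_V by blast
    have "un y \<in> E ?P2" "cs y \<in> E ?P1" using un[OF yV] cs[OF yV] E_Pw[OF PV(1)] E_Pw[OF XV] by auto
    then show ?thesis using qap[OF y] un[OF yV] cs[OF yV] PV by simp
  qed
  \<comment> \<open>The images under \<open>q\<close> of sets in \<open>W\<close>. One of least
    cardinality is taken as \<open>L\<close>, so that the image of \<open>W\<close> on it is
    uniform.\<close>
  define Q where "Q = (\<lambda>L. \<exists>B\<in>E W. \<forall>z\<in>V. z \<in> E L \<longleftrightarrow> (\<exists>y\<in>E B. z = ap M q y))"
  have Qiff: "Q L \<longleftrightarrow> (\<exists>B\<in>E W. E L = ap M q ` E B)" for L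
  proof -
    have "(\<forall>z\<in>V. z \<in> E L \<longleftrightarrow> (\<exists>y\<in>E B. z = ap M q y)) \<longleftrightarrow> E L = ap M q ` E B" if "B \<in> E W" for B
      using E_V ap_V by blast
    then show ?thesis unfolding Q_def by blast
  qed
  have dQ: "dfn M (\<lambda>e. Q (e 0))" unfolding Q_def by (intro dfns WV qV)
  have YW: "Y \<in> E W" using u(2) unfolding is_ultrafilter_def is_filter_def by blast
  have "isset M ((ap M q) ` E Y)" by (rule isset_image[OF WV(1)]) (intro dfns qV)
  then obtain LY where LY: "LY \<in> V" "E LY = ap M q ` E Y" unfolding isset_def by blast
  then have "Q LY" using Qiff YW by blast
  from min_card[OF dQ LY(1) this]
  obtain L B where L: "L \<in> V" "B \<in> E W" "E L = ap M q ` E B" and Lmin: "\<forall>L'\<in>V. Q L' \<longrightarrow> card_le M L L'"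
    unfolding Qiff by blast
  have unifW: "card_le M L L'" if "B' \<in> E W" "L' \<in> V" "E L' = ap M q ` E B'" for B' L'
    using Lmin that Qiff by blast
  have BY: "E B \<subseteq> E Y" by (rule uf_sub[OF u(2) L(2)])
  have XL: "card_le M X L"
  proof -
    define D where "D = Sep M (cprod M Y X) (\<lambda>p. op (sn M p) (fs M p) \<in> E C)"
    have YX: "cprod M Y X \<in> V" using E_cprod UV WV by blast
    have D: "D \<in> V" "E D = {p \<in> E (cprod M Y X). op (sn M p) (fs M p) \<in> E C}"
      unfolding D_def by (rule Sep_V E_Sep, rule YX, intro dfns CV)+
    have mem: "op y x \<in> E D \<longleftrightarrow> op x y \<in> E C" if "x \<in> E X" "y \<in> E Y" for x y
      using that E_V[OF that(1)] E_V[OF that(2)] UV WV unfolding D(2) by auto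
    have "undec W U D" unfolding undec_def
    proof (intro ballI)
      fix B A assume B: "B \<in> E W" and A: "A \<in> E U"
      have "E A \<subseteq> E X" "E B \<subseteq> E Y" using uf_sub u A B by auto
      then show "(\<exists>x\<in>E B. \<exists>y\<in>E A. op x y \<in> E D) \<and> (\<exists>x\<in>E B. \<exists>y\<in>E A. op x y \<notin> E D)"
        using C A B mem unfolding undec_def by (meson subsetD)
    qed
    \<comment> \<open>\<open>push\<close> with the ultrafilters exchanged: now \<open>W\<close> is
      replaced by its image on \<open>L\<close>, and it is \<open>u1\<close> and the sections of the
      transposed set \<open>D\<close> that factor through \<open>q\<close>. Minimality of
      \<open>X\<close> then bounds \<open>L\<close> from below.\<close>
    then have "\<exists>W'\<in>V. bad L W' X U"
    proof (rule push[OF u(2,1) wV u1V D(1) qV L(1) cw cu1 _ L(2) _ L(3)])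
      fix y y' assume y: "y \<in> E B" "y' \<in> E B" "ap M q y = ap M q y'"
      have yY: "y \<in> E Y" "y' \<in> E Y" using y BY by auto
      have yV: "y \<in> V" "y' \<in> V" using yY E_V by auto
      have eq: "un y = un y'" "cs y = cs y'" using y(3) qap yY un(1) cs(1) yV by auto
      have "\<forall>x\<in>E X. op x y \<in> E C \<longleftrightarrow> op x y' \<in> E C" using eq(2) cs(2)[OF yV(1)] cs(2)[OF yV(2)] by auto
      then show "ap M u1 y = ap M u1 y' \<and> (\<forall>x\<in>E X. op y x \<in> E D \<longleftrightarrow> op y' x \<in> E D)"
        using u1ap yY eq(1) mem by auto
    qed
    then show ?thesis using min by blast
  qed
  have LP2: "card_le M L ?P2"
  proof -
    have "E L \<subseteq> E (cprod M ?P2 ?P1)" using L(3) qC BY by auto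
    then have "card_le M L (cprod M ?P2 ?P1)" using card_le_subset L(1) by blast
    moreover have "card_le M ?P1 ?P2"
    proof (rule card_leI[where t="\<lambda>x. the_set M {x}"])
      have sg: "the_set M {x} \<in> V" "E (the_set M {x}) = {x}" if "x \<in> V" for x
        using that by (auto intro: the_set_V isset_sing simp: E_the_set isset_sing)
      show "dft M (\<lambda>e. the_set M {e 0})" by (intro dfns)
      fix x assume x: "x \<in> E ?P1"
      show "the_set M {x} \<in> E ?P2" using sg[OF E_V[OF x]] x E_Pw[OF PV(1)] by auto
      fix y assume y: "y \<in> E ?P1" "the_set M {x} = the_set M {y}"
      have "{x} = E (the_set M {x})" "{y} = E (the_set M {y})" using sg(2)[OF E_V[OF x]] sg(2)[OF E_V[OF y(1)]] by blast+
      then show "x = y" using y(2) by (metis singleton_inject)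
    qed (rule PV)
    then have "card_le M (cprod M ?P2 ?P1) (cprod M ?P2 ?P2)" using card_le_cprod[OF refl[OF PV(2)]] PV by blast
    ultimately show ?thesis using card_le_trans[OF _ card_le_trans[OF _ hessenberg[OF PV(2) inf2]]] L(1) CC by blast
  qed
  have w1: "wo ?P1 r1" using r1 unfolding init_def by blast
  have get: "\<exists>h. unb Y W K s h" if "init K s" "nomax K s" "card_le M L K" "card_le M K L" for K s
    by (rule unb_of_uniform[OF u(2) L(2) qV L(1,3) _ that]) (rule unifW)
  have n0: "\<not> card_le M L X" using get[OF r nmX _ XL] S0 by blast
  have n1: "\<not> (card_le M L ?P1 \<and> card_le M ?P1 L)" using get[OF r1 nm1] S1 by blast
  have n2: "\<not> card_le M ?P2 L" using get[OF r2 nm2 LP2] S2 by blast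
  show False
  \<comment> \<open>GCH between \<open>X\<close> and its power set, and between that and the double
    power set, leaves no further cardinality for \<open>L\<close>.\<close>
  proof (cases "card_le M ?P1 L")
    case True
    then show False using gch[OF inf1 PV(1) L(1) True LP2] n1 n2 by blast
  next
    case False
    then obtain k where k: "k \<in> E ?P1" "card_le M L (Ini ?P1 r1 k)" using compar[OF w1 L(1)] by blast
    have "card_le M (Ini ?P1 r1 k) ?P1" by (rule card_le_subset) (use PV wo_V[OF w1] E_V[OF k(1)] in auto)
    then have "card_le M L ?P1" using card_le_trans[OF k(2)] L(1) by blast
    then show False using gch[OF infX XV L(1) XL] n0 False by blast
  qed
qed

end

section \<open>Functions in an ultrapower\<close>

text \<open>The closure properties of \<open>N\<close> under which equality and membership of classes can be read off
  representatives.  They are checked directly for ultrapowers, which avoids a proof that these satisfy ZFC.\<close>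

locale ultra_base =
  fixes N :: "'b eps_model" and Z D :: 'b
  assumes filt: "is_filter N Z D"
    and int: "a \<in> univ N \<Longrightarrow> b \<in> univ N \<Longrightarrow> isset N (elts N a \<inter> elts N b)"
    and eqs: "f \<in> funs N Z \<Longrightarrow> g \<in> funs N Z \<Longrightarrow> isset N {x \<in> elts N Z. app N f x = app N g x}"
    and mems: "f \<in> funs N Z \<Longrightarrow> g \<in> funs N Z \<Longrightarrow> isset N {x \<in> elts N Z. mem N (app N f x) (app N g x)}"
begin

lemma large_int:
  assumes "large N D S" "large N D T" "isset N R" "S \<inter> T \<subseteq> R" "R \<subseteq> elts N Z"
  shows "large N D R"
proof -
  have "\<exists>a\<in>elts N D. elts N a = S" "\<exists>b\<in>elts N D. elts N b = T"
    using assms(1,2) by (auto simp: large_def)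
  then obtain a b where ab: "a \<in> elts N D" "elts N a = S" "b \<in> elts N D" "elts N b = T" by blast
  then have "a \<in> univ N" "b \<in> univ N" by (auto simp: elts_def)
  from int[OF this] obtain c where c: "c \<in> univ N" "elts N c = elts N a \<inter> elts N b" by (auto simp: isset_def)
  have up1: "\<forall>A\<in>elts N D. \<forall>B\<in>elts N D. \<forall>C\<in>univ N. elts N C = elts N A \<inter> elts N B \<longrightarrow> C \<in> elts N D"
    using filt unfolding is_filter_def by (elim conjE) assumption
  have up2: "\<forall>A\<in>elts N D. \<forall>B\<in>univ N. elts N A \<subseteq> elts N B \<longrightarrow> elts N B \<subseteq> elts N Z \<longrightarrow> B \<in> elts N D"
    using filt unfolding is_filter_def by (elim conjE) assumption
  have cD: "c \<in> elts N D" using up1[rule_format, OF ab(1,3) c] .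
  obtain d where d: "d \<in> univ N" "elts N d = R" using assms(3) by (auto simp: isset_def)
  have "d \<in> elts N D" by (rule up2[rule_format, OF cD d(1)]) (use c(2) d(2) ab assms(4,5) in auto)
  then show ?thesis using d(2) by (auto simp: large_def)
qed

lemma large_all: "large N D {x \<in> elts N Z. app N f x = app N f x}"
proof -
  have "Z \<in> elts N D" using filt unfolding is_filter_def by (elim conjE) assumption
  then show ?thesis by (auto simp: large_def)
qed

lemma class_self: "f \<in> funs N Z \<Longrightarrow> f \<in> ult_class N Z D f"
  using large_all unfolding ult_class_def by auto

lemma class_eq:
  assumes fg: "f \<in> funs N Z" "g \<in> funs N Z"
  shows "ult_class N Z D f = ult_class N Z D g \<longleftrightarrow> large N D {x \<in> elts N Z. app N f x = app N g x}"
proof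
  assume "ult_class N Z D f = ult_class N Z D g"
  then have "g \<in> ult_class N Z D f" using class_self[OF fg(2)] by simp
  then show "large N D {x \<in> elts N Z. app N f x = app N g x}" unfolding ult_class_def by simp
next
  assume l: "large N D {x \<in> elts N Z. app N f x = app N g x}"
  have "large N D {x \<in> elts N Z. app N f x = app N h x} \<longleftrightarrow> large N D {x \<in> elts N Z. app N g x = app N h x}"
    if h: "h \<in> funs N Z" for h
  proof
    assume "large N D {x \<in> elts N Z. app N f x = app N h x}"
    then show "large N D {x \<in> elts N Z. app N g x = app N h x}"
      by (rule large_int[OF l _ eqs[OF fg(2) h]]) auto
  next
    assume "large N D {x \<in> elts N Z. app N g x = app N h x}"
    then show "large N D {x \<in> elts N Z. app N f x = app N h x}"
      by (rule large_int[OF l _ eqs[OF fg(1) h]]) auto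
  qed
  then show "ult_class N Z D f = ult_class N Z D g" unfolding ult_class_def by auto
qed

lemma class_mem:
  assumes fg: "f \<in> funs N Z" "g \<in> funs N Z"
  shows "mem (ult N Z D) (ult_class N Z D f) (ult_class N Z D g) \<longleftrightarrow>
    large N D {x \<in> elts N Z. mem N (app N f x) (app N g x)}"
proof
  assume "mem (ult N Z D) (ult_class N Z D f) (ult_class N Z D g)"
  then obtain f' g' where f': "f' \<in> ult_class N Z D f" "g' \<in> ult_class N Z D g"
    and l: "large N D {x \<in> elts N Z. mem N (app N f' x) (app N g' x)}" unfolding ult_def by auto
  have fF: "f' \<in> funs N Z" "large N D {x \<in> elts N Z. app N f x = app N f' x}"
    and gF: "g' \<in> funs N Z" "large N D {x \<in> elts N Z. app N g x = app N g' x}"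
    using f' unfolding ult_class_def by auto
  have "large N D {x \<in> elts N Z. mem N (app N f x) (app N g' x)}"
    by (rule large_int[OF l fF(2) mems[OF fg(1) gF(1)]]) auto
  then show "large N D {x \<in> elts N Z. mem N (app N f x) (app N g x)}"
    by (rule large_int[OF _ gF(2) mems[OF fg]]) auto
next
  assume "large N D {x \<in> elts N Z. mem N (app N f x) (app N g x)}"
  then show "mem (ult N Z D) (ult_class N Z D f) (ult_class N Z D g)"
    using class_self fg unfolding ult_def by auto
qed

end

section \<open>Los's theorem for the formulas at hand\<close>

locale zfc_ult = zfc +
  fixes Y W :: 'a
  assumes uf: "is_ultrafilter M Y W"
begin

abbreviation "N \<equiv> ult M Y W"
abbreviation "cl \<equiv> ult_class M Y W"
abbreviation "FY \<equiv> funs M Y"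
abbreviation "aW P \<equiv> almost M W Y P"

lemma YV: "Y \<in> V" and WV: "W \<in> V" using uf_V uf by auto

lemma base: "ultra_base M Y W"
proof
  show "is_filter M Y W" using uf unfolding is_ultrafilter_def by blast
  show "isset M (E a \<inter> E b)" if "a \<in> V" "b \<in> V" for a b
  proof -
    have "isset M {x \<in> E a. x \<in> E b}" by (rule isset_sep, rule that, intro dfns that)
    then show ?thesis by (simp add: Int_def)
  qed
  fix f g assume fg: "f \<in> FY" "g \<in> FY"
  have "isset M {x \<in> E Y. ap M f x = ap M g x}" by (rule isset_sep, rule YV, intro dfns fg[THEN funs_V])
  moreover have "{x \<in> E Y. ap M f x = ap M g x} = {x \<in> E Y. app M f x = app M g x}" using ap_app fg by auto
  ultimately show "isset M {x \<in> E Y. app M f x = app M g x}" by simp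
  have "isset M {x \<in> E Y. ap M f x \<in> E (ap M g x)}" by (rule isset_sep, rule YV, intro dfns fg[THEN funs_V])
  moreover have "{x \<in> E Y. ap M f x \<in> E (ap M g x)} = {x \<in> E Y. mem M (app M f x) (app M g x)}"
    using ap_app fg ap_V E_V unfolding elts_def by (metis (no_types, lifting) mem_Collect_eq)
  ultimately show "isset M {x \<in> E Y. mem M (app M f x) (app M g x)}" by simp
qed

lemma cl_eq:
  assumes "F \<in> FY" "G \<in> FY" shows "cl F = cl G \<longleftrightarrow> aW (\<lambda>y. ap M F y = ap M G y)"
proof -
  have "{x \<in> E Y. ap M F x = ap M G x} = {x \<in> E Y. app M F x = app M G x}" using ap_app assms by auto
  then show ?thesis using ultra_base.class_eq[OF base assms] unfolding almost_def by simp
qed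

lemma cl_mem:
  assumes "F \<in> FY" "G \<in> FY" shows "mem N (cl F) (cl G) \<longleftrightarrow> aW (\<lambda>y. ap M F y \<in> E (ap M G y))"
proof -
  have "{x \<in> E Y. ap M F x \<in> E (ap M G x)} = {x \<in> E Y. mem M (app M F x) (app M G x)}"
    using ap_app assms ap_V E_V unfolding elts_def by (metis (no_types, lifting) mem_Collect_eq)
  then show ?thesis using ultra_base.class_mem[OF base assms] unfolding almost_def by simp
qed

lemma univ_N: "univ N = cl ` FY" by (simp add: ult_def)

lemma cl_univ [simp]: "F \<in> FY \<Longrightarrow> cl F \<in> univ N" by (simp add: univ_N)

lemma univ_E: assumes "a \<in> univ N" obtains F where "F \<in> FY" "a = cl F" using assms univ_N by auto

lemma elts_cl: "F \<in> FY \<Longrightarrow> G \<in> FY \<Longrightarrow> cl F \<in> elts N (cl G) \<longleftrightarrow> aW (\<lambda>y. ap M F y \<in> E (ap M G y))"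
  using cl_mem unfolding elts_def[of N] by simp

lemma eltsE: assumes "a \<in> elts N b" obtains F where "F \<in> FY" "a = cl F" using assms univ_E unfolding elts_def by blast

lemma LamF [simp]: "dft M (\<lambda>e. t (e 0)) \<Longrightarrow> Lam M Y t \<in> FY"
  using Lam_funs YV by blast

text \<open>The existential step of Los's theorem: witnesses are chosen simultaneously from the
  union \<open>B\<close> of all the sets \<open>H y\<close>.\<close>

lemma los_ex:
  assumes H: "dft M (\<lambda>e. H (e 0))" and Q: "dfn M (\<lambda>e. Q (e 0) (e 1))"
    and al: "aW (\<lambda>y. \<exists>z\<in>E (H y). Q y z)"
  shows "\<exists>F\<in>FY. aW (\<lambda>y. ap M F y \<in> E (H y) \<and> Q y (ap M F y))"
proof -
  have Q': "dfn M (\<lambda>e. Q (e i) (e j))" for i j by (rule dfn2_subst[OF Q]) (intro dfns)+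
  have H': "dft M (\<lambda>e. H (e i))" for i by (rule dft1_subst[OF H]) (intro dfns)
  obtain I where I: "I \<in> V" "E I = H ` E Y" using isset_image[OF YV H] unfolding isset_def by blast
  obtain B where B: "B \<in> V" "E B = (\<Union>x\<in>E I. E x)" using Un_E[OF I(1)] by blast
  obtain y0 z0 where z0: "y0 \<in> E Y" "z0 \<in> E (H y0)" using al_ex[OF uf al] by blast
  have HB: "z \<in> E B" if "y \<in> E Y" "z \<in> E (H y)" for y z using that B I by blast
  \<comment> \<open>The implication lets indices without a witness take an arbitrary value in
    \<open>B\<close>, which is nonempty because of \<open>z0\<close>.\<close>
  have d: "dfn M (\<lambda>e. (\<exists>z\<in>E (H (e 0)). Q (e 0) z) \<longrightarrow> e 1 \<in> E (H (e 0)) \<and> Q (e 0) (e 1))"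
    by (intro dfns H' Q')
  have "\<exists>z\<in>E B. (\<exists>z\<in>E (H y). Q y z) \<longrightarrow> z \<in> E (H y) \<and> Q y z" if "y \<in> E Y" for y
    using HB that z0 by blast
  from choice[OF YV B(1) d this]
  obtain F where F: "F \<in> FY" "\<forall>y\<in>E Y. (\<exists>z\<in>E (H y). Q y z) \<longrightarrow> ap M F y \<in> E (H y) \<and> Q y (ap M F y)" by blast
  have dF: "dft M (\<lambda>e. ap M F (e 0))" by (intro dfns funs_V[OF F(1)])
  have "dfn M (\<lambda>e. ap M F (e 0) \<in> E (H (e 0)) \<and> Q (e 0) (ap M F (e 0)))"
    by (intro dfns H' dF dfn2_subst[OF Q])
  from al_mono[OF uf al this] show ?thesis using F by blast
qed

text \<open>If inclusion fails almost everywhere, \<open>los_ex\<close> assembles the pointwise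
  counterexamples into an element of the ultrapower. Extensionality \<open>extN\<close> follows from
  this.\<close>

lemma elts_sub:
  assumes F: "F \<in> FY" "G \<in> FY"
  shows "elts N (cl F) \<subseteq> elts N (cl G) \<longleftrightarrow> aW (\<lambda>y. E (ap M F y) \<subseteq> E (ap M G y))"
proof
  note FV = F[THEN funs_V]
  assume sub: "elts N (cl F) \<subseteq> elts N (cl G)"
  show "aW (\<lambda>y. E (ap M F y) \<subseteq> E (ap M G y))"
  proof (rule ccontr)
    assume n: "\<not> ?thesis"
    have d: "dfn M (\<lambda>e. E (ap M F (e 0)) \<subseteq> E (ap M G (e 0)))" by (intro dfns FV)
    have "aW (\<lambda>y. \<not> E (ap M F y) \<subseteq> E (ap M G y))" using n al_not[OF uf d] by blast
    then have 1: "aW (\<lambda>y. \<exists>z\<in>E (ap M F y). z \<notin> E (ap M G y))" by (simp add: subset_iff Bex_def)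
    have d1: "dft M (\<lambda>e. ap M F (e 0))" "dfn M (\<lambda>e. e 1 \<notin> E (ap M G (e 0)))" by (intro dfns FV)+
    from los_ex[OF d1 1] obtain H where H: "H \<in> FY" "aW (\<lambda>y. ap M H y \<in> E (ap M F y) \<and> ap M H y \<notin> E (ap M G y))" by blast
    have HV: "H \<in> V" using H funs_V by blast
    have d2: "dfn M (\<lambda>e. ap M H (e 0) \<in> E (ap M F (e 0)))" "dfn M (\<lambda>e. ap M H (e 0) \<in> E (ap M G (e 0)))"
      "dfn M (\<lambda>e. ap M H (e 0) \<notin> E (ap M G (e 0)))" by (intro dfns FV HV)+
    have "aW (\<lambda>y. ap M H y \<in> E (ap M F y))" "\<not> aW (\<lambda>y. ap M H y \<in> E (ap M G y))"
      using H(2) unfolding al_conj[OF uf d2(1,3)] al_not[OF uf d2(2)] by auto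
    then show False using sub elts_cl H(1) F by blast
  qed
next
  note FV = F[THEN funs_V]
  assume s: "aW (\<lambda>y. E (ap M F y) \<subseteq> E (ap M G y))"
  show "elts N (cl F) \<subseteq> elts N (cl G)"
  proof
    fix a assume a: "a \<in> elts N (cl F)"
    then obtain H where H: "H \<in> FY" "a = cl H" by (rule eltsE)
    have HV: "H \<in> V" using H funs_V by blast
    have d2: "dfn M (\<lambda>e. ap M H (e 0) \<in> E (ap M F (e 0)))" "dfn M (\<lambda>e. ap M H (e 0) \<in> E (ap M G (e 0)))"
      "dfn M (\<lambda>e. E (ap M F (e 0)) \<subseteq> E (ap M G (e 0)))" by (intro dfns FV HV)+
    have "aW (\<lambda>y. E (ap M F y) \<subseteq> E (ap M G y) \<and> ap M H y \<in> E (ap M F y))"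
      unfolding al_conj[OF uf d2(3,1)] using s a H elts_cl F by blast
    then have "aW (\<lambda>y. ap M H y \<in> E (ap M G y))" by (rule al_mono[OF uf _ d2(2)]) blast
    then show "a \<in> elts N (cl G)" using H elts_cl F by blast
  qed
qed

lemma extN: assumes "a \<in> univ N" "b \<in> univ N" "elts N a = elts N b" shows "a = b"
proof -
  obtain F G where F: "F \<in> FY" "a = cl F" "G \<in> FY" "b = cl G" using assms univ_E by metis
  note FV = F(1,3)[THEN funs_V]
  have "aW (\<lambda>y. E (ap M F y) \<subseteq> E (ap M G y))" "aW (\<lambda>y. E (ap M G y) \<subseteq> E (ap M F y))"
    using elts_sub F assms(3) by blast+
  moreover have d: "dfn M (\<lambda>e. E (ap M F (e 0)) \<subseteq> E (ap M G (e 0)))" "dfn M (\<lambda>e. E (ap M G (e 0)) \<subseteq> E (ap M F (e 0)))"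
     "dfn M (\<lambda>e. ap M F (e 0) = ap M G (e 0))" by (intro dfns FV)+
  ultimately have "aW (\<lambda>y. E (ap M F y) \<subseteq> E (ap M G y) \<and> E (ap M G y) \<subseteq> E (ap M F y))" using al_conj[OF uf d(1,2)] by blast
  then have "aW (\<lambda>y. ap M F y = ap M G y)"
    by (rule al_mono[OF uf _ d(3)]) (use ext ap_V E_V in blast)
  then show ?thesis using cl_eq F by blast
qed

lemma the_set_N: assumes "c \<in> univ N" "elts N c = S" shows "the_set N S = c"
  unfolding the_set_def by (rule the_equality) (use assms extN in auto)

lemma pair_N:
  assumes F: "F \<in> FY" "G \<in> FY"
  shows "the_set N {cl F, cl G} = cl (Lam M Y (\<lambda>y. the_set M {ap M F y, ap M G y}))"
proof -
  note FV = F[THEN funs_V]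
  let ?t = "\<lambda>y. the_set M {ap M F y, ap M G y}"
  have dt: "dft M (\<lambda>e. ?t (e 0))" by (intro dfns FV)
  have tE: "E (?t y) = {ap M F y, ap M G y}" if "y \<in> E Y" for y
    using that E_V ap_V by (intro E_the_set isset_pair) auto
  have key: "cl H \<in> elts N (cl (Lam M Y ?t)) \<longleftrightarrow> cl H = cl F \<or> cl H = cl G" if H: "H \<in> FY" for H
  proof -
    have HV: "H \<in> V" using H funs_V by blast
    have d: "dfn M (\<lambda>e. ap M H (e 0) = ap M F (e 0))" "dfn M (\<lambda>e. ap M H (e 0) = ap M G (e 0))"
      "dfn M (\<lambda>e. \<not> ap M H (e 0) = ap M F (e 0))" "dfn M (\<lambda>e. \<not> ap M H (e 0) = ap M G (e 0))"
      "dfn M (\<lambda>e. ap M H (e 0) = ap M F (e 0) \<or> ap M H (e 0) = ap M G (e 0))"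
      by (intro dfns FV HV)+
    have "cl H \<in> elts N (cl (Lam M Y ?t)) \<longleftrightarrow> aW (\<lambda>y. ap M H y = ap M F y \<or> ap M H y = ap M G y)"
      unfolding elts_cl[OF H LamF[OF dt]] by (rule al_cong) (simp add: ap_Lam[OF YV dt] tE)
    also have "\<dots> \<longleftrightarrow> \<not> aW (\<lambda>y. \<not> ap M H y = ap M F y \<and> \<not> ap M H y = ap M G y)"
      using al_not[OF uf d(5)] by (simp add: de_Morgan_disj)
    also have "\<dots> \<longleftrightarrow> aW (\<lambda>y. ap M H y = ap M F y) \<or> aW (\<lambda>y. ap M H y = ap M G y)"
      unfolding al_conj[OF uf d(3,4)] al_not[OF uf d(1)] al_not[OF uf d(2)] by blast
    finally show ?thesis using cl_eq H F by blast
  qed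
  show ?thesis
  proof (rule the_set_N)
    show "elts N (cl (Lam M Y ?t)) = {cl F, cl G}"
    proof (intro set_eqI iffI)
      fix a assume a: "a \<in> elts N (cl (Lam M Y ?t))"
      then obtain H where "H \<in> FY" "a = cl H" by (rule eltsE)
      then show "a \<in> {cl F, cl G}" using key a by blast
    next
      fix a assume "a \<in> {cl F, cl G}" then show "a \<in> elts N (cl (Lam M Y ?t))" using key F by blast
    qed
  qed (use LamF[OF dt] in simp)
qed

lemma opair_N:
  assumes F: "F \<in> FY" "G \<in> FY"
  shows "opair N (cl F) (cl G) = cl (Lam M Y (\<lambda>y. op (ap M F y) (ap M G y)))"
proof -
  note FV = F[THEN funs_V]
  let ?s = "\<lambda>y. the_set M {ap M F y, ap M F y}" and ?t = "\<lambda>y. the_set M {ap M F y, ap M G y}"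
  have d: "dft M (\<lambda>e. ?s (e 0))" "dft M (\<lambda>e. ?t (e 0))" by (intro dfns FV)+
  have d': "dft M (\<lambda>e. the_set M {ap M (Lam M Y ?s) (e 0), ap M (Lam M Y ?t) (e 0)})" by (intro dfns Lam_V[OF YV] d)
  have d'': "dft M (\<lambda>e. op (ap M F (e 0)) (ap M G (e 0)))" by (intro dfns FV)
  have "opair N (cl F) (cl G) = the_set N {the_set N {cl F, cl F}, the_set N {cl F, cl G}}" by (simp add: opair_def)
  also have "\<dots> = the_set N {cl (Lam M Y ?s), cl (Lam M Y ?t)}" using pair_N[OF F] pair_N[OF F(1) F(1)] by simp
  also have "\<dots> = cl (Lam M Y (\<lambda>y. the_set M {ap M (Lam M Y ?s) y, ap M (Lam M Y ?t) y}))"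
    by (rule pair_N) (use d LamF in auto)
  also have "\<dots> = cl (Lam M Y (\<lambda>y. op (ap M F y) (ap M G y)))"
    unfolding cl_eq[OF LamF[OF d'] LamF[OF d'']]
  proof (rule al_all[OF uf])
    fix y assume y: "y \<in> E Y"
    show "ap M (Lam M Y (\<lambda>y. the_set M {ap M (Lam M Y ?s) y, ap M (Lam M Y ?t) y})) y =
       ap M (Lam M Y (\<lambda>y. op (ap M F y) (ap M G y))) y"
      unfolding ap_Lam[OF YV d' y] ap_Lam[OF YV d'' y] ap_Lam[OF YV d(1) y] ap_Lam[OF YV d(2) y]
      by (simp add: opair_def)
  qed
  finally show ?thesis .
qed

lemma opair_elts:
  assumes "F \<in> FY" "G \<in> FY" "H \<in> FY"
  shows "opair N (cl F) (cl G) \<in> elts N (cl H) \<longleftrightarrow> aW (\<lambda>y. op (ap M F y) (ap M G y) \<in> E (ap M H y))"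
proof -
  have d: "dft M (\<lambda>e. op (ap M F (e 0)) (ap M G (e 0)))" by (intro dfns assms[THEN funs_V])
  show ?thesis unfolding opair_N[OF assms(1,2)] elts_cl[OF LamF[OF d] assms(3)]
    by (rule al_cong) (simp add: ap_Lam[OF YV d])
qed

text \<open>Los's theorem for function application. It is stated with the graph because
  \<open>app\<close> is a description: the equivalence supplies existence and uniqueness of the
  value at once.\<close>

lemma app_term:
  assumes F: "F \<in> FY" "G \<in> FY" "z \<in> FY" and f: "aW (\<lambda>y. ap M F y \<in> funs M (ap M z y))" and g: "aW (\<lambda>y. ap M G y \<in> E (ap M z y))"
    and H: "H \<in> FY"
  shows "opair N (cl G) (cl H) \<in> elts N (cl F) \<longleftrightarrow> cl H = cl (Lam M Y (\<lambda>y. ap M (ap M F y) (ap M G y)))"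
proof -
  note FV = F[THEN funs_V] H[THEN funs_V]
  have d: "dft M (\<lambda>e. ap M (ap M F (e 0)) (ap M G (e 0)))" by (intro dfns FV)
  have df: "dfn M (\<lambda>e. ap M F (e 0) \<in> funs M (ap M z (e 0)))" "dfn M (\<lambda>e. ap M G (e 0) \<in> E (ap M z (e 0)))"
    "dfn M (\<lambda>e. ap M F (e 0) \<in> funs M (ap M z (e 0)) \<and> ap M G (e 0) \<in> E (ap M z (e 0)))" by (intro dfns FV)+
  have fg: "aW (\<lambda>y. ap M F y \<in> funs M (ap M z y) \<and> ap M G y \<in> E (ap M z y))" unfolding al_conj[OF uf df(1,2)] using f g by blast
  have "opair N (cl G) (cl H) \<in> elts N (cl F) \<longleftrightarrow> aW (\<lambda>y. op (ap M G y) (ap M H y) \<in> E (ap M F y))"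
    by (rule opair_elts) (use F H in auto)
  also have "\<dots> \<longleftrightarrow> aW (\<lambda>y. ap M H y = ap M (ap M F y) (ap M G y))"
  proof (rule al_cong_al[OF uf fg df(3)])
    fix y assume y: "y \<in> E Y" and a: "ap M F y \<in> funs M (ap M z y) \<and> ap M G y \<in> E (ap M z y)"
    have "ap M H y \<in> V" using ap_V y E_V by blast
    then show "(op (ap M G y) (ap M H y) \<in> E (ap M F y)) = (ap M H y = ap M (ap M F y) (ap M G y))"
      using app_in[of "ap M F y" "ap M z y" "ap M G y"] ap_app[of "ap M F y" "ap M z y" "ap M G y"] a by metis
  qed (intro dfns FV)+
  also have "\<dots> \<longleftrightarrow> cl H = cl (Lam M Y (\<lambda>y. ap M (ap M F y) (ap M G y)))"
    unfolding cl_eq[OF H LamF[OF d]] by (rule al_cong) (simp add: ap_Lam[OF YV d])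
  finally show ?thesis .
qed

lemma app_N:
  assumes F: "F \<in> FY" "G \<in> FY" "z \<in> FY" and f: "aW (\<lambda>y. ap M F y \<in> funs M (ap M z y))" and g: "aW (\<lambda>y. ap M G y \<in> E (ap M z y))"
  shows "app N (cl F) (cl G) = cl (Lam M Y (\<lambda>y. ap M (ap M F y) (ap M G y)))"
proof -
  have d: "dft M (\<lambda>e. ap M (ap M F (e 0)) (ap M G (e 0)))" by (intro dfns F[THEN funs_V])
  show ?thesis unfolding app_def
  proof (rule the_equality)
    show "cl (Lam M Y (\<lambda>y. ap M (ap M F y) (ap M G y))) \<in> univ N \<and>
      opair N (cl G) (cl (Lam M Y (\<lambda>y. ap M (ap M F y) (ap M G y)))) \<in> elts N (cl F)"
      using app_term[OF F f g LamF[OF d]] LamF[OF d] cl_univ by blast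
    fix h assume h: "h \<in> univ N \<and> opair N (cl G) h \<in> elts N (cl F)"
    then obtain H where "H \<in> FY" "h = cl H" using univ_E by blast
    then show "h = cl (Lam M Y (\<lambda>y. ap M (ap M F y) (ap M G y)))" using h app_term[OF F f g] by blast
  qed
qed

lemma funs_N_I:
  assumes F: "F \<in> FY" "z \<in> FY" and f: "aW (\<lambda>y. ap M F y \<in> funs M (ap M z y))"
  shows "cl F \<in> funs N (cl z)"
  unfolding funs_def
proof (intro CollectI conjI ballI cl_univ F)
  note FV = F[THEN funs_V]
  fix p assume p: "p \<in> elts N (cl F)"
  then obtain P where P: "P \<in> FY" "p = cl P" by (rule eltsE)
  have PV: "P \<in> V" using P funs_V by blast
  have d: "dft M (\<lambda>e. fs M (ap M P (e 0)))" "dft M (\<lambda>e. sn M (ap M P (e 0)))" by (intro dfns PV)+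
  let ?X = "Lam M Y (\<lambda>y. fs M (ap M P y))" and ?V = "Lam M Y (\<lambda>y. sn M (ap M P y))"
  have XV: "?X \<in> V" "?V \<in> V" by (intro Lam_V[OF YV] d)+
  have d1: "dfn M (\<lambda>e. ap M F (e 0) \<in> funs M (ap M z (e 0)))" "dfn M (\<lambda>e. ap M P (e 0) \<in> E (ap M F (e 0)))" by (intro dfns FV PV)+
  have al: "aW (\<lambda>y. ap M F y \<in> funs M (ap M z y) \<and> ap M P y \<in> E (ap M F y))"
    unfolding al_conj[OF uf d1] using f p P elts_cl F by blast
  have st: "fs M (ap M P y) \<in> E (ap M z y) \<and> ap M P y = op (fs M (ap M P y)) (sn M (ap M P y))"
    if a: "ap M F y \<in> funs M (ap M z y) \<and> ap M P y \<in> E (ap M F y)" for y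
  proof -
    obtain x v where x: "x \<in> E (ap M z y)" "v \<in> V" "ap M P y = op x v" using a unfolding funs_def by blast
    have "x \<in> V" using x E_V by blast
    then show ?thesis using x by simp
  qed
  have d2: "dfn M (\<lambda>e. ap M ?X (e 0) \<in> E (ap M z (e 0)))" by (intro dfns FV XV)
  have d3: "dft M (\<lambda>e. op (ap M ?X (e 0)) (ap M ?V (e 0)))" by (intro dfns XV)
  have d4: "dfn M (\<lambda>e. ap M P (e 0) = ap M (Lam M Y (\<lambda>y. op (ap M ?X y) (ap M ?V y))) (e 0))" by (intro dfns PV XV Lam_V[OF YV])
  have "aW (\<lambda>y. ap M ?X y \<in> E (ap M z y))" by (rule al_mono[OF uf al d2]) (use st ap_Lam[OF YV d(1)] in simp)
  then have x: "cl ?X \<in> elts N (cl z)" using elts_cl LamF[OF d(1)] F by blast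
  have "aW (\<lambda>y. ap M P y = ap M (Lam M Y (\<lambda>y. op (ap M ?X y) (ap M ?V y))) y)"
    by (rule al_mono[OF uf al d4]) (use st in \<open>simp add: ap_Lam[OF YV d3] ap_Lam[OF YV d(1)] ap_Lam[OF YV d(2)]\<close>)
  then have "p = opair N (cl ?X) (cl ?V)"
    unfolding opair_N[OF LamF[OF d(1)] LamF[OF d(2)]] P(2) using cl_eq[OF P(1) LamF[OF d3]] by blast
  then show "\<exists>x\<in>elts N (cl z). \<exists>y\<in>univ N. p = opair N x y" using x LamF[OF d(2)] cl_univ by blast
next
  fix x assume x: "x \<in> elts N (cl z)"
  then obtain G where G: "G \<in> FY" "x = cl G" by (rule eltsE)
  have g: "aW (\<lambda>y. ap M G y \<in> E (ap M z y))" using x G elts_cl F by blast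
  have d: "dft M (\<lambda>e. ap M (ap M F (e 0)) (ap M G (e 0)))" by (intro dfns F[THEN funs_V] G(1)[THEN funs_V])
  note at = app_term[OF F(1) G(1) F(2) f g]
  show "\<exists>!y. y \<in> univ N \<and> opair N x y \<in> elts N (cl F)"
  proof (rule ex1I)
    show "cl (Lam M Y (\<lambda>y. ap M (ap M F y) (ap M G y))) \<in> univ N \<and> opair N x (cl (Lam M Y (\<lambda>y. ap M (ap M F y) (ap M G y)))) \<in> elts N (cl F)"
      using at[OF LamF[OF d]] LamF[OF d] cl_univ G by blast
    fix h assume h: "h \<in> univ N \<and> opair N x h \<in> elts N (cl F)"
    then obtain H where "H \<in> FY" "h = cl H" using univ_E by blast
    then show "h = cl (Lam M Y (\<lambda>y. ap M (ap M F y) (ap M G y)))" using h at G by blast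
  qed
qed

text \<open>The three clauses of being a function on \<open>z(y)\<close> are treated separately. If
  one fails for almost all \<open>y\<close>, \<open>los_ex\<close> produces elements of the
  ultrapower that violate the same clause for \<open>cl F\<close>.\<close>

lemma funs_N_D:
  assumes F: "F \<in> FY" "z \<in> FY" and f: "cl F \<in> funs N (cl z)"
  shows "aW (\<lambda>y. ap M F y \<in> funs M (ap M z y))"
proof -
  note FV = F[THEN funs_V]
  have f1: "\<forall>p\<in>elts N (cl F). \<exists>x\<in>elts N (cl z). \<exists>y\<in>univ N. p = opair N x y"
    and f2: "\<forall>x\<in>elts N (cl z). \<exists>!y. y \<in> univ N \<and> opair N x y \<in> elts N (cl F)" using f by (auto simp: funs_def)
  define P1 where "P1 = (\<lambda>y. \<forall>p\<in>E (ap M F y). \<exists>x\<in>E (ap M z y). \<exists>v\<in>V. p = op x v)"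
  define P2 where "P2 = (\<lambda>y. \<forall>x\<in>E (ap M z y). \<exists>v\<in>V. op x v \<in> E (ap M F y))"
  \<comment> \<open>Uniqueness of values is phrased for two elements of the graph with equal first
    components, since \<open>los_ex\<close> needs its witnesses bounded by a set.\<close>
  define P3 where "P3 = (\<lambda>y. \<forall>p\<in>E (ap M F y). \<forall>p'\<in>E (ap M F y). fs M p = fs M p' \<longrightarrow> p = p')"
  have d: "dfn M (\<lambda>e. P1 (e 0))" "dfn M (\<lambda>e. P2 (e 0))" "dfn M (\<lambda>e. P3 (e 0))"
    unfolding P1_def P2_def P3_def by (intro dfns FV)+
  have dF: "dft M (\<lambda>e. ap M F (e 0))" "dft M (\<lambda>e. ap M z (e 0))" by (intro dfns FV)+
  have A1: "aW P1"
  proof (rule ccontr)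
    assume "\<not> aW P1"
    then have "aW (\<lambda>y. \<not> P1 y)" using al_not[OF uf d(1)] by blast
    then have 1: "aW (\<lambda>y. \<exists>p\<in>E (ap M F y). \<not> (\<exists>x\<in>E (ap M z y). \<exists>v\<in>V. p = op x v))" unfolding P1_def by simp
    have "dfn M (\<lambda>e. \<not> (\<exists>x\<in>E (ap M z (e 0)). \<exists>v\<in>V. e 1 = op x v))" by (intro dfns FV)
    from los_ex[OF dF(1) this 1] obtain P where P: "P \<in> FY"
      and al: "aW (\<lambda>y. ap M P y \<in> E (ap M F y) \<and> \<not> (\<exists>x\<in>E (ap M z y). \<exists>v\<in>V. ap M P y = op x v))" by blast
    have PV: "P \<in> V" using P funs_V by blast
    have "dfn M (\<lambda>e. ap M P (e 0) \<in> E (ap M F (e 0)))" by (intro dfns PV FV)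
    from al_mono[OF uf al this] have "cl P \<in> elts N (cl F)" using elts_cl P F by blast
    then obtain x v where xv: "x \<in> elts N (cl z)" "v \<in> univ N" "cl P = opair N x v" using f1 by blast
    obtain X where X: "X \<in> FY" "x = cl X" using xv(1) by (rule eltsE)
    obtain U where U: "U \<in> FY" "v = cl U" using xv(2) by (rule univ_E)
    have XV: "X \<in> V" "U \<in> V" using X U funs_V by auto
    have dd: "dft M (\<lambda>e. op (ap M X (e 0)) (ap M U (e 0)))" by (intro dfns XV)
    have e1: "aW (\<lambda>y. ap M P y = op (ap M X y) (ap M U y))"
    proof -
      have "cl P = cl (Lam M Y (\<lambda>y. op (ap M X y) (ap M U y)))" using xv X U opair_N by simp
      then have "aW (\<lambda>y. ap M P y = ap M (Lam M Y (\<lambda>y. op (ap M X y) (ap M U y))) y)" using cl_eq[OF P LamF[OF dd]] by blast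
      moreover have "aW (\<lambda>y. ap M P y = ap M (Lam M Y (\<lambda>y. op (ap M X y) (ap M U y))) y) \<longleftrightarrow> aW (\<lambda>y. ap M P y = op (ap M X y) (ap M U y))"
        by (rule al_cong) (simp add: ap_Lam[OF YV dd])
      ultimately show ?thesis by blast
    qed
    have e2: "aW (\<lambda>y. ap M X y \<in> E (ap M z y))" using xv X elts_cl F by blast
    have d5: "dfn M (\<lambda>e. ap M P (e 0) = op (ap M X (e 0)) (ap M U (e 0)))" "dfn M (\<lambda>e. ap M X (e 0) \<in> E (ap M z (e 0)))"
      "dfn M (\<lambda>e. ap M P (e 0) \<in> E (ap M F (e 0)) \<and> \<not> (\<exists>x\<in>E (ap M z (e 0)). \<exists>v\<in>V. ap M P (e 0) = op x v))"
      "dfn M (\<lambda>e. ap M P (e 0) = op (ap M X (e 0)) (ap M U (e 0)) \<and> ap M X (e 0) \<in> E (ap M z (e 0)))"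
      by (intro dfns PV FV XV)+
    have "aW (\<lambda>y. (ap M P y = op (ap M X y) (ap M U y) \<and> ap M X y \<in> E (ap M z y)) \<and> 
       (ap M P y \<in> E (ap M F y) \<and> \<not> (\<exists>x\<in>E (ap M z y). \<exists>v\<in>V. ap M P y = op x v)))"
      unfolding al_conj[OF uf d5(4,3)] al_conj[OF uf d5(1,2)] using e1 e2 al by blast
    then obtain y where y: "y \<in> E Y"
      and c: "(ap M P y = op (ap M X y) (ap M U y) \<and> ap M X y \<in> E (ap M z y)) \<and>
       (ap M P y \<in> E (ap M F y) \<and> \<not> (\<exists>x\<in>E (ap M z y). \<exists>v\<in>V. ap M P y = op x v))" by (rule al_ex[OF uf])
    note y = y c[THEN conjunct1, THEN conjunct1] c[THEN conjunct1, THEN conjunct2] c[THEN conjunct2, THEN conjunct2]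
    have "ap M U y \<in> V" by (rule ap_V[OF E_V[OF y(1)]])
    then show False using y by blast
  qed
  have A2: "aW P2"
  proof (rule ccontr)
    assume "\<not> aW P2"
    then have "aW (\<lambda>y. \<not> P2 y)" using al_not[OF uf d(2)] by blast
    then have 1: "aW (\<lambda>y. \<exists>x\<in>E (ap M z y). \<not> (\<exists>v\<in>V. op x v \<in> E (ap M F y)))" unfolding P2_def by simp
    have "dfn M (\<lambda>e. \<not> (\<exists>v\<in>V. op (e 1) v \<in> E (ap M F (e 0))))" by (intro dfns FV)
    from los_ex[OF dF(2) this 1] obtain X where X: "X \<in> FY"
      and al: "aW (\<lambda>y. ap M X y \<in> E (ap M z y) \<and> \<not> (\<exists>v\<in>V. op (ap M X y) v \<in> E (ap M F y)))" by blast
    have XV: "X \<in> V" using X funs_V by blast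
    have "dfn M (\<lambda>e. ap M X (e 0) \<in> E (ap M z (e 0)))" by (intro dfns XV FV)
    from al_mono[OF uf al this] have "cl X \<in> elts N (cl z)" using elts_cl X F by blast
    then obtain v where v: "v \<in> univ N" "opair N (cl X) v \<in> elts N (cl F)" using f2 by blast
    obtain U where U: "U \<in> FY" "v = cl U" using v(1) by (rule univ_E)
    have UV: "U \<in> V" using U funs_V by auto
    have e1: "aW (\<lambda>y. op (ap M X y) (ap M U y) \<in> E (ap M F y))" using opair_elts X U F v by blast
    have d5: "dfn M (\<lambda>e. op (ap M X (e 0)) (ap M U (e 0)) \<in> E (ap M F (e 0)))"
      "dfn M (\<lambda>e. ap M X (e 0) \<in> E (ap M z (e 0)) \<and> \<not> (\<exists>v\<in>V. op (ap M X (e 0)) v \<in> E (ap M F (e 0))))" by (intro dfns XV UV FV)+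
    have "aW (\<lambda>y. op (ap M X y) (ap M U y) \<in> E (ap M F y) \<and> ap M X y \<in> E (ap M z y) \<and> \<not> (\<exists>v\<in>V. op (ap M X y) v \<in> E (ap M F y)))"
      unfolding al_conj[OF uf d5] using e1 al by blast
    from al_ex[OF uf this] obtain y where y: "y \<in> E Y" "op (ap M X y) (ap M U y) \<in> E (ap M F y)"
      "\<not> (\<exists>v\<in>V. op (ap M X y) v \<in> E (ap M F y))" by blast
    have "ap M U y \<in> V" by (rule ap_V[OF E_V[OF y(1)]])
    then show False using y by blast
  qed
  have A3: "aW P3"
  proof (rule ccontr)
    assume "\<not> aW P3"
    then have "aW (\<lambda>y. \<not> P3 y)" using al_not[OF uf d(3)] by blast
    then have 1: "aW (\<lambda>y. \<exists>p\<in>E (ap M F y). \<exists>p'\<in>E (ap M F y). fs M p = fs M p' \<and> p \<noteq> p')" unfolding P3_def by simp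
    have "dfn M (\<lambda>e. \<exists>p'\<in>E (ap M F (e 0)). fs M (e 1) = fs M p' \<and> e 1 \<noteq> p')" by (intro dfns FV)
    from los_ex[OF dF(1) this 1] obtain P where P: "P \<in> FY"
      and al: "aW (\<lambda>y. ap M P y \<in> E (ap M F y) \<and> (\<exists>p'\<in>E (ap M F y). fs M (ap M P y) = fs M p' \<and> ap M P y \<noteq> p'))" by blast
    have PV: "P \<in> V" using P funs_V by blast
    have "dfn M (\<lambda>e. \<exists>p'\<in>E (ap M F (e 0)). fs M (ap M P (e 0)) = fs M p' \<and> ap M P (e 0) \<noteq> p')" by (intro dfns FV PV)
    from al_mono[OF uf al this] have 2: "aW (\<lambda>y. \<exists>p'\<in>E (ap M F y). fs M (ap M P y) = fs M p' \<and> ap M P y \<noteq> p')" by blast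
    have "dfn M (\<lambda>e. fs M (ap M P (e 0)) = fs M (e 1) \<and> ap M P (e 0) \<noteq> e 1)" by (intro dfns FV PV)
    from los_ex[OF dF(1) this 2] obtain R where R: "R \<in> FY"
      and al2: "aW (\<lambda>y. ap M R y \<in> E (ap M F y) \<and> fs M (ap M P y) = fs M (ap M R y) \<and> ap M P y \<noteq> ap M R y)" by blast
    have RV: "R \<in> V" using R funs_V by blast
    let ?B = "\<lambda>y. ap M P y \<in> E (ap M F y) \<and> ap M R y \<in> E (ap M F y) \<and> fs M (ap M P y) = fs M (ap M R y) \<and> ap M P y \<noteq> ap M R y \<and> P1 y"
    have dP1: "dfn M (\<lambda>e. P1 (e 0))" by (rule d)
    have "dfn M (\<lambda>e. ap M P (e 0) \<in> E (ap M F (e 0)))" by (intro dfns FV PV)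
    from al_mono[OF uf al this] have 3: "aW (\<lambda>y. ap M P y \<in> E (ap M F y))" by blast
    have d6: "dfn M (\<lambda>e. ap M P (e 0) \<in> E (ap M F (e 0)))"
      "dfn M (\<lambda>e. ap M R (e 0) \<in> E (ap M F (e 0)) \<and> fs M (ap M P (e 0)) = fs M (ap M R (e 0)) \<and> ap M P (e 0) \<noteq> ap M R (e 0))"
      "dfn M (\<lambda>e. ap M P (e 0) \<in> E (ap M F (e 0)) \<and> (ap M R (e 0) \<in> E (ap M F (e 0)) \<and> fs M (ap M P (e 0)) = fs M (ap M R (e 0)) \<and> ap M P (e 0) \<noteq> ap M R (e 0)))"
      by (intro dfns FV PV RV)+
    have B: "aW (\<lambda>y. P1 y \<and> ap M P y \<in> E (ap M F y) \<and> (ap M R y \<in> E (ap M F y) \<and> fs M (ap M P y) = fs M (ap M R y) \<and> ap M P y \<noteq> ap M R y))"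
      unfolding al_conj[OF uf dP1 d6(3)] al_conj[OF uf d6(1,2)] using A1 3 al2 by blast
    let ?f = "\<lambda>y. fs M (ap M P y)" and ?s = "\<lambda>y. sn M (ap M P y)" and ?s' = "\<lambda>y. sn M (ap M R y)"
    have dd: "dft M (\<lambda>e. ?f (e 0))" "dft M (\<lambda>e. ?s (e 0))" "dft M (\<lambda>e. ?s' (e 0))" by (intro dfns PV RV)+
    note L = LamF[OF dd(1)] LamF[OF dd(2)] LamF[OF dd(3)]
    note LV = L[THEN funs_V]
    note Lap = ap_Lam[OF YV dd(1)] ap_Lam[OF YV dd(2)] ap_Lam[OF YV dd(3)]
    have st: "?f y \<in> E (ap M z y) \<and> op (?f y) (?s y) = ap M P y \<and> op (?f y) (?s' y) = ap M R y \<and> ?s y \<noteq> ?s' y"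
      if a: "P1 y \<and> ap M P y \<in> E (ap M F y) \<and> (ap M R y \<in> E (ap M F y) \<and> fs M (ap M P y) = fs M (ap M R y) \<and> ap M P y \<noteq> ap M R y)" for y
    proof -
      obtain x v where x: "x \<in> E (ap M z y)" "v \<in> V" "ap M P y = op x v" using a unfolding P1_def by blast
      obtain x' v' where x': "x' \<in> E (ap M z y)" "v' \<in> V" "ap M R y = op x' v'" using a unfolding P1_def by blast
      have "x \<in> V" "x' \<in> V" using x x' E_V by auto
      then show ?thesis using x x' a by auto
    qed
    have "aW (\<lambda>y. ap M (Lam M Y ?f) y \<in> E (ap M z y))"
      by (rule al_mono[OF uf B]) (intro dfns LV FV, use st Lap in simp)
    then have 4: "cl (Lam M Y ?f) \<in> elts N (cl z)" using elts_cl L F by blast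
    have "aW (\<lambda>y. op (ap M (Lam M Y ?f) y) (ap M (Lam M Y ?s) y) \<in> E (ap M F y))"
      by (rule al_mono[OF uf B]) (intro dfns LV FV, use st Lap in simp)
    then have 5: "opair N (cl (Lam M Y ?f)) (cl (Lam M Y ?s)) \<in> elts N (cl F)" using opair_elts L F by blast
    have "aW (\<lambda>y. op (ap M (Lam M Y ?f) y) (ap M (Lam M Y ?s') y) \<in> E (ap M F y))"
      by (rule al_mono[OF uf B]) (intro dfns LV FV, use st Lap in simp)
    then have 6: "opair N (cl (Lam M Y ?f)) (cl (Lam M Y ?s')) \<in> elts N (cl F)" using opair_elts L F by blast
    have "cl (Lam M Y ?s) = cl (Lam M Y ?s')" using f2 4 5 6 L cl_univ by blast
    then have 7: "aW (\<lambda>y. ap M (Lam M Y ?s) y = ap M (Lam M Y ?s') y)" using cl_eq L by blast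
    have d8: "dfn M (\<lambda>e. ap M (Lam M Y ?s) (e 0) = ap M (Lam M Y ?s') (e 0))" by (intro dfns LV)
    have "aW (\<lambda>y. \<not> ap M (Lam M Y ?s) y = ap M (Lam M Y ?s') y)"
      by (rule al_mono[OF uf B]) (intro dfns LV FV, use st Lap in simp)
    then show False using 7 al_not[OF uf d8] by blast
  qed
  have dC: "dfn M (\<lambda>e. P1 (e 0) \<and> P2 (e 0))" by (intro dfns d)
  have "aW (\<lambda>y. (P1 y \<and> P2 y) \<and> P3 y)" unfolding al_conj[OF uf dC d(3)] al_conj[OF uf d(1,2)] using A1 A2 A3 by blast
  then show ?thesis
  proof (rule al_mono[OF uf])
    show "dfn M (\<lambda>e. ap M F (e 0) \<in> funs M (ap M z (e 0)))" by (intro dfns FV)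
    fix y assume y: "y \<in> E Y" and a: "(P1 y \<and> P2 y) \<and> P3 y"
    have "ap M F y \<in> V" using ap_V y E_V by blast
    moreover have "\<exists>!v. v \<in> V \<and> op x v \<in> E (ap M F y)" if x: "x \<in> E (ap M z y)" for x
    proof -
      have xV: "x \<in> V" using x E_V by blast
      obtain v where v: "v \<in> V" "op x v \<in> E (ap M F y)" using a x unfolding P2_def by blast
      show ?thesis
      proof (rule ex1I[of _ v])
        fix v' assume v': "v' \<in> V \<and> op x v' \<in> E (ap M F y)"
        then have "op x v' = op x v" using a v xV unfolding P3_def by (metis fs_op)
        then show "v' = v" using v v' xV by simp
      qed (use v in blast)
    qed
    ultimately show "ap M F y \<in> funs M (ap M z y)" using a unfolding funs_def P1_def by blast
  qed
qed

text \<open>Los's theorem for separation: separating in each fibre \<open>z(y)\<close> represents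
  the separated subset of \<open>cl z\<close>. The last claim turns largeness inside the ultrapower
  into the iterated quantifier, \<open>D(y)\<close>-almost all after \<open>W\<close>-almost
  all.\<close>

lemma sub_N:
  assumes z: "z \<in> FY" and P: "dfn M (\<lambda>e. P (e 0) (e 1))"
    and QP: "\<And>G. G \<in> FY \<Longrightarrow> aW (\<lambda>y. ap M G y \<in> E (ap M z y)) \<Longrightarrow> Q (cl G) \<longleftrightarrow> aW (\<lambda>y. P y (ap M G y))"
  shows "Lam M Y (\<lambda>y. Sep M (ap M z y) (P y)) \<in> FY"
    and "elts N (cl (Lam M Y (\<lambda>y. Sep M (ap M z y) (P y)))) = {t \<in> elts N (cl z). Q t}"
    and "D \<in> FY \<Longrightarrow> large N (cl D) {t \<in> elts N (cl z). Q t} \<longleftrightarrow> aW (\<lambda>y. almost M (ap M D y) (ap M z y) (P y))"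
proof -
  have zV: "z \<in> V" using z funs_V by blast
  have P': "dfn M (\<lambda>e. P (e i) (e j))" for i j by (rule dfn2_subst[OF P]) (intro dfns)+
  let ?t = "\<lambda>y. Sep M (ap M z y) (P y)"
  have dt: "dft M (\<lambda>e. ?t (e 0))" by (intro dfns zV P')
  show L: "Lam M Y ?t \<in> FY" by (rule LamF[OF dt])
  have dPy: "dfn M (\<lambda>e. P y (e 0))" if "y \<in> V" for y by (rule dfn2_subst[OF P]) (intro dfns that)+
  have tE: "E (?t y) = {u \<in> E (ap M z y). P y u}" "?t y \<in> V" if "y \<in> E Y" for y
    using E_Sep[OF ap_V dPy] Sep_V[OF ap_V dPy] E_V[OF that] by blast+
  have key: "cl G \<in> elts N (cl (Lam M Y ?t)) \<longleftrightarrow> cl G \<in> elts N (cl z) \<and> Q (cl G)" if G: "G \<in> FY" for G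
  proof -
    have GV: "G \<in> V" using G funs_V by blast
    have d: "dfn M (\<lambda>e. ap M G (e 0) \<in> E (ap M z (e 0)))" "dfn M (\<lambda>e. P (e 0) (ap M G (e 0)))"
      by (intro dfns zV GV dfn2_subst[OF P])+
    have "cl G \<in> elts N (cl (Lam M Y ?t)) \<longleftrightarrow> aW (\<lambda>y. ap M G y \<in> E (ap M z y) \<and> P y (ap M G y))"
      unfolding elts_cl[OF G L] by (rule al_cong) (simp add: ap_Lam[OF YV dt] tE)
    then show ?thesis unfolding al_conj[OF uf d] elts_cl[OF G z] using QP[OF G] by blast
  qed
  show S: "elts N (cl (Lam M Y ?t)) = {t \<in> elts N (cl z). Q t}"
  proof (intro set_eqI iffI)
    fix t assume t: "t \<in> elts N (cl (Lam M Y ?t))"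
    then obtain G where "G \<in> FY" "t = cl G" by (rule eltsE)
    then show "t \<in> {t \<in> elts N (cl z). Q t}" using key t by blast
  next
    fix t assume t: "t \<in> {t \<in> elts N (cl z). Q t}"
    then have "t \<in> elts N (cl z)" by blast
    then obtain G where "G \<in> FY" "t = cl G" by (rule eltsE)
    then show "t \<in> elts N (cl (Lam M Y ?t))" using key t by blast
  qed
  assume D: "D \<in> FY"
  have "large N (cl D) {t \<in> elts N (cl z). Q t} \<longleftrightarrow> cl (Lam M Y ?t) \<in> elts N (cl D)"
  proof
    assume "large N (cl D) {t \<in> elts N (cl z). Q t}"
    then obtain A where A: "A \<in> elts N (cl D)" "elts N A = {t \<in> elts N (cl z). Q t}" unfolding large_def by auto
    then have "A = cl (Lam M Y ?t)" using extN[of A "cl (Lam M Y ?t)"] S L by (simp add: elts_def[of N "cl D"])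
    then show "cl (Lam M Y ?t) \<in> elts N (cl D)" using A by simp
  qed (use S in \<open>auto simp: large_def\<close>)
  also have "\<dots> \<longleftrightarrow> aW (\<lambda>y. ?t y \<in> E (ap M D y))"
    unfolding elts_cl[OF L D] by (rule al_cong) (simp add: ap_Lam[OF YV dt])
  also have "\<dots> \<longleftrightarrow> aW (\<lambda>y. almost M (ap M D y) (ap M z y) (P y))"
    by (rule al_cong) (use al_iff[OF ap_V dPy] E_V in blast)
  finally show "large N (cl D) {t \<in> elts N (cl z). Q t} \<longleftrightarrow> aW (\<lambda>y. almost M (ap M D y) (ap M z y) (P y))" .
qed

end

section \<open>Iterated ultrapowers\<close>

context zfc
begin

lemma uf_top: "uf X U \<Longrightarrow> X \<in> E U"
  and uf_ne: "uf X U \<Longrightarrow> A \<in> E U \<Longrightarrow> \<exists>x\<in>E A. True"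
  and uf_up: "uf X U \<Longrightarrow> A \<in> E U \<Longrightarrow> B \<in> V \<Longrightarrow> E A \<subseteq> E B \<Longrightarrow> E B \<subseteq> E X \<Longrightarrow> B \<in> E U"
  and uf_int: "uf X U \<Longrightarrow> A \<in> E U \<Longrightarrow> B \<in> E U \<Longrightarrow> C \<in> V \<Longrightarrow> E C = E A \<inter> E B \<Longrightarrow> C \<in> E U"
  and uf_compl: "uf X U \<Longrightarrow> A \<in> V \<Longrightarrow> B \<in> V \<Longrightarrow> E A \<subseteq> E X \<Longrightarrow> E B = E X - E A \<Longrightarrow> A \<in> E U \<or> B \<in> E U"
proof -
  assume u: "uf X U"
  note conj = u[unfolded is_ultrafilter_def is_filter_def]
  show "X \<in> E U" using conj by (elim conjE)
  show "\<exists>x\<in>E A. True" if "A \<in> E U"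
  proof -
    have "\<forall>A\<in>E U. E A \<noteq> {}" using conj by (elim conjE)
    then show ?thesis using that by blast
  qed
  show "B \<in> E U" if "A \<in> E U" "B \<in> V" "E A \<subseteq> E B" "E B \<subseteq> E X"
  proof -
    have "\<forall>A\<in>E U. \<forall>B\<in>V. E A \<subseteq> E B \<longrightarrow> E B \<subseteq> E X \<longrightarrow> B \<in> E U" using conj by (elim conjE)
    then show ?thesis using that by blast
  qed
  show "C \<in> E U" if "A \<in> E U" "B \<in> E U" "C \<in> V" "E C = E A \<inter> E B"
  proof -
    have "\<forall>A\<in>E U. \<forall>B\<in>E U. \<forall>C\<in>V. E C = E A \<inter> E B \<longrightarrow> C \<in> E U" using conj by (elim conjE)
    then show ?thesis using that by blast
  qed
  show "A \<in> E U \<or> B \<in> E U" if "A \<in> V" "B \<in> V" "E A \<subseteq> E X" "E B = E X - E A"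
  proof -
    have "\<forall>A\<in>V. \<forall>B\<in>V. E A \<subseteq> E X \<longrightarrow> E B = E X - E A \<longrightarrow> A \<in> E U \<or> B \<in> E U" using conj by (elim conjE)
    then show ?thesis using that by blast
  qed
qed

lemma al_disj:
  assumes u: "uf X U" and d: "dfn M (\<lambda>e. P (e 0))" "dfn M (\<lambda>e. Q (e 0))" and al: "almost M U X (\<lambda>x. P x \<or> Q x)"
  shows "almost M U X P \<or> almost M U X Q"
proof (rule ccontr)
  assume n: "\<not> ?thesis"
  have d': "dfn M (\<lambda>e. \<not> P (e 0))" "dfn M (\<lambda>e. \<not> Q (e 0))" "dfn M (\<lambda>e. P (e 0) \<or> Q (e 0))"
    "dfn M (\<lambda>e. \<not> P (e 0) \<and> \<not> Q (e 0))" by (intro dfns d)+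
  have "almost M U X (\<lambda>x. (P x \<or> Q x) \<and> (\<not> P x \<and> \<not> Q x))"
    unfolding al_conj[OF u d'(3,4)] al_conj[OF u d'(1,2)] al_not[OF u d(1)] al_not[OF u d(2)] using n al by blast
  from al_ex[OF u this] show False by blast
qed

lemma const_fun_Lam: "const_fun M X a = Lam M X (\<lambda>_. a)"
  by (simp add: const_fun_def Lam_def)

text \<open>For constant families \<open>capw\<close> says that the quantifiers of \<open>U\<close>
  and \<open>W\<close> commute, and this is symmetric.\<close>

lemma swap_capw:
  assumes c: "capw X U Y W (Lam M Y (\<lambda>_. U))" and u: "uf X U" "uf Y W"
  shows "capw Y W X U (Lam M X (\<lambda>_. W))"
  unfolding capw_def
proof
  fix R assume R: "R \<in> V"
  note UV = uf_V[OF u(1)] and WV = uf_V[OF u(2)]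
  have "dfn M (\<lambda>e. op (e 1) (e 0) \<in> E R)" by (intro dfns R)
  from capwD[OF c UV(1) WV(1) this]
  have "almost M U X (\<lambda>x. almost M W Y (\<lambda>y. op y x \<in> E R)) = almost M W Y (\<lambda>y. almost M (ap M (Lam M Y (\<lambda>_. U)) y) X (\<lambda>x. op y x \<in> E R))" .
  also have "\<dots> = almost M W Y (\<lambda>y. almost M U X (\<lambda>x. op y x \<in> E R))"
    by (rule al_cong) (simp add: ap_Lam WV dft_const UV)
  finally have "almost M W Y (\<lambda>y. almost M U X (\<lambda>x. op y x \<in> E R)) = almost M U X (\<lambda>x. almost M W Y (\<lambda>y. op y x \<in> E R))" by simp
  also have "\<dots> = almost M U X (\<lambda>x. almost M (ap M (Lam M X (\<lambda>_. W)) x) Y (\<lambda>y. op y x \<in> E R))"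
    by (rule al_cong) (simp add: ap_Lam WV dft_const UV)
  finally show "almost M W Y (\<lambda>x. almost M U X (\<lambda>y. op x y \<in> E R)) =
    almost M U X (\<lambda>y. almost M (ap M (Lam M X (\<lambda>_. W)) y) Y (\<lambda>x. op x y \<in> E R))" .
qed

end

context zfc_ult
begin

text \<open>Los's theorem for being an ultrafilter, checked clause by clause. Sets whose existence a
  clause presupposes, intersections and complements, are represented fibrewise by
  \<open>sub_N\<close> and identified by \<open>extN\<close>.\<close>

lemma ult_lift:
  assumes z: "z \<in> FY" "D \<in> FY" and al: "aW (\<lambda>y. uf (ap M z y) (ap M D y))"
  shows "is_ultrafilter N (cl z) (cl D)"
proof -
  note zV = z[THEN funs_V]
  have du: "dfn M (\<lambda>e. uf (ap M z (e 0)) (ap M D (e 0)))" by (intro dfns zV)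
  \<comment> \<open>A pointwise implication valid for ultrafilters passes to \<open>W\<close>-almost
    all \<open>y\<close>.\<close>
  have mp: "aW Q" if "aW P" "dfn M (\<lambda>e. P (e 0))" "dfn M (\<lambda>e. Q (e 0))"
    "\<And>y. y \<in> E Y \<Longrightarrow> uf (ap M z y) (ap M D y) \<Longrightarrow> P y \<Longrightarrow> Q y" for P Q
  proof -
    have "aW (\<lambda>y. uf (ap M z y) (ap M D y) \<and> P y)" unfolding al_conj[OF uf du that(2)] using al that(1) by blast
    then show ?thesis by (rule al_mono[OF uf _ that(3)]) (use that(4) in blast)
  qed
  have inD: "aW (\<lambda>y. ap M A y \<in> E (ap M D y))" "A \<in> V" if "cl A \<in> elts N (cl D)" "A \<in> FY" for A
    using that elts_cl z funs_V by blast+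
  show ?thesis unfolding is_ultrafilter_def is_filter_def
  proof (intro conjI ballI impI cl_univ z)
    fix a assume a: "a \<in> elts N (cl D)"
    then obtain A where A: "A \<in> FY" "a = cl A" by (rule eltsE)
    note iA = inD[OF a[unfolded A(2)] A(1)]
    have dA: "dfn M (\<lambda>e. ap M A (e 0) \<in> E (ap M D (e 0)))" by (intro dfns zV iA)
    show "elts N a \<subseteq> elts N (cl z)"
      unfolding A(2) elts_sub[OF A(1) z(1)] by (rule mp[OF iA(1) dA]) (intro dfns zV iA, rule uf_sub)
    have dne: "dfn M (\<lambda>e. \<exists>x\<in>E (ap M A (e 0)). True)" by (intro dfns iA(2))
    have "aW (\<lambda>y. \<exists>x\<in>E (ap M A y). True)" by (rule mp[OF iA(1) dA dne]) (rule uf_ne)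
    moreover have "dft M (\<lambda>e. ap M A (e 0))" by (intro dfns iA(2))
    ultimately obtain H where H: "H \<in> FY" "aW (\<lambda>y. ap M H y \<in> E (ap M A y) \<and> True)"
      using los_ex[of "ap M A" "\<lambda>_ _. True"] dfn_bool by blast
    then have "cl H \<in> elts N a" using elts_cl A by simp
    then show "elts N a \<noteq> {}" by blast
    {
      fix b c assume b: "b \<in> elts N (cl D)" and c: "c \<in> univ N" "elts N c = elts N a \<inter> elts N b"
      obtain B where B: "B \<in> FY" "b = cl B" using b by (rule eltsE)
      note iB = inD[OF b[unfolded B(2)] B(1)]
      have P: "dfn M (\<lambda>e. e 1 \<in> E (ap M B (e 0)))" by (intro dfns iB)
      let ?t = "\<lambda>y. Sep M (ap M A y) (\<lambda>u. u \<in> E (ap M B y))"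
      have dt: "dft M (\<lambda>e. ?t (e 0))" by (intro dfns iA iB)
      have S: "Lam M Y ?t \<in> FY" "elts N (cl (Lam M Y ?t)) = {t \<in> elts N (cl A). t \<in> elts N (cl B)}"
        using sub_N(1,2)[OF A(1) P, of "\<lambda>t. t \<in> elts N (cl B)", OF elts_cl[OF _ B(1)]] by blast+
      have eq: "c = cl (Lam M Y ?t)" by (rule extN) (use c S A B in auto)
      have dAB: "dfn M (\<lambda>e. ap M B (e 0) \<in> E (ap M D (e 0)))" "dfn M (\<lambda>e. ap M A (e 0) \<in> E (ap M D (e 0)) \<and> ap M B (e 0) \<in> E (ap M D (e 0)))"
        by (intro dfns zV iA iB)+
      have "aW (\<lambda>y. ap M A y \<in> E (ap M D y) \<and> ap M B y \<in> E (ap M D y))" unfolding al_conj[OF uf dA dAB(1)] using iA iB by blast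
      then have "aW (\<lambda>y. ap M (Lam M Y ?t) y \<in> E (ap M D y))"
      proof (rule mp[OF _ dAB(2)])
        show "dfn M (\<lambda>e. ap M (Lam M Y ?t) (e 0) \<in> E (ap M D (e 0)))" by (intro dfns S(1)[THEN funs_V] zV)
        fix y assume y: "y \<in> E Y" and u: "uf (ap M z y) (ap M D y)" and ab: "ap M A y \<in> E (ap M D y) \<and> ap M B y \<in> E (ap M D y)"
        have dB: "dfn M (\<lambda>e. e 0 \<in> E (ap M B y))" by (intro dfns ap_V E_V[OF y])
        have AV: "ap M A y \<in> V" by (rule ap_V[OF E_V[OF y]])
        have "E (?t y) = E (ap M A y) \<inter> E (ap M B y)" "?t y \<in> V" using E_Sep[OF AV dB] Sep_V[OF AV dB] by auto
        then show "ap M (Lam M Y ?t) y \<in> E (ap M D y)" 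
          unfolding ap_Lam[OF YV dt y] using uf_int[OF u] ab by blast
      qed
      then show "c \<in> elts N (cl D)" unfolding eq elts_cl[OF S(1) z(2)] .
    }
    {
      fix b assume b: "b \<in> univ N" "elts N a \<subseteq> elts N b" "elts N b \<subseteq> elts N (cl z)"
      obtain B where B: "B \<in> FY" "b = cl B" using b(1) by (rule univ_E)
      have BV: "B \<in> V" using B funs_V by blast
      have d: "dfn M (\<lambda>e. E (ap M A (e 0)) \<subseteq> E (ap M B (e 0)))" "dfn M (\<lambda>e. E (ap M B (e 0)) \<subseteq> E (ap M z (e 0)))"
        "dfn M (\<lambda>e. E (ap M A (e 0)) \<subseteq> E (ap M B (e 0)) \<and> E (ap M B (e 0)) \<subseteq> E (ap M z (e 0)))"
        "dfn M (\<lambda>e. ap M A (e 0) \<in> E (ap M D (e 0)) \<and> E (ap M A (e 0)) \<subseteq> E (ap M B (e 0)) \<and> E (ap M B (e 0)) \<subseteq> E (ap M z (e 0)))"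
        "dfn M (\<lambda>e. ap M B (e 0) \<in> E (ap M D (e 0)))"
        by (intro dfns zV iA BV)+
      have "aW (\<lambda>y. ap M A y \<in> E (ap M D y) \<and> E (ap M A y) \<subseteq> E (ap M B y) \<and> E (ap M B y) \<subseteq> E (ap M z y))"
        unfolding al_conj[OF uf dA d(3)] al_conj[OF uf d(1,2)] using iA b elts_sub A B z by blast
      then have "aW (\<lambda>y. ap M B y \<in> E (ap M D y))"
        by (rule mp[OF _ d(4,5)]) (use uf_up ap_V E_V in blast)
      then show "b \<in> elts N (cl D)" unfolding B(2) elts_cl[OF B(1) z(2)] .
    }
  next
    have dd: "dfn M (\<lambda>e. True)" "dfn M (\<lambda>e. ap M z (e 0) \<in> E (ap M D (e 0)))" by (intro dfns zV)+
    have "aW (\<lambda>y. ap M z y \<in> E (ap M D y))"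
      by (rule mp[OF al_all[OF uf] dd]) (use uf_top in auto)
    then show "cl z \<in> elts N (cl D)" unfolding elts_cl[OF z] .
  next
    fix a b assume a: "a \<in> univ N" "b \<in> univ N" "elts N a \<subseteq> elts N (cl z)" "elts N b = elts N (cl z) - elts N a"
    obtain A where A: "A \<in> FY" "a = cl A" using a(1) by (rule univ_E)
    have AV: "A \<in> V" using A funs_V by blast
    have P: "dfn M (\<lambda>e. \<not> e 1 \<in> E (ap M A (e 0)))" by (intro dfns AV)
    let ?t = "\<lambda>y. Sep M (ap M z y) (\<lambda>u. \<not> u \<in> E (ap M A y))"
    have dt: "dft M (\<lambda>e. ?t (e 0))" by (intro dfns zV AV)
    have QP: "cl G \<notin> elts N (cl A) \<longleftrightarrow> aW (\<lambda>y. \<not> ap M G y \<in> E (ap M A y))" if G: "G \<in> FY" for G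
    proof -
      have "dfn M (\<lambda>e. ap M G (e 0) \<in> E (ap M A (e 0)))" by (intro dfns AV G[THEN funs_V])
      from al_not[OF uf this] show ?thesis using elts_cl[OF G A(1)] by blast
    qed
    have S: "Lam M Y ?t \<in> FY" "elts N (cl (Lam M Y ?t)) = {t \<in> elts N (cl z). t \<notin> elts N (cl A)}"
      using sub_N(1,2)[OF z(1) P, of "\<lambda>t. t \<notin> elts N (cl A)", OF QP] by blast+
    have eq: "b = cl (Lam M Y ?t)" by (rule extN) (use a S A in auto)
    have d: "dfn M (\<lambda>e. E (ap M A (e 0)) \<subseteq> E (ap M z (e 0)))" "dfn M (\<lambda>e. ap M A (e 0) \<in> E (ap M D (e 0)))"
      "dfn M (\<lambda>e. ap M (Lam M Y ?t) (e 0) \<in> E (ap M D (e 0)))"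
      "dfn M (\<lambda>e. ap M A (e 0) \<in> E (ap M D (e 0)) \<or> ap M (Lam M Y ?t) (e 0) \<in> E (ap M D (e 0)))"
      by (intro dfns AV zV S(1)[THEN funs_V])+
    have "aW (\<lambda>y. E (ap M A y) \<subseteq> E (ap M z y))" using elts_sub A z a by blast
    then have "aW (\<lambda>y. ap M A y \<in> E (ap M D y) \<or> ap M (Lam M Y ?t) y \<in> E (ap M D y))"
    proof (rule mp[OF _ d(1,4)])
      fix y assume y: "y \<in> E Y" and u: "uf (ap M z y) (ap M D y)" and s: "E (ap M A y) \<subseteq> E (ap M z y)"
      have dA: "dfn M (\<lambda>e. \<not> e 0 \<in> E (ap M A y))" by (intro dfns ap_V E_V[OF y])
      have V2: "ap M A y \<in> V" "ap M z y \<in> V" using ap_V[OF E_V[OF y]] by auto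
      have "E (?t y) = E (ap M z y) - E (ap M A y)" "?t y \<in> V" using E_Sep[OF V2(2) dA] Sep_V[OF V2(2) dA] by auto
      then show "ap M A y \<in> E (ap M D y) \<or> ap M (Lam M Y ?t) y \<in> E (ap M D y)"
        using uf_compl[OF u V2(1) _ s] ap_Lam[OF YV dt y] by simp
    qed
    from al_disj[OF uf d(2,3) this] show "a \<in> elts N (cl D) \<or> b \<in> elts N (cl D)"
      unfolding eq A(2) elts_cl[OF S(1) z(2)] elts_cl[OF A(1) z(2)] .
  qed
qed

lemma funs_N_E:
  assumes "f \<in> funs N a" obtains F where "F \<in> FY" "f = cl F"
proof -
  have "f \<in> univ N" using assms unfolding funs_def by simp
  then show thesis using that by (rule univ_E)
qed

text \<open>The closure properties needed to form an ultrapower of the ultrapower; each required set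
  is separated fibrewise by \<open>sub_N\<close>.\<close>

lemma base2:
  assumes z: "z \<in> FY" "D \<in> FY" and uN: "is_ultrafilter N (cl z) (cl D)"
  shows "ultra_base N (cl z) (cl D)"
proof
  show "is_filter N (cl z) (cl D)" using uN unfolding is_ultrafilter_def by blast
next
  fix a b assume "a \<in> univ N" "b \<in> univ N"
  then obtain A B where A: "A \<in> FY" "a = cl A" and B: "B \<in> FY" "b = cl B" using univ_E by metis
  have P: "dfn M (\<lambda>e. e 1 \<in> E (ap M B (e 0)))" by (intro dfns funs_V[OF B(1)])
  have "\<And>G. G \<in> FY \<Longrightarrow> cl G \<in> elts N (cl B) \<longleftrightarrow> aW (\<lambda>y. ap M G y \<in> E (ap M B y))" using elts_cl B by blast
  from sub_N(1,2)[OF A(1) P, of "\<lambda>t. t \<in> elts N (cl B)", OF this] show "isset N (elts N a \<inter> elts N b)"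
    unfolding isset_def A(2) B(2) Int_def by (intro bexI[OF _ cl_univ])
next
  fix f g assume f: "f \<in> funs N (cl z)" and g: "g \<in> funs N (cl z)"
  obtain F where F: "F \<in> FY" "f = cl F" using f by (rule funs_N_E)
  obtain G where G: "G \<in> FY" "g = cl G" using g by (rule funs_N_E)
  note FV = F(1)[THEN funs_V] G(1)[THEN funs_V]
  have af: "aW (\<lambda>y. ap M F y \<in> funs M (ap M z y))" "aW (\<lambda>y. ap M G y \<in> funs M (ap M z y))"
    using funs_N_D F G z f g by blast+
  have P: "dfn M (\<lambda>e. ap M (ap M F (e 0)) (e 1) = ap M (ap M G (e 0)) (e 1))"
    "dfn M (\<lambda>e. ap M (ap M F (e 0)) (e 1) \<in> E (ap M (ap M G (e 0)) (e 1)))" by (intro dfns FV)+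
  have QP: "app N f (cl T) = app N g (cl T) \<longleftrightarrow> aW (\<lambda>y. ap M (ap M F y) (ap M T y) = ap M (ap M G y) (ap M T y))"
    "mem N (app N f (cl T)) (app N g (cl T)) \<longleftrightarrow> aW (\<lambda>y. ap M (ap M F y) (ap M T y) \<in> E (ap M (ap M G y) (ap M T y)))"
    if T: "T \<in> FY" "aW (\<lambda>y. ap M T y \<in> E (ap M z y))" for T
  proof -
    have d: "dft M (\<lambda>e. ap M (ap M F (e 0)) (ap M T (e 0)))" "dft M (\<lambda>e. ap M (ap M G (e 0)) (ap M T (e 0)))"
      by (intro dfns FV funs_V[OF T(1)])+
    note e = app_N[OF F(1) T(1) z(1) af(1) T(2), folded F(2)] app_N[OF G(1) T(1) z(1) af(2) T(2), folded G(2)]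
    show "app N f (cl T) = app N g (cl T) \<longleftrightarrow> aW (\<lambda>y. ap M (ap M F y) (ap M T y) = ap M (ap M G y) (ap M T y))"
      unfolding e cl_eq[OF LamF[OF d(1)] LamF[OF d(2)]] by (rule al_cong) (simp add: ap_Lam[OF YV d(1)] ap_Lam[OF YV d(2)])
    show "mem N (app N f (cl T)) (app N g (cl T)) \<longleftrightarrow> aW (\<lambda>y. ap M (ap M F y) (ap M T y) \<in> E (ap M (ap M G y) (ap M T y)))"
      unfolding e cl_mem[OF LamF[OF d(1)] LamF[OF d(2)]] by (rule al_cong) (simp add: ap_Lam[OF YV d(1)] ap_Lam[OF YV d(2)])
  qed
  show "isset N {x \<in> elts N (cl z). app N f x = app N g x}"
    using sub_N(1,2)[OF z(1) P(1), of "\<lambda>x. app N f x = app N g x"] QP(1) cl_univ unfolding isset_def by blast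
  show "isset N {x \<in> elts N (cl z). mem N (app N f x) (app N g x)}"
    using sub_N(1,2)[OF z(1) P(2), of "\<lambda>x. mem N (app N f x) (app N g x)"] QP(2) cl_univ unfolding isset_def by blast
qed

text \<open>Equality and membership in the iterated ultrapower become iterated quantifiers over
  \<open>M\<close>. All later comparisons of the two sides of the internal relation rest on this
  translation.\<close>

lemma class2:
  assumes z: "z \<in> FY" "D \<in> FY" and uN: "is_ultrafilter N (cl z) (cl D)"
    and F: "F \<in> FY" "G \<in> FY" and af: "aW (\<lambda>y. ap M F y \<in> funs M (ap M z y))" "aW (\<lambda>y. ap M G y \<in> funs M (ap M z y))"
  shows "ult_class N (cl z) (cl D) (cl F) = ult_class N (cl z) (cl D) (cl G) \<longleftrightarrow>
      aW (\<lambda>y. almost M (ap M D y) (ap M z y) (\<lambda>v. ap M (ap M F y) v = ap M (ap M G y) v))"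
    and "mem (ult N (cl z) (cl D)) (ult_class N (cl z) (cl D) (cl F)) (ult_class N (cl z) (cl D) (cl G)) \<longleftrightarrow>
      aW (\<lambda>y. almost M (ap M D y) (ap M z y) (\<lambda>v. ap M (ap M F y) v \<in> E (ap M (ap M G y) v)))"
proof -
  note FV = F[THEN funs_V]
  have P: "dfn M (\<lambda>e. ap M (ap M F (e 0)) (e 1) = ap M (ap M G (e 0)) (e 1))"
    "dfn M (\<lambda>e. ap M (ap M F (e 0)) (e 1) \<in> E (ap M (ap M G (e 0)) (e 1)))" by (intro dfns FV)+
  have fN: "cl F \<in> funs N (cl z)" "cl G \<in> funs N (cl z)" using funs_N_I F z af by blast+
  have QP: "app N (cl F) (cl T) = app N (cl G) (cl T) \<longleftrightarrow> aW (\<lambda>y. ap M (ap M F y) (ap M T y) = ap M (ap M G y) (ap M T y))"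
    "mem N (app N (cl F) (cl T)) (app N (cl G) (cl T)) \<longleftrightarrow> aW (\<lambda>y. ap M (ap M F y) (ap M T y) \<in> E (ap M (ap M G y) (ap M T y)))"
    if T: "T \<in> FY" "aW (\<lambda>y. ap M T y \<in> E (ap M z y))" for T
  proof -
    have d: "dft M (\<lambda>e. ap M (ap M F (e 0)) (ap M T (e 0)))" "dft M (\<lambda>e. ap M (ap M G (e 0)) (ap M T (e 0)))"
      by (intro dfns FV funs_V[OF T(1)])+
    note e = app_N[OF F(1) T(1) z(1) af(1) T(2)] app_N[OF F(2) T(1) z(1) af(2) T(2)]
    show "app N (cl F) (cl T) = app N (cl G) (cl T) \<longleftrightarrow> aW (\<lambda>y. ap M (ap M F y) (ap M T y) = ap M (ap M G y) (ap M T y))"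
      unfolding e cl_eq[OF LamF[OF d(1)] LamF[OF d(2)]] by (rule al_cong) (simp add: ap_Lam[OF YV d(1)] ap_Lam[OF YV d(2)])
    show "mem N (app N (cl F) (cl T)) (app N (cl G) (cl T)) \<longleftrightarrow> aW (\<lambda>y. ap M (ap M F y) (ap M T y) \<in> E (ap M (ap M G y) (ap M T y)))"
      unfolding e cl_mem[OF LamF[OF d(1)] LamF[OF d(2)]] by (rule al_cong) (simp add: ap_Lam[OF YV d(1)] ap_Lam[OF YV d(2)])
  qed
  show "ult_class N (cl z) (cl D) (cl F) = ult_class N (cl z) (cl D) (cl G) \<longleftrightarrow>
      aW (\<lambda>y. almost M (ap M D y) (ap M z y) (\<lambda>v. ap M (ap M F y) v = ap M (ap M G y) v))"
    unfolding ultra_base.class_eq[OF base2[OF z uN] fN] by (rule sub_N(3)[OF z(1) P(1) QP(1) z(2)])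
  show "mem (ult N (cl z) (cl D)) (ult_class N (cl z) (cl D) (cl F)) (ult_class N (cl z) (cl D) (cl G)) \<longleftrightarrow>
      aW (\<lambda>y. almost M (ap M D y) (ap M z y) (\<lambda>v. ap M (ap M F y) v \<in> E (ap M (ap M G y) v)))"
    unfolding ultra_base.class_mem[OF base2[OF z uN] fN] by (rule sub_N(3)[OF z(1) P(2) QP(2) z(2)])
qed

lemma univ2E:
  assumes "c \<in> univ (ult N (cl z) (cl D))" "z \<in> FY"
  obtains F where "F \<in> FY" "aW (\<lambda>y. ap M F y \<in> funs M (ap M z y))" "c = ult_class N (cl z) (cl D) (cl F)"
proof -
  obtain f where f: "f \<in> funs N (cl z)" "c = ult_class N (cl z) (cl D) f" using assms(1) by (auto simp: ult_def)
  obtain F where F: "F \<in> FY" "f = cl F" using f(1) by (rule funs_N_E)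
  show thesis by (rule that[OF F(1) funs_N_D[OF F(1) assms(2)]]) (use f F in auto)
qed

lemma univ2I:
  assumes "F \<in> FY" "z \<in> FY" "aW (\<lambda>y. ap M F y \<in> funs M (ap M z y))"
  shows "ult_class N (cl z) (cl D) (cl F) \<in> univ (ult N (cl z) (cl D))"
  using funs_N_I[OF assms] by (simp add: ult_def)

text \<open>A representative of the constant function on \<open>cl z\<close> with value
  \<open>cl B\<close>, as formed inside the ultrapower.\<close>

definition cst :: "'a \<Rightarrow> 'a \<Rightarrow> 'a" where
  "cst z B = Lam M Y (\<lambda>y. Lam M (ap M z y) (\<lambda>_. ap M B y))"

lemma cst:
  assumes z: "z \<in> FY" "B \<in> FY"
  shows "cst z B \<in> FY" and "\<And>y. y \<in> E Y \<Longrightarrow> ap M (cst z B) y \<in> funs M (ap M z y)"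
    and "\<And>y v. y \<in> E Y \<Longrightarrow> v \<in> E (ap M z y) \<Longrightarrow> ap M (ap M (cst z B) y) v = ap M B y"
    and "const_fun N (cl z) (cl B) = cl (cst z B)"
proof -
  note zV = z[THEN funs_V]
  let ?t = "\<lambda>y. Lam M (ap M z y) (\<lambda>_. ap M B y)"
  have dt: "dft M (\<lambda>e. ?t (e 0))" by (intro dfns zV)
  show KF: "cst z B \<in> FY" unfolding cst_def by (rule LamF[OF dt])
  have Kap: "ap M (cst z B) y = ?t y" if "y \<in> E Y" for y unfolding cst_def by (rule ap_Lam[OF YV dt that])
  have zy: "ap M z y \<in> V" "dft M (\<lambda>e. ap M B y)" if "y \<in> E Y" for y
    using ap_V[OF E_V[OF that]] by (auto intro: dft_const)
  show "ap M (cst z B) y \<in> funs M (ap M z y)" if "y \<in> E Y" for y unfolding Kap[OF that] by (rule Lam_funs[OF zy[OF that]])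
  show "ap M (ap M (cst z B) y) v = ap M B y" if "y \<in> E Y" "v \<in> E (ap M z y)" for y v
    unfolding Kap[OF that(1)] by (rule ap_Lam[OF zy[OF that(1)] that(2)])
  have KE: "E (ap M (cst z B) y) = {op x (ap M B y) | x. x \<in> E (ap M z y)}" if "y \<in> E Y" for y
    unfolding Kap[OF that] using Lam_E[OF zy[OF that]] by blast
  show "const_fun N (cl z) (cl B) = cl (cst z B)" unfolding const_fun_def
  proof (rule the_set_N[OF cl_univ[OF KF]], intro set_eqI iffI)
    fix p assume p: "p \<in> elts N (cl (cst z B))"
    then obtain P where P: "P \<in> FY" "p = cl P" by (rule eltsE)
    have PV: "P \<in> V" using P funs_V by blast
    have al: "aW (\<lambda>y. ap M P y \<in> E (ap M (cst z B) y))" using p P elts_cl KF by blast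
    have d: "dft M (\<lambda>e. fs M (ap M P (e 0)))" by (intro dfns PV)
    let ?X = "Lam M Y (\<lambda>y. fs M (ap M P y))"
    have X: "?X \<in> FY" by (rule LamF[OF d])
    have XV: "?X \<in> V" using X funs_V by blast
    have dd: "dft M (\<lambda>e. op (ap M ?X (e 0)) (ap M B (e 0)))" by (intro dfns XV zV)
    have st: "fs M (ap M P y) \<in> E (ap M z y) \<and> ap M P y = op (fs M (ap M P y)) (ap M B y)"
      if y: "y \<in> E Y" "ap M P y \<in> E (ap M (cst z B) y)" for y
    proof -
      obtain x where x: "x \<in> E (ap M z y)" "ap M P y = op x (ap M B y)" using y KE by blast
      then show ?thesis using E_V[OF x(1)] ap_V[OF E_V[OF y(1)]] by simp
    qed
    have "aW (\<lambda>y. ap M ?X y \<in> E (ap M z y))"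
      by (rule al_mono[OF uf al]) (intro dfns XV zV, use st ap_Lam[OF YV d] in simp)
    then have 1: "cl ?X \<in> elts N (cl z)" using elts_cl X z by blast
    have d3: "dfn M (\<lambda>e. ap M P (e 0) = ap M (Lam M Y (\<lambda>y. op (ap M ?X y) (ap M B y))) (e 0))"
      by (intro dfns PV XV zV Lam_V[OF YV])
    have "aW (\<lambda>y. ap M P y = ap M (Lam M Y (\<lambda>y. op (ap M ?X y) (ap M B y))) y)"
      by (rule al_mono[OF uf al d3]) (use st in \<open>simp add: ap_Lam[OF YV dd] ap_Lam[OF YV d]\<close>)
    then have "p = opair N (cl ?X) (cl B)" unfolding P(2) opair_N[OF X z(2)] using cl_eq[OF P(1) LamF[OF dd]] by blast
    then show "p \<in> {opair N x (cl B) |x. x \<in> elts N (cl z)}" using 1 by blast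
  next
    fix p assume "p \<in> {opair N x (cl B) |x. x \<in> elts N (cl z)}"
    then obtain x where x: "x \<in> elts N (cl z)" "p = opair N x (cl B)" by blast
    obtain X where X: "X \<in> FY" "x = cl X" using x(1) by (rule eltsE)
    have XV: "X \<in> V" using X funs_V by blast
    have "aW (\<lambda>y. ap M X y \<in> E (ap M z y))" using x X elts_cl z by blast
    then have "aW (\<lambda>y. op (ap M X y) (ap M B y) \<in> E (ap M (cst z B) y))"
      by (rule al_mono[OF uf]) (intro dfns XV zV funs_V[OF KF], use KE in blast)
    then show "p \<in> elts N (cl (cst z B))" unfolding x(2) X(2) using opair_elts X z KF by blast
  qed
qed

end

section \<open>The internal relation\<close>

context zfc
begin

lemma dft2_subst:
  assumes f: "dft M (\<lambda>e. f (e 0) (e 1))" and st: "dft M s" "dft M t" shows "dft M (\<lambda>e. f (s e) (t e))"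
proof -
  have 1: "dfn M (\<lambda>e. e 0 = f (e 1) (e 2))" using f unfolding dft_def by (simp add: numeral_2_eq_2)
  have "dfn M (\<lambda>e. e 0 = f (s (\<lambda>n. e (Suc n))) (t (\<lambda>n. e (Suc n))))"
    by (rule dfn3_subst[where Q="\<lambda>x y z. x = f y z", OF 1]) (intro dfns dft_shift st)+
  moreover have "f (s e) (t e) \<in> V" if "e \<in> envs M" for e
    using dft_in[OF f, of "\<lambda>n. if n = 0 then s e else t e"] dft_in[OF st(1) that] dft_in[OF st(2) that]
    by (simp add: envs_def)
  ultimately show ?thesis unfolding dft_def by blast
qed

end

context zfc_ult
begin

text \<open>The element of \<open>j_W(M_D)\<close> represented by the matrix \<open>t\<close> on \<open>Y\<close> and \<open>Z\<close>, where \<open>D\<close> is an ultrafilter on \<open>Z\<close>.\<close>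

definition cu :: "'a \<Rightarrow> 'a \<Rightarrow> ('a \<Rightarrow> 'a \<Rightarrow> 'a) \<Rightarrow> 'a set set" where
  "cu Z D t = ult_class N (cl (Lam M Y (\<lambda>_. Z))) (cl (Lam M Y (\<lambda>_. D))) (cl (Lam M Y (\<lambda>y. Lam M Z (t y))))"

lemma emb_cl: "ult_emb M Y W Z = cl (Lam M Y (\<lambda>_. Z))"
  by (simp add: ult_emb_def const_fun_Lam)

lemma const_FY [simp]: "a \<in> V \<Longrightarrow> Lam M Y (\<lambda>_. a) \<in> FY"
  and ap_const [simp]: "a \<in> V \<Longrightarrow> y \<in> E Y \<Longrightarrow> ap M (Lam M Y (\<lambda>_. a)) y = a"
  using LamF[OF dft_const] ap_Lam[OF YV dft_const] by auto

lemma const_uf: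
  assumes "uf Z D" shows "is_ultrafilter N (cl (Lam M Y (\<lambda>_. Z))) (cl (Lam M Y (\<lambda>_. D)))"
  using ult_lift[OF const_FY const_FY al_all[OF uf]] assms uf_V by simp

lemma class_const:
  assumes u: "uf Z D" and F: "F \<in> FY" "G \<in> FY" and af: "aW (\<lambda>y. ap M F y \<in> funs M Z)" "aW (\<lambda>y. ap M G y \<in> funs M Z)"
  shows "ult_class N (cl (Lam M Y (\<lambda>_. Z))) (cl (Lam M Y (\<lambda>_. D))) (cl F) =
      ult_class N (cl (Lam M Y (\<lambda>_. Z))) (cl (Lam M Y (\<lambda>_. D))) (cl G) \<longleftrightarrow>
      aW (\<lambda>y. almost M D Z (\<lambda>v. ap M (ap M F y) v = ap M (ap M G y) v))"
    and "mem (ult N (cl (Lam M Y (\<lambda>_. Z))) (cl (Lam M Y (\<lambda>_. D))))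
        (ult_class N (cl (Lam M Y (\<lambda>_. Z))) (cl (Lam M Y (\<lambda>_. D))) (cl F))
        (ult_class N (cl (Lam M Y (\<lambda>_. Z))) (cl (Lam M Y (\<lambda>_. D))) (cl G)) \<longleftrightarrow>
      aW (\<lambda>y. almost M D Z (\<lambda>v. ap M (ap M F y) v \<in> E (ap M (ap M G y) v)))"
proof -
  note V = uf_V[OF u]
  have a: "aW (\<lambda>y. ap M H y \<in> funs M (ap M (Lam M Y (\<lambda>_. Z)) y))" if "aW (\<lambda>y. ap M H y \<in> funs M Z)" for H
    using that al_cong[of Y "\<lambda>y. ap M H y \<in> funs M (ap M (Lam M Y (\<lambda>_. Z)) y)" "\<lambda>y. ap M H y \<in> funs M Z"] V by simp
  note c = class2[OF const_FY[OF V(1)] const_FY[OF V(2)] const_uf[OF u] F a[OF af(1)] a[OF af(2)]]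
  show "ult_class N (cl (Lam M Y (\<lambda>_. Z))) (cl (Lam M Y (\<lambda>_. D))) (cl F) =
      ult_class N (cl (Lam M Y (\<lambda>_. Z))) (cl (Lam M Y (\<lambda>_. D))) (cl G) \<longleftrightarrow>
      aW (\<lambda>y. almost M D Z (\<lambda>v. ap M (ap M F y) v = ap M (ap M G y) v))"
    unfolding c(1) by (rule al_cong) (simp add: V)
  show "mem (ult N (cl (Lam M Y (\<lambda>_. Z))) (cl (Lam M Y (\<lambda>_. D))))
        (ult_class N (cl (Lam M Y (\<lambda>_. Z))) (cl (Lam M Y (\<lambda>_. D))) (cl F))
        (ult_class N (cl (Lam M Y (\<lambda>_. Z))) (cl (Lam M Y (\<lambda>_. D))) (cl G)) \<longleftrightarrow>
      aW (\<lambda>y. almost M D Z (\<lambda>v. ap M (ap M F y) v \<in> E (ap M (ap M G y) v)))"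
    unfolding c(2) by (rule al_cong) (simp add: V)
qed

lemma cu_fun:
  assumes Z: "Z \<in> V" and t: "dft M (\<lambda>e. t (e 0) (e 1))"
  shows "Lam M Y (\<lambda>y. Lam M Z (t y)) \<in> FY"
    and "\<And>y. y \<in> E Y \<Longrightarrow> ap M (Lam M Y (\<lambda>y. Lam M Z (t y))) y \<in> funs M Z"
    and "\<And>y v. y \<in> E Y \<Longrightarrow> v \<in> E Z \<Longrightarrow> ap M (ap M (Lam M Y (\<lambda>y. Lam M Z (t y))) y) v = t y v"
    and "aW (\<lambda>y. ap M (Lam M Y (\<lambda>y. Lam M Z (t y))) y \<in> funs M Z)"
proof -
  have t': "dft M (\<lambda>e. t (e i) (e j))" for i j by (rule dft2_subst[OF t]) (intro dfns)+
  have d: "dft M (\<lambda>e. Lam M Z (t (e 0)))" by (intro dfns Z t')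
  show "Lam M Y (\<lambda>y. Lam M Z (t y)) \<in> FY" by (rule LamF[OF d])
  show 2: "ap M (Lam M Y (\<lambda>y. Lam M Z (t y))) y \<in> funs M Z" if y: "y \<in> E Y" for y
  proof -
    have ty: "dft M (\<lambda>e. t y (e 0))" by (rule dft2_subst[OF t]) (intro dfns E_V[OF y])+
    show ?thesis unfolding ap_Lam[OF YV d y] by (rule Lam_funs[OF Z ty])
  qed
  show "aW (\<lambda>y. ap M (Lam M Y (\<lambda>y. Lam M Z (t y))) y \<in> funs M Z)" by (rule al_all[OF uf 2])
  fix y assume y: "y \<in> E Y"
  have ty: "dft M (\<lambda>e. t y (e 0))" by (rule dft2_subst[OF t]) (intro dfns E_V[OF y])+
  have ap: "ap M (Lam M Y (\<lambda>y. Lam M Z (t y))) y = Lam M Z (t y)" by (rule ap_Lam[OF YV d y])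
  fix v assume v: "v \<in> E Z"
  show "ap M (ap M (Lam M Y (\<lambda>y. Lam M Z (t y))) y) v = t y v" unfolding ap by (rule ap_Lam[OF Z ty v])
qed

lemma cu_eq:
  assumes u: "uf Z D" and d: "dft M (\<lambda>e. t (e 0) (e 1))" "dft M (\<lambda>e. s (e 0) (e 1))"
  shows "cu Z D t = cu Z D s \<longleftrightarrow> aW (\<lambda>y. almost M D Z (\<lambda>v. t y v = s y v))"
proof -
  note t = cu_fun[OF uf_V(1)[OF u] d(1)] and s = cu_fun[OF uf_V(1)[OF u] d(2)]
  show ?thesis unfolding cu_def class_const(1)[OF u t(1) s(1) t(4) s(4)]
    by (intro al_cong) (simp add: t(3) s(3))
qed

lemma cu_mem:
  assumes u: "uf Z D" and d: "dft M (\<lambda>e. t (e 0) (e 1))" "dft M (\<lambda>e. s (e 0) (e 1))"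
  shows "mem (ult N (cl (Lam M Y (\<lambda>_. Z))) (cl (Lam M Y (\<lambda>_. D)))) (cu Z D t) (cu Z D s) \<longleftrightarrow>
    aW (\<lambda>y. almost M D Z (\<lambda>v. t y v \<in> E (s y v)))"
proof -
  note t = cu_fun[OF uf_V(1)[OF u] d(1)] and s = cu_fun[OF uf_V(1)[OF u] d(2)]
  show ?thesis unfolding cu_def class_const(2)[OF u t(1) s(1) t(4) s(4)]
    by (intro al_cong) (simp add: t(3) s(3))
qed

lemma cu_univ:
  assumes u: "uf Z D" and d: "dft M (\<lambda>e. t (e 0) (e 1))"
  shows "cu Z D t \<in> univ (ult N (cl (Lam M Y (\<lambda>_. Z))) (cl (Lam M Y (\<lambda>_. D))))"
proof -
  note V = uf_V[OF u] and t = cu_fun[OF uf_V(1)[OF u] d]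
  show ?thesis unfolding cu_def
    by (rule univ2I[OF t(1) const_FY[OF V(1)] al_all[OF uf]]) (use t(2) V in simp)
qed

lemma cu_I:
  assumes u: "uf Z D" and F: "F \<in> FY" "aW (\<lambda>y. ap M F y \<in> funs M Z)" and d: "dft M (\<lambda>e. t (e 0) (e 1))"
    and eq: "\<And>y v. y \<in> E Y \<Longrightarrow> v \<in> E Z \<Longrightarrow> ap M (ap M F y) v = t y v"
  shows "ult_class N (cl (Lam M Y (\<lambda>_. Z))) (cl (Lam M Y (\<lambda>_. D))) (cl F) = cu Z D t"
proof -
  note t = cu_fun[OF uf_V(1)[OF u] d]
  show ?thesis unfolding cu_def class_const(1)[OF u F(1) t(1) F(2) t(4)]
    by (intro al_all[OF uf] al_all[OF u]) (simp_all add: t(3) eq)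
qed

lemma cu_E:
  assumes u: "uf Z D" and c: "c \<in> univ (ult N (cl (Lam M Y (\<lambda>_. Z))) (cl (Lam M Y (\<lambda>_. D))))"
  obtains F where "F \<in> V" "c = cu Z D (\<lambda>y v. ap M (ap M F y) v)"
proof -
  note V = uf_V[OF u]
  obtain F where F: "F \<in> FY" "aW (\<lambda>y. ap M F y \<in> funs M (ap M (Lam M Y (\<lambda>_. Z)) y))"
    "c = ult_class N (cl (Lam M Y (\<lambda>_. Z))) (cl (Lam M Y (\<lambda>_. D))) (cl F)"
    using univ2E[OF c const_FY[OF V(1)]] by metis
  have "aW (\<lambda>y. ap M F y \<in> funs M Z)"
    using F(2) al_cong[of Y "\<lambda>y. ap M F y \<in> funs M (ap M (Lam M Y (\<lambda>_. Z)) y)" "\<lambda>y. ap M F y \<in> funs M Z"] V by simp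
  moreover have "dft M (\<lambda>e. ap M (ap M F (e 0)) (e 1))" by (intro dfns funs_V[OF F(1)])
  ultimately have "c = cu Z D (\<lambda>y v. ap M (ap M F y) v)" unfolding F(3) by (rule cu_I[OF u F(1)]) simp
  then show thesis by (rule that[OF funs_V[OF F(1)]])
qed

lemma cu_emb:
  assumes u: "uf Z D" and B: "B \<in> FY"
  shows "ult_emb N (cl (Lam M Y (\<lambda>_. Z))) (cl (Lam M Y (\<lambda>_. D))) (cl B) = cu Z D (\<lambda>y v. ap M B y)"
proof -
  note V = uf_V[OF u] and c = cst[OF const_FY[OF uf_V(1)[OF u]] B]
  have d: "dft M (\<lambda>e. ap M B (e 0))" by (intro dfns funs_V[OF B])
  show ?thesis unfolding ult_emb_def c(4)
    by (rule cu_I[OF u c(1) al_all[OF uf] d]) (use c(2,3) V in simp_all)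
qed

end

text \<open>Prefix \<open>A\<close> belongs to the ultrapower by \<open>W\<close>, prefix
  \<open>B\<close> to that by \<open>U\<close>. Thus \<open>A.cu X U\<close> denotes elements of
  \<open>j_W(M_U)\<close>, and \<open>B.cu Y W\<close> elements of \<open>j_U(M_W)\<close>.\<close>

locale two_ultrafilters = zfc M + A: zfc_ult M Y W + B: zfc_ult M X U
  for M :: "'a eps_model" and X U Y W :: 'a
begin

text \<open>The embedding makes a function of \<open>y\<close> into a matrix constant in
  \<open>x\<close>. All representatives of the class give the same matrix modulo \<open>U\<close>
  and \<open>W\<close>, which is what \<open>the_elem\<close> requires.\<close>

lemma restr_cl:
  assumes B0: "B0 \<in> A.FY"
  shows "ult_emb_restr M X U Y W (A.cl B0) = B.cu Y W (\<lambda>x y. ap M B0 y)"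
proof -
  have d: "dft M (\<lambda>e. ap M G (e 1))" if "G \<in> A.FY" for G by (intro dfns funs_V[OF that])
  have 1: "ult_class B.N (ult_emb M X U Y) (ult_emb M X U W) (ult_emb M X U g) = B.cu Y W (\<lambda>x y. ap M g y)" if g: "g \<in> A.FY" for g
    unfolding B.emb_cl by (rule B.cu_I[OF A.uf B.const_FY[OF funs_V[OF g]] al_all[OF B.uf] d[OF g]]) (use g funs_V in simp_all)
  have 2: "B.cu Y W (\<lambda>x y. ap M g y) = B.cu Y W (\<lambda>x y. ap M B0 y)" and 3: "g \<in> A.FY" if g: "g \<in> A.cl B0" for g
  proof -
    show gF: "g \<in> A.FY" using g by (simp add: ult_class_def)
    have "large M W {x \<in> E Y. app M B0 x = app M g x}" using g by (simp add: ult_class_def)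
    then have "A.cl B0 = A.cl g" by (rule iffD2[OF ultra_base.class_eq[OF A.base B0 gF]])
    then have al: "A.aW (\<lambda>y. ap M g y = ap M B0 y)" using A.cl_eq[OF gF B0] by simp
    show "B.cu Y W (\<lambda>x y. ap M g y) = B.cu Y W (\<lambda>x y. ap M B0 y)"
      unfolding B.cu_eq[OF A.uf d[OF gF] d[OF B0]] using al al_all[OF B.uf] by simp
  qed
  have "(\<lambda>g. ult_class B.N (ult_emb M X U Y) (ult_emb M X U W) (ult_emb M X U g)) ` A.cl B0 = {B.cu Y W (\<lambda>x y. ap M B0 y)}"
  proof (intro equalityI subsetI)
    fix c assume "c \<in> (\<lambda>g. ult_class B.N (ult_emb M X U Y) (ult_emb M X U W) (ult_emb M X U g)) ` A.cl B0"
    then obtain g where g: "g \<in> A.cl B0" and c: "c = ult_class B.N (ult_emb M X U Y) (ult_emb M X U W) (ult_emb M X U g)"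
      by (rule imageE)
    show "c \<in> {B.cu Y W (\<lambda>x y. ap M B0 y)}" unfolding c 1[OF 3[OF g]] 2[OF g] by (rule singletonI)
  next
    fix c assume "c \<in> {B.cu Y W (\<lambda>x y. ap M B0 y)}"
    then have c: "c = ult_class B.N (ult_emb M X U Y) (ult_emb M X U W) (ult_emb M X U B0)" unfolding 1[OF B0] by (rule singletonD)
    show "c \<in> (\<lambda>g. ult_class B.N (ult_emb M X U Y) (ult_emb M X U W) (ult_emb M X U g)) ` A.cl B0"
      unfolding c by (rule imageI[OF ultra_base.class_self[OF A.base B0]])
  qed
  then show ?thesis unfolding ult_emb_restr_def by simp
qed

text \<open>The internal ultrafilter is \<open>j_W(U)\<close>, so the isomorphism goes from
  \<open>j_W(M_U)\<close> to \<open>j_U(M_W)\<close>.\<close>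

lemma internal_rel_const:
  assumes cw: "capw X U Y W (Lam M Y (\<lambda>_. U))"
  shows "internal_rel M X U Y W"
proof -
  let ?S = "ult A.N (A.cl (Lam M Y (\<lambda>_. X))) (A.cl (Lam M Y (\<lambda>_. U)))"
  let ?T = "ult_of_ult M X U Y W"
  have T: "?T = ult B.N (B.cl (Lam M X (\<lambda>_. Y))) (B.cl (Lam M X (\<lambda>_. W)))"
    by (simp add: ult_of_ult_def B.emb_cl)
  have XYV: "cprod M X Y \<in> V" by (rule E_cprod[OF B.YV A.YV])
  have comm: "almost M U X (\<lambda>x. A.aW (Q x)) \<longleftrightarrow> A.aW (\<lambda>y. almost M U X (\<lambda>x. Q x y))" if "dfn M (\<lambda>e. Q (e 0) (e 1))" for Q
    unfolding capwD[OF cw B.YV A.YV that] by (rule al_cong) (simp add: B.WV)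
  \<comment> \<open>\<open>a\<close> and \<open>b\<close> are the two readings of a function
    \<open>H\<close> on the product. Since the quantifiers commute, they identify the same functions
    and define the same membership.\<close>
  define a where "a = (\<lambda>H. A.cu X U (\<lambda>y x. ap M H (op x y)))"
  define b where "b = (\<lambda>H. B.cu Y W (\<lambda>x y. ap M H (op x y)))"
  have da: "dft M (\<lambda>e. ap M H (op (e 1) (e 0)))" and db: "dft M (\<lambda>e. ap M H (op (e 0) (e 1)))" if "H \<in> V" for H
    by (intro dfns that)+
  have eq: "a H = a H' \<longleftrightarrow> b H = b H'" if H: "H \<in> V" "H' \<in> V" for H H'
  proof -
    have "dfn M (\<lambda>e. ap M H (op (e 0) (e 1)) = ap M H' (op (e 0) (e 1)))" by (intro dfns H)
    from comm[OF this] show ?thesis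
      unfolding a_def b_def A.cu_eq[OF B.uf da[OF H(1)] da[OF H(2)]] B.cu_eq[OF A.uf db[OF H(1)] db[OF H(2)]] by simp
  qed
  have mm: "mem ?S (a H) (a H') \<longleftrightarrow> mem ?T (b H) (b H')" if H: "H \<in> V" "H' \<in> V" for H H'
  proof -
    have "dfn M (\<lambda>e. ap M H (op (e 0) (e 1)) \<in> E (ap M H' (op (e 0) (e 1))))" by (intro dfns H)
    from comm[OF this] show ?thesis unfolding T
      unfolding a_def b_def A.cu_mem[OF B.uf da[OF H(1)] da[OF H(2)]] B.cu_mem[OF A.uf db[OF H(1)] db[OF H(2)]] by simp
  qed
  have au: "a H \<in> univ ?S" and bu: "b H \<in> univ ?T" if "H \<in> V" for H
    unfolding T a_def b_def using A.cu_univ[OF B.uf da[OF that]] B.cu_univ[OF A.uf db[OF that]] by simp_all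
  have uncurry: "\<exists>H\<in>V. a H = A.cu X U (\<lambda>y x. t x y) \<and> b H = B.cu Y W t" if t: "dft M (\<lambda>e. t (e 0) (e 1))" for t
  proof -
    have t': "dft M (\<lambda>e. t (e 1) (e 0))" by (rule dft2_subst[OF t]) (intro dfns)+
    have d: "dft M (\<lambda>e. t (fs M (e 0)) (sn M (e 0)))" by (rule dft2_subst[OF t]) (intro dfns)+
    let ?H = "Lam M (cprod M X Y) (\<lambda>p. t (fs M p) (sn M p))"
    have H: "?H \<in> V" using Lam_funs[OF XYV d] by (rule funs_V)
    have ap: "ap M ?H (op x y) = t x y" if "x \<in> E X" "y \<in> E Y" for x y
      using ap_Lam[OF XYV d, of "op x y"] that E_V B.YV A.YV by simp
    have "a ?H = A.cu X U (\<lambda>y x. t x y)" unfolding a_def A.cu_eq[OF B.uf da[OF H] t']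
      by (intro al_all[OF A.uf] al_all[OF B.uf]) (rule ap)
    moreover have "b ?H = B.cu Y W t" unfolding b_def B.cu_eq[OF A.uf db[OF H] t]
      by (intro al_all[OF A.uf] al_all[OF B.uf]) (rule ap)
    ultimately show ?thesis using H by blast
  qed
  have asurj: "\<exists>H\<in>V. c = a H" if c: "c \<in> univ ?S" for c
  proof -
    obtain F where F: "F \<in> V" "c = A.cu X U (\<lambda>y x. ap M (ap M F y) x)" by (rule A.cu_E[OF B.uf c])
    have "dft M (\<lambda>e. ap M (ap M F (e 1)) (e 0))" by (intro dfns F)
    from uncurry[OF this] show ?thesis using F by auto
  qed
  have bsurj: "\<exists>H\<in>V. c = b H" if c: "c \<in> univ ?T" for c
  proof -
    obtain F where F: "F \<in> V" "c = B.cu Y W (\<lambda>x y. ap M (ap M F x) y)" by (rule B.cu_E[OF A.uf c[unfolded T]])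
    have "dft M (\<lambda>e. ap M (ap M F (e 0)) (e 1))" by (intro dfns F)
    from uncurry[OF this] show ?thesis using F by auto
  qed
  \<comment> \<open>Any \<open>H\<close> with the given first reading may be used, because equal
    first readings force equal second readings.\<close>
  define k where "k = (\<lambda>c. b (SOME H. H \<in> V \<and> a H = c))"
  have k: "k (a H) = b H" if "H \<in> V" for H
  proof -
    have "(SOME H'. H' \<in> V \<and> a H' = a H) \<in> V \<and> a (SOME H'. H' \<in> V \<and> a H' = a H) = a H"
      by (rule someI[of _ H]) (use that in blast)
    then show ?thesis unfolding k_def using eq that by blast
  qed
  have "model_iso k ?S ?T" unfolding model_iso_def
  proof (intro conjI ballI)
    show "bij_betw k (univ ?S) (univ ?T)" unfolding bij_betw_def
    proof
      show "inj_on k (univ ?S)" 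
      proof (rule inj_onI)
        fix c d assume cd: "c \<in> univ ?S" "d \<in> univ ?S" "k c = k d"
        obtain H H' where H: "H \<in> V" "c = a H" "H' \<in> V" "d = a H'" using asurj[OF cd(1)] asurj[OF cd(2)] by blast
        show "c = d" using cd(3) eq[OF H(1,3)] k[OF H(1)] k[OF H(3)] unfolding H(2,4) by simp
      qed
      show "k ` univ ?S = univ ?T"
      proof (intro equalityI subsetI)
        fix c assume "c \<in> k ` univ ?S"
        then obtain d where d: "d \<in> univ ?S" "c = k d" by (rule imageE)
        obtain H where H: "H \<in> V" "d = a H" using asurj[OF d(1)] by blast
        show "c \<in> univ ?T" unfolding d(2) H(2) k[OF H(1)] by (rule bu[OF H(1)])
      next
        fix c assume "c \<in> univ ?T"
        then obtain H where H: "H \<in> V" "c = b H" using bsurj by blast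
        show "c \<in> k ` univ ?S" unfolding H(2) k[OF H(1), symmetric] by (rule imageI[OF au[OF H(1)]])
      qed
    qed
    fix c d assume cd: "c \<in> univ ?S" "d \<in> univ ?S"
    obtain H H' where H: "H \<in> V" "c = a H" "H' \<in> V" "d = a H'" using asurj[OF cd(1)] asurj[OF cd(2)] by blast
    show "mem ?T (k c) (k d) \<longleftrightarrow> mem ?S c d" unfolding H(2,4) k[OF H(1)] k[OF H(3)] mm[OF H(1,3)] ..
  qed
  moreover have "k (ult_emb A.N (A.cl (Lam M Y (\<lambda>_. X))) (A.cl (Lam M Y (\<lambda>_. U))) c) = ult_emb_restr M X U Y W c"
    if c: "c \<in> univ A.N" for c
  proof -
    obtain G where G: "G \<in> A.FY" "c = A.cl G" using c by (rule A.univ_E)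
    have "dft M (\<lambda>e. ap M G (e 1))" by (intro dfns funs_V[OF G(1)])
    from uncurry[OF this] obtain H where H: "H \<in> V" "a H = A.cu X U (\<lambda>y x. ap M G y)" "b H = B.cu Y W (\<lambda>x y. ap M G y)" by blast
    show ?thesis unfolding G(2) restr_cl[OF G(1)] A.cu_emb[OF B.uf G(1)] using k[OF H(1)] H by simp
  qed
  ultimately show ?thesis unfolding internal_rel_def using A.const_uf[OF B.uf] by blast
qed

text \<open>The class of the identity on \<open>X\<close> is a seed of \<open>j_U\<close>:
  membership of the seed in the image of a set expresses largeness in \<open>U\<close>. Its preimage
  under the isomorphism is represented by functions \<open>G(y)\<close> on \<open>z(y)\<close>, and
  \<open>u(y)\<close> is the image of \<open>D(y)\<close> under \<open>G(y)\<close>.\<close>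

lemma capw_of_internal_rel:
  assumes ir: "internal_rel M X U Y W"
  shows "\<exists>u\<in>V. capw X U Y W u"
proof -
  let ?T = "ult_of_ult M X U Y W"
  have T: "?T = ult B.N (B.cl (Lam M X (\<lambda>_. Y))) (B.cl (Lam M X (\<lambda>_. W)))"
    by (simp add: ult_of_ult_def B.emb_cl)
  obtain Z' D' k where uD': "is_ultrafilter A.N Z' D'" and iso: "model_iso k (ult A.N Z' D') ?T"
    and kemb: "\<And>a. a \<in> univ A.N \<Longrightarrow> k (ult_emb A.N Z' D' a) = ult_emb_restr M X U Y W a"
    using ir unfolding internal_rel_def by metis
  have "Z' \<in> univ A.N" using uD' unfolding is_ultrafilter_def is_filter_def by (elim conjE)
  then obtain z where z: "z \<in> A.FY" "Z' = A.cl z" by (rule A.univ_E)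
  have "D' \<in> univ A.N" using uD' unfolding is_ultrafilter_def is_filter_def by (elim conjE)
  then obtain D where D: "D \<in> A.FY" "D' = A.cl D" by (rule A.univ_E)
  note zV = z(1)[THEN funs_V] D(1)[THEN funs_V]
  note uD = uD'[unfolded z(2) D(2)] and iso = iso[unfolded z(2) D(2)] and kemb = kemb[unfolded z(2) D(2)]
  let ?S = "ult A.N (A.cl z) (A.cl D)"
  \<comment> \<open>The seed: the matrix whose entry at \<open>(x, y)\<close> is
    \<open>x\<close>.\<close>
  define c where "c = B.cu Y W (\<lambda>x y. x)"
  have dx: "dft M (\<lambda>e. e 0)" by (intro dfns)
  have kS: "k ` univ ?S = univ ?T" using iso unfolding model_iso_def by (elim conjE) (rule bij_betw_imp_surj_on)
  have "c \<in> univ ?T" unfolding T c_def by (rule B.cu_univ[OF A.uf dx])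
  then obtain g where g: "c = k g" "g \<in> univ ?S" unfolding kS[symmetric] by (rule imageE)
  note g = g(2) g(1)[symmetric]
  obtain G where G: "G \<in> A.FY" "A.aW (\<lambda>y. ap M G y \<in> funs M (ap M z y))" "g = ult_class A.N (A.cl z) (A.cl D) (A.cl G)"
    using A.univ2E[OF g(1) z(1)] by metis
  have GV: "G \<in> V" using G(1) by (rule funs_V)
  have PX: "Pw X \<in> V" using B.YV by simp
  let ?P = "\<lambda>y S. almost M (ap M D y) (ap M z y) (\<lambda>v. ap M (ap M G y) v \<in> E S)"
  have dP: "dfn M (\<lambda>e. ?P (e i) (e j))" for i j by (intro dfns zV GV)
  \<comment> \<open>Only subsets of \<open>X\<close> are collected, so \<open>u(y)\<close> is a set;
    the construction does not have to make each \<open>u(y)\<close> an ultrafilter.\<close>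
  define u where "u = Lam M Y (\<lambda>y. Sep M (Pw X) (?P y))"
  have du: "dft M (\<lambda>e. Sep M (Pw X) (?P (e 0)))" by (intro dfns PX dP)
  have uV: "u \<in> V" unfolding u_def by (rule funs_V[OF A.LamF[OF du]])
  have "capw X U Y W u" unfolding capw_def
  proof
    fix R assume R: "R \<in> V"
    have dR: "dfn M (\<lambda>e. op (e 0) y \<in> E R)" if "y \<in> V" for y by (intro dfns R that)
    let ?e = "\<lambda>y. Sep M X (\<lambda>x. op x y \<in> E R)"
    have de: "dft M (\<lambda>e. ?e (e 0))" by (intro dfns B.YV R)
    \<comment> \<open>The sections of \<open>R\<close>, as an element of the ultrapower by
      \<open>W\<close>. Both iterated quantifiers in \<open>capw\<close> express membership of the
      seed in the image of this element, once on each side of \<open>k\<close>.\<close>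
    define e where "e = Lam M Y ?e"
    have eF: "e \<in> A.FY" unfolding e_def by (rule A.LamF[OF de])
    have ey: "ap M e y = ?e y" if "y \<in> E Y" for y unfolding e_def by (rule ap_Lam[OF A.YV de that])
    have eE: "E (?e y) = {x \<in> E X. op x y \<in> E R}" "?e y \<in> V" if "y \<in> E Y" for y
      using E_Sep[OF B.YV dR[OF E_V[OF that]]] Sep_V[OF B.YV dR[OF E_V[OF that]]] by auto
    note cs = A.cst[OF z(1) eF]
    have de': "dft M (\<lambda>n. ap M e (n 1))" by (intro dfns funs_V[OF eF])
    have "almost M U X (\<lambda>x. A.aW (\<lambda>y. op x y \<in> E R)) \<longleftrightarrow> almost M U X (\<lambda>x. A.aW (\<lambda>y. x \<in> E (ap M e y)))"
      by (intro al_cong) (simp add: ey eE)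
    also have "\<dots> \<longleftrightarrow> mem ?T (k g) (k (ult_emb A.N (A.cl z) (A.cl D) (A.cl e)))"
      unfolding kemb[OF A.cl_univ[OF eF]] restr_cl[OF eF] g(2) c_def T B.cu_mem[OF A.uf dx de'] ..
    also have "\<dots> \<longleftrightarrow> mem ?S g (ult_emb A.N (A.cl z) (A.cl D) (A.cl e))"
    proof -
      have "ult_emb A.N (A.cl z) (A.cl D) (A.cl e) \<in> univ ?S"
        unfolding ult_emb_def cs(4) by (rule A.univ2I[OF cs(1) z(1) al_all[OF A.uf cs(2)]])
      then show ?thesis using iso g(1) unfolding model_iso_def by blast
    qed
    also have "\<dots> \<longleftrightarrow> A.aW (\<lambda>y. almost M (ap M D y) (ap M z y) (\<lambda>v. ap M (ap M G y) v \<in> E (ap M (ap M (A.cst z e) y) v)))"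
      unfolding ult_emb_def cs(4) G(3) by (rule A.class2(2)[OF z(1) D(1) uD G(1) cs(1) G(2) al_all[OF A.uf cs(2)]])
    also have "\<dots> \<longleftrightarrow> A.aW (\<lambda>y. almost M (ap M u y) X (\<lambda>x. op x y \<in> E R))"
    proof (rule al_cong)
      fix y assume y: "y \<in> E Y"
      have dy: "dfn M (\<lambda>n. ?P y (n 0))" by (intro dfns zV GV E_V[OF y])
      have "almost M (ap M D y) (ap M z y) (\<lambda>v. ap M (ap M G y) v \<in> E (ap M (ap M (A.cst z e) y) v)) \<longleftrightarrow> ?P y (?e y)"
        by (rule al_cong) (simp add: cs(3) y ey)
      also have "\<dots> \<longleftrightarrow> ?e y \<in> E (ap M u y)"
        unfolding u_def ap_Lam[OF A.YV du y] E_Sep[OF PX dy] E_Pw[OF B.YV] using eE[OF y] by auto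
      also have "\<dots> \<longleftrightarrow> almost M (ap M u y) X (\<lambda>x. op x y \<in> E R)" using al_iff[OF B.YV dR[OF E_V[OF y]]] by simp
      finally show "almost M (ap M D y) (ap M z y) (\<lambda>v. ap M (ap M G y) v \<in> E (ap M (ap M (A.cst z e) y) v)) \<longleftrightarrow>
        almost M (ap M u y) X (\<lambda>x. op x y \<in> E R)" .
    qed
    finally show "almost M U X (\<lambda>x. A.aW (\<lambda>y. op x y \<in> E R)) \<longleftrightarrow> A.aW (\<lambda>y. almost M (ap M u y) X (\<lambda>x. op x y \<in> E R))" .
  qed
  then show ?thesis using uV by blast
qed

section \<open>The filter generated by rectangles\<close>

definition rect_filter :: 'a where
  "rect_filter = Sep M (Pw (cprod M X Y)) (\<lambda>C. \<exists>A\<in>E U. \<exists>B\<in>E W. \<forall>x\<in>E A. \<forall>y\<in>E B. op x y \<in> E C)"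

lemma XY: "cprod M X Y \<in> V" "E (cprod M X Y) = {op x y |x y. x \<in> E X \<and> y \<in> E Y}"
  using E_cprod[OF B.YV A.YV] by auto

lemma rect_filter_V: "rect_filter \<in> V"
  and E_rect: "E rect_filter = {C \<in> V. E C \<subseteq> E (cprod M X Y) \<and> (\<exists>A\<in>E U. \<exists>B\<in>E W. \<forall>x\<in>E A. \<forall>y\<in>E B. op x y \<in> E C)}"
proof -
  have P: "Pw (cprod M X Y) \<in> V" using XY by simp
  have d: "dfn M (\<lambda>e. \<exists>A\<in>E U. \<exists>B\<in>E W. \<forall>x\<in>E A. \<forall>y\<in>E B. op x y \<in> E (e 0))" by (intro dfns A.WV B.WV)
  show "rect_filter \<in> V" unfolding rect_filter_def by (rule Sep_V[OF P d])
  show "E rect_filter = {C \<in> V. E C \<subseteq> E (cprod M X Y) \<and> (\<exists>A\<in>E U. \<exists>B\<in>E W. \<forall>x\<in>E A. \<forall>y\<in>E B. op x y \<in> E C)}"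
    unfolding rect_filter_def E_Sep[OF P d] E_Pw[OF XY(1)] by auto
qed

lemma rectE:
  assumes "C \<in> E rect_filter"
  obtains A B where "A \<in> E U" "B \<in> E W" "\<forall>x\<in>E A. \<forall>y\<in>E B. op x y \<in> E C"
  using assms that unfolding E_rect mem_Collect_eq by blast

lemma rect_elt:
  assumes "A \<in> E U" "B \<in> E W"
  shows "cprod M A B \<in> V" "E (cprod M A B) = {op x y |x y. x \<in> E A \<and> y \<in> E B}" "E (cprod M A B) \<subseteq> E (cprod M X Y)"
proof -
  note V = assms[THEN E_V]
  show 1: "cprod M A B \<in> V" "E (cprod M A B) = {op x y |x y. x \<in> E A \<and> y \<in> E B}" using E_cprod[OF V] by auto
  show "E (cprod M A B) \<subseteq> E (cprod M X Y)" unfolding 1(2) XY(2)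
    using uf_sub[OF B.uf assms(1)] uf_sub[OF A.uf assms(2)] by blast
qed

lemma inter_elt:
  assumes "uf X' U'" "A \<in> E U'" "A' \<in> E U'" obtains A'' where "A'' \<in> E U'" "E A'' = E A \<inter> E A'"
proof -
  have V: "A \<in> V" "A' \<in> V" using assms E_V by auto
  have d: "dfn M (\<lambda>e. e 0 \<in> E A')" by (intro dfns V)
  have "E (Sep M A (\<lambda>x. x \<in> E A')) = E A \<inter> E A'" unfolding E_Sep[OF V(1) d] by blast
  with uf_int[OF assms Sep_V[OF V(1) d]] show thesis using that by blast
qed

lemma rect_is_filter: "is_filter M (cprod M X Y) rect_filter"
  unfolding is_filter_def
proof (intro conjI ballI impI XY(1) rect_filter_V)
  have XU: "X \<in> E U" "Y \<in> E W" using uf_top A.uf B.uf by auto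
  show "cprod M X Y \<in> E rect_filter" unfolding E_rect using XU XY by blast
next
  fix C assume C: "C \<in> E rect_filter"
  then obtain A B where CV: "C \<in> V" "E C \<subseteq> E (cprod M X Y)" and AB: "A \<in> E U" "B \<in> E W" "\<forall>x\<in>E A. \<forall>y\<in>E B. op x y \<in> E C"
    unfolding E_rect by blast
  show "E C \<subseteq> E (cprod M X Y)" by (rule CV)
  show "E C \<noteq> {}" using uf_ne[OF B.uf AB(1)] uf_ne[OF A.uf AB(2)] AB(3) by blast
  {
    fix C' C'' assume C': "C' \<in> E rect_filter" "C'' \<in> V" "E C'' = E C \<inter> E C'"
    then obtain A' B' where AB': "A' \<in> E U" "B' \<in> E W" "\<forall>x\<in>E A'. \<forall>y\<in>E B'. op x y \<in> E C'"
      unfolding E_rect by blast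
    obtain A'' where A'': "A'' \<in> E U" "E A'' = E A \<inter> E A'" by (rule inter_elt[OF B.uf AB(1) AB'(1)])
    obtain B'' where B'': "B'' \<in> E W" "E B'' = E B \<inter> E B'" by (rule inter_elt[OF A.uf AB(2) AB'(2)])
    have "\<forall>x\<in>E A''. \<forall>y\<in>E B''. op x y \<in> E C''" using A'' B'' AB(3) AB'(3) C'(3) by blast
    moreover have "E C'' \<subseteq> E (cprod M X Y)" using C'(3) CV(2) by blast
    ultimately show "C'' \<in> E rect_filter" unfolding E_rect using C'(2) A''(1) B''(1) by blast
  }
  fix C' assume C': "C' \<in> V" "E C \<subseteq> E C'" "E C' \<subseteq> E (cprod M X Y)"
  have "\<forall>x\<in>E A. \<forall>y\<in>E B. op x y \<in> E C'" using AB(3) C'(2) by blast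
  then show "C' \<in> E rect_filter" unfolding E_rect using C' AB(1,2) by blast
qed

text \<open>Any filter containing the rectangles contains their supersets, and these supersets
  already form a filter, because two rectangles meet in a rectangle and sets in \<open>U\<close> and
  \<open>W\<close> are nonempty.\<close>

lemma product_filter_eq: "product_filter M X U Y W = rect_filter"
  unfolding product_filter_def
proof (rule the_set_eq[OF rect_filter_V], intro equalityI subsetI)
  fix C assume C: "C \<in> E rect_filter"
  then obtain A B where CV: "C \<in> V" "E C \<subseteq> E (cprod M X Y)" and AB: "A \<in> E U" "B \<in> E W" "\<forall>x\<in>E A. \<forall>y\<in>E B. op x y \<in> E C"
    unfolding E_rect by blast
  have "C \<in> E F" if F: "is_filter M (cprod M X Y) F" "\<forall>A\<in>E U. \<forall>B\<in>E W. cprod M A B \<in> E F" for F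
  proof -
    have up: "\<forall>A\<in>E F. \<forall>B\<in>V. E A \<subseteq> E B \<longrightarrow> E B \<subseteq> E (cprod M X Y) \<longrightarrow> B \<in> E F"
      using F(1) unfolding is_filter_def by (elim conjE)
    have "cprod M A B \<in> E F" using F(2) AB by blast
    moreover have "E (cprod M A B) \<subseteq> E C" unfolding rect_elt(2)[OF AB(1,2)] using AB(3) by blast
    ultimately show ?thesis using up CV by blast
  qed
  then show "C \<in> {C \<in> V. \<forall>F. is_filter M (cprod M X Y) F \<and> (\<forall>A\<in>E U. \<forall>B\<in>E W. cprod M A B \<in> E F) \<longrightarrow> C \<in> E F}"
    using CV(1) by blast
next
  fix C assume C: "C \<in> {C \<in> V. \<forall>F. is_filter M (cprod M X Y) F \<and> (\<forall>A\<in>E U. \<forall>B\<in>E W. cprod M A B \<in> E F) \<longrightarrow> C \<in> E F}"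
  have "cprod M A B \<in> E rect_filter" if "A \<in> E U" "B \<in> E W" for A B
    unfolding E_rect using rect_elt[OF that] that by blast
  then show "C \<in> E rect_filter" using C rect_is_filter by blast
qed

lemma rect_al:
  assumes "A \<in> E U" "B \<in> E W" and Q: "dfn M (\<lambda>e. Q (e 0) (e 1))" and r: "\<forall>x\<in>E A. \<forall>y\<in>E B. Q x y"
  shows "almost M U X (\<lambda>x. A.aW (Q x))"
proof -
  have Q': "dfn M (\<lambda>e. Q (e i) (e j))" for i j by (rule dfn2_subst[OF Q]) (intro dfns)+
  have a: "almost M U X (\<lambda>x. x \<in> E A)" using al_mem[OF B.uf E_V[OF assms(1)] uf_sub[OF B.uf assms(1)]] assms(1) by simp
  have b: "A.aW (\<lambda>y. y \<in> E B)" using al_mem[OF A.uf E_V[OF assms(2)] uf_sub[OF A.uf assms(2)]] assms(2) by simp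
  show ?thesis
  proof (rule al_mono[OF B.uf a])
    show "dfn M (\<lambda>e. A.aW (Q (e 0)))" by (intro dfns A.WV A.YV Q')
    fix x assume x: "x \<in> E X" "x \<in> E A"
    have "dfn M (\<lambda>e. Q x (e 0))" by (rule dfn2_subst[OF Q]) (intro dfns E_V[OF x(1)])+
    then show "A.aW (Q x)" by (rule al_mono[OF A.uf b]) (use x r in blast)
  qed
qed

lemma ultrafilter_of_decided:
  assumes "\<And>C. C \<in> V \<Longrightarrow> \<not> undec U W C"
  shows "uf (cprod M X Y) rect_filter"
  unfolding is_ultrafilter_def
proof (intro conjI rect_is_filter ballI impI)
  fix C C' assume C: "C \<in> V" "C' \<in> V" "E C \<subseteq> E (cprod M X Y)" "E C' = E (cprod M X Y) - E C"
  obtain A B where AB: "A \<in> E U" "B \<in> E W" and d: "(\<forall>x\<in>E A. \<forall>y\<in>E B. op x y \<notin> E C) \<or> (\<forall>x\<in>E A. \<forall>y\<in>E B. op x y \<in> E C)"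
    using assms[OF C(1)] unfolding undec_def by blast
  have sub: "op x y \<in> E (cprod M X Y)" if "x \<in> E A" "y \<in> E B" for x y using rect_elt[OF AB] that by blast
  from d show "C \<in> E rect_filter \<or> C' \<in> E rect_filter"
  proof
    assume n: "\<forall>x\<in>E A. \<forall>y\<in>E B. op x y \<notin> E C"
    have "\<forall>x\<in>E A. \<forall>y\<in>E B. op x y \<in> E C'" using n sub C(4) by blast
    moreover have "E C' \<subseteq> E (cprod M X Y)" using C(4) by blast
    ultimately show ?thesis unfolding E_rect using C(2) AB by blast
  next
    assume "\<forall>x\<in>E A. \<forall>y\<in>E B. op x y \<in> E C"
    then show ?thesis unfolding E_rect using C(1,3) AB by blast
  qed
qed

text \<open>The same results with the roles of \<open>U\<close> and \<open>W\<close>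
  exchanged.\<close>

interpretation S: two_ultrafilters M Y W X U
  by (intro two_ultrafilters.intro zfc_axioms A.zfc_ult_axioms B.zfc_ult_axioms)

text \<open>Some rectangle lies inside \<open>R\<close> or inside its complement, and on a rectangle
  both orders of the quantifiers give the same answer.\<close>

lemma capw_of_ultrafilter:
  assumes u: "uf (cprod M X Y) rect_filter"
  shows "capw X U Y W (Lam M Y (\<lambda>_. U))"
  unfolding capw_def
proof
  fix R assume R: "R \<in> V"
  have dR: "dfn M (\<lambda>e. e 0 \<in> E R)" "dfn M (\<lambda>e. \<not> e 0 \<in> E R)" by (intro dfns R)+
  have Q: "dfn M (\<lambda>e. op (e 0) (e 1) \<in> E R)" "dfn M (\<lambda>e. op (e 1) (e 0) \<in> E R)"
    "dfn M (\<lambda>e. \<not> op (e 0) (e 1) \<in> E R)" "dfn M (\<lambda>e. \<not> op (e 1) (e 0) \<in> E R)" by (intro dfns R)+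
  let ?C = "Sep M (cprod M X Y) (\<lambda>p. p \<in> E R)" and ?C' = "Sep M (cprod M X Y) (\<lambda>p. \<not> p \<in> E R)"
  have C: "?C \<in> V" "?C' \<in> V" "E ?C \<subseteq> E (cprod M X Y)" "E ?C' = E (cprod M X Y) - E ?C"
    unfolding E_Sep[OF XY(1) dR(1)] E_Sep[OF XY(1) dR(2)] using Sep_V[OF XY(1)] dR by auto
  have "?C \<in> E rect_filter \<or> ?C' \<in> E rect_filter" by (rule uf_compl[OF u C])
  then have "almost M U X (\<lambda>x. A.aW (\<lambda>y. op x y \<in> E R)) \<longleftrightarrow> A.aW (\<lambda>y. almost M U X (\<lambda>x. op x y \<in> E R))"
  proof
    assume "?C \<in> E rect_filter"
    then obtain A B where AB: "A \<in> E U" "B \<in> E W" "\<forall>x\<in>E A. \<forall>y\<in>E B. op x y \<in> E ?C" by (rule rectE)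
    note AB = AB(1,2) AB(3)[unfolded E_Sep[OF XY(1) dR(1)] mem_Collect_eq]
    have "almost M U X (\<lambda>x. A.aW (\<lambda>y. op x y \<in> E R))" by (rule rect_al[OF AB(1,2) Q(1)]) (use AB(3) in blast)
    moreover have "A.aW (\<lambda>y. almost M U X (\<lambda>x. op x y \<in> E R))"
      by (rule S.rect_al[OF AB(2,1) Q(2)]) (use AB(3) in blast)
    ultimately show ?thesis by simp
  next
    assume "?C' \<in> E rect_filter"
    then obtain A B where AB: "A \<in> E U" "B \<in> E W" "\<forall>x\<in>E A. \<forall>y\<in>E B. op x y \<in> E ?C'" by (rule rectE)
    note AB = AB(1,2) AB(3)[unfolded E_Sep[OF XY(1) dR(2)] mem_Collect_eq]
    have dd: "dfn M (\<lambda>e. A.aW (\<lambda>y. op (e 0) y \<in> E R))" "dfn M (\<lambda>e. almost M U X (\<lambda>x. op x (e 0) \<in> E R))"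
      by (intro dfns R A.YV A.WV B.YV B.WV)+
    have "almost M U X (\<lambda>x. A.aW (\<lambda>y. \<not> op x y \<in> E R))" by (rule rect_al[OF AB(1,2) Q(3)]) (use AB(3) in blast)
    also have "almost M U X (\<lambda>x. A.aW (\<lambda>y. \<not> op x y \<in> E R)) \<longleftrightarrow> almost M U X (\<lambda>x. \<not> A.aW (\<lambda>y. op x y \<in> E R))"
    proof (rule al_cong)
      fix x assume x: "x \<in> E X"
      have "dfn M (\<lambda>e. op x (e 0) \<in> E R)" by (intro dfns R E_V[OF x])
      from al_not[OF A.uf this] show "A.aW (\<lambda>y. \<not> op x y \<in> E R) \<longleftrightarrow> \<not> A.aW (\<lambda>y. op x y \<in> E R)" .
    qed
    finally have 1: "\<not> almost M U X (\<lambda>x. A.aW (\<lambda>y. op x y \<in> E R))" using al_not[OF B.uf dd(1)] by blast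
    have "A.aW (\<lambda>y. almost M U X (\<lambda>x. \<not> op x y \<in> E R))"
      by (rule S.rect_al[OF AB(2,1) Q(4)]) (use AB(3) in blast)
    also have "A.aW (\<lambda>y. almost M U X (\<lambda>x. \<not> op x y \<in> E R)) \<longleftrightarrow> A.aW (\<lambda>y. \<not> almost M U X (\<lambda>x. op x y \<in> E R))"
    proof (rule al_cong)
      fix y assume y: "y \<in> E Y"
      have "dfn M (\<lambda>e. op (e 0) y \<in> E R)" by (intro dfns R E_V[OF y])
      from al_not[OF B.uf this] show "almost M U X (\<lambda>x. \<not> op x y \<in> E R) \<longleftrightarrow> \<not> almost M U X (\<lambda>x. op x y \<in> E R)" .
    qed
    finally have "\<not> A.aW (\<lambda>y. almost M U X (\<lambda>x. op x y \<in> E R))" using al_not[OF A.uf dd(2)] by blast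
    with 1 show ?thesis by simp
  qed
  also have "\<dots> \<longleftrightarrow> A.aW (\<lambda>y. almost M (ap M (Lam M Y (\<lambda>_. U)) y) X (\<lambda>x. op x y \<in> E R))"
    by (rule al_cong) (simp add: B.WV)
  finally show "almost M U X (\<lambda>x. A.aW (\<lambda>y. op x y \<in> E R)) \<longleftrightarrow>
    A.aW (\<lambda>y. almost M (ap M (Lam M Y (\<lambda>_. U)) y) X (\<lambda>x. op x y \<in> E R))" .
qed

theorem product_ultrafilter_iff:
  assumes "zfc_gch M"
  shows "uf (cprod M X Y) (product_filter M X U Y W) \<longleftrightarrow> internal_rel M X U Y W \<and> internal_rel M Y W X U"
  unfolding product_filter_eq
proof (intro iffI conjI)
  assume "uf (cprod M X Y) rect_filter"
  then have c: "capw X U Y W (Lam M Y (\<lambda>_. U))" by (rule capw_of_ultrafilter)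
  show "internal_rel M X U Y W" by (rule internal_rel_const[OF c])
  show "internal_rel M Y W X U" by (rule S.internal_rel_const[OF swap_capw[OF c B.uf A.uf]])
next
  assume "internal_rel M X U Y W \<and> internal_rel M Y W X U"
  then have "\<exists>u\<in>V. capw X U Y W u" "\<exists>w\<in>V. capw Y W X U w"
    using capw_of_internal_rel S.capw_of_internal_rel by auto
  with zfc_gch.no_bad[OF assms, of X U Y W] show "uf (cprod M X Y) rect_filter"
    by (intro ultrafilter_of_decided) (use A.uf B.uf in \<open>auto simp: bad_def\<close>)
qed

end

theorem theorem3p18:
  fixes M :: "'a eps_model" and X Y U W :: 'a
  assumes "ZFC M" and "GCH M"
    and "is_ultrafilter M X U" and "is_ultrafilter M Y W"
  shows "is_ultrafilter M (cprod M X Y) (product_filter M X U Y W) \<longleftrightarrow>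
    internal_rel M X U Y W \<and> internal_rel M Y W X U"
proof -
  interpret zfc M by unfold_locales (rule assms)
  interpret two_ultrafilters M X U Y W by unfold_locales (rule assms)+
  show ?thesis by (rule product_ultrafilter_iff) (unfold_locales, rule assms)
qed

end
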